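(* Let $\pi:E\to Q$ be a fibred manifold and $r\ge1$. Then $\mathcal G^r_\pi:=\ker T\pi_{r,r-1}$ is a polarisation of the $N^r_\pi$-contact manifold $(J^r\pi,\mathcal C^r_\pi)$.
   Context: Here $\dim Q=n$, $\pi$ has fibre dimension $m$, $N^r_\pi=m\binom{n+r-1}{r-1}$. $J^r\pi$ is the $r$-th jet bundle ($J^0\pi=E$), $\pi_{r,s}:J^r\pi\to J^s\pi$ the projections, and $\mathcal C^r_\pi$ is the Cartan distribution, locally the common kernel of the contact forms $\theta^\alpha_I=du^\alpha_I-\sum_iu^\alpha_{I+\widehat e_i}dx^i$, $|I|\le r-1$, in adapted jet coordinates $(x^i,u^\alpha_I)_{|I|\le r}$ ($\widehat e_i$ the $i$-th unit multi-index). A $k$-contact form on an open set $U$ is an $\mathbb R^k$-valued one-form $\boldsymbol\eta=\sum_A\eta^A\otimes e_A$ such that $\ker\boldsymbol\eta=\bigcap_A\ker\eta^A$ is a non-zero distribution of corank $k$ and $\ker\boldsymbol\eta\oplus\ker d\boldsymbol\eta=TU$ with $\ker d\boldsymbol\eta=\bigcap_A\ker d\eta^A$. A $k$-contact manifold is a pair $(M,\mathcal D)$ where the regular corank-$k$ distribution $\mathcal D$ is locally, around every point, the kernel of a $k$-contact form. $(J^r\pi,\mathcal C^r_\pi)$ is an $N^r_\pi$-contact manifold. The Levi tensor of a regular distribution $\mathcal D$ is $\mathcal L_{\mathcal D}:\Lambda^2\mathcal D\to TM/\mathcal D$, $\mathcal L_{\mathcal D}(X_x,Y_x)=[X,Y]_x\bmod\mathcal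 D_x$ ($X,Y$ local extensions in $\Gamma(\mathcal D)$). A subspace $E_x\subset\mathcal D_x$ is isotropic if $\mathcal L_{\mathcal D}$ vanishes on $E_x\times E_x$, and Legendrian if it is isotropic and has an isotropic complement $W_x$ in $\mathcal D_x$, $\mathcal D_x=E_x\oplus W_x$. A subbundle of $\mathcal D$ is isotropic/Legendrian if it is so at each point. A polarisation of a $k$-contact manifold $(M,\mathcal D)$ is an integrable Legendrian subbundle $\mathcal P\subset\mathcal D$ that has maximal rank among all integrable Legendrian subbundles of $\mathcal D$. *)

theory Defs
  imports
    "HOL-Analysis.Analysis"
    "HOL-Library.Function_Algebras"
    "HOL-Library.Multiset"
begin

text \<open>
  Tangent vectors are real-valued functionals on functions. The pointwise real vector space
  structure makes \<open>subspace\<close>, \<open>span\<close>, \<open>independent\<close> available for them.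
\<close>

instantiation "fun" :: (type, real_vector) real_vector
begin

definition scaleR_fun :: "real \<Rightarrow> ('a \<Rightarrow> 'b) \<Rightarrow> 'a \<Rightarrow> 'b"
  where "scaleR_fun c f = (\<lambda>x. c *\<^sub>R f x)"

instance
  by standard
    (simp_all add: scaleR_fun_def plus_fun_def fun_eq_iff scaleR_add_right scaleR_add_left)

end

definition direct_sum :: "'v::real_vector set \<Rightarrow> 'v set \<Rightarrow> 'v set \<Rightarrow> bool"
  where "direct_sum V W T \<longleftrightarrow> subspace V \<and> subspace W \<and> V \<inter> W = {0} \<and>
           T = {v + w | v w. v \<in> V \<and> w \<in> W}"


section \<open>Smooth functions of finitely many real variables\<close>

text \<open>
  For a finite index set \<open>I\<close>, the space of \<open>I\<close>-tuples of reals is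
  \<open>powertop_real I\<close>; its points are the functions that are \<open>undefined\<close> outside \<open>I\<close>.
\<close>

definition pd :: "'i \<Rightarrow> (('i \<Rightarrow> real) \<Rightarrow> real) \<Rightarrow> ('i \<Rightarrow> real) \<Rightarrow> real"
  where "pd i g x = deriv (\<lambda>t. g (x(i := t))) (x i)"

text \<open>
  Multi-indices are multisets: \<open>count J i\<close> is the order of differentiation with respect to
  the \<open>i\<close>-th variable, the length is \<open>size J\<close>, and \<open>add_mset i J\<close> is \<open>J\<close> plus the
  \<open>i\<close>-th unit multi-index. For smooth functions the order of differentiation chosen
  below is immaterial.
\<close>

definition pd_multi :: "'i multiset \<Rightarrow> (('i \<Rightarrow> real) \<Rightarrow> real) \<Rightarrow> ('i \<Rightarrow> real) \<Rightarrow> real"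
  where "pd_multi J g = foldr pd (SOME is. mset is = J) g"

primrec Ck_on :: "'i set \<Rightarrow> nat \<Rightarrow> ('i \<Rightarrow> real) set \<Rightarrow> (('i \<Rightarrow> real) \<Rightarrow> real) \<Rightarrow> bool"
  where
    "Ck_on I 0 W g \<longleftrightarrow> continuous_map (subtopology (powertop_real I) W) euclideanreal g"
  | "Ck_on I (Suc k) W g \<longleftrightarrow>
       continuous_map (subtopology (powertop_real I) W) euclideanreal g \<and>
       (\<forall>i\<in>I. (\<forall>x\<in>W. (\<lambda>t. g (x(i := t))) differentiable (at (x i))) \<and> Ck_on I k W (pd i g))"

definition smooth_on :: "'i set \<Rightarrow> ('i \<Rightarrow> real) set \<Rightarrow> (('i \<Rightarrow> real) \<Rightarrow> real) \<Rightarrow> bool"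
  where "smooth_on I W g \<longleftrightarrow> (\<forall>k. Ck_on I k W g)"


section \<open>Smooth manifolds\<close>

type_synonym ('a, 'i) chart = "'a set \<times> ('a \<Rightarrow> 'i \<Rightarrow> real)"

text \<open>
  A manifold is given by an atlas, whose charts have coordinates labelled by the finite set
  \<open>idx\<close>. The underlying set is the union of the chart domains, and the topology is the
  one induced by the atlas.
\<close>

record ('a, 'i) mfd =
  idx :: "'i set"
  atlas :: "('a, 'i) chart set"

definition carrier :: "('a, 'i) mfd \<Rightarrow> 'a set"
  where "carrier M = (\<Union>(V, \<phi>)\<in>atlas M. V)"

definition mdim :: "('a, 'i) mfd \<Rightarrow> nat"
  where "mdim M = card (idx M)"

definition mtop :: "('a, 'i) mfd \<Rightarrow> 'a topology"
  where "mtop M = topology_generated_by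
           {{p \<in> V. \<phi> p \<in> W} | V \<phi> W. (V, \<phi>) \<in> atlas M \<and> openin (powertop_real (idx M)) W}"

definition is_chart :: "'i set \<Rightarrow> ('a, 'i) chart \<Rightarrow> bool"
  where "is_chart I = (\<lambda>(V, \<phi>). inj_on \<phi> V \<and> openin (powertop_real I) (\<phi> ` V))"

definition smooth_transition :: "'i set \<Rightarrow> ('a, 'i) chart \<Rightarrow> ('a, 'i) chart \<Rightarrow> bool"
  where "smooth_transition I = (\<lambda>(V, \<phi>) (W, \<psi>). openin (powertop_real I) (\<phi> ` (V \<inter> W)) \<and>
           (\<forall>i\<in>I. smooth_on I (\<phi> ` (V \<inter> W)) (\<lambda>x. \<psi> (inv_into V \<phi> x) i)))"

definition compatible_charts :: "'i set \<Rightarrow> ('a, 'i) chart \<Rightarrow> ('a, 'i) chart \<Rightarrow> bool"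
  where "compatible_charts I c d \<longleftrightarrow> smooth_transition I c d \<and> smooth_transition I d c"

definition smooth_manifold :: "('a, 'i) mfd \<Rightarrow> bool"
  where "smooth_manifold M \<longleftrightarrow> finite (idx M) \<and> carrier M \<noteq> {} \<and>
           (\<forall>c\<in>atlas M. is_chart (idx M) c) \<and>
           (\<forall>c\<in>atlas M. \<forall>d\<in>atlas M. compatible_charts (idx M) c d) \<and>
           Hausdorff_space (mtop M) \<and> second_countable (mtop M)"

text \<open>The maximal atlas.\<close>

definition charts :: "('a, 'i) mfd \<Rightarrow> ('a, 'i) chart set"
  where "charts M = {c. fst c \<subseteq> carrier M \<and> is_chart (idx M) c \<and>
           (\<forall>d\<in>atlas M. compatible_charts (idx M) c d)}"

text \<open>\<open>smooth_at M p f\<close>: the real function \<open>f\<close> is smooth on a neighbourhood of \<open>p\<close>.\<close>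

definition smooth_at :: "('a, 'i) mfd \<Rightarrow> 'a \<Rightarrow> ('a \<Rightarrow> real) \<Rightarrow> bool"
  where "smooth_at M p f \<longleftrightarrow> (\<exists>(V, \<phi>)\<in>atlas M. p \<in> V \<and>
           (\<exists>W. openin (powertop_real (idx M)) W \<and> \<phi> p \<in> W \<and> W \<subseteq> \<phi> ` V \<and>
                smooth_on (idx M) W (\<lambda>x. f (inv_into V \<phi> x))))"

text \<open>
  A map is smooth near \<open>p\<close> if it pulls back smooth germs to smooth germs; as indicator
  functions of neighbourhoods of \<open>F p\<close> are smooth near \<open>F p\<close>, this includes continuity.
\<close>

definition smooth_map_at :: "('a, 'i) mfd \<Rightarrow> ('b, 'j) mfd \<Rightarrow> ('a \<Rightarrow> 'b) \<Rightarrow> 'a \<Rightarrow> bool"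
  where "smooth_map_at M N F p \<longleftrightarrow> F p \<in> carrier N \<and>
           (\<forall>f. smooth_at N (F p) f \<longrightarrow> smooth_at M p (\<lambda>q. f (F q)))"

definition open_subset_mfd :: "'i set \<Rightarrow> ('i \<Rightarrow> real) set \<Rightarrow> ('i \<Rightarrow> real, 'i) mfd"
  where "open_subset_mfd I W = \<lparr>idx = I, atlas = {(W, \<lambda>x. x)}\<rparr>"


section \<open>Tangent vectors, vector fields, distributions\<close>

text \<open>
  Tangent vectors at \<open>p\<close> are the derivations at \<open>p\<close> of the functions smooth near \<open>p\<close>.
  They depend only on germs, by the Leibniz rule applied to indicator functions of
  neighbourhoods of \<open>p\<close>. The value \<open>0\<close> on non-smooth functions is a normalisation that
  makes equality of tangent vectors equality of functionals. The differential of a function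
  \<open>f\<close>, evaluated at a tangent vector \<open>v\<close>, is \<open>v f\<close>.
\<close>

type_synonym 'a tvec = "('a \<Rightarrow> real) \<Rightarrow> real"

definition tangent :: "('a, 'i) mfd \<Rightarrow> 'a \<Rightarrow> 'a tvec set"
  where "tangent M p = {v.
           (\<forall>f. \<not> smooth_at M p f \<longrightarrow> v f = 0) \<and>
           (\<forall>f g a b. smooth_at M p f \<longrightarrow> smooth_at M p g \<longrightarrow>
              v (\<lambda>q. a * f q + b * g q) = a * v f + b * v g) \<and>
           (\<forall>f g. smooth_at M p f \<longrightarrow> smooth_at M p g \<longrightarrow>
              v (\<lambda>q. f q * g q) = v f * g p + f p * v g)}"

definition tmap ::
    "('b, 'j) mfd \<Rightarrow> ('a \<Rightarrow> 'b) \<Rightarrow> 'a \<Rightarrow> 'a tvec \<Rightarrow> 'b tvec"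
  where "tmap N F p v = (\<lambda>f. if smooth_at N (F p) f then v (\<lambda>q. f (F q)) else 0)"

definition vector_field_on :: "('a, 'i) mfd \<Rightarrow> 'a set \<Rightarrow> ('a \<Rightarrow> 'a tvec) \<Rightarrow> bool"
  where "vector_field_on M U X \<longleftrightarrow> (\<forall>p\<in>U. X p \<in> tangent M p \<and>
           (\<forall>f. smooth_at M p f \<longrightarrow> smooth_at M p (\<lambda>q. X q f)))"

definition lie_bracket ::
    "('a, 'i) mfd \<Rightarrow> ('a \<Rightarrow> 'a tvec) \<Rightarrow> ('a \<Rightarrow> 'a tvec) \<Rightarrow> 'a \<Rightarrow> 'a tvec"
  where "lie_bracket M X Y p = (\<lambda>f. if smooth_at M p f
           then X p (\<lambda>q. Y q f) - Y p (\<lambda>q. X q f) else 0)"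

text \<open>
  \<open>distribution M U d D\<close>: over the open set \<open>U\<close>, the family \<open>D\<close> of subsets of the tangent
  spaces is a smooth subbundle of rank \<open>d\<close> of the tangent bundle, that is, it has smooth
  local frames.
\<close>

definition distribution :: "('a, 'i) mfd \<Rightarrow> 'a set \<Rightarrow> nat \<Rightarrow> ('a \<Rightarrow> 'a tvec set) \<Rightarrow> bool"
  where "distribution M U d D \<longleftrightarrow>
           (\<forall>p\<in>U. \<exists>V (X :: nat \<Rightarrow> 'a \<Rightarrow> 'a tvec). openin (mtop M) V \<and> p \<in> V \<and> V \<subseteq> U \<and>
              (\<forall>i<d. vector_field_on M V (X i)) \<and>
              (\<forall>q\<in>V. inj_on (\<lambda>i. X i q) {..<d} \<and> independent ((\<lambda>i. X i q) ` {..<d}) \<and>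
                      span ((\<lambda>i. X i q) ` {..<d}) = D q))"

definition regular_distribution :: "('a, 'i) mfd \<Rightarrow> nat \<Rightarrow> ('a \<Rightarrow> 'a tvec set) \<Rightarrow> bool"
  where "regular_distribution M k D \<longleftrightarrow> (\<exists>d. d + k = mdim M \<and> distribution M (carrier M) d D)"

definition local_section ::
    "('a, 'i) mfd \<Rightarrow> ('a \<Rightarrow> 'a tvec set) \<Rightarrow> 'a \<Rightarrow> ('a \<Rightarrow> 'a tvec) \<Rightarrow> bool"
  where "local_section M D p X \<longleftrightarrow>
           (\<exists>U. openin (mtop M) U \<and> p \<in> U \<and> vector_field_on M U X \<and> (\<forall>q\<in>U. X q \<in> D q))"

text \<open>
  Integrability of a subbundle of rank \<open>d\<close>: through every point passes a \<open>d\<close>-dimensional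
  integral manifold, given by an injective immersion \<open>s\<close> of an open set \<open>W\<close>.
\<close>

definition integrable :: "('a, 'i) mfd \<Rightarrow> nat \<Rightarrow> ('a \<Rightarrow> 'a tvec set) \<Rightarrow> bool"
  where "integrable M d D \<longleftrightarrow>
           (\<forall>p\<in>carrier M. \<exists>W (s :: (nat \<Rightarrow> real) \<Rightarrow> 'a).
              openin (powertop_real {..<d}) W \<and> p \<in> s ` W \<and> inj_on s W \<and>
              (\<forall>y\<in>W. smooth_map_at (open_subset_mfd {..<d} W) M s y \<and>
                 inj_on (tmap M s y) (tangent (open_subset_mfd {..<d} W) y) \<and>
                 tmap M s y ` tangent (open_subset_mfd {..<d} W) y = D (s y)))"


section \<open>\<open>k\<close>-contact manifolds\<close>

definition one_form_on :: "('a, 'i) mfd \<Rightarrow> 'a set \<Rightarrow> ('a \<Rightarrow> 'a tvec \<Rightarrow> real) \<Rightarrow> bool"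
  where "one_form_on M U \<eta> \<longleftrightarrow>
           (\<forall>p\<in>U. (\<forall>v\<in>tangent M p. \<forall>w\<in>tangent M p. \<forall>a b.
                      \<eta> p (a *\<^sub>R v + b *\<^sub>R w) = a * \<eta> p v + b * \<eta> p w) \<and>
                   (\<forall>X. local_section M (tangent M) p X \<longrightarrow> smooth_at M p (\<lambda>q. \<eta> q (X q))))"

text \<open>
  The exterior derivative of a one-form at \<open>p\<close>, by the invariant formula
  \<open>d\<eta>(X, Y) = X(\<eta>(Y)) - Y(\<eta>(X)) - \<eta>([X, Y])\<close>; it does not depend on the chosen local
  extensions of \<open>v\<close> and \<open>w\<close>.
\<close>

definition ext_deriv ::
    "('a, 'i) mfd \<Rightarrow> ('a \<Rightarrow> 'a tvec \<Rightarrow> real) \<Rightarrow> 'a \<Rightarrow> 'a tvec \<Rightarrow> 'a tvec \<Rightarrow> real"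
  where "ext_deriv M \<eta> p v w = (SOME c. \<exists>X Y.
           local_section M (tangent M) p X \<and> local_section M (tangent M) p Y \<and> X p = v \<and> Y p = w \<and>
           c = X p (\<lambda>q. \<eta> q (Y q)) - Y p (\<lambda>q. \<eta> q (X q)) - \<eta> p (lie_bracket M X Y p))"

definition ker_form ::
    "('a, 'i) mfd \<Rightarrow> nat \<Rightarrow> (nat \<Rightarrow> 'a \<Rightarrow> 'a tvec \<Rightarrow> real) \<Rightarrow> 'a \<Rightarrow> 'a tvec set"
  where "ker_form M k \<eta> p = {v \<in> tangent M p. \<forall>A<k. \<eta> A p v = 0}"

definition ker_ext_deriv ::
    "('a, 'i) mfd \<Rightarrow> nat \<Rightarrow> (nat \<Rightarrow> 'a \<Rightarrow> 'a tvec \<Rightarrow> real) \<Rightarrow> 'a \<Rightarrow> 'a tvec set"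
  where "ker_ext_deriv M k \<eta> p =
           {v \<in> tangent M p. \<forall>A<k. \<forall>w\<in>tangent M p. ext_deriv M (\<eta> A) p v w = 0}"

text \<open>The components of the vector-valued form are \<open>\<eta> A\<close> for \<open>A < k\<close>.\<close>

definition k_contact_form ::
    "('a, 'i) mfd \<Rightarrow> 'a set \<Rightarrow> nat \<Rightarrow> (nat \<Rightarrow> 'a \<Rightarrow> 'a tvec \<Rightarrow> real) \<Rightarrow> bool"
  where "k_contact_form M U k \<eta> \<longleftrightarrow> openin (mtop M) U \<and> (\<forall>A<k. one_form_on M U (\<eta> A)) \<and>
           (\<exists>d>0. d + k = mdim M \<and> distribution M U d (ker_form M k \<eta>)) \<and>
           (\<forall>p\<in>U. direct_sum (ker_form M k \<eta> p) (ker_ext_deriv M k \<eta> p) (tangent M p))"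

definition k_contact_manifold ::
    "nat \<Rightarrow> ('a, 'i) mfd \<Rightarrow> ('a \<Rightarrow> 'a tvec set) \<Rightarrow> bool"
  where "k_contact_manifold k M D \<longleftrightarrow> smooth_manifold M \<and> regular_distribution M k D \<and>
           (\<forall>p\<in>carrier M. \<exists>U \<eta>. p \<in> U \<and> k_contact_form M U k \<eta> \<and>
              (\<forall>q\<in>U. D q = ker_form M k \<eta> q))"


section \<open>Levi tensor, Legendrian subbundles and polarisations\<close>

text \<open>
  Elements of the quotient of the tangent space at \<open>p\<close> by \<open>D p\<close> are cosets, with zero
  \<open>D p\<close>. The value of the Levi tensor does not depend on the chosen local extensions.
\<close>

definition coset :: "'v::real_vector set \<Rightarrow> 'v \<Rightarrow> 'v set"
  where "coset D z = {z + d | d. d \<in> D}"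

definition levi ::
    "('a, 'i) mfd \<Rightarrow> ('a \<Rightarrow> 'a tvec set) \<Rightarrow> 'a \<Rightarrow> 'a tvec \<Rightarrow> 'a tvec \<Rightarrow> 'a tvec set"
  where "levi M D p v w = (SOME c. \<exists>X Y.
           local_section M D p X \<and> local_section M D p Y \<and> X p = v \<and> Y p = w \<and>
           c = coset (D p) (lie_bracket M X Y p))"

definition isotropic ::
    "('a, 'i) mfd \<Rightarrow> ('a \<Rightarrow> 'a tvec set) \<Rightarrow> 'a \<Rightarrow> 'a tvec set \<Rightarrow> bool"
  where "isotropic M D p L \<longleftrightarrow> subspace L \<and> L \<subseteq> D p \<and>
           (\<forall>v\<in>L. \<forall>w\<in>L. levi M D p v w = D p)"

definition legendrian ::
    "('a, 'i) mfd \<Rightarrow> ('a \<Rightarrow> 'a tvec set) \<Rightarrow> 'a \<Rightarrow> 'a tvec set \<Rightarrow> bool"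
  where "legendrian M D p L \<longleftrightarrow> isotropic M D p L \<and>
           (\<exists>W. isotropic M D p W \<and> direct_sum L W (D p))"

definition integrable_legendrian_subbundle ::
    "('a, 'i) mfd \<Rightarrow> ('a \<Rightarrow> 'a tvec set) \<Rightarrow> nat \<Rightarrow> ('a \<Rightarrow> 'a tvec set) \<Rightarrow> bool"
  where "integrable_legendrian_subbundle M D d P \<longleftrightarrow>
           distribution M (carrier M) d P \<and> (\<forall>p\<in>carrier M. legendrian M D p (P p)) \<and>
           integrable M d P"

definition polarisation ::
    "nat \<Rightarrow> ('a, 'i) mfd \<Rightarrow> ('a \<Rightarrow> 'a tvec set) \<Rightarrow> ('a \<Rightarrow> 'a tvec set) \<Rightarrow> bool"
  where "polarisation k M D P \<longleftrightarrow> k_contact_manifold k M D \<and>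
           (\<exists>d. integrable_legendrian_subbundle M D d P \<and>
              (\<forall>P' d'. integrable_legendrian_subbundle M D d' P' \<longrightarrow> d' \<le> d))"


section \<open>Fibred manifolds and adapted charts\<close>

text \<open>
  The base has dimension \<open>CARD('n)\<close> and the fibres have dimension \<open>CARD('m)\<close>; both are
  positive. Coordinates of the total space are labelled by \<open>'n + 'm\<close>.
\<close>

definition fibred_manifold ::
    "('e, 'n::finite + 'm::finite) mfd \<Rightarrow> ('q, 'n) mfd \<Rightarrow> ('e \<Rightarrow> 'q) \<Rightarrow> bool"
  where "fibred_manifold E Q \<pi> \<longleftrightarrow> smooth_manifold E \<and> smooth_manifold Q \<and>
           idx E = UNIV \<and> idx Q = UNIV \<and> \<pi> ` carrier E = carrier Q \<and>
           (\<forall>e\<in>carrier E. smooth_map_at E Q \<pi> e \<and> tmap Q \<pi> e ` tangent E e = tangent Q (\<pi> e))"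

text \<open>
  In an adapted chart \<open>(V, \<phi>, \<xi>)\<close> the pair \<open>(\<pi> ` V, \<xi>)\<close> is the underlying chart of the
  base. The base coordinates are \<open>\<phi> e (Inl i)\<close>, the fibre coordinates \<open>\<phi> e (Inr \<alpha>)\<close>.
\<close>

type_synonym ('e, 'q, 'n, 'm) adapted = "'e set \<times> ('e \<Rightarrow> 'n + 'm \<Rightarrow> real) \<times> ('q \<Rightarrow> 'n \<Rightarrow> real)"

definition adapted_charts ::
    "('e, 'n + 'm) mfd \<Rightarrow> ('q, 'n) mfd \<Rightarrow> ('e \<Rightarrow> 'q) \<Rightarrow> ('e, 'q, 'n, 'm) adapted set"
  where "adapted_charts E Q \<pi> = {(V, \<phi>, \<xi>). (V, \<phi>) \<in> charts E \<and> (\<pi> ` V, \<xi>) \<in> charts Q \<and>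
           (\<forall>e\<in>V. \<forall>i. \<phi> e (Inl i) = \<xi> (\<pi> e) i)}"


section \<open>Jet bundles\<close>

text \<open>
  Local sections near \<open>x\<close> are total functions of which only the behaviour near \<open>x\<close> matters.
\<close>

definition sections_at ::
    "('e, 'n + 'm) mfd \<Rightarrow> ('q, 'n) mfd \<Rightarrow> ('e \<Rightarrow> 'q) \<Rightarrow> 'q \<Rightarrow> ('q \<Rightarrow> 'e) set"
  where "sections_at E Q \<pi> x = {\<sigma>. \<exists>U. openin (mtop Q) U \<and> x \<in> U \<and>
           (\<forall>y\<in>U. smooth_map_at Q E \<sigma> y \<and> \<pi> (\<sigma> y) = y)}"

text \<open>
  \<open>section_deriv \<pi> (V, \<phi>, \<xi>) \<sigma> \<alpha> J x\<close> is the partial derivative of order \<open>J\<close> at \<open>x\<close> of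
  the \<open>\<alpha>\<close>-th component of the local section \<open>\<sigma>\<close> in the given adapted coordinates.
\<close>

definition section_deriv ::
    "('e \<Rightarrow> 'q) \<Rightarrow> ('e, 'q, 'n, 'm) adapted \<Rightarrow> ('q \<Rightarrow> 'e) \<Rightarrow> 'm \<Rightarrow> 'n multiset \<Rightarrow> 'q \<Rightarrow> real"
  where "section_deriv \<pi> = (\<lambda>(V, \<phi>, \<xi>) \<sigma> \<alpha> J x.
           pd_multi J (\<lambda>y. \<phi> (\<sigma> (inv_into (\<pi> ` V) \<xi> y)) (Inr \<alpha>)) (\<xi> x))"

definition jet_equiv ::
    "('e, 'n + 'm) mfd \<Rightarrow> ('q, 'n) mfd \<Rightarrow> ('e \<Rightarrow> 'q) \<Rightarrow> nat \<Rightarrow> 'q \<Rightarrow> ('q \<Rightarrow> 'e) \<Rightarrow> ('q \<Rightarrow> 'e) \<Rightarrow> bool"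
  where "jet_equiv E Q \<pi> r x \<sigma> \<tau> \<longleftrightarrow>
           \<sigma> \<in> sections_at E Q \<pi> x \<and> \<tau> \<in> sections_at E Q \<pi> x \<and> \<sigma> x = \<tau> x \<and>
           (\<exists>c\<in>adapted_charts E Q \<pi>. \<sigma> x \<in> fst c \<and>
              (\<forall>\<alpha> J. size J \<le> r \<longrightarrow> section_deriv \<pi> c \<sigma> \<alpha> J x = section_deriv \<pi> c \<tau> \<alpha> J x))"

text \<open>The \<open>r\<close>-jet of \<open>\<sigma>\<close> at \<open>x\<close> is the base point together with the equivalence class.\<close>

type_synonym ('e, 'q) jet = "'q \<times> ('q \<Rightarrow> 'e) set"

definition jet ::
    "('e, 'n + 'm) mfd \<Rightarrow> ('q, 'n) mfd \<Rightarrow> ('e \<Rightarrow> 'q) \<Rightarrow> nat \<Rightarrow> 'q \<Rightarrow> ('q \<Rightarrow> 'e) \<Rightarrow> ('e, 'q) jet"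
  where "jet E Q \<pi> r x \<sigma> = (x, {\<tau>. jet_equiv E Q \<pi> r x \<sigma> \<tau>})"

definition jet_rep :: "('e, 'q) jet \<Rightarrow> 'q \<Rightarrow> 'e"
  where "jet_rep p = (SOME \<sigma>. \<sigma> \<in> snd p)"

text \<open>
  Jet coordinates: \<open>Inl i\<close> labels the \<open>i\<close>-th base coordinate, and \<open>Inr (\<alpha>, J)\<close> with
  \<open>size J \<le> r\<close> labels the derivative of order \<open>J\<close> of the \<open>\<alpha>\<close>-th fibre coordinate.
\<close>

type_synonym ('n, 'm) jet_index = "'n + 'm \<times> 'n multiset"

definition jet_idx :: "nat \<Rightarrow> ('n, 'm) jet_index set"
  where "jet_idx r = UNIV <+> UNIV \<times> {J. size J \<le> r}"

definition jet_domain ::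
    "('e, 'n + 'm) mfd \<Rightarrow> ('q, 'n) mfd \<Rightarrow> ('e \<Rightarrow> 'q) \<Rightarrow> nat \<Rightarrow> ('e, 'q, 'n, 'm) adapted
       \<Rightarrow> ('e, 'q) jet set"
  where "jet_domain E Q \<pi> r c =
           {jet E Q \<pi> r x \<sigma> | x \<sigma>. x \<in> carrier Q \<and> \<sigma> \<in> sections_at E Q \<pi> x \<and> \<sigma> x \<in> fst c}"

definition jet_coords ::
    "('e \<Rightarrow> 'q) \<Rightarrow> nat \<Rightarrow> ('e, 'q, 'n, 'm) adapted \<Rightarrow> ('e, 'q) jet
       \<Rightarrow> ('n, 'm) jet_index \<Rightarrow> real"
  where "jet_coords \<pi> r = (\<lambda>(V, \<phi>, \<xi>) p. restrict (\<lambda>l. case l of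
             Inl i \<Rightarrow> \<xi> (fst p) i
           | Inr (\<alpha>, J) \<Rightarrow> section_deriv \<pi> (V, \<phi>, \<xi>) (jet_rep p) \<alpha> J (fst p)) (jet_idx r))"

definition jet_manifold ::
    "('e, 'n + 'm) mfd \<Rightarrow> ('q, 'n) mfd \<Rightarrow> ('e \<Rightarrow> 'q) \<Rightarrow> nat
       \<Rightarrow> (('e, 'q) jet, ('n, 'm) jet_index) mfd"
  where "jet_manifold E Q \<pi> r = \<lparr>idx = jet_idx r,
           atlas = {(jet_domain E Q \<pi> r c, jet_coords \<pi> r c) | c. c \<in> adapted_charts E Q \<pi>}\<rparr>"

text \<open>
  The projection of \<open>s\<close>-jets or higher jets to \<open>s\<close>-jets. A \<open>0\<close>-jet is determined by the
  value of the section, so \<open>jet_manifold E Q \<pi> 0\<close> is \<open>E\<close> up to the identification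
  of \<open>jet E Q \<pi> 0 x \<sigma>\<close> with \<open>\<sigma> x\<close>.
\<close>

definition jet_proj ::
    "('e, 'n + 'm) mfd \<Rightarrow> ('q, 'n) mfd \<Rightarrow> ('e \<Rightarrow> 'q) \<Rightarrow> nat \<Rightarrow> ('e, 'q) jet \<Rightarrow> ('e, 'q) jet"
  where "jet_proj E Q \<pi> s p = jet E Q \<pi> s (fst p) (jet_rep p)"

definition contact_form ::
    "('e \<Rightarrow> 'q) \<Rightarrow> nat \<Rightarrow> ('e, 'q, 'n::finite, 'm) adapted \<Rightarrow> 'm \<Rightarrow> 'n multiset
       \<Rightarrow> ('e, 'q) jet \<Rightarrow> ('e, 'q) jet tvec \<Rightarrow> real"
  where "contact_form \<pi> r c \<alpha> J p v =
           v (\<lambda>q. jet_coords \<pi> r c q (Inr (\<alpha>, J))) -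
           (\<Sum>i\<in>UNIV. jet_coords \<pi> r c p (Inr (\<alpha>, add_mset i J)) *
                      v (\<lambda>q. jet_coords \<pi> r c q (Inl i)))"

definition cartan_distribution ::
    "('e, 'n::finite + 'm) mfd \<Rightarrow> ('q, 'n) mfd \<Rightarrow> ('e \<Rightarrow> 'q) \<Rightarrow> nat
       \<Rightarrow> ('e, 'q) jet \<Rightarrow> ('e, 'q) jet tvec set"
  where "cartan_distribution E Q \<pi> r p = {v \<in> tangent (jet_manifold E Q \<pi> r) p.
           \<forall>c\<in>adapted_charts E Q \<pi>. p \<in> jet_domain E Q \<pi> r c \<longrightarrow>
             (\<forall>\<alpha> J. size J < r \<longrightarrow> contact_form \<pi> r c \<alpha> J p v = 0)}"

definition vertical_distribution ::
    "('e, 'n + 'm) mfd \<Rightarrow> ('q, 'n) mfd \<Rightarrow> ('e \<Rightarrow> 'q) \<Rightarrow> nat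
       \<Rightarrow> ('e, 'q) jet \<Rightarrow> ('e, 'q) jet tvec set"
  where "vertical_distribution E Q \<pi> r p = {v \<in> tangent (jet_manifold E Q \<pi> r) p.
           tmap (jet_manifold E Q \<pi> (r - 1)) (jet_proj E Q \<pi> (r - 1)) p v = 0}"

end

theory Submission
  imports Defs
begin

text \<open>
  The jet bundle is a manifold because a submersion has adapted charts, by the inverse function
  theorem (\<open>adapted_chart_exists\<close>), because every tuple of derivatives is realised by a section
  that is polynomial in coordinates (\<open>section_jet_realize\<close>), and because repeated use of the chain
  rule expresses the derivatives of a section in one adapted chart smoothly through those of at
  most the same order in another (\<open>jet_transition_exists\<close>). The same chain rule, applied to a
  single additional derivative, shows that the contact forms of any one adapted chart define the
  Cartan distribution (\<open>cartan_iff\<close>). So it has a frame dual to the base coordinates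
  \<open>x\<^sub>i\<close> and the coordinates \<open>u\<^sub>K\<close> of top order \<open>|K| = r\<close>: the truncated total derivatives and the
  top coordinate vectors, the latter spanning the vertical distribution.

  For \<open>r \<ge> 2\<close> the contact forms \<open>\<theta>\<^sub>I = du\<^sub>I - \<Sum>\<^sub>i u\<^sub>I\<^sub>+\<^sub>i dx\<^sub>i\<close> do not themselves constitute a
  \<open>k\<close>-contact form, since their exterior derivatives involve jet coordinates of all positive
  orders, so that the common kernel of these is too small. The combinations
  \<open>\<eta>\<^sub>J = \<Sum> (-x)\<^sup>I\<^sup>-\<^sup>J / (I - J)! \<theta>\<^sub>I\<close>, summed over the multi-indices \<open>I \<ge> J\<close> with \<open>|I| < r\<close>, have the
  same common kernel. They are adapted to the translations of sections by polynomials of degree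
  less than \<open>r\<close>, which act as commuting Reeb fields. The sum telescopes to
  \<open>\<eta>\<^sub>J = dU\<^sub>J - \<Sum>\<^sub>i P\<^sub>J\<^sub>,\<^sub>i dx\<^sub>i\<close> with coefficients \<open>P\<^sub>J\<^sub>,\<^sub>i\<close> of top order only (\<open>eta_telescope\<close>).
  Hence the common kernel of the \<open>d\<eta>\<^sub>J\<close> is given by the vanishing of the base and the top
  components (\<open>ext_deriv_eta_zero_iff\<close>), a complement of the Cartan distribution.

  The Levi tensor vanishes on two Cartan vectors exactly if the forms \<open>\<Sum>\<^sub>i du\<^sub>J\<^sub>+\<^sub>i \<and> dx\<^sub>i\<close> with
  \<open>|J| = r - 1\<close> do (\<open>levi_eq_iff\<close>). These pair top components with base components, so that the
  vertical space and the span of the truncated total derivatives are complementary isotropic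
  subspaces. The vertical distribution is integrable because its integral manifolds are the fibres
  of the projection.

  Maximality already holds among the isotropic subspaces \<open>L\<close> of one Cartan space
  (\<open>isotropic_rank_le\<close>). Choose a minimal set \<open>B\<close> of base coordinates whose vanishing on a vector
  of \<open>L\<close> forces all its base components to vanish; then \<open>L\<close> contains dual vectors to the
  coordinates in \<open>B\<close>. Isotropy against these makes a vertical vector of \<open>L\<close> vanish as soon as its
  components at the top multi-indices that avoid \<open>B\<close> do (\<open>isotropic_vector_zero\<close>). Therefore
  \<open>dim L\<close> is at most \<open>|B|\<close> plus the number of top labels avoiding \<open>B\<close>. Assigning to \<open>a \<in> B\<close> the
  multi-index \<open>r \<cdot> a\<close>, which meets \<open>B\<close>, bounds this by the number of all top labels, the rank of
  the vertical distribution.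
\<close>

section \<open>Open sets and continuous functions of finitely many real variables\<close>

definition tuples :: "'i set \<Rightarrow> ('i \<Rightarrow> real) set"
  where "tuples I = PiE I (\<lambda>_. UNIV)"

lemma topspace_powertop_real [simp]: "topspace (powertop_real I) = tuples I"
  by (simp add: tuples_def)

(* The simplifier would replace tuple spaces by products again. *)
declare topspace_product_topology [simp del]

lemma tuples_iff: "x \<in> tuples I \<longleftrightarrow> (\<forall>i. i \<notin> I \<longrightarrow> x i = undefined)"
  by (simp add: tuples_def PiE_iff extensional_def)

lemma tuples_UNIV [simp]: "tuples UNIV = UNIV"
  by (auto simp: tuples_iff)

lemma restrict_in_tuples [simp]: "restrict f I \<in> tuples I"
  by (simp add: tuples_iff)

abbreviation ropen :: "'i set \<Rightarrow> ('i \<Rightarrow> real) set \<Rightarrow> bool"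
  where "ropen I W \<equiv> openin (powertop_real I) W"

lemma ropen_subset_tuples: "ropen I W \<Longrightarrow> W \<subseteq> tuples I"
  using openin_subset[of "powertop_real I" W] by simp

lemma tuples_upd: "x \<in> tuples I \<Longrightarrow> i \<in> I \<Longrightarrow> x(i := t) \<in> tuples I"
  by (simp add: tuples_iff)

lemma tuples_eqI: "x \<in> tuples I \<Longrightarrow> y \<in> tuples I \<Longrightarrow> (\<And>i. i \<in> I \<Longrightarrow> x i = y i) \<Longrightarrow> x = y"
  by (metis ext tuples_iff)

lemma ropen_iff_box:
  assumes "finite I"
  shows "ropen I W \<longleftrightarrow> W \<subseteq> tuples I \<and>
    (\<forall>x\<in>W. \<exists>e>0. \<forall>y\<in>tuples I. (\<forall>i\<in>I. \<bar>y i - x i\<bar> < e) \<longrightarrow> y \<in> W)" (is "?L \<longleftrightarrow> ?R")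
proof
  assume L: ?L
  have "\<exists>e>0. \<forall>y\<in>tuples I. (\<forall>i\<in>I. \<bar>y i - x i\<bar> < e) \<longrightarrow> y \<in> W" if x: "x \<in> W" for x
  proof -
    obtain U where U: "\<forall>i\<in>I. open (U i)" "x \<in> Pi\<^sub>E I U" "Pi\<^sub>E I U \<subseteq> W"
      using L x unfolding openin_product_topology_alt by (metis open_openin)
    have "\<exists>e>0. ball (x i) e \<subseteq> U i" if "i \<in> I" for i
      using U that by (meson PiE_mem open_contains_ball)
    then obtain e where e: "\<And>i. i \<in> I \<Longrightarrow> e i > 0 \<and> ball (x i) (e i) \<subseteq> U i" by metis
    define d where "d = Min (insert 1 (e ` I))"
    have "d > 0" using assms e by (auto simp: d_def)
    moreover have "y \<in> W" if yI: "y \<in> tuples I" and yd: "\<forall>i\<in>I. \<bar>y i - x i\<bar> < d" for y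
    proof -
      have "y i \<in> U i" if i: "i \<in> I" for i
      proof -
        have "d \<le> e i" using assms i by (auto simp: d_def)
        moreover have "\<bar>y i - x i\<bar> < d" using yd i by blast
        ultimately have "y i \<in> ball (x i) (e i)" by (simp add: dist_real_def abs_minus_commute)
        then show ?thesis using e[OF i] by blast
      qed
      then have "y \<in> Pi\<^sub>E I U" using yI by (simp add: PiE_iff tuples_iff extensional_def)
      then show ?thesis using U(3) by blast
    qed
    ultimately show ?thesis by blast
  qed
  then have "\<forall>x\<in>W. \<exists>e>0. \<forall>y\<in>tuples I. (\<forall>i\<in>I. \<bar>y i - x i\<bar> < e) \<longrightarrow> y \<in> W" ..
  with ropen_subset_tuples[OF L] show ?R ..
next
  assume R: ?R
  show ?L unfolding openin_product_topology_alt
  proof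
    fix x assume x: "x \<in> W"
    then obtain e where e: "e > 0" "\<And>y. y \<in> tuples I \<Longrightarrow> (\<forall>i\<in>I. \<bar>y i - x i\<bar> < e) \<Longrightarrow> y \<in> W"
      using bspec[OF conjunct2[OF R] x] by meson
    have "x \<in> tuples I" using subsetD[OF conjunct1[OF R] x] .
    then have "x \<in> (\<Pi>\<^sub>E i\<in>I. ball (x i) e)" using e(1) by (simp add: PiE_iff tuples_iff extensional_def)
    moreover have "(\<Pi>\<^sub>E i\<in>I. ball (x i) e) \<subseteq> W"
      by (auto intro!: e(2) simp: PiE_iff dist_real_def abs_minus_commute tuples_iff extensional_def)
    ultimately show "\<exists>U. finite {i \<in> I. U i \<noteq> topspace euclideanreal} \<and>
      (\<forall>i\<in>I. openin euclideanreal (U i)) \<and> x \<in> Pi\<^sub>E I U \<and> Pi\<^sub>E I U \<subseteq> W"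
      using assms by (intro exI[of _ "\<lambda>i. ball (x i) e"]) auto
  qed
qed

lemma ropen_tuples: "ropen I (tuples I)"
  using openin_topspace[of "powertop_real I"] by simp

lemma ropen_boxE:
  assumes "finite I" "ropen I W" "x \<in> W"
  obtains e where "e > 0" "\<And>y. y \<in> tuples I \<Longrightarrow> (\<And>i. i \<in> I \<Longrightarrow> \<bar>y i - x i\<bar> < e) \<Longrightarrow> y \<in> W"
  using assms ropen_iff_box[of I W] by metis

definition rbox :: "'i set \<Rightarrow> ('i \<Rightarrow> real) \<Rightarrow> real \<Rightarrow> ('i \<Rightarrow> real) set"
  where "rbox I x e = {y \<in> tuples I. \<forall>i\<in>I. \<bar>y i - x i\<bar> < e}"

lemma rbox_centre: "x \<in> tuples I \<Longrightarrow> e > 0 \<Longrightarrow> x \<in> rbox I x e"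
  by (simp add: rbox_def)

lemma ropen_rbox: assumes "finite I" shows "ropen I (rbox I x e)"
  unfolding ropen_iff_box[OF assms]
proof (intro conjI ballI)
  show "rbox I x e \<subseteq> tuples I" by (auto simp: rbox_def)
  fix y assume y: "y \<in> rbox I x e"
  define d where "d = Min (insert 1 ((\<lambda>i. e - \<bar>y i - x i\<bar>) ` I))"
  have "d > 0" using assms y by (auto simp: d_def rbox_def)
  moreover have "z \<in> rbox I x e" if z: "z \<in> tuples I" "\<forall>i\<in>I. \<bar>z i - y i\<bar> < d" for z
  proof -
    have "\<bar>z i - x i\<bar> < e" if i: "i \<in> I" for i
    proof -
      have "d \<le> e - \<bar>y i - x i\<bar>" using assms i by (auto simp: d_def)
      then show ?thesis using z(2) i by force
    qed
    then show ?thesis using z by (simp add: rbox_def)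
  qed
  ultimately show "\<exists>d>0. \<forall>z\<in>tuples I. (\<forall>i\<in>I. \<bar>z i - y i\<bar> < d) \<longrightarrow> z \<in> rbox I x e" by blast
qed

text \<open>
  This replaces continuity between abstract topologies by the type-class notion
  \<open>continuous_on\<close>, which has better automation.
\<close>

lemma subtopology_powertop_real:
  assumes "W \<subseteq> tuples I"
  shows "subtopology (powertop_real I) W = top_of_set W"
proof -
  have "continuous_map (subtopology (powertop_real I) W) (powertop_real UNIV) (\<lambda>x. x)"
    unfolding continuous_map_componentwise_UNIV
  proof
    fix k show "continuous_map (subtopology (powertop_real I) W) euclideanreal (\<lambda>x. x k)"
    proof (cases "k \<in> I")
      case True
      then show ?thesis
        by (intro continuous_map_from_subtopology continuous_map_product_projection)
    next
      case False
      with assms have undef: "x k = undefined" if "x \<in> W" for x using that by (auto simp: tuples_iff)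
      have "continuous_map (subtopology (powertop_real I) W) euclideanreal (\<lambda>_. undefined)" by simp
      then show ?thesis by (rule continuous_map_eq) (simp add: undef)
    qed
  qed
  then have 1: "continuous_map (subtopology (powertop_real I) W) (top_of_set W) (\<lambda>x. x)"
    unfolding euclidean_product_topology by (auto simp: continuous_map_in_subtopology)
  have "continuous_map (top_of_set W) (powertop_real I) (\<lambda>x. x)"
    unfolding continuous_map_componentwise using assms
    by (auto simp: extensional_def tuples_iff
        intro!: continuous_on_subset[OF continuous_on_product_coordinates])
  then have 2: "continuous_map (top_of_set W) (subtopology (powertop_real I) W) (\<lambda>x. x)"
    by (auto simp: continuous_map_in_subtopology)
  have W: "W \<inter> tuples I = W" using assms by blast
  show ?thesis unfolding topology_eq
  proof (intro allI iffI)
    fix S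
    assume S: "openin (subtopology (powertop_real I) W) S"
    then have "S \<subseteq> W" using openin_subset by fastforce
    then have "{x \<in> W. x \<in> S} = S" by blast
    then show "openin (top_of_set W) S" using openin_continuous_map_preimage[OF 2 S] by simp
  next
    fix S
    assume S: "openin (top_of_set W) S"
    then have "S \<subseteq> W" using openin_subset by fastforce
    then have "{x \<in> W. x \<in> S} = S" by blast
    then show "openin (subtopology (powertop_real I) W) S"
      using openin_continuous_map_preimage[OF 1 S] by (simp add: W Int_commute)
  qed
qed

lemma continuous_map_iff_continuous_on:
  "W \<subseteq> tuples I \<Longrightarrow>
    continuous_map (subtopology (powertop_real I) W) euclideanreal g \<longleftrightarrow> continuous_on W g"
  by (simp add: subtopology_powertop_real)

lemma continuous_on_tuple_valued:
  assumes "\<And>j. j \<in> J \<Longrightarrow> continuous_on W (f j)"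
  shows "continuous_on W (\<lambda>x. \<lambda>j\<in>J. f j x)"
proof (rule continuous_on_coordinatewise_then_product)
  fix j show "continuous_on W (\<lambda>x. (\<lambda>j\<in>J. f j x) j)"
    by (cases "j \<in> J") (use assms in auto)
qed

lemma ropen_preimage:
  assumes "ropen I W" "continuous_on W h" "h ` W \<subseteq> tuples J" "ropen J W'"
  shows "ropen I {x \<in> W. h x \<in> W'}"
proof -
  have W: "W \<subseteq> tuples I" using assms(1) by (rule ropen_subset_tuples)
  have "continuous_map (top_of_set W) (subtopology (powertop_real J) (tuples J)) h"
    using assms(2,3) by (auto simp: subtopology_powertop_real continuous_map_in_subtopology)
  then have "continuous_map (subtopology (powertop_real I) W) (powertop_real J) h"
    by (simp add: continuous_map_in_subtopology subtopology_powertop_real[OF W])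
  then show ?thesis using assms(4,1) W
    by (auto dest!: openin_continuous_map_preimage simp: openin_open_subtopology Int_absorb1
          Int_absorb2)
qed

lemma continuous_on_rboxE:
  assumes "finite I" "ropen I W" "continuous_on W g" "x \<in> W" "(\<epsilon>::real) > 0"
  obtains e where "e > 0" "rbox I x e \<subseteq> W" "\<And>y. y \<in> rbox I x e \<Longrightarrow> \<bar>g y - g x\<bar> < \<epsilon>"
proof -
  have "continuous_map (subtopology (powertop_real I) W) euclideanreal g"
    using assms(3) by (simp add: continuous_map_iff_continuous_on ropen_subset_tuples[OF assms(2)])
  from openin_continuous_map_preimage[OF this, of "ball (g x) \<epsilon>"]
  have "openin (subtopology (powertop_real I) W) {y \<in> W. g y \<in> ball (g x) \<epsilon>}"
    using ropen_subset_tuples[OF assms(2)] by (simp add: Int_absorb1)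
  then have "ropen I {y \<in> W. g y \<in> ball (g x) \<epsilon>}"
    using assms(2) by (simp add: openin_open_subtopology)
  then obtain e where "e > 0" "\<And>y. y \<in> tuples I \<Longrightarrow> (\<And>i. i \<in> I \<Longrightarrow> \<bar>y i - x i\<bar> < e) \<Longrightarrow>
      y \<in> {y \<in> W. g y \<in> ball (g x) \<epsilon>}"
    using ropen_boxE[OF assms(1)] assms(4,5) by (metis (no_types, lifting) centre_in_ball mem_Collect_eq)
  then show ?thesis
    by (intro that[of e]) (auto simp: rbox_def dist_real_def abs_minus_commute)
qed

section \<open>Functions of class \<open>C\<^sup>k\<close>\<close>

lemma Ck_on_continuous: "Ck_on I k W g \<Longrightarrow> W \<subseteq> tuples I \<Longrightarrow> continuous_on W g"
  by (cases k) (simp_all add: continuous_map_iff_continuous_on)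

lemma Ck_on_pd: "Ck_on I (Suc k) W g \<Longrightarrow> i \<in> I \<Longrightarrow> Ck_on I k W (pd i g)"
  by simp

lemma Ck_on_DERIV:
  assumes "Ck_on I (Suc k) W g" "i \<in> I" "x(i := s) \<in> W"
  shows "((\<lambda>t. g (x(i := t))) has_real_derivative pd i g (x(i := s))) (at s)"
proof -
  have "\<forall>x\<in>W. (\<lambda>t. g (x(i := t))) differentiable (at (x i))" using assms(1,2) by simp
  from bspec[OF this assms(3)] have "(\<lambda>t. g (x(i := t))) differentiable (at s)" by simp
  then show ?thesis unfolding pd_def
    using DERIV_deriv_iff_real_differentiable by force
qed

lemma Ck_on_mono: "Ck_on I k W g \<Longrightarrow> l \<le> k \<Longrightarrow> Ck_on I l W g"
proof (induction k arbitrary: l g)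
  case (Suc k)
  then show ?case
    by (cases l) auto
qed simp

lemma Ck_on_subset: "Ck_on I k W g \<Longrightarrow> V \<subseteq> W \<Longrightarrow> Ck_on I k V g"
  by (induction k arbitrary: g)
    (auto intro: continuous_map_from_subtopology_mono)

lemma eventually_upd_in:
  assumes "finite I" "ropen I W" "i \<in> I" "x(i := s) \<in> W"
  shows "eventually (\<lambda>t. x(i := t) \<in> W) (at s)" "eventually (\<lambda>t. x(i := t) \<in> W) (nhds s)"
proof -
  obtain e where e: "e > 0"
    "\<And>y. y \<in> tuples I \<Longrightarrow> (\<And>j. j \<in> I \<Longrightarrow> \<bar>y j - (x(i := s)) j\<bar> < e) \<Longrightarrow> y \<in> W"
    using ropen_boxE[OF assms(1,2,4)] by metis
  have "x(i := s) \<in> tuples I" using assms ropen_subset_tuples by blast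
  then have "x(i := t) \<in> tuples I" for t using tuples_upd[of "x(i := s)" I i t] assms(3) by simp
  then have "x(i := t) \<in> W" if "dist t s < e" for t
    using e(1) that by (intro e(2)) (auto simp: dist_real_def)
  then show "eventually (\<lambda>t. x(i := t) \<in> W) (nhds s)"
    unfolding eventually_nhds_metric using e(1) by blast
  then show "eventually (\<lambda>t. x(i := t) \<in> W) (at s)"
    by (simp add: eventually_at_filter eventually_mono)
qed

lemma pd_cong:
  assumes "finite I" "ropen I W" "i \<in> I" "x \<in> W" "\<And>y. y \<in> W \<Longrightarrow> f y = g y"
  shows "pd i f x = pd i g x"
  unfolding pd_def
proof (rule deriv_cong_ev)
  have "x(i := x i) \<in> W" using assms(4) by simp
  from eventually_upd_in(2)[OF assms(1-3) this]
  show "\<forall>\<^sub>F t in nhds (x i). f (x(i := t)) = g (x(i := t))"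
    by (rule eventually_mono) (rule assms(5))
qed simp

lemma Ck_on_cong_imp:
  assumes "finite I" "ropen I W" "\<And>y. y \<in> W \<Longrightarrow> f y = g y" "Ck_on I k W f"
  shows "Ck_on I k W g"
  using assms(3,4)
proof (induction k arbitrary: f g)
  case 0
  then show ?case
    using continuous_on_cong[of W W f g] by (simp add: continuous_map_iff_continuous_on ropen_subset_tuples[OF assms(2)])
next
  case (Suc k)
  have "Ck_on I k W (pd i g)" if "i \<in> I" for i
  proof (rule Suc.IH)
    show "pd i f y = pd i g y" if "y \<in> W" for y
      by (rule pd_cong[OF assms(1,2) \<open>i \<in> I\<close> that Suc.prems(1)])
    show "Ck_on I k W (pd i f)" using Suc.prems that by simp
  qed
  moreover have "(\<lambda>t. g (x(i := t))) differentiable (at (x i))" if "i \<in> I" "x \<in> W" for i x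
  proof -
    have x: "x(i := x i) \<in> W" using that by simp
    have "((\<lambda>t. f (x(i := t))) has_real_derivative pd i f (x(i := x i))) (at (x i))"
      using Suc.prems(2) that(1) x by (rule Ck_on_DERIV)
    moreover have "\<forall>\<^sub>F t in nhds (x i). f (x(i := t)) = g (x(i := t))"
      using eventually_upd_in(2)[OF assms(1,2) that(1) x]
      by (rule eventually_mono) (rule Suc.prems(1))
    ultimately have "((\<lambda>t. g (x(i := t))) has_real_derivative pd i f (x(i := x i))) (at (x i))"
      by (simp add: DERIV_cong_ev[OF refl _ refl, of "\<lambda>t. f (x(i := t))"])
    then show ?thesis
      using real_differentiable_def by blast
  qed
  moreover have "continuous_map (subtopology (powertop_real I) W) euclideanreal g"
    using Suc.prems continuous_on_cong[of W W f g]
    by (simp add: continuous_map_iff_continuous_on ropen_subset_tuples[OF assms(2)])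
  ultimately show ?case by simp
qed

text \<open>
  Derivatives found by the calculus of one variable can be supplied as they are, without first
  identifying them with \<open>pd\<close>.
\<close>

lemma Ck_on_SucI:
  assumes "finite I" "ropen I W" "continuous_on W g"
    "\<And>i x. i \<in> I \<Longrightarrow> x \<in> W \<Longrightarrow> ((\<lambda>t. g (x(i := t))) has_real_derivative d i x) (at (x i))"
    "\<And>i. i \<in> I \<Longrightarrow> Ck_on I k W (d i)"
  shows "Ck_on I (Suc k) W g"
proof -
  have pd: "d i x = pd i g x" if "i \<in> I" "x \<in> W" for i x
    using assms(4)[OF that] by (simp add: pd_def DERIV_imp_deriv)
  have "Ck_on I k W (pd i g)" if "i \<in> I" for i
    using Ck_on_cong_imp[OF assms(1,2) pd assms(5)] that by blast
  moreover have "(\<lambda>t. g (x(i := t))) differentiable (at (x i))" if "i \<in> I" "x \<in> W" for i x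
    using assms(4)[OF that] real_differentiable_def by blast
  ultimately show ?thesis
    using assms(3) by (simp add: continuous_map_iff_continuous_on ropen_subset_tuples[OF assms(2)])
qed

lemma pd_eqI: "((\<lambda>t. g (x(i := t))) has_real_derivative d) (at (x i)) \<Longrightarrow> pd i g x = d"
  by (simp add: pd_def DERIV_imp_deriv)

lemma Ck_on_DERIV_at:
  assumes "Ck_on I (Suc k) W g" "i \<in> I" "x \<in> W"
  shows "((\<lambda>t. g (x(i := t))) has_real_derivative pd i g x) (at (x i))"
  using Ck_on_DERIV[OF assms(1,2), of x "x i"] assms(3) by simp

lemma pd_const: "pd i (\<lambda>x. c) x = 0"
  by (simp add: pd_def)

lemma pd_coord: "pd i (\<lambda>x. x j) x = (if i = j then 1 else 0)"
  by (simp add: pd_def)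

lemma Ck_on_const: assumes "finite I" "ropen I W" shows "Ck_on I k W (\<lambda>x. c)"
proof (induction k arbitrary: c)
  case 0 then show ?case by simp
next
  case (Suc k) show ?case
    by (rule Ck_on_SucI[OF assms, where d = "\<lambda>i x. 0"]) (auto intro: Suc)
qed

lemma Ck_on_coord: assumes "finite I" "ropen I W" "j \<in> I" shows "Ck_on I k W (\<lambda>x. x j)"
proof (cases k)
  case 0 then show ?thesis using assms
    by (auto simp: continuous_map_iff_continuous_on[OF ropen_subset_tuples[OF assms(2)]]
        intro: continuous_on_subset[OF continuous_on_product_coordinates])
next
  case (Suc k) show ?thesis unfolding Suc
    by (rule Ck_on_SucI[OF assms(1,2), where d = "\<lambda>i x. if i = j then 1 else 0"])
      (auto intro: Ck_on_const assms continuous_on_subset[OF continuous_on_product_coordinates])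
qed

lemma Ck_on_add:
  assumes "finite I" "ropen I W" "Ck_on I k W f" "Ck_on I k W g"
  shows "Ck_on I k W (\<lambda>x. f x + g x)"
  using assms(3,4)
proof (induction k arbitrary: f g)
  case 0
  then show ?case
    by (simp add: continuous_map_iff_continuous_on ropen_subset_tuples[OF assms(2)] continuous_intros)
next
  case (Suc k) show ?case
  proof (rule Ck_on_SucI[OF assms(1,2), where d = "\<lambda>i x. pd i f x + pd i g x"])
    show "continuous_on W (\<lambda>x. f x + g x)"
      using Suc.prems[THEN Ck_on_continuous, OF ropen_subset_tuples[OF assms(2)]]
      by (auto intro: continuous_intros)
    show "((\<lambda>t. f (x(i := t)) + g (x(i := t))) has_real_derivative pd i f x + pd i g x) (at (x i))"
      if "i \<in> I" "x \<in> W" for i x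
      using Suc.prems[THEN Ck_on_DERIV_at, OF that] by (rule DERIV_add)
    show "Ck_on I k W (\<lambda>x. pd i f x + pd i g x)" if "i \<in> I" for i
      using Suc.prems that by (intro Suc.IH) auto
  qed
qed

lemma Ck_on_mult:
  assumes "finite I" "ropen I W" "Ck_on I k W f" "Ck_on I k W g"
  shows "Ck_on I k W (\<lambda>x. f x * g x)"
  using assms(3,4)
proof (induction k arbitrary: f g)
  case 0
  then show ?case
    by (simp add: continuous_map_iff_continuous_on ropen_subset_tuples[OF assms(2)] continuous_intros)
next
  case (Suc k) show ?case
  proof (rule Ck_on_SucI[OF assms(1,2), where d = "\<lambda>i x. pd i f x * g x + pd i g x * f x"])
    show "continuous_on W (\<lambda>x. f x * g x)"
      using Suc.prems[THEN Ck_on_continuous, OF ropen_subset_tuples[OF assms(2)]]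
      by (auto intro: continuous_intros)
    show "((\<lambda>t. f (x(i := t)) * g (x(i := t))) has_real_derivative pd i f x * g x + pd i g x * f x) (at (x i))"
      if "i \<in> I" "x \<in> W" for i x
      using DERIV_mult[OF Suc.prems[THEN Ck_on_DERIV_at, OF that]] by (simp only: fun_upd_triv)
    show "Ck_on I k W (\<lambda>x. pd i f x * g x + pd i g x * f x)" if "i \<in> I" for i
      using Suc.prems that Ck_on_mono[of I "Suc k" W _ k]
      by (intro Ck_on_add[OF assms(1,2)] Suc.IH) auto
  qed
qed

lemma Ck_on_sum:
  assumes "finite I" "ropen I W" "\<And>a. a \<in> A \<Longrightarrow> Ck_on I k W (f a)"
  shows "Ck_on I k W (\<lambda>x. \<Sum>a\<in>A. f a x)"
  using assms(3)
  by (induction A rule: infinite_finite_induct) (auto intro: Ck_on_add Ck_on_const assms simp del: Ck_on.simps)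

lemma Ck_on_prod:
  assumes "finite I" "ropen I W" "\<And>a. a \<in> A \<Longrightarrow> Ck_on I k W (f a)"
  shows "Ck_on I k W (\<lambda>x. \<Prod>a\<in>A. f a x)"
  using assms(3)
  by (induction A rule: infinite_finite_induct) (auto intro: Ck_on_mult Ck_on_const assms simp del: Ck_on.simps)

lemma Ck_on_inverse:
  assumes "finite I" "ropen I W" "Ck_on I k W f" "\<And>x. x \<in> W \<Longrightarrow> f x \<noteq> 0"
  shows "Ck_on I k W (\<lambda>x. inverse (f x))"
  using assms(3)
proof (induction k)
  case 0
  then show ?case using assms(4)
    by (auto simp: continuous_map_iff_continuous_on ropen_subset_tuples[OF assms(2)] intro!: continuous_intros)
next
  case (Suc k) show ?case
  proof (rule Ck_on_SucI[OF assms(1,2), where d = "\<lambda>i x. (-1) * (inverse (f x) * pd i f x * inverse (f x))"])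
    show "continuous_on W (\<lambda>x. inverse (f x))"
      using Suc.prems[THEN Ck_on_continuous, OF ropen_subset_tuples[OF assms(2)]] assms(4)
      by (auto intro!: continuous_intros)
    show "((\<lambda>t. inverse (f (x(i := t)))) has_real_derivative
        (-1) * (inverse (f x) * pd i f x * inverse (f x))) (at (x i))"
      if "i \<in> I" "x \<in> W" for i x
      using DERIV_inverse'[OF Ck_on_DERIV_at[OF Suc.prems that]] assms(4)[OF that(2)]
      by (simp only: fun_upd_triv mult_minus1 not_False_eq_True)
    show "Ck_on I k W (\<lambda>x. (-1) * (inverse (f x) * pd i f x * inverse (f x)))" if "i \<in> I" for i
      using Suc that Ck_on_mono[OF Suc.prems, of k] by (intro Ck_on_mult Ck_on_const assms) auto
  qed
qed

lemma Ck_on_local: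
  assumes "finite I" "ropen I W"
    "\<And>x. x \<in> W \<Longrightarrow> \<exists>V. ropen I V \<and> x \<in> V \<and> V \<subseteq> W \<and> Ck_on I k V g"
  shows "Ck_on I k W g"
  using assms(3)
proof (induction k arbitrary: g)
  case 0
  have "continuous_on W g" unfolding continuous_on_def
  proof
    fix x assume "x \<in> W"
    then obtain V where V: "ropen I V" "x \<in> V" "V \<subseteq> W" "Ck_on I 0 V g" using 0 by blast
    have "openin (top_of_set W) V" using V(1,3) assms(2)
      by (simp add: openin_open_subtopology flip: subtopology_powertop_real[OF ropen_subset_tuples[OF assms(2)]])
    then obtain T where T: "open T" "V = W \<inter> T" by (auto simp: openin_open)
    have "at x within W = at x within V"
      by (rule at_within_nhd[of x T]) (use T V(2) in auto)
    moreover have "continuous_on V g" using V(4) ropen_subset_tuples[OF V(1)] by (rule Ck_on_continuous)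
    ultimately show "(g \<longlongrightarrow> g x) (at x within W)"
      using V(2) by (simp add: continuous_on_def)
  qed
  then show ?case by (simp add: continuous_map_iff_continuous_on ropen_subset_tuples[OF assms(2)])
next
  case (Suc k)
  have "Ck_on I (Suc k) W g \<longleftrightarrow> continuous_on W g \<and>
       (\<forall>i\<in>I. (\<forall>x\<in>W. (\<lambda>t. g (x(i := t))) differentiable (at (x i))) \<and> Ck_on I k W (pd i g))"
    by (simp add: continuous_map_iff_continuous_on ropen_subset_tuples[OF assms(2)])
  moreover have "Ck_on I k W g"
    by (rule Suc.IH) (use Suc.prems Ck_on_mono[of I "Suc k" _ g k] in \<open>metis le_SucI order_refl\<close>)
  then have "continuous_on W g" using ropen_subset_tuples[OF assms(2)] by (rule Ck_on_continuous)
  moreover have "(\<lambda>t. g (x(i := t))) differentiable (at (x i))" if i: "i \<in> I" and x: "x \<in> W" for i x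
  proof -
    obtain V where V: "Ck_on I (Suc k) V g" "x \<in> V" using Suc.prems[OF x] by blast
    from Ck_on_DERIV_at[OF V(1) i V(2)] show ?thesis
      unfolding real_differentiable_def by (rule exI)
  qed
  moreover have "Ck_on I k W (pd i g)" if "i \<in> I" for i
  proof (rule Suc.IH)
    fix x assume "x \<in> W"
    then obtain V where "ropen I V" "x \<in> V" "V \<subseteq> W" "Ck_on I (Suc k) V g" using Suc.prems by blast
    then show "\<exists>V. ropen I V \<and> x \<in> V \<and> V \<subseteq> W \<and> Ck_on I k V (pd i g)"
      using Ck_on_pd[OF _ that] by blast
  qed
  ultimately show ?case by simp
qed

section \<open>The chain rule\<close>

lemma MVT_unordered:
  fixes F F' :: "real \<Rightarrow> real"
  assumes "\<And>s. min a b \<le> s \<Longrightarrow> s \<le> max a b \<Longrightarrow> (F has_real_derivative F' s) (at s)"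
  shows "\<exists>s. min a b \<le> s \<and> s \<le> max a b \<and> F b - F a = (b - a) * F' s"
proof -
  consider "a < b" | "a = b" | "b < a" by linarith
  then show ?thesis
  proof cases
    case 1
    then show ?thesis using MVT2[of a b F F'] assms by (metis less_eq_real_def max.absorb4 min.absorb3)
  next
    case 2 then show ?thesis by auto
  next
    case 3
    then obtain s where "b < s" "s < a" "F a - F b = (a - b) * F' s"
      using MVT2[of b a F F'] assms by (metis less_eq_real_def max.absorb3 min.absorb4)
    then show ?thesis using 3 by (intro exI[of _ s]) (auto simp: algebra_simps)
  qed
qed

lemma rbox_mono: "d \<le> e \<Longrightarrow> rbox I x d \<subseteq> rbox I x e"
  by (force simp: rbox_def)

text \<open>
  Change the coordinates one at a time and apply the mean value theorem to each change:
  continuity of the partial derivatives makes every error small.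
\<close>

lemma Ck_on_frechet:
  assumes "finite I" "ropen I W" "Ck_on I (Suc 0) W g" "x \<in> W" "\<epsilon> > 0"
  obtains e where "e > 0" "rbox I x e \<subseteq> W"
    "\<And>y. y \<in> rbox I x e \<Longrightarrow>
       \<bar>g y - g x - (\<Sum>i\<in>I. pd i g x * (y i - x i))\<bar> \<le> \<epsilon> * (\<Sum>i\<in>I. \<bar>y i - x i\<bar>)"
proof -
  have WI: "W \<subseteq> tuples I" using assms(2) by (rule ropen_subset_tuples)
  have "\<exists>e>0. rbox I x e \<subseteq> W \<and> (\<forall>y\<in>rbox I x e. \<bar>pd i g y - pd i g x\<bar> < \<epsilon>)" if i: "i \<in> I" for i
  proof -
    have "continuous_on W (pd i g)" using Ck_on_pd[OF assms(3) i] WI by (rule Ck_on_continuous)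
    from continuous_on_rboxE[OF assms(1,2) this assms(4,5)] show ?thesis by metis
  qed
  then obtain d where d: "\<And>i. i \<in> I \<Longrightarrow> d i > 0"
    "\<And>i y. i \<in> I \<Longrightarrow> y \<in> rbox I x (d i) \<Longrightarrow> \<bar>pd i g y - pd i g x\<bar> < \<epsilon>" by metis
  obtain e0 where e0: "e0 > 0" "\<And>y. y \<in> tuples I \<Longrightarrow> (\<And>i. i \<in> I \<Longrightarrow> \<bar>y i - x i\<bar> < e0) \<Longrightarrow> y \<in> W"
    using ropen_boxE[OF assms(1,2,4)] by metis
  define e where "e = Min (insert e0 (d ` I))"
  have e: "e > 0" "e \<le> e0" "\<And>i. i \<in> I \<Longrightarrow> e \<le> d i"
    using assms(1) d(1) e0(1) by (auto simp: e_def)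
  have eW: "rbox I x e \<subseteq> W" using e0(2) e(2) by (force simp: rbox_def)
  have "\<bar>g y - g x - (\<Sum>i\<in>I. pd i g x * (y i - x i))\<bar> \<le> \<epsilon> * (\<Sum>i\<in>I. \<bar>y i - x i\<bar>)"
    if y: "y \<in> rbox I x e" for y
  proof -
    have xI: "x \<in> tuples I" using assms(4) WI by blast
    have yI: "y \<in> tuples I" and yd: "\<And>i. i \<in> I \<Longrightarrow> \<bar>y i - x i\<bar> < e" using y by (auto simp: rbox_def)
    define z where "z A = override_on x y A" for A
    have z_in: "z A \<in> rbox I x e" if "A \<subseteq> I" for A
      using that xI yI yd e(1) unfolding rbox_def z_def override_on_def by (auto simp: tuples_iff)
    have "\<bar>g (z A) - g x - (\<Sum>i\<in>A. pd i g x * (y i - x i))\<bar> \<le> \<epsilon> * (\<Sum>i\<in>A. \<bar>y i - x i\<bar>)"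
      if "finite A" "A \<subseteq> I" for A
      using that
    proof (induction A)
      case empty
      then show ?case by (simp add: z_def)
    next
      case (insert j A)
      then have j: "j \<in> I" "j \<notin> A" "A \<subseteq> I" by auto
      have zj: "z (insert j A) = (z A)(j := y j)"
        by (auto simp: z_def override_on_def)
      have zj0: "(z A)(j := x j) = z A" using j(2) by (auto simp: z_def override_on_def)
      have seg: "(z A)(j := s) \<in> rbox I x e" if s: "min (x j) (y j) \<le> s" "s \<le> max (x j) (y j)" for s
      proof -
        have "\<bar>s - x j\<bar> \<le> \<bar>y j - x j\<bar>" using s by (auto simp: min_def max_def split: if_splits)
        then have "\<bar>s - x j\<bar> < e" using yd[OF j(1)] by linarith
        then show ?thesis using z_in[OF j(3)] j(1) by (auto simp: rbox_def intro: tuples_upd)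
      qed
      have "((\<lambda>s. g ((z A)(j := s))) has_real_derivative pd j g ((z A)(j := s))) (at s)"
        if "min (x j) (y j) \<le> s" "s \<le> max (x j) (y j)" for s
        using Ck_on_DERIV[OF assms(3) j(1)] seg[OF that] eW by blast
      from MVT_unordered[OF this] obtain s where s: "min (x j) (y j) \<le> s" "s \<le> max (x j) (y j)"
        "g ((z A)(j := y j)) - g ((z A)(j := x j)) = (y j - x j) * pd j g ((z A)(j := s))" by blast
      have "\<bar>pd j g ((z A)(j := s)) - pd j g x\<bar> \<le> \<epsilon>"
        using d(2)[OF j(1)] seg[OF s(1,2)] rbox_mono[OF e(3)[OF j(1)]] by (meson less_imp_le subsetD)
      then have "\<bar>pd j g ((z A)(j := s)) - pd j g x\<bar> * \<bar>y j - x j\<bar> \<le> \<epsilon> * \<bar>y j - x j\<bar>"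
        by (rule mult_right_mono) simp
      then have "\<bar>(pd j g ((z A)(j := s)) - pd j g x) * (y j - x j)\<bar> \<le> \<epsilon> * \<bar>y j - x j\<bar>"
        by (simp only: abs_mult)
      moreover have "g (z (insert j A)) - g x - (\<Sum>i\<in>insert j A. pd i g x * (y i - x i)) =
        (g (z A) - g x - (\<Sum>i\<in>A. pd i g x * (y i - x i))) + (pd j g ((z A)(j := s)) - pd j g x) * (y j - x j)"
        using s(3) insert.hyps unfolding zj zj0 by (simp add: algebra_simps)
      moreover have "\<bar>g (z A) - g x - (\<Sum>i\<in>A. pd i g x * (y i - x i))\<bar> \<le> \<epsilon> * (\<Sum>i\<in>A. \<bar>y i - x i\<bar>)"
        using insert by blast
      ultimately show ?case using insert.hyps by (simp add: distrib_left)
    qed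
    from this[OF assms(1) order_refl] moreover have "z I = y"
      using xI yI by (auto simp: z_def override_on_def tuples_iff)
    ultimately show ?thesis by simp
  qed
  then show ?thesis using that e(1) eW by blast
qed

text \<open>
  Moving one argument of a composed function moves the point at which the outer function is
  evaluated along a curve, so the chain rule for partial derivatives is an instance. The proof
  only takes limits over real numbers.
\<close>

lemma DERIV_curve:
  assumes fin: "finite I" and W: "ropen I W" and g: "Ck_on I (Suc 0) W g" and c0: "c t0 \<in> W"
    and cI: "\<And>t. c t \<in> tuples I"
    and dc: "\<And>i. i \<in> I \<Longrightarrow> ((\<lambda>t. c t i) has_real_derivative d i) (at t0)"
  shows "((\<lambda>t. g (c t)) has_real_derivative (\<Sum>i\<in>I. pd i g (c t0) * d i)) (at t0)"
proof -
  define q where "q i t = (c t i - c t0 i) / (t - t0)" for i t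
  have q: "(q i \<longlongrightarrow> d i) (at t0)" if "i \<in> I" for i
    using dc[OF that] unfolding has_field_derivative_iff q_def .
  define L where "L t = (\<Sum>i\<in>I. pd i g (c t0) * q i t)" for t
  have L: "(L \<longlongrightarrow> (\<Sum>i\<in>I. pd i g (c t0) * d i)) (at t0)"
    unfolding L_def by (intro tendsto_intros q)
  define K where "K = (\<Sum>i\<in>I. \<bar>d i\<bar>) + 1"
  have K: "K > 0" unfolding K_def by (smt (verit) sum_nonneg abs_ge_zero)
  have "((\<lambda>t. \<Sum>i\<in>I. \<bar>q i t\<bar>) \<longlongrightarrow> (\<Sum>i\<in>I. \<bar>d i\<bar>)) (at t0)" by (intro tendsto_intros q)
  then have qK: "eventually (\<lambda>t. (\<Sum>i\<in>I. \<bar>q i t\<bar>) < K) (at t0)"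
    by (rule order_tendstoD) (simp add: K_def)
  have "((\<lambda>t. (g (c t) - g (c t0)) / (t - t0) - L t) \<longlongrightarrow> 0) (at t0)"
  proof (rule tendstoI)
    fix \<eta> :: real assume "\<eta> > 0"
    then have \<eta>K: "\<eta> / K > 0" using K by simp
    obtain e where e: "e > 0"
      "\<And>y. y \<in> rbox I (c t0) e \<Longrightarrow> \<bar>g y - g (c t0) - (\<Sum>i\<in>I. pd i g (c t0) * (y i - c t0 i))\<bar>
          \<le> \<eta> / K * (\<Sum>i\<in>I. \<bar>y i - c t0 i\<bar>)"
      by (rule Ck_on_frechet[OF fin W g c0 \<eta>K]) (rule that)
    have "eventually (\<lambda>t. \<bar>c t i - c t0 i\<bar> < e) (at t0)" if "i \<in> I" for i
    proof -
      have "((\<lambda>t. c t i) \<longlongrightarrow> c t0 i) (at t0)"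
        using DERIV_isCont[OF dc[OF that]] by (simp add: isCont_def)
      from tendstoD[OF this e(1)] show ?thesis by (simp add: dist_real_def)
    qed
    then have "eventually (\<lambda>t. \<forall>i\<in>I. \<bar>c t i - c t0 i\<bar> < e) (at t0)"
      using fin by (simp add: eventually_ball_finite)
    moreover have "eventually (\<lambda>t. t \<noteq> t0) (at t0)" by (simp add: eventually_at_filter)
    ultimately show "eventually (\<lambda>t. dist ((g (c t) - g (c t0)) / (t - t0) - L t) 0 < \<eta>) (at t0)"
      using qK
    proof eventually_elim
      case (elim t)
      have "c t \<in> rbox I (c t0) e" using elim(1) cI by (simp add: rbox_def)
      then have 1: "\<bar>g (c t) - g (c t0) - (\<Sum>i\<in>I. pd i g (c t0) * (c t i - c t0 i))\<bar>
          \<le> \<eta> / K * (\<Sum>i\<in>I. \<bar>c t i - c t0 i\<bar>)" by (rule e(2))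
      have t: "\<bar>t - t0\<bar> > 0" using elim(2) by simp
      have e1: "(\<Sum>i\<in>I. pd i g (c t0) * (c t i - c t0 i)) = L t * (t - t0)"
        using elim(2) by (simp add: L_def q_def sum_distrib_right)
      have e2: "(\<Sum>i\<in>I. \<bar>c t i - c t0 i\<bar>) = (\<Sum>i\<in>I. \<bar>q i t\<bar>) * \<bar>t - t0\<bar>"
        using elim(2) by (simp add: q_def sum_distrib_right abs_divide)
      have "(g (c t) - g (c t0)) / (t - t0) - L t = (g (c t) - g (c t0) - L t * (t - t0)) / (t - t0)"
        using elim(2) by (simp add: field_simps)
      then have "\<bar>(g (c t) - g (c t0)) / (t - t0) - L t\<bar> = \<bar>g (c t) - g (c t0) - L t * (t - t0)\<bar> / \<bar>t - t0\<bar>"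
        by (simp add: abs_divide)
      also have "\<dots> \<le> (\<eta> / K * ((\<Sum>i\<in>I. \<bar>q i t\<bar>) * \<bar>t - t0\<bar>)) / \<bar>t - t0\<bar>"
        using 1 t unfolding e1 e2 by (intro divide_right_mono) auto
      also have "\<dots> = \<eta> / K * (\<Sum>i\<in>I. \<bar>q i t\<bar>)" using t by simp
      also have "\<dots> < \<eta> / K * K" using elim(3) \<open>\<eta> / K > 0\<close> by (rule mult_strict_left_mono)
      also have "\<dots> = \<eta>" using K by simp
      finally show ?case by simp
    qed
  qed
  from tendsto_add[OF this L] show ?thesis unfolding has_field_derivative_iff by simp
qed

text \<open>
  The values outside \<open>J\<close> are undefined, so that outer functions are evaluated at
  points of the tuple space.
\<close>

definition tuple_map :: "'j set \<Rightarrow> ('j \<Rightarrow> 'a \<Rightarrow> real) \<Rightarrow> 'a \<Rightarrow> 'j \<Rightarrow> real"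
  where "tuple_map J f x = (\<lambda>j\<in>J. f j x)"

lemma tuple_map_in_tuples [simp]: "tuple_map J f x \<in> tuples J"
  by (simp add: tuple_map_def)

lemma tuple_map_apply [simp]: "j \<in> J \<Longrightarrow> tuple_map J f x j = f j x"
  by (simp add: tuple_map_def)

lemma tuple_map_eqI: "y \<in> tuples J \<Longrightarrow> (\<And>j. j \<in> J \<Longrightarrow> f j x = y j) \<Longrightarrow> tuple_map J f x = y"
  by (rule tuples_eqI) auto

context
  fixes I :: "'i set" and J :: "'j set" and W W' f
  assumes fin: "finite I" "finite J" and opn: "ropen I W" "ropen J W'"
    and maps: "\<And>x. x \<in> W \<Longrightarrow> tuple_map J f x \<in> W'"
begin

lemma DERIV_compose:
  assumes "Ck_on J (Suc 0) W' g" "\<And>j. j \<in> J \<Longrightarrow> Ck_on I (Suc 0) W (f j)" "i \<in> I" "x \<in> W"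
  shows "((\<lambda>t. g (tuple_map J f (x(i := t)))) has_real_derivative
      (\<Sum>j\<in>J. pd j g (tuple_map J f x) * pd i (f j) x)) (at (x i))"
proof -
  have "((\<lambda>t. g (tuple_map J f (x(i := t)))) has_real_derivative
      (\<Sum>j\<in>J. pd j g (tuple_map J f (x(i := x i))) * pd i (f j) x)) (at (x i))"
  proof (rule DERIV_curve[OF fin(2) opn(2) assms(1)])
    show "tuple_map J f (x(i := x i)) \<in> W'" using maps[OF assms(4)] by simp
    show "((\<lambda>t. tuple_map J f (x(i := t)) j) has_real_derivative pd i (f j) x) (at (x i))" if "j \<in> J" for j
      using Ck_on_DERIV_at[OF assms(2)[OF that] assms(3,4)] that by (simp only: tuple_map_apply)
  qed simp
  then show ?thesis by (simp only: fun_upd_triv)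
qed

lemma pd_compose:
  assumes "Ck_on J (Suc 0) W' g" "\<And>j. j \<in> J \<Longrightarrow> Ck_on I (Suc 0) W (f j)" "i \<in> I" "x \<in> W"
  shows "pd i (\<lambda>x. g (tuple_map J f x)) x = (\<Sum>j\<in>J. pd j g (tuple_map J f x) * pd i (f j) x)"
  using DERIV_compose[OF assms] by (rule pd_eqI)

lemma Ck_on_compose:
  assumes "Ck_on J k W' g" "\<And>j. j \<in> J \<Longrightarrow> Ck_on I k W (f j)"
  shows "Ck_on I k W (\<lambda>x. g (tuple_map J f x))"
  using assms
proof (induction k arbitrary: g)
  have cont: "continuous_on W (\<lambda>x. g (tuple_map J f x))"
    if "continuous_on W' g" "\<And>j. j \<in> J \<Longrightarrow> continuous_on W (f j)" for g
    by (rule continuous_on_compose2[OF that(1)]) (use maps that(2) in \<open>auto simp: tuple_map_def intro: continuous_on_tuple_valued\<close>)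
  {
    case 0
    then show ?case using cont
      by (simp add: continuous_map_iff_continuous_on opn[THEN ropen_subset_tuples])
  next
    case (Suc k)
    have f: "Ck_on I (Suc 0) W (f j)" "Ck_on I k W (f j)" if "j \<in> J" for j
      using Ck_on_mono[OF Suc.prems(2)[OF that]] by (blast intro: le_SucI)+
    have g: "Ck_on J (Suc 0) W' g" using Ck_on_mono[OF Suc.prems(1), of "Suc 0"] by blast
    have "continuous_on W' g" by (rule Ck_on_continuous[OF g ropen_subset_tuples[OF opn(2)]])
    moreover have "continuous_on W (f j)" if "j \<in> J" for j
      by (rule Ck_on_continuous[OF f(1)[OF that] ropen_subset_tuples[OF opn(1)]])
    ultimately have contg: "continuous_on W (\<lambda>x. g (tuple_map J f x))" by (rule cont)
    show ?case
    proof (rule Ck_on_SucI[OF fin(1) opn(1)])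
      show "continuous_on W (\<lambda>x. g (tuple_map J f x))" by (rule contg)
      show "((\<lambda>t. g (tuple_map J f (x(i := t)))) has_real_derivative
        (\<Sum>j\<in>J. pd j g (tuple_map J f x) * pd i (f j) x)) (at (x i))" if "i \<in> I" "x \<in> W" for i x
        by (rule DERIV_compose[OF g f(1) that])
      show "Ck_on I k W (\<lambda>x. \<Sum>j\<in>J. pd j g (tuple_map J f x) * pd i (f j) x)" if "i \<in> I" for i
      proof (intro Ck_on_sum[OF fin(1) opn(1)] Ck_on_mult[OF fin(1) opn(1)])
        fix j assume j: "j \<in> J"
        show "Ck_on I k W (\<lambda>x. pd j g (tuple_map J f x))"
          by (rule Suc.IH) (use Suc.prems(1) f(2) j in auto)
        show "Ck_on I k W (pd i (f j))" using Suc.prems(2)[OF j] that by simp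
      qed
    qed
  }
qed

end

section \<open>Smooth functions\<close>

lemma smooth_on_Ck: "smooth_on I W g \<Longrightarrow> Ck_on I k W g"
  by (simp add: smooth_on_def)

lemma smooth_on_pd: "smooth_on I W g \<Longrightarrow> i \<in> I \<Longrightarrow> smooth_on I W (pd i g)"
  unfolding smooth_on_def by (metis Ck_on_pd)

lemma smooth_on_subset: "smooth_on I W g \<Longrightarrow> V \<subseteq> W \<Longrightarrow> smooth_on I V g"
  unfolding smooth_on_def by (metis Ck_on_subset)

lemma smooth_on_continuous: "smooth_on I W g \<Longrightarrow> W \<subseteq> tuples I \<Longrightarrow> continuous_on W g"
  using smooth_on_Ck[of I W g 0] Ck_on_continuous by blast

lemma smooth_on_DERIV_at:
  "smooth_on I W g \<Longrightarrow> i \<in> I \<Longrightarrow> x \<in> W \<Longrightarrow>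
    ((\<lambda>t. g (x(i := t))) has_real_derivative pd i g x) (at (x i))"
  by (rule Ck_on_DERIV_at[OF smooth_on_Ck])

context
  fixes I :: "'i set" and W
  assumes fin: "finite I" and opn: "ropen I W"
begin

lemma smooth_on_cong:
  "smooth_on I W f \<Longrightarrow> (\<And>y. y \<in> W \<Longrightarrow> f y = g y) \<Longrightarrow> smooth_on I W g"
  unfolding smooth_on_def using Ck_on_cong_imp[OF fin opn, of f g] by blast

lemma smooth_on_local:
  assumes "\<And>x. x \<in> W \<Longrightarrow> \<exists>V. ropen I V \<and> x \<in> V \<and> V \<subseteq> W \<and> smooth_on I V g"
  shows "smooth_on I W g"
  unfolding smooth_on_def
proof
  fix k show "Ck_on I k W g"
  proof (rule Ck_on_local[OF fin opn])
    fix x assume "x \<in> W"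
    from assms[OF this] show "\<exists>V. ropen I V \<and> x \<in> V \<and> V \<subseteq> W \<and> Ck_on I k V g"
      using smooth_on_Ck by blast
  qed
qed

lemma smooth_on_const: "smooth_on I W (\<lambda>x. c)"
  unfolding smooth_on_def using Ck_on_const[OF fin opn] by blast

lemma smooth_on_coord: "i \<in> I \<Longrightarrow> smooth_on I W (\<lambda>x. x i)"
  unfolding smooth_on_def using Ck_on_coord[OF fin opn] by blast

lemma smooth_on_add: "smooth_on I W f \<Longrightarrow> smooth_on I W g \<Longrightarrow> smooth_on I W (\<lambda>x. f x + g x)"
  unfolding smooth_on_def using Ck_on_add[OF fin opn] by blast

lemma smooth_on_mult: "smooth_on I W f \<Longrightarrow> smooth_on I W g \<Longrightarrow> smooth_on I W (\<lambda>x. f x * g x)"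
  unfolding smooth_on_def using Ck_on_mult[OF fin opn] by blast

lemma smooth_on_sum: "(\<And>a. a \<in> A \<Longrightarrow> smooth_on I W (f a)) \<Longrightarrow> smooth_on I W (\<lambda>x. \<Sum>a\<in>A. f a x)"
  unfolding smooth_on_def by (rule allI, rule Ck_on_sum[OF fin opn]) blast

lemma smooth_on_prod: "(\<And>a. a \<in> A \<Longrightarrow> smooth_on I W (f a)) \<Longrightarrow> smooth_on I W (\<lambda>x. \<Prod>a\<in>A. f a x)"
  unfolding smooth_on_def by (rule allI, rule Ck_on_prod[OF fin opn]) blast

end

lemma smooth_on_power:
  "finite I \<Longrightarrow> ropen I W \<Longrightarrow> smooth_on I W f \<Longrightarrow> smooth_on I W (\<lambda>x. f x ^ n)"
  by (induction n) (auto intro: smooth_on_const smooth_on_mult)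

lemma smooth_on_diff:
  assumes "finite I" "ropen I W" "smooth_on I W f" "smooth_on I W g"
  shows "smooth_on I W (\<lambda>x. f x - g x)"
proof -
  have "smooth_on I W (\<lambda>x. f x + (-1) * g x)"
    by (intro smooth_on_add smooth_on_mult smooth_on_const assms)
  then show ?thesis by simp
qed

lemma smooth_on_compose:
  assumes "finite I" "finite J" "ropen I W" "ropen J W'"
    "smooth_on J W' g" "\<And>j. j \<in> J \<Longrightarrow> smooth_on I W (f j)" "\<And>x. x \<in> W \<Longrightarrow> tuple_map J f x \<in> W'"
  shows "smooth_on I W (\<lambda>x. g (tuple_map J f x))"
  unfolding smooth_on_def
proof
  fix k show "Ck_on I k W (\<lambda>x. g (tuple_map J f x))"
    by (rule Ck_on_compose[OF assms(1-4,7)]) (use assms(5,6) smooth_on_Ck in blast)+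
qed

lemma pd_compose_smooth:
  assumes "finite I" "finite J" "ropen I W" "ropen J W'"
    "smooth_on J W' g" "\<And>j. j \<in> J \<Longrightarrow> smooth_on I W (f j)" "\<And>x. x \<in> W \<Longrightarrow> tuple_map J f x \<in> W'"
    "i \<in> I" "x \<in> W"
  shows "pd i (\<lambda>x. g (tuple_map J f x)) x = (\<Sum>j\<in>J. pd j g (tuple_map J f x) * pd i (f j) x)"
  by (rule pd_compose[OF assms(1-4,7) _ _ assms(8,9)]) (use assms(5,6) smooth_on_Ck in blast)+

lemma pd_add:
  assumes "smooth_on I W f" "smooth_on I W g" "i \<in> I" "x \<in> W"
  shows "pd i (\<lambda>x. f x + g x) x = pd i f x + pd i g x"
  by (rule pd_eqI) (intro DERIV_add smooth_on_DERIV_at[OF assms(1,3,4)] smooth_on_DERIV_at[OF assms(2,3,4)])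

lemma pd_mult:
  assumes "smooth_on I W f" "smooth_on I W g" "i \<in> I" "x \<in> W"
  shows "pd i (\<lambda>x. f x * g x) x = pd i f x * g x + f x * pd i g x"
proof (rule pd_eqI)
  from DERIV_mult[OF smooth_on_DERIV_at[OF assms(1,3,4)] smooth_on_DERIV_at[OF assms(2,3,4)]]
  show "((\<lambda>t. f (x(i := t)) * g (x(i := t))) has_real_derivative pd i f x * g x + f x * pd i g x) (at (x i))"
    by (simp only: fun_upd_triv mult.commute)
qed

lemma pd_sum:
  assumes "finite A" "\<And>a. a \<in> A \<Longrightarrow> smooth_on I W (f a)" "i \<in> I" "x \<in> W"
  shows "pd i (\<lambda>x. \<Sum>a\<in>A. f a x) x = (\<Sum>a\<in>A. pd i (f a) x)"
  by (rule pd_eqI, rule DERIV_sum) (rule smooth_on_DERIV_at[OF assms(2) assms(3,4)])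

section \<open>Symmetry of iterated partial derivatives\<close>

text \<open>
  The mean value theorem in the variable \<open>i\<close> and then in the variable
  \<open>j\<close>. As the second difference is symmetric, exchanging the variables exhibits one
  number as a nearby value of either mixed derivative, which by continuity forces these to be
  equal.
\<close>

lemma second_difference:
  assumes W: "ropen I W" and g: "smooth_on I W g" and ij: "i \<in> I" "j \<in> I" "i \<noteq> j"
    and x: "x \<in> W" and h: "h > 0"
    and box: "\<And>s t. s \<in> {x i..x i + h} \<Longrightarrow> t \<in> {x j..x j + h} \<Longrightarrow> x(i := s, j := t) \<in> W"
  obtains s t where "s \<in> {x i..x i + h}" "t \<in> {x j..x j + h}"
    "g (x(i := x i + h, j := x j + h)) - g (x(i := x i + h, j := x j)) -
       (g (x(i := x i, j := x j + h)) - g (x(i := x i, j := x j)))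
     = h * h * pd j (pd i g) (x(i := s, j := t))"
proof -
  have d: "((\<lambda>s. g (x(i := s, j := t))) has_real_derivative pd i g (x(i := s, j := t))) (at s)"
    if "s \<in> {x i..x i + h}" "t \<in> {x j..x j + h}" for s t
    using Ck_on_DERIV[OF smooth_on_Ck[OF g] ij(1), of "x(j := t)" s] box[OF that] ij(3)
    unfolding fun_upd_twist[OF ij(3)[symmetric]] by blast
  have "((\<lambda>s. g (x(i := s, j := x j + h)) - g (x(i := s, j := x j))) has_real_derivative
     pd i g (x(i := s, j := x j + h)) - pd i g (x(i := s, j := x j))) (at s)"
    if "x i \<le> s" "s \<le> x i + h" for s
    using that h by (intro DERIV_diff d) auto
  from MVT2[of "x i" "x i + h", OF _ this] obtain s where s: "s > x i" "s < x i + h"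
    "(g (x(i := x i + h, j := x j + h)) - g (x(i := x i + h, j := x j))) -
       (g (x(i := x i, j := x j + h)) - g (x(i := x i, j := x j)))
      = (x i + h - x i) * (pd i g (x(i := s, j := x j + h)) - pd i g (x(i := s, j := x j)))"
    using h by (metis less_add_same_cancel1)
  have "((\<lambda>t. pd i g (x(i := s, j := t))) has_real_derivative pd j (pd i g) (x(i := s, j := t))) (at t)"
    if "x j \<le> t" "t \<le> x j + h" for t
    using Ck_on_DERIV[OF smooth_on_Ck[OF smooth_on_pd[OF g ij(1)]] ij(2), of "x(i := s)" t] box[of s t] s that
    by simp
  from MVT2[of "x j" "x j + h", OF _ this] obtain t where t: "t > x j" "t < x j + h"
    "pd i g (x(i := s, j := x j + h)) - pd i g (x(i := s, j := x j)) =
      (x j + h - x j) * pd j (pd i g) (x(i := s, j := t))"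
    using h by (metis less_add_same_cancel1)
  show ?thesis by (rule that[of s t]) (use s t in auto)
qed

lemma pd_commute:
  assumes fin: "finite I" and W: "ropen I W" and g: "smooth_on I W g" and ij: "i \<in> I" "j \<in> I" and x: "x \<in> W"
  shows "pd i (pd j g) x = pd j (pd i g) x"
proof (cases "i = j")
  case False
  have WI: "W \<subseteq> tuples I" using W by (rule ropen_subset_tuples)
  show ?thesis
  proof (rule ccontr)
    assume ne: "pd i (pd j g) x \<noteq> pd j (pd i g) x"
    define \<epsilon> where "\<epsilon> = \<bar>pd i (pd j g) x - pd j (pd i g) x\<bar> / 2"
    have \<epsilon>: "\<epsilon> > 0" using ne by (simp add: \<epsilon>_def)
    have c: "continuous_on W (pd i (pd j g))" "continuous_on W (pd j (pd i g))"
      using smooth_on_continuous[OF smooth_on_pd[OF smooth_on_pd[OF g]]] ij WI by blast+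
    obtain e1 where e1: "e1 > 0" "rbox I x e1 \<subseteq> W" "\<And>y. y \<in> rbox I x e1 \<Longrightarrow> \<bar>pd i (pd j g) y - pd i (pd j g) x\<bar> < \<epsilon>"
      using continuous_on_rboxE[OF fin W c(1) x \<epsilon>] by metis
    obtain e2 where e2: "e2 > 0" "rbox I x e2 \<subseteq> W" "\<And>y. y \<in> rbox I x e2 \<Longrightarrow> \<bar>pd j (pd i g) y - pd j (pd i g) x\<bar> < \<epsilon>"
      using continuous_on_rboxE[OF fin W c(2) x \<epsilon>] by metis
    define h where "h = min e1 e2 / 2"
    have h: "h > 0" "h < e1" "h < e2" using e1(1) e2(1) by (auto simp: h_def)
    have xI: "x \<in> tuples I" using x WI by blast
    have box: "x(i := s, j := t) \<in> rbox I x e" if "s \<in> {x i..x i + h}" "t \<in> {x j..x j + h}" "h < e" for s t e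
      using that h(1) ij False tuples_upd[OF tuples_upd[OF xI ij(1)] ij(2)] by (auto simp: rbox_def)
    have box': "x(j := t, i := s) = x(i := s, j := t)" for s t using False by (rule fun_upd_twist[symmetric])
    obtain s t where st: "s \<in> {x i..x i + h}" "t \<in> {x j..x j + h}"
      "g (x(i := x i + h, j := x j + h)) - g (x(i := x i + h, j := x j)) -
       (g (x(i := x i, j := x j + h)) - g (x(i := x i, j := x j)))
       = h * h * pd j (pd i g) (x(i := s, j := t))"
      using second_difference[OF W g ij False x h(1)] box[OF _ _ h(2)] e1(2) by blast
    obtain t' s' where st': "t' \<in> {x j..x j + h}" "s' \<in> {x i..x i + h}"
      "g (x(j := x j + h, i := x i + h)) - g (x(j := x j + h, i := x i)) -
       (g (x(j := x j, i := x i + h)) - g (x(j := x j, i := x i)))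
       = h * h * pd i (pd j g) (x(j := t', i := s'))"
      using second_difference[OF W g ij(2,1) False[symmetric] x h(1)] box[OF _ _ h(2)] e1(2)
      unfolding box' by blast
    have "h * h * pd j (pd i g) (x(i := s, j := t)) = h * h * pd i (pd j g) (x(i := s', j := t'))"
      using st(3) st'(3) unfolding box' by linarith
    then have "pd j (pd i g) (x(i := s, j := t)) = pd i (pd j g) (x(i := s', j := t'))" using h(1) by simp
    moreover have "\<bar>pd j (pd i g) (x(i := s, j := t)) - pd j (pd i g) x\<bar> < \<epsilon>"
      using e2(3)[OF box[OF st(1,2) h(3)]] .
    moreover have "\<bar>pd i (pd j g) (x(i := s', j := t')) - pd i (pd j g) x\<bar> < \<epsilon>"
      using e1(3)[OF box[OF st'(2,1) h(2)]] .
    ultimately have "\<bar>pd i (pd j g) x - pd j (pd i g) x\<bar> < \<epsilon> + \<epsilon>" by linarith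
    then show False unfolding \<epsilon>_def by simp
  qed
qed simp

lemma smooth_on_foldr_pd:
  "smooth_on I W g \<Longrightarrow> set is \<subseteq> I \<Longrightarrow> smooth_on I W (foldr pd is g)"
  by (induction "is") (auto intro: smooth_on_pd)

lemma foldr_pd_cong:
  assumes "finite I" "ropen I W" "\<And>y. y \<in> W \<Longrightarrow> f y = g y" "set is \<subseteq> I" "x \<in> W"
  shows "foldr pd is f x = foldr pd is g x"
  using assms(4,5)
proof (induction "is" arbitrary: x)
  case Nil then show ?case using assms(3) by simp
next
  case (Cons i "is")
  show ?case using Cons.prems Cons.IH pd_cong[OF assms(1,2), of i x "foldr pd is f" "foldr pd is g"]
    by (metis comp_apply foldr_Cons list.set_intros(1) set_subset_Cons subset_trans subsetD)
qed

text \<open>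
  Adjacent derivatives commute, so the first derivative of one list can be moved to the front of
  the other.
\<close>

lemma foldr_pd_mset:
  assumes fin: "finite I" and W: "ropen I W" and g: "smooth_on I W g"
  shows "mset is = mset js \<Longrightarrow> set is \<subseteq> I \<Longrightarrow> x \<in> W \<Longrightarrow> foldr pd is g x = foldr pd js g x"
proof (induction "is" arbitrary: js x)
  case Nil then show ?case by simp
next
  case (Cons i "is")
  have I: "i \<in> I" "set is \<subseteq> I" using Cons.prems by auto
  have move: "foldr pd (as @ i # bs) g x = foldr pd (i # as @ bs) g x"
    if "set as \<subseteq> I" "set bs \<subseteq> I" "x \<in> W" for as bs x
    using that
  proof (induction as arbitrary: x)
    case (Cons a as)
    have sm: "smooth_on I W (foldr pd (as @ bs) g)"
      by (rule smooth_on_foldr_pd[OF g]) (use Cons.prems in auto)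
    have "foldr pd ((a # as) @ i # bs) g x = pd a (foldr pd (as @ i # bs) g) x" by simp
    also have "\<dots> = pd a (foldr pd (i # as @ bs) g) x"
      by (rule pd_cong[OF fin W]) (use Cons in auto)
    also have "\<dots> = pd i (pd a (foldr pd (as @ bs) g)) x"
      unfolding foldr_Cons comp_apply
      by (rule pd_commute[OF fin W sm]) (use Cons.prems I in auto)
    finally show ?case by simp
  qed simp
  have "i \<in> set js" using Cons.prems by (metis list.set_intros(1) set_mset_mset)
  then obtain as bs where js: "js = as @ i # bs" by (meson split_list)
  have m: "mset is = mset (as @ bs)" using Cons.prems js by simp
  have sub: "set as \<subseteq> I" "set bs \<subseteq> I" using I(2) mset_eq_setD[OF m] by auto
  have "foldr pd (i # is) g x = pd i (foldr pd is g) x" by simp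
  also have "\<dots> = pd i (foldr pd (as @ bs) g) x"
    by (rule pd_cong[OF fin W I(1) Cons.prems(3)]) (rule Cons.IH[OF m I(2)])
  also have "\<dots> = foldr pd js g x" unfolding js move[OF sub Cons.prems(3)] by simp
  finally show ?case .
qed

context
  fixes I :: "'i set" and W g
  assumes fin: "finite I" and W: "ropen I W" and g: "smooth_on I W g"
begin

lemma pd_multi_mset: "set is \<subseteq> I \<Longrightarrow> x \<in> W \<Longrightarrow> pd_multi (mset is) g x = foldr pd is g x"
  unfolding pd_multi_def
  by (rule foldr_pd_mset[OF fin W g])
    (metis (mono_tags, lifting) someI, metis (mono_tags, lifting) mset_eq_setD someI)

lemma pd_multi_add_mset:
  assumes "i \<in> I" "set_mset J \<subseteq> I" "x \<in> W"
  shows "pd_multi (add_mset i J) g x = pd i (pd_multi J g) x"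
proof -
  obtain "is" where J: "J = mset is" by (metis ex_mset)
  have "pd_multi (add_mset i J) g x = foldr pd (i # is) g x"
    using pd_multi_mset[of "i # is" x] assms J by simp
  also have "\<dots> = pd i (pd_multi J g) x" unfolding foldr_Cons comp_apply
    by (rule pd_cong[OF fin W]) (use assms J pd_multi_mset[of "is"] in auto)
  finally show ?thesis .
qed

lemma smooth_on_pd_multi:
  assumes "set_mset J \<subseteq> I" shows "smooth_on I W (pd_multi J g)"
proof -
  obtain "is" where J: "J = mset is" by (metis ex_mset)
  have "smooth_on I W (foldr pd is g)" by (rule smooth_on_foldr_pd[OF g]) (use assms J in auto)
  then show ?thesis
    by (rule smooth_on_cong[OF fin W]) (use assms J pd_multi_mset[of "is"] in auto)
qed

end

lemma pd_multi_empty [simp]: "pd_multi {#} g = g"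
  by (simp add: pd_multi_def)

lemma pd_multi_cong:
  assumes "finite I" "ropen I W" "\<And>y. y \<in> W \<Longrightarrow> f y = g y" "set_mset J \<subseteq> I" "x \<in> W"
  shows "pd_multi J f x = pd_multi J g x"
proof -
  obtain "is" where "mset is = J" by (metis ex_mset)
  then have "mset (SOME is. mset is = J) = J" by (rule someI)
  then have "set (SOME is. mset is = J) \<subseteq> I" using assms(4) by (metis set_mset_mset)
  from foldr_pd_cong[OF assms(1-3) this assms(5)] show ?thesis unfolding pd_multi_def .
qed

section \<open>Hadamard's lemma\<close>

text \<open>
  First-order Taylor expansion with smooth remainder coefficients, which are averages of the
  partial derivatives over segments. It forces derivations of germs to be determined by their
  values on coordinates.
\<close>

context
  fixes I :: "'i set" and x0 :: "'i \<Rightarrow> real" and e :: real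
  assumes fin: "finite I" and x0: "x0 \<in> tuples I" and e: "e > 0"
begin

definition seg :: "real \<Rightarrow> ('i \<Rightarrow> real) \<Rightarrow> 'i \<Rightarrow> real"
  where "seg t x = (\<lambda>i\<in>I. x0 i + t * (x i - x0 i))"

text \<open>
  The power of \<open>t\<close> makes the averages closed under partial differentiation, which multiplies the
  integrand by another \<open>t\<close>.
\<close>

definition seg_average :: "nat \<Rightarrow> (('i \<Rightarrow> real) \<Rightarrow> real) \<Rightarrow> ('i \<Rightarrow> real) \<Rightarrow> real"
  where "seg_average m f x = integral (cbox 0 1) (\<lambda>t. t ^ m * f (seg t x))"

lemma seg_in_rbox:
  assumes "x \<in> rbox I x0 e" "t \<in> cbox 0 1" shows "seg t x \<in> rbox I x0 e"
proof -
  have "\<bar>t * (x i - x0 i)\<bar> < e" if "i \<in> I" for i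
  proof -
    have "\<bar>t\<bar> * \<bar>x i - x0 i\<bar> \<le> 1 * \<bar>x i - x0 i\<bar>" using assms(2) by (intro mult_right_mono) auto
    moreover have "\<bar>x i - x0 i\<bar> < e" using assms(1) that by (simp add: rbox_def)
    ultimately show ?thesis by (simp add: abs_mult)
  qed
  then show ?thesis by (simp add: rbox_def seg_def)
qed

lemma seg_upd: "i \<in> I \<Longrightarrow> seg t (x(i := s)) = (seg t x)(i := x0 i + t * (s - x0 i))"
  by (auto simp: seg_def fun_eq_iff)

lemma continuous_on_seg:
  assumes "continuous_on (rbox I x0 e) f"
  shows "continuous_on (rbox I x0 e \<times> cbox 0 1) (\<lambda>(x, t). t ^ m * f (seg t x))"
proof -
  have "continuous_on (rbox I x0 e \<times> cbox (0::real) 1) (\<lambda>p. seg (snd p) (fst p))"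
    unfolding seg_def
  proof (rule continuous_on_tuple_valued)
    fix i
    have "continuous_on (rbox I x0 e \<times> cbox (0::real) 1) (\<lambda>p. fst p i)"
      by (rule continuous_on_compose2[OF continuous_on_product_coordinates]) (auto intro: continuous_intros)
    then show "continuous_on (rbox I x0 e \<times> cbox (0::real) 1) (\<lambda>p. x0 i + snd p * (fst p i - x0 i))"
      by (intro continuous_intros)
  qed
  then have "continuous_on (rbox I x0 e \<times> cbox 0 1) (\<lambda>p. f (seg (snd p) (fst p)))"
    by (rule continuous_on_compose2[OF assms]) (use seg_in_rbox in auto)
  then have "continuous_on (rbox I x0 e \<times> cbox 0 1) (\<lambda>p. snd p ^ m * f (seg (snd p) (fst p)))"
    by (intro continuous_intros)
  then show ?thesis by (simp add: case_prod_beta)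
qed

lemma Ck_on_seg_average: "Ck_on I k (rbox I x0 e) f \<Longrightarrow> Ck_on I k (rbox I x0 e) (seg_average m f)"
proof (induction k arbitrary: f m)
  note opn = ropen_rbox[OF fin, of x0 e]
  have cont: "continuous_on (rbox I x0 e) (seg_average m f)" if "continuous_on (rbox I x0 e) f" for f m
    unfolding seg_average_def by (rule integral_continuous_on_param[OF continuous_on_seg[OF that]])
  {
    case 0
    then show ?case using cont by (simp add: continuous_map_iff_continuous_on[OF ropen_subset_tuples[OF opn]])
  next
    case (Suc k)
    have f: "continuous_on (rbox I x0 e) f"
      using Suc.prems ropen_subset_tuples[OF opn] by (rule Ck_on_continuous)
    show ?case
    proof (rule Ck_on_SucI[OF fin opn cont[OF f], where d = "\<lambda>i. seg_average (Suc m) (pd i f)"])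
      show "Ck_on I k (rbox I x0 e) (seg_average (Suc m) (pd i f))" if "i \<in> I" for i
        by (rule Suc.IH) (rule Ck_on_pd[OF Suc.prems that])
    next
      fix i x assume i: "i \<in> I" and x: "x \<in> rbox I x0 e"
      define U where "U = {x0 i - e<..<x0 i + e}"
      have xU: "x(i := s) \<in> rbox I x0 e" if "s \<in> U" for s
        using x i that by (auto simp: rbox_def U_def intro: tuples_upd)
      have pf: "continuous_on (rbox I x0 e) (pd i f)"
        by (rule Ck_on_continuous[OF Ck_on_pd[OF Suc.prems i] ropen_subset_tuples[OF opn]])
      have upd: "continuous_on (U \<times> cbox (0::real) 1) (\<lambda>p. x(i := fst p))"
      proof (rule continuous_on_coordinatewise_then_product)
        fix j show "continuous_on (U \<times> cbox (0::real) 1) (\<lambda>p. (x(i := fst p)) j)"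
          by (cases "j = i") (auto intro: continuous_intros)
      qed
      have "((\<lambda>s. integral (cbox 0 1) (\<lambda>t. t ^ m * f (seg t (x(i := s))))) has_real_derivative
          integral (cbox 0 1) (\<lambda>t. t ^ Suc m * pd i f (seg t (x(i := x i))))) (at (x i) within U)"
      proof (rule leibniz_rule_field_derivative)
        fix s t assume s: "s \<in> U" and t: "t \<in> cbox (0::real) 1"
        have "((\<lambda>r. f ((seg t x)(i := r))) has_real_derivative pd i f ((seg t x)(i := x0 i + t * (s - x0 i))))
            (at (x0 i + t * (s - x0 i)))"
          by (rule Ck_on_DERIV[OF Suc.prems i]) (use seg_in_rbox[OF xU[OF s] t] seg_upd[OF i] in simp)
        moreover have "((\<lambda>s. x0 i + t * (s - x0 i)) has_real_derivative t) (at s)"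
          by (auto intro!: derivative_eq_intros)
        ultimately have "((\<lambda>s. f ((seg t x)(i := x0 i + t * (s - x0 i)))) has_real_derivative
            pd i f ((seg t x)(i := x0 i + t * (s - x0 i))) * t) (at s)" by (rule DERIV_chain2)
        then have "((\<lambda>s. t ^ m * f (seg t (x(i := s)))) has_real_derivative
            t ^ m * (pd i f (seg t (x(i := s))) * t)) (at s)"
          unfolding seg_upd[OF i] by (rule DERIV_cmult)
        then show "((\<lambda>s. t ^ m * f (seg t (x(i := s)))) has_real_derivative
            t ^ Suc m * pd i f (seg t (x(i := s)))) (at s within U)"
          by (auto intro: has_field_derivative_at_within simp: mult_ac simp del: fun_upd_apply)
      next
        fix s assume s: "s \<in> U"
        have "continuous_on (cbox 0 1) (\<lambda>t. (\<lambda>(x, t). t ^ m * f (seg t x)) (x(i := s), t))"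
          by (rule continuous_on_compose2[OF continuous_on_seg[OF f, of m]])
            (use xU[OF s] in \<open>auto intro!: continuous_intros\<close>)
        then show "(\<lambda>t. t ^ m * f (seg t (x(i := s)))) integrable_on cbox 0 1"
          by (intro integrable_continuous) simp
      next
        have "continuous_on (U \<times> cbox 0 1) (\<lambda>p. (\<lambda>(x, t). t ^ Suc m * pd i f (seg t x)) (x(i := fst p), snd p))"
        proof (rule continuous_on_compose2[OF continuous_on_seg[OF pf, of "Suc m"]])
          show "continuous_on (U \<times> cbox (0::real) 1) (\<lambda>p. (x(i := fst p), snd p))"
            by (rule continuous_on_Pair[OF upd]) (rule continuous_on_snd, rule continuous_on_id)
        qed (use xU in auto)
        then show "continuous_on (U \<times> cbox 0 1) (\<lambda>(s, t). t ^ Suc m * pd i f (seg t (x(i := s))))"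
          by (simp add: case_prod_beta)
      next
        show "x i \<in> U" using x i by (auto simp: U_def rbox_def abs_less_iff)
      qed (simp add: U_def)
      moreover have "at (x i) within U = at (x i)"
        by (rule at_within_open) (use x i in \<open>auto simp: U_def rbox_def abs_less_iff\<close>)
      ultimately show "((\<lambda>t. seg_average m f (x(i := t))) has_real_derivative seg_average (Suc m) (pd i f) x) (at (x i))"
        unfolding seg_average_def by simp
    qed
  }
qed

lemma seg_average_centre: "seg_average 0 f x0 = f x0"
proof -
  have "seg t x0 = x0" for t
    by (rule tuples_eqI[OF _ x0]) (auto simp: seg_def)
  then show ?thesis by (simp add: seg_average_def)
qed

lemma seg_average_expansion:
  assumes "ropen I W" "smooth_on I W g" "rbox I x0 e \<subseteq> W" "x \<in> rbox I x0 e"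
  shows "g x = g x0 + (\<Sum>i\<in>I. (x i - x0 i) * seg_average 0 (pd i g) x)"
proof -
  have seg0: "seg 0 x = x0" by (rule tuples_eqI[OF _ x0]) (auto simp: seg_def)
  have seg1: "seg 1 x = x" by (rule tuples_eqI) (use assms(4) in \<open>auto simp: seg_def rbox_def\<close>)
  have d: "((\<lambda>t. g (seg t x)) has_real_derivative (\<Sum>i\<in>I. pd i g (seg t x) * (x i - x0 i))) (at t)"
    if t: "t \<in> cbox 0 1" for t
  proof (rule DERIV_curve[OF fin assms(1) smooth_on_Ck[OF assms(2)]])
    show "seg t x \<in> W" using seg_in_rbox[OF assms(4) t] assms(3) by blast
    show "seg t x \<in> tuples I" for t by (simp add: seg_def)
    show "((\<lambda>t. seg t x i) has_real_derivative x i - x0 i) (at t)" if "i \<in> I" for i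
      using that by (auto simp: seg_def intro!: derivative_eq_intros)
  qed
  have "((\<lambda>t. \<Sum>i\<in>I. pd i g (seg t x) * (x i - x0 i)) has_integral (g (seg 1 x) - g (seg 0 x))) {0..1}"
  proof (rule fundamental_theorem_of_calculus)
    fix t :: real assume "t \<in> {0..1}"
    then show "((\<lambda>t. g (seg t x)) has_vector_derivative (\<Sum>i\<in>I. pd i g (seg t x) * (x i - x0 i))) (at t within {0..1})"
      using d[of t] by (auto simp: has_real_derivative_iff_has_vector_derivative intro: has_vector_derivative_at_within)
  qed simp
  then have "g x - g x0 = integral {0..1} (\<lambda>t. \<Sum>i\<in>I. pd i g (seg t x) * (x i - x0 i))"
    by (simp add: integral_unique seg0 seg1)
  also have "\<dots> = (\<Sum>i\<in>I. integral {0..1} (\<lambda>t. pd i g (seg t x) * (x i - x0 i)))"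
  proof (rule integral_sum[OF fin])
    fix i assume i: "i \<in> I"
    have "continuous_on (rbox I x0 e) (pd i g)"
      by (rule smooth_on_continuous[OF smooth_on_subset[OF smooth_on_pd[OF assms(2) i] assms(3)]]) (auto simp: rbox_def)
    from continuous_on_seg[OF this, of 0]
    have "continuous_on (cbox 0 1) (\<lambda>t. (\<lambda>(x, t). t ^ 0 * pd i g (seg t x)) (x, t))"
      by (rule continuous_on_compose2) (use assms(4) in \<open>auto intro!: continuous_intros\<close>)
    then have "continuous_on {0..1} (\<lambda>t. pd i g (seg t x) * (x i - x0 i))"
      by (intro continuous_intros) simp
    then show "(\<lambda>t. pd i g (seg t x) * (x i - x0 i)) integrable_on {0..1}"
      by (rule integrable_continuous_real)
  qed
  also have "\<dots> = (\<Sum>i\<in>I. (x i - x0 i) * seg_average 0 (pd i g) x)"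
    by (simp add: seg_average_def mult.commute)
  finally show ?thesis by simp
qed

end

lemma hadamard:
  assumes "finite I" "ropen I W" "smooth_on I W g" "x0 \<in> W"
  obtains e h where "e > 0" "rbox I x0 e \<subseteq> W" "\<And>i. i \<in> I \<Longrightarrow> smooth_on I (rbox I x0 e) (h i)"
    "\<And>x. x \<in> rbox I x0 e \<Longrightarrow> g x = g x0 + (\<Sum>i\<in>I. (x i - x0 i) * h i x)"
    "\<And>i. i \<in> I \<Longrightarrow> h i x0 = pd i g x0"
proof -
  have x0: "x0 \<in> tuples I" using assms(2,4) ropen_subset_tuples by blast
  obtain e where e: "e > 0" "rbox I x0 e \<subseteq> W"
    by (rule ropen_boxE[OF assms(1,2,4)]) (auto intro: that simp: rbox_def)
  show ?thesis
  proof (rule that[OF e, of "\<lambda>i. seg_average I x0 0 (pd i g)"])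
    show "smooth_on I (rbox I x0 e) (seg_average I x0 0 (pd i g))" if "i \<in> I" for i
      unfolding smooth_on_def
    proof
      fix k show "Ck_on I k (rbox I x0 e) (seg_average I x0 0 (pd i g))"
        by (rule Ck_on_seg_average[OF assms(1) x0 e(1)])
          (rule Ck_on_subset[OF smooth_on_Ck[OF smooth_on_pd[OF assms(3) that]] e(2)])
    qed
    show "g x = g x0 + (\<Sum>i\<in>I. (x i - x0 i) * seg_average I x0 0 (pd i g) x)" if "x \<in> rbox I x0 e" for x
      by (rule seg_average_expansion[OF assms(1) x0 e(1) assms(2,3) e(2) that])
    show "seg_average I x0 0 (pd i g) x0 = pd i g x0" for i
      by (rule seg_average_centre[OF assms(1) x0 e(1)])
  qed
qed

section \<open>The inverse function theorem\<close>

lemma ropen_UNIV_vec_iff: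
  fixes U :: "(real ^ 'k::finite) set"
  shows "ropen UNIV ((\<lambda>v. ($) v) ` U) \<longleftrightarrow> open U"
proof -
  have 1: "continuous_on UNIV (\<lambda>v :: real ^ 'k. ($) v)"
    by (rule continuous_on_coordinatewise_then_product) (intro continuous_intros)
  have 2: "continuous_on UNIV (\<lambda>f :: 'k \<Rightarrow> real. \<chi> i. f i)"
    by (intro continuous_on_vec_lambda continuous_on_product_coordinates)
  have S: "(($) ` U) = (\<lambda>f. \<chi> i. f i) -` U" by (force simp: image_iff vec_nth_inverse)
  have "open (($) ` U) \<longleftrightarrow> open U"
  proof
    assume "open (($) ` U)"
    then have "open (($) -` (($) ` U))" using 1 by (rule open_vimage)
    moreover have "($) -` (($) ` U) = U" by (rule inj_vimage_image_eq) (simp add: inj_on_def vec_nth_inject)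
    ultimately show "open U" by simp
  next
    assume "open U"
    then show "open (($) ` U)" unfolding S using 2 by (rule open_vimage)
  qed
  then show ?thesis by (simp only: euclidean_product_topology flip: open_openin)
qed

lemma Ck_on_det:
  fixes M :: "'k::finite \<Rightarrow> 'k \<Rightarrow> ('i \<Rightarrow> real) \<Rightarrow> real"
  assumes "finite I" "ropen I W" "\<And>a b. Ck_on I k W (M a b)"
  shows "Ck_on I k W (\<lambda>y. det (\<chi> a b. M a b y))"
  unfolding det_def
  by (intro Ck_on_sum Ck_on_mult Ck_on_prod Ck_on_const assms) (simp add: assms del: Ck_on.simps)

lemma has_derivative_vec_pd:
  fixes g :: "('k::finite \<Rightarrow> real) \<Rightarrow> real" and v :: "real ^ 'k"
  assumes "ropen UNIV W" "smooth_on UNIV W g" "($) v \<in> W"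
  shows "((\<lambda>v. g (($) v)) has_derivative (\<lambda>w. \<Sum>j\<in>UNIV. pd j g (($) v) * w $ j)) (at v)"
  unfolding has_derivative_at_alt
proof (intro conjI allI impI)
  show "bounded_linear (\<lambda>w :: real ^ 'k. \<Sum>j\<in>UNIV. pd j g (($) v) * w $ j)"
    by (intro bounded_linear_sum bounded_linear_const_mult bounded_linear_vec_nth)
  fix \<eta> :: real assume "\<eta> > 0"
  then have \<eta>: "\<eta> / CARD('k) > 0" by simp
  obtain e where e: "e > 0"
    "\<And>y. y \<in> rbox UNIV (($) v) e \<Longrightarrow>
       \<bar>g y - g (($) v) - (\<Sum>i\<in>UNIV. pd i g (($) v) * (y i - v $ i))\<bar> \<le> \<eta> / CARD('k) * (\<Sum>i\<in>UNIV. \<bar>y i - v $ i\<bar>)"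
    by (rule Ck_on_frechet[OF finite assms(1) smooth_on_Ck[OF assms(2)] assms(3) \<eta>]) (rule that)
  have "norm (g (($) w) - g (($) v) - (\<Sum>j\<in>UNIV. pd j g (($) v) * (w - v) $ j)) \<le> \<eta> * norm (w - v)"
    if w: "norm (w - v) < e" for w
  proof -
    have c: "\<bar>w $ i - v $ i\<bar> \<le> norm (w - v)" for i
      using component_le_norm_cart[of "w - v" i] by simp
    then have "($) w \<in> rbox UNIV (($) v) e" using w by (auto simp: rbox_def intro: le_less_trans)
    from e(2)[OF this]
    have "\<bar>g (($) w) - g (($) v) - (\<Sum>i\<in>UNIV. pd i g (($) v) * (w $ i - v $ i))\<bar>
       \<le> \<eta> / CARD('k) * (\<Sum>i\<in>UNIV. \<bar>w $ i - v $ i\<bar>)" .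
    also have "(\<Sum>i\<in>UNIV. \<bar>w $ i - v $ i\<bar>) \<le> of_nat CARD('k) * norm (w - v)"
      by (rule sum_bounded_above) (use c in auto)
    then have "\<eta> / CARD('k) * (\<Sum>i\<in>UNIV. \<bar>w $ i - v $ i\<bar>) \<le> \<eta> / CARD('k) * (of_nat CARD('k) * norm (w - v))"
      using \<eta> by (intro mult_left_mono) auto
    also have "\<dots> = \<eta> * norm (w - v)" by simp
    finally show ?thesis by simp
  qed
  then show "\<exists>d>0. \<forall>w. norm (w - v) < d \<longrightarrow>
      norm (g (($) w) - g (($) v) - (\<Sum>j\<in>UNIV. pd j g (($) v) * (w - v) $ j)) \<le> \<eta> * norm (w - v)"
    using e(1) by blast
qed

text \<open>
  For continuously differentiable maps \<open>inverse_function_theorem\<close> provides a differentiable local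
  inverse. Its partial derivatives are, by
  Cramer's rule, rational expressions in the partial derivatives of the given map evaluated at
  the inverse; so each order of differentiability of the inverse yields the next one.
\<close>

lemma smooth_inverse_function:
  fixes h :: "'k::finite \<Rightarrow> ('k \<Rightarrow> real) \<Rightarrow> real"
  assumes W: "ropen UNIV W" and h: "\<And>i. smooth_on UNIV W (h i)" and x0: "x0 \<in> W"
    and inv: "invertible (\<chi> i j. pd j (h i) x0 :: real ^ 'k ^ 'k)"
  defines "H \<equiv> (\<lambda>x i. h i x)"
  obtains U where "ropen UNIV U" "x0 \<in> U" "U \<subseteq> W" "inj_on H U" "ropen UNIV (H ` U)"
    "\<And>i. smooth_on UNIV (H ` U) (\<lambda>y. inv_into U H y i)"
proof -
  define A where "A v = (\<chi> i j. pd j (h i) (($) v))" for v :: "real ^ 'k"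
  define F where "F v = (\<chi> i. h i (($) v))" for v :: "real ^ 'k"
  define W' where "W' = {v :: real ^ 'k. ($) v \<in> W}"
  have "y = ($) (vec_lambda y)" for y :: "'k \<Rightarrow> real" by (simp add: vec_lambda_inverse)
  then have nth_W': "(\<lambda>v. ($) v) ` W' = W"
    unfolding W'_def by (fastforce simp: image_iff)
  have W': "open W'" using W nth_W' ropen_UNIV_vec_iff[of W'] by simp
  have HF: "H (($) v) = ($) (F v)" for v by (rule ext) (simp add: H_def F_def)
  have derF: "(F has_derivative blinfun_apply (Blinfun (\<lambda>w. A v *v w))) (at v)" if "v \<in> W'" for v
  proof -
    have "(F has_derivative (\<lambda>w. A v *v w)) (at v)"
    proof (rule has_derivative_componentwise_within[THEN iffD2], rule ballI)
      fix b :: "real ^ 'k" assume "b \<in> Basis"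
      then obtain i where b: "b = axis i 1" by (auto simp: Basis_vec_def)
      have "((\<lambda>v. h i (($) v)) has_derivative (\<lambda>w. \<Sum>j\<in>UNIV. pd j (h i) (($) v) * w $ j)) (at v)"
        by (rule has_derivative_vec_pd[OF W h]) (use that in \<open>simp add: W'_def\<close>)
      then show "((\<lambda>v. F v \<bullet> b) has_derivative (\<lambda>w. (A v *v w) \<bullet> b)) (at v)"
        by (simp add: b inner_axis F_def A_def matrix_vector_mult_def)
    qed
    then show ?thesis by (simp add: bounded_linear_Blinfun_apply)
  qed
  have contA: "continuous_on W' (\<lambda>v. pd j (h i) (($) v))" for i j
  proof (rule continuous_on_compose2[OF smooth_on_continuous[OF smooth_on_pd[OF h]]])
    show "continuous_on W' (\<lambda>v. ($) v)"
      by (rule continuous_on_coordinatewise_then_product) (intro continuous_intros)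
  qed (auto simp: W'_def)
  have contf: "continuous_on W' (\<lambda>v. Blinfun (\<lambda>w. A v *v w))"
  proof (rule continuous_on_blinfun_componentwise)
    fix b :: "real ^ 'k"
    show "continuous_on W' (\<lambda>v. blinfun_apply (Blinfun (\<lambda>w. A v *v w)) b)"
      unfolding bounded_linear_Blinfun_apply[OF matrix_vector_mul_bounded_linear]
      by (simp add: A_def matrix_vector_mult_def) (intro continuous_intros contA)
  qed
  define v0 :: "real ^ 'k" where "v0 = vec_lambda x0"
  have v0: "v0 \<in> W'" "($) v0 = x0" using x0 by (simp_all add: v0_def W'_def vec_lambda_inverse)
  obtain B where B: "B ** A v0 = mat 1"
    using inv unfolding invertible_def A_def v0(2) by blast
  have invf: "Blinfun (\<lambda>w. B *v w) o\<^sub>L Blinfun (\<lambda>w. A v0 *v w) = id_blinfun"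
    by (rule blinfun_eqI)
      (simp add: bounded_linear_Blinfun_apply matrix_vector_mul_assoc B)
  obtain U' V' g g' where U': "open U'" "U' \<subseteq> W'" "v0 \<in> U'" and V': "open V'" "F v0 \<in> V'"
    and hom: "homeomorphism U' V' F g"
    and g': "\<And>y. y \<in> V' \<Longrightarrow> (g has_derivative (g' y)) (at y)"
      "\<And>y. y \<in> V' \<Longrightarrow> g' y = inv (blinfun_apply (Blinfun (\<lambda>w. A (g y) *v w)))"
      "\<And>y. y \<in> V' \<Longrightarrow> bij (blinfun_apply (Blinfun (\<lambda>w. A (g y) *v w)))"
    by (rule inverse_function_theorem[OF W' derF contf v0(1) invf]) (assumption, rule that)
  define U where "U = (\<lambda>v. ($) v) ` U'"
  have gF: "g (F v) = v" "F v \<in> V'" if "v \<in> U'" for v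
    using hom that unfolding homeomorphism_def by blast+
  have Fg: "F (g y) = y" "g y \<in> U'" if "y \<in> V'" for y
    using hom that unfolding homeomorphism_def by blast+
  have inj: "inj_on H U"
    unfolding U_def by (rule inj_onI) (metis (no_types, lifting) HF gF(1) imageE vec_nth_inject)
  have HU: "H ` U = (\<lambda>v. ($) v) ` V'"
  proof -
    have "F ` U' = V'" using hom by (simp add: homeomorphism_def)
    then show ?thesis unfolding U_def image_image HF by (metis image_image)
  qed
  have opV: "ropen UNIV (H ` U)" unfolding HU ropen_UNIV_vec_iff by (rule V')
  define \<Psi> where "\<Psi> i y = g (vec_lambda y) $ i" for i y
  have in_HU: "y \<in> H ` U \<longleftrightarrow> vec_lambda y \<in> V'" for y
    unfolding HU by (auto simp: image_iff vec_nth_inverse) (metis vec_lambda_inverse UNIV_I)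
  have inv\<Psi>: "inv_into U H y = (\<lambda>i. \<Psi> i y)" if "y \<in> H ` U" for y
  proof (rule inv_into_f_eq[OF inj])
    have y: "vec_lambda y \<in> V'" using that in_HU by blast
    have eq: "(\<lambda>i. \<Psi> i y) = ($) (g (vec_lambda y))" by (simp add: \<Psi>_def)
    show "(\<lambda>i. \<Psi> i y) \<in> U" unfolding eq U_def using Fg(2)[OF y] by blast
    show "H (\<lambda>i. \<Psi> i y) = y" unfolding eq HF Fg(1)[OF y] by (simp add: vec_lambda_inverse)
  qed
  have tm: "tuple_map UNIV \<Psi> y = ($) (g (vec_lambda y))" for y
    by (auto simp: tuple_map_def \<Psi>_def)
  \<comment> \<open>By Cramer's rule \<open>N k j y / D y\<close> is the \<open>(k, j)\<close> entry of the inverse Jacobian matrix.\<close>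
  define N where "N k j y = det (\<chi> a b. if b = k then (axis j 1 :: real ^ 'k) $ a else A (g (vec_lambda y)) $ a $ b)" for k j y
  define D where "D y = det (A (g (vec_lambda y)))" for y
  have D: "D y \<noteq> 0" and N: "g' (vec_lambda y) (axis j 1) $ k = N k j y * inverse (D y)"
    if y: "y \<in> H ` U" for y j k
  proof -
    let ?A = "A (g (vec_lambda y))"
    have y': "vec_lambda y \<in> V'" using y in_HU by blast
    have bij: "bij (\<lambda>w. ?A *v w)"
      using g'(3)[OF y'] by (simp add: bounded_linear_Blinfun_apply)
    then have "invertible ?A" by (simp add: invertible_eq_bij)
    then show "D y \<noteq> 0" by (simp add: invertible_det_nz D_def)
    have "?A *v (g' (vec_lambda y) (axis j 1)) = axis j 1"
      unfolding g'(2)[OF y'] bounded_linear_Blinfun_apply[OF matrix_vector_mul_bounded_linear]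
      by (rule surj_f_inv_f[OF bij_is_surj[OF bij]])
    then have "g' (vec_lambda y) (axis j 1) = (\<chi> k. N k j y / D y)"
      using cramer[of ?A "g' (vec_lambda y) (axis j 1)" "axis j 1"] \<open>D y \<noteq> 0\<close> by (simp add: D_def N_def)
    then show "g' (vec_lambda y) (axis j 1) $ k = N k j y * inverse (D y)" by (simp add: divide_inverse)
  qed
  have "Ck_on UNIV n (H ` U) (\<Psi> i)" for n i
  proof (induction n arbitrary: i)
    have c: "continuous_on (H ` U) (\<Psi> i)" for i
      unfolding \<Psi>_def
    proof (rule continuous_on_component, rule continuous_on_compose2[of V' g])
      show "continuous_on V' g" using hom by (simp add: homeomorphism_def)
      show "continuous_on (H ` U) vec_lambda"
        by (intro continuous_on_vec_lambda continuous_on_subset[OF continuous_on_product_coordinates]) simp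
    qed (use in_HU in blast)
    {
      case 0
      show ?case using c by (simp add: continuous_map_iff_continuous_on)
    next
      case (Suc n)
      show ?case
      proof (rule Ck_on_SucI[OF finite opV c, where d = "\<lambda>j y. N i j y * inverse (D y)"])
        fix j y assume y: "y \<in> H ` U"
        have l: "vec_lambda (y(j := t)) = vec_lambda y + (t - y j) *\<^sub>R (axis j 1 :: real ^ 'k)" for t
          by (simp add: vec_eq_iff axis_def)
        have "((\<lambda>t. vec_lambda y + (t - y j) *\<^sub>R (axis j 1 :: real ^ 'k)) has_vector_derivative axis j 1) (at (y j))"
          by (auto intro!: derivative_eq_intros)
        then have 1: "((\<lambda>t. vec_lambda (y(j := t))) has_vector_derivative (axis j 1 :: real ^ 'k)) (at (y j))"
          unfolding l .
        have "vec_lambda y \<in> V'" using y in_HU by blast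
        then have 2: "(g has_derivative g' (vec_lambda y)) (at (vec_lambda (y(j := y j))))" using g'(1) by simp
        have 3: "((\<lambda>t. g (vec_lambda (y(j := t)))) has_derivative (\<lambda>s. g' (vec_lambda y) (s *\<^sub>R axis j 1))) (at (y j))"
          using has_derivative_compose[OF 1[unfolded has_vector_derivative_def] 2] by (simp only: o_def)
        have lin: "linear (g' (vec_lambda y))" using 2 has_derivative_linear by blast
        have "((\<lambda>t. g (vec_lambda (y(j := t))) $ i) has_derivative (\<lambda>s. g' (vec_lambda y) (s *\<^sub>R axis j 1) $ i)) (at (y j))"
          by (rule bounded_linear.has_derivative[OF bounded_linear_vec_nth 3])
        then have "((\<lambda>t. g (vec_lambda (y(j := t))) $ i) has_real_derivative g' (vec_lambda y) (axis j 1) $ i) (at (y j))"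
          unfolding has_field_derivative_def linear_cmul[OF lin] by (simp only: vector_scaleR_component real_scaleR_def mult_commute_abs)
        then show "((\<lambda>t. \<Psi> i (y(j := t))) has_real_derivative N i j y * inverse (D y)) (at (y j))"
          unfolding \<Psi>_def N[OF y] .
      next
        fix j
        have A: "Ck_on UNIV n (H ` U) (\<lambda>y. A (g (vec_lambda y)) $ a $ b)" for a b
        proof -
          have "Ck_on UNIV n (H ` U) (\<lambda>y. pd b (h a) (tuple_map UNIV \<Psi> y))"
          proof (rule Ck_on_compose[OF finite finite opV W])
            fix y assume "y \<in> H ` U"
            then have "g (vec_lambda y) \<in> W'" using in_HU Fg(2) U'(2) by blast
            then show "tuple_map UNIV \<Psi> y \<in> W" unfolding tm by (simp add: W'_def)
          qed (use smooth_on_Ck[OF smooth_on_pd[OF h]] Suc in \<open>auto simp del: Ck_on.simps\<close>)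
          then show ?thesis by (simp only: tm A_def vec_lambda_beta)
        qed
        have D1: "Ck_on UNIV n (H ` U) D"
          using Ck_on_det[OF finite opV, of n "\<lambda>a b y. A (g (vec_lambda y)) $ a $ b"] A
          unfolding D_def by (simp add: vec_lambda_eta del: Ck_on.simps)
        have N1: "Ck_on UNIV n (H ` U) (N i j)"
          unfolding N_def
        proof (rule Ck_on_det[OF finite opV])
          fix a b
          show "Ck_on UNIV n (H ` U) (\<lambda>y. if b = i then (axis j 1 :: real ^ 'k) $ a else A (g (vec_lambda y)) $ a $ b)"
            by (cases "b = i") (simp_all add: A Ck_on_const[OF finite opV] del: Ck_on.simps)
        qed
        show "Ck_on UNIV n (H ` U) (\<lambda>y. N i j y * inverse (D y))"
          by (rule Ck_on_mult[OF finite opV N1 Ck_on_inverse[OF finite opV D1 D]])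
      qed
    }
  qed
  then have sm: "smooth_on UNIV (H ` U) (\<Psi> i)" for i by (simp add: smooth_on_def)
  show ?thesis
  proof (rule that[OF _ _ _ inj opV])
    show "ropen UNIV U" unfolding U_def ropen_UNIV_vec_iff by (rule U')
    show "x0 \<in> U" unfolding U_def using U'(3) v0(2) by blast
    show "U \<subseteq> W" unfolding U_def using U'(2) nth_W' by blast
    show "smooth_on UNIV (H ` U) (\<lambda>y. inv_into U H y i)" for i
      by (rule smooth_on_cong[OF finite opV sm]) (simp add: inv\<Psi>)
  qed
qed

section \<open>Charts, topology and smooth functions on a manifold\<close>

text \<open>
  The local theory of an atlas. On jet bundles it is used to establish the Hausdorff property
  and second countability.
\<close>

locale atlas_manifold =
  fixes M :: "('a, 'i) mfd"
  assumes fin: "finite (idx M)"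
    and is_chart_atlas: "c \<in> atlas M \<Longrightarrow> is_chart (idx M) c"
    and compatible_atlas: "c \<in> atlas M \<Longrightarrow> d \<in> atlas M \<Longrightarrow> compatible_charts (idx M) c d"

lemma smooth_manifold_atlas_manifold: "smooth_manifold M \<Longrightarrow> atlas_manifold M"
  by (unfold_locales) (auto simp: smooth_manifold_def)

context atlas_manifold
begin

abbreviation "I \<equiv> idx M"

lemma atlas_subset_charts: "atlas M \<subseteq> charts M"
  using is_chart_atlas compatible_atlas by (auto simp: charts_def carrier_def)

lemma carrierE:
  assumes "p \<in> carrier M" obtains V \<phi> where "(V, \<phi>) \<in> atlas M" "p \<in> V"
  using assms by (auto simp: carrier_def)

lemma chartD:
  assumes "(V, \<phi>) \<in> charts M"
  shows "V \<subseteq> carrier M" "inj_on \<phi> V" "ropen I (\<phi> ` V)"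
  using assms by (auto simp: charts_def is_chart_def)

lemma chart_tuples: "(V, \<phi>) \<in> charts M \<Longrightarrow> p \<in> V \<Longrightarrow> \<phi> p \<in> tuples I"
  using chartD(3) ropen_subset_tuples by blast

lemma chart_inv: "(V, \<phi>) \<in> charts M \<Longrightarrow> p \<in> V \<Longrightarrow> inv_into V \<phi> (\<phi> p) = p"
  using chartD(2) by (simp add: inv_into_f_f)

lemma atlas_compatible:
  assumes "(V, \<phi>) \<in> charts M" "(W, \<psi>) \<in> atlas M"
  shows "smooth_transition I (V, \<phi>) (W, \<psi>)" "smooth_transition I (W, \<psi>) (V, \<phi>)"
  using assms by (auto simp: charts_def compatible_charts_def)

lemma transition_preimage:
  assumes c: "(V, \<phi>) \<in> charts M" and d: "(W, \<psi>) \<in> charts M"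
    and t: "smooth_transition I (V, \<phi>) (W, \<psi>)" and T: "ropen I T"
  shows "ropen I (\<phi> ` {p \<in> V \<inter> W. \<psi> p \<in> T})"
proof -
  have op: "ropen I (\<phi> ` (V \<inter> W))" and sm: "\<And>i. i \<in> I \<Longrightarrow> smooth_on I (\<phi> ` (V \<inter> W)) (\<lambda>x. \<psi> (inv_into V \<phi> x) i)"
    using t by (auto simp: smooth_transition_def)
  have eq: "tuple_map I (\<lambda>i x. \<psi> (inv_into V \<phi> x) i) (\<phi> p) = \<psi> p" if "p \<in> V" "p \<in> W" for p
    using that chart_inv[OF c] chart_tuples[OF d] by (intro tuple_map_eqI) auto
  have "continuous_on (\<phi> ` (V \<inter> W)) (tuple_map I (\<lambda>i x. \<psi> (inv_into V \<phi> x) i))"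
    unfolding tuple_map_def
    by (rule continuous_on_tuple_valued) (rule smooth_on_continuous[OF sm ropen_subset_tuples[OF op]])
  then have "ropen I {x \<in> \<phi> ` (V \<inter> W). tuple_map I (\<lambda>i x. \<psi> (inv_into V \<phi> x) i) x \<in> T}"
    by (rule ropen_preimage[OF op _ _ T]) auto
  also have "{x \<in> \<phi> ` (V \<inter> W). tuple_map I (\<lambda>i x. \<psi> (inv_into V \<phi> x) i) x \<in> T} = \<phi> ` {p \<in> V \<inter> W. \<psi> p \<in> T}"
    using eq by force
  finally show ?thesis .
qed

lemma topspace_mtop: "topspace (mtop M) = carrier M"
proof -
  have "\<Union>{{p \<in> V. \<phi> p \<in> W} | V \<phi> W. (V, \<phi>) \<in> atlas M \<and> ropen I W} = carrier M"
  proof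
    show "carrier M \<subseteq> \<Union>{{p \<in> V. \<phi> p \<in> W} | V \<phi> W. (V, \<phi>) \<in> atlas M \<and> ropen I W}"
    proof
      fix p assume "p \<in> carrier M"
      then obtain V \<phi> where "(V, \<phi>) \<in> atlas M" "p \<in> V" by (rule carrierE)
      moreover have "\<phi> p \<in> tuples I" using calculation atlas_subset_charts chart_tuples by blast
      ultimately show "p \<in> \<Union>{{p \<in> V. \<phi> p \<in> W} | V \<phi> W. (V, \<phi>) \<in> atlas M \<and> ropen I W}"
        using ropen_tuples[of I] by blast
    qed
  qed (auto simp: carrier_def)
  then show ?thesis by (simp add: mtop_def)
qed

text \<open>
  Induction over the generation of the topology. For a generator the claim is the continuity of
  a transition map.
\<close>

lemma mtop_imp_ropen_atlas:
  assumes "openin (mtop M) U" "(V, \<phi>) \<in> atlas M"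
  shows "ropen I (\<phi> ` (U \<inter> V))"
proof -
  have c: "(V, \<phi>) \<in> charts M" using assms(2) atlas_subset_charts by blast
  have "generate_topology_on {{p \<in> V. \<phi> p \<in> W} | V \<phi> W. (V, \<phi>) \<in> atlas M \<and> ropen I W} U"
    using assms(1) by (simp add: mtop_def openin_topology_generated_by_iff)
  then show ?thesis
  proof (induction U rule: generate_topology_on.induct)
    case (Int a b)
    have "\<phi> ` (a \<inter> b \<inter> V) = \<phi> ` (a \<inter> V) \<inter> \<phi> ` (b \<inter> V)"
      using chartD(2)[OF c] by (auto simp: inj_on_def)
    then show ?case using Int by (simp add: openin_Int)
  next
    case (UN K)
    have "\<phi> ` (\<Union>K \<inter> V) = \<Union>((\<lambda>k. \<phi> ` (k \<inter> V)) ` K)" by auto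
    then show ?case using UN by auto
  next
    case (Basis s)
    then obtain V' \<phi>' W where s: "s = {p \<in> V'. \<phi>' p \<in> W}" "(V', \<phi>') \<in> atlas M" "ropen I W" by blast
    have d: "(V', \<phi>') \<in> charts M" using s(2) atlas_subset_charts by blast
    have "\<phi> ` (s \<inter> V) = \<phi> ` {p \<in> V \<inter> V'. \<phi>' p \<in> W}" unfolding s(1) by blast
    then show ?case using transition_preimage[OF c d atlas_compatible(1)[OF c s(2)] s(3)] by simp
  qed simp
qed

lemma openin_mtop_iff:
  "openin (mtop M) U \<longleftrightarrow> U \<subseteq> carrier M \<and> (\<forall>(V, \<phi>)\<in>atlas M. ropen I (\<phi> ` (U \<inter> V)))"
proof
  assume "openin (mtop M) U"
  then show "U \<subseteq> carrier M \<and> (\<forall>(V, \<phi>)\<in>atlas M. ropen I (\<phi> ` (U \<inter> V)))"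
    using openin_subset topspace_mtop mtop_imp_ropen_atlas by (metis (no_types, lifting) case_prodI2)
next
  assume U: "U \<subseteq> carrier M \<and> (\<forall>(V, \<phi>)\<in>atlas M. ropen I (\<phi> ` (U \<inter> V)))"
  show "openin (mtop M) U"
  proof (subst openin_subopen, rule ballI)
    fix p assume p: "p \<in> U"
    then have "p \<in> carrier M" using U by blast
    then obtain V \<phi> where c: "(V, \<phi>) \<in> atlas M" "p \<in> V" by (rule carrierE)
    have inj: "inj_on \<phi> V" using c(1) atlas_subset_charts chartD(2) by blast
    have "ropen I (\<phi> ` (U \<inter> V))" using U c(1) by blast
    then have "openin (mtop M) {q \<in> V. \<phi> q \<in> \<phi> ` (U \<inter> V)}"
      unfolding mtop_def using c(1) by (intro topology_generated_by_Basis) blast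
    moreover have "{q \<in> V. \<phi> q \<in> \<phi> ` (U \<inter> V)} = U \<inter> V"
      using inj by (auto simp: inj_on_def)
    ultimately show "\<exists>T. openin (mtop M) T \<and> p \<in> T \<and> T \<subseteq> U" using p c(2) by (metis IntI Int_lower1)
  qed
qed

lemma ropen_chart_image:
  assumes U: "openin (mtop M) U" and c: "(V, \<phi>) \<in> charts M"
  shows "ropen I (\<phi> ` (U \<inter> V))"
proof (subst openin_subopen, rule ballI)
  fix x assume "x \<in> \<phi> ` (U \<inter> V)"
  then obtain p where p: "p \<in> U" "p \<in> V" "x = \<phi> p" by blast
  then have "p \<in> carrier M" using chartD(1)[OF c] by blast
  then obtain W \<psi> where d: "(W, \<psi>) \<in> atlas M" "p \<in> W" by (rule carrierE)
  have dc: "(W, \<psi>) \<in> charts M" using d(1) atlas_subset_charts by blast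
  let ?T = "\<phi> ` {p \<in> V \<inter> W. \<psi> p \<in> \<psi> ` (U \<inter> W)}"
  have "ropen I ?T"
    by (rule transition_preimage[OF c dc atlas_compatible(1)[OF c d(1)] mtop_imp_ropen_atlas[OF U d(1)]])
  moreover have "x \<in> ?T" using p d(2) by blast
  moreover have "?T \<subseteq> \<phi> ` (U \<inter> V)" using chartD(2)[OF dc] by (auto simp: inj_on_def)
  ultimately show "\<exists>T. ropen I T \<and> x \<in> T \<and> T \<subseteq> \<phi> ` (U \<inter> V)" by blast
qed

lemma openin_chart_preimage:
  assumes c: "(V, \<phi>) \<in> charts M" and T: "ropen I T"
  shows "openin (mtop M) {p \<in> V. \<phi> p \<in> T}"
  unfolding openin_mtop_iff
proof (intro conjI ballI, safe)
  show "p \<in> carrier M" if "p \<in> V" for p using that chartD(1)[OF c] by blast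
  fix W \<psi> assume d: "(W, \<psi>) \<in> atlas M"
  have dc: "(W, \<psi>) \<in> charts M" using d atlas_subset_charts by blast
  have "{p \<in> V. \<phi> p \<in> T} \<inter> W = {p \<in> W \<inter> V. \<phi> p \<in> T}" by blast
  then show "ropen I (\<psi> ` ({p \<in> V. \<phi> p \<in> T} \<inter> W))"
    using transition_preimage[OF dc c atlas_compatible(2)[OF c d] T] by simp
qed

lemma openin_chart_domain: assumes "(V, \<phi>) \<in> charts M" shows "openin (mtop M) V"
proof -
  have "{p \<in> V. \<phi> p \<in> tuples I} = V" using chart_tuples[OF assms] by blast
  then show ?thesis using openin_chart_preimage[OF assms ropen_tuples] by simp
qed

text \<open>
  While \<open>smooth_at\<close> asks for some chart of the atlas, this is the condition in one
  given chart of the maximal atlas.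
\<close>

definition smooth_in_chart :: "'a set \<Rightarrow> ('a \<Rightarrow> 'i \<Rightarrow> real) \<Rightarrow> 'a \<Rightarrow> ('a \<Rightarrow> real) \<Rightarrow> bool"
  where "smooth_in_chart V \<phi> p f \<longleftrightarrow> (\<exists>W. ropen I W \<and> \<phi> p \<in> W \<and> W \<subseteq> \<phi> ` V \<and>
    smooth_on I W (\<lambda>x. f (inv_into V \<phi> x)))"

lemma smooth_in_chart_transfer:
  assumes c: "(V, \<phi>) \<in> charts M" and d: "(W, \<psi>) \<in> charts M"
    and t: "smooth_transition I (V, \<phi>) (W, \<psi>)" and p: "p \<in> V" "p \<in> W"
    and f: "smooth_in_chart W \<psi> p f"
  shows "smooth_in_chart V \<phi> p f"
proof -
  obtain T where T: "ropen I T" "\<psi> p \<in> T" "T \<subseteq> \<psi> ` W" "smooth_on I T (\<lambda>x. f (inv_into W \<psi> x))"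
    using f by (auto simp: smooth_in_chart_def)
  let ?S = "\<phi> ` {p \<in> V \<inter> W. \<psi> p \<in> T}"
  have S: "ropen I ?S" by (rule transition_preimage[OF c d t T(1)])
  have sm: "smooth_on I (\<phi> ` (V \<inter> W)) (\<lambda>x. \<psi> (inv_into V \<phi> x) i)" if "i \<in> I" for i
    using t that by (auto simp: smooth_transition_def)
  have eq: "tuple_map I (\<lambda>i x. \<psi> (inv_into V \<phi> x) i) (\<phi> q) = \<psi> q" if "q \<in> V" "q \<in> W" for q
    using that chart_inv[OF c] chart_tuples[OF d] by (intro tuple_map_eqI) auto
  have "smooth_on I ?S (\<lambda>x. f (inv_into W \<psi> (tuple_map I (\<lambda>i x. \<psi> (inv_into V \<phi> x) i) x)))"
  proof (rule smooth_on_compose[OF fin fin S T(1,4)])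
    show "smooth_on I ?S (\<lambda>x. \<psi> (inv_into V \<phi> x) i)" if "i \<in> I" for i
      by (rule smooth_on_subset[OF sm[OF that]]) auto
    show "tuple_map I (\<lambda>i x. \<psi> (inv_into V \<phi> x) i) x \<in> T" if "x \<in> ?S" for x
      using that eq by auto
  qed
  then have "smooth_on I ?S (\<lambda>x. f (inv_into V \<phi> x))"
    by (rule smooth_on_cong[OF fin S]) (use eq chart_inv[OF c] chart_inv[OF d] in auto)
  then show ?thesis unfolding smooth_in_chart_def using S p T(2) by blast
qed

lemma smooth_at_iff_chart:
  assumes c: "(V, \<phi>) \<in> charts M" and p: "p \<in> V"
  shows "smooth_at M p f \<longleftrightarrow> smooth_in_chart V \<phi> p f"
proof
  assume "smooth_at M p f"
  then obtain W \<psi> where d: "(W, \<psi>) \<in> atlas M" "p \<in> W" "smooth_in_chart W \<psi> p f"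
    unfolding smooth_at_def smooth_in_chart_def by blast
  have dc: "(W, \<psi>) \<in> charts M" using d atlas_subset_charts by blast
  show "smooth_in_chart V \<phi> p f"
    by (rule smooth_in_chart_transfer[OF c dc atlas_compatible(1)[OF c d(1)] p d(2,3)])
next
  assume f: "smooth_in_chart V \<phi> p f"
  have "p \<in> carrier M" using p chartD(1)[OF c] by blast
  then obtain W \<psi> where d: "(W, \<psi>) \<in> atlas M" "p \<in> W" by (rule carrierE)
  have dc: "(W, \<psi>) \<in> charts M" using d atlas_subset_charts by blast
  have "smooth_in_chart W \<psi> p f"
    by (rule smooth_in_chart_transfer[OF dc c atlas_compatible(2)[OF c d(1)] d(2) p f])
  then show "smooth_at M p f" unfolding smooth_at_def smooth_in_chart_def using d by blast
qed

lemma smooth_at_chartE: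
  assumes "(V, \<phi>) \<in> charts M" "p \<in> V" "smooth_at M p f"
  obtains W where "ropen I W" "\<phi> p \<in> W" "W \<subseteq> \<phi> ` V" "smooth_on I W (\<lambda>x. f (inv_into V \<phi> x))"
  using assms smooth_at_iff_chart[OF assms(1,2)] by (auto simp: smooth_in_chart_def)

lemma smooth_at_chartI:
  assumes c: "(V, \<phi>) \<in> charts M" and p: "p \<in> V" and W: "ropen I W" "\<phi> p \<in> W" "smooth_on I W g"
    and f: "\<And>q. q \<in> V \<Longrightarrow> \<phi> q \<in> W \<Longrightarrow> f q = g (\<phi> q)"
  shows "smooth_at M p f"
proof -
  have op: "ropen I (W \<inter> \<phi> ` V)" using W(1) chartD(3)[OF c] by (rule openin_Int)
  have "smooth_on I (W \<inter> \<phi> ` V) (\<lambda>x. f (inv_into V \<phi> x))"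
    by (rule smooth_on_cong[OF fin op smooth_on_subset[OF W(3)]]) (use f chart_inv[OF c] in auto)
  then show ?thesis unfolding smooth_at_iff_chart[OF c p] smooth_in_chart_def using op W(2) p by blast
qed

lemma smooth_at_coord:
  assumes "(V, \<phi>) \<in> charts M" "p \<in> V" "i \<in> I" shows "smooth_at M p (\<lambda>q. \<phi> q i)"
  by (rule smooth_at_chartI[OF assms(1,2) ropen_tuples chart_tuples[OF assms(1,2)]])
    (auto intro: smooth_on_coord[OF fin ropen_tuples assms(3)])

lemma smooth_transition_charts:
  assumes c: "(V, \<phi>) \<in> charts M" and d: "(W, \<psi>) \<in> charts M"
  shows "smooth_transition I (V, \<phi>) (W, \<psi>)"
proof -
  have op: "ropen I (\<phi> ` (V \<inter> W))"
    using ropen_chart_image[OF openin_chart_domain[OF d] c] by (simp add: Int_commute)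
  have "smooth_on I (\<phi> ` (V \<inter> W)) (\<lambda>x. \<psi> (inv_into V \<phi> x) i)" if i: "i \<in> I" for i
  proof (rule smooth_on_local[OF fin op])
    fix x assume "x \<in> \<phi> ` (V \<inter> W)"
    then obtain p where p: "p \<in> V" "p \<in> W" "x = \<phi> p" by blast
    obtain T where T: "ropen I T" "\<phi> p \<in> T" "T \<subseteq> \<phi> ` V" "smooth_on I T (\<lambda>x. \<psi> (inv_into V \<phi> x) i)"
      using smooth_at_chartE[OF c p(1) smooth_at_coord[OF d p(2) i]] by blast
    show "\<exists>T. ropen I T \<and> x \<in> T \<and> T \<subseteq> \<phi> ` (V \<inter> W) \<and> smooth_on I T (\<lambda>x. \<psi> (inv_into V \<phi> x) i)"
      using T p op by (intro exI[of _ "T \<inter> \<phi> ` (V \<inter> W)"]) (auto intro: smooth_on_subset)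
  qed
  then show ?thesis using op by (simp add: smooth_transition_def)
qed

lemma smooth_at_carrier: "smooth_at M p f \<Longrightarrow> p \<in> carrier M"
  by (auto simp: smooth_at_def carrier_def)

lemma carrier_chartE:
  assumes "p \<in> carrier M" obtains V \<phi> where "(V, \<phi>) \<in> charts M" "p \<in> V"
  using assms carrierE atlas_subset_charts by (metis subsetD)

lemma smooth_at_nbhd:
  assumes "smooth_at M p f"
  obtains U where "openin (mtop M) U" "p \<in> U" "\<And>q. q \<in> U \<Longrightarrow> smooth_at M q f"
proof -
  obtain V \<phi> where c: "(V, \<phi>) \<in> charts M" "p \<in> V" using smooth_at_carrier[OF assms] by (rule carrier_chartE)
  obtain W where W: "ropen I W" "\<phi> p \<in> W" "W \<subseteq> \<phi> ` V" "smooth_on I W (\<lambda>x. f (inv_into V \<phi> x))"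
    using smooth_at_chartE[OF c assms] by blast
  have "smooth_at M q f" if q: "q \<in> {q \<in> V. \<phi> q \<in> W}" for q
    by (rule smooth_at_chartI[OF c(1) _ W(1) _ W(4)]) (use q chart_inv[OF c(1)] in auto)
  then show ?thesis using that[OF openin_chart_preimage[OF c(1) W(1)]] c(2) W(2) by blast
qed

lemma smooth_at_germ:
  assumes f: "smooth_at M p f" and U: "openin (mtop M) U" "p \<in> U" and eq: "\<And>q. q \<in> U \<Longrightarrow> f q = g q"
  shows "smooth_at M p g"
proof -
  obtain V \<phi> where c: "(V, \<phi>) \<in> charts M" "p \<in> V" using smooth_at_carrier[OF f] by (rule carrier_chartE)
  obtain W where W: "ropen I W" "\<phi> p \<in> W" "W \<subseteq> \<phi> ` V" "smooth_on I W (\<lambda>x. f (inv_into V \<phi> x))"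
    using smooth_at_chartE[OF c f] by blast
  have op: "ropen I (W \<inter> \<phi> ` (U \<inter> V))" using W(1) ropen_chart_image[OF U(1) c(1)] by (rule openin_Int)
  show ?thesis
  proof (rule smooth_at_chartI[OF c op _ smooth_on_subset[OF W(4)]])
    fix q assume q: "q \<in> V" "\<phi> q \<in> W \<inter> \<phi> ` (U \<inter> V)"
    then have "q \<in> U" using chartD(2)[OF c(1)] by (auto simp: inj_on_def)
    then show "g q = f (inv_into V \<phi> (\<phi> q))" using eq chart_inv[OF c(1) q(1)] by simp
  qed (use W(2) U(2) c(2) in auto)
qed

lemma smooth_at_const: assumes "p \<in> carrier M" shows "smooth_at M p (\<lambda>q. k)"
proof -
  obtain V \<phi> where c: "(V, \<phi>) \<in> charts M" "p \<in> V" using assms by (rule carrier_chartE)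
  show ?thesis
    by (rule smooth_at_chartI[OF c ropen_tuples chart_tuples[OF c] smooth_on_const[OF fin ropen_tuples]]) simp
qed

lemma smooth_at_comb:
  assumes f: "smooth_at M p f" and g: "smooth_at M p g"
    and h: "\<And>W u v. ropen I W \<Longrightarrow> smooth_on I W u \<Longrightarrow> smooth_on I W v \<Longrightarrow> smooth_on I W (\<lambda>x. H (u x) (v x))"
  shows "smooth_at M p (\<lambda>q. H (f q) (g q))"
proof -
  obtain V \<phi> where c: "(V, \<phi>) \<in> charts M" "p \<in> V" using smooth_at_carrier[OF f] by (rule carrier_chartE)
  obtain W where W: "ropen I W" "\<phi> p \<in> W" "W \<subseteq> \<phi> ` V" "smooth_on I W (\<lambda>x. f (inv_into V \<phi> x))"
    using smooth_at_chartE[OF c f] by blast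
  obtain W' where W': "ropen I W'" "\<phi> p \<in> W'" "W' \<subseteq> \<phi> ` V" "smooth_on I W' (\<lambda>x. g (inv_into V \<phi> x))"
    using smooth_at_chartE[OF c g] by blast
  have op: "ropen I (W \<inter> W')" using W(1) W'(1) by (rule openin_Int)
  show ?thesis
    by (rule smooth_at_chartI[OF c op _ h[OF op smooth_on_subset[OF W(4)] smooth_on_subset[OF W'(4)]]])
      (use W W' chart_inv[OF c(1)] in auto)
qed

lemma smooth_at_add: "smooth_at M p f \<Longrightarrow> smooth_at M p g \<Longrightarrow> smooth_at M p (\<lambda>q. f q + g q)"
  by (rule smooth_at_comb) (auto intro: smooth_on_add fin)

lemma smooth_at_mult: "smooth_at M p f \<Longrightarrow> smooth_at M p g \<Longrightarrow> smooth_at M p (\<lambda>q. f q * g q)"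
  by (rule smooth_at_comb) (auto intro: smooth_on_mult fin)

lemma smooth_at_diff: "smooth_at M p f \<Longrightarrow> smooth_at M p g \<Longrightarrow> smooth_at M p (\<lambda>q. f q - g q)"
  by (rule smooth_at_comb) (auto intro: smooth_on_diff fin)

lemma smooth_at_sum:
  assumes "p \<in> carrier M" "\<And>a. a \<in> A \<Longrightarrow> smooth_at M p (f a)"
  shows "smooth_at M p (\<lambda>q. \<Sum>a\<in>A. f a q)"
  using assms(2)
  by (induction A rule: infinite_finite_induct) (auto intro: smooth_at_add smooth_at_const assms(1))

lemma smooth_at_lincomb:
  "smooth_at M p f \<Longrightarrow> smooth_at M p g \<Longrightarrow> smooth_at M p (\<lambda>q. a * f q + b * g q)"
  by (intro smooth_at_add smooth_at_mult smooth_at_const smooth_at_carrier)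

lemma smooth_at_indicator:
  assumes "openin (mtop M) U" "p \<in> U" shows "smooth_at M p (\<lambda>q. if q \<in> U then 1 else 0)"
proof (rule smooth_at_germ[OF _ assms])
  show "smooth_at M p (\<lambda>q. 1)"
    using assms openin_subset topspace_mtop by (intro smooth_at_const) blast
qed simp

lemma smooth_at_nonzero_nbhd:
  assumes f: "smooth_at M p f" "f p \<noteq> 0"
  obtains U where "openin (mtop M) U" "p \<in> U" "\<And>q. q \<in> U \<Longrightarrow> f q \<noteq> 0"
proof -
  obtain V \<phi> where c: "(V, \<phi>) \<in> charts M" "p \<in> V" using smooth_at_carrier[OF f(1)] by (rule carrier_chartE)
  obtain W where W: "ropen I W" "\<phi> p \<in> W" "W \<subseteq> \<phi> ` V" "smooth_on I W (\<lambda>x. f (inv_into V \<phi> x))"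
    using smooth_at_chartE[OF c f(1)] by blast
  have cont: "continuous_on W (\<lambda>x. f (inv_into V \<phi> x))"
    using W(4) ropen_subset_tuples[OF W(1)] by (rule smooth_on_continuous)
  have "\<bar>f p\<bar> > 0" using f(2) by simp
  then obtain e where e: "e > 0" "rbox I (\<phi> p) e \<subseteq> W"
    "\<And>y. y \<in> rbox I (\<phi> p) e \<Longrightarrow> \<bar>f (inv_into V \<phi> y) - f (inv_into V \<phi> (\<phi> p))\<bar> < \<bar>f p\<bar>"
    by (rule continuous_on_rboxE[OF fin W(1) cont W(2)]) (rule that)
  show ?thesis
  proof (rule that[OF openin_chart_preimage[OF c(1) ropen_rbox[OF fin]]])
    show "p \<in> {q \<in> V. \<phi> q \<in> rbox I (\<phi> p) e}" using c(2) rbox_centre[OF chart_tuples[OF c] e(1)] by simp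
    show "f q \<noteq> 0" if "q \<in> {q \<in> V. \<phi> q \<in> rbox I (\<phi> p) e}" for q
      using that e(3)[of "\<phi> q"] chart_inv[OF c(1)] c(2) by auto
  qed
qed

end

text \<open>
  The indicator function of \<open>U'\<close> is smooth near \<open>F p\<close>; hence its
  pullback is smooth near \<open>p\<close>, and non-zero there.
\<close>

lemma smooth_map_at_preimage:
  assumes "atlas_manifold M" "atlas_manifold N" "smooth_map_at M N F p" "openin (mtop N) U'" "F p \<in> U'"
  obtains U where "openin (mtop M) U" "p \<in> U" "\<And>q. q \<in> U \<Longrightarrow> F q \<in> U'"
proof -
  interpret M: atlas_manifold M by fact
  interpret N: atlas_manifold N by fact
  have "smooth_at M p (\<lambda>q. if F q \<in> U' then 1 else 0)"
    using assms(3)[unfolded smooth_map_at_def, THEN conjunct2, rule_format, OF N.smooth_at_indicator[OF assms(4,5)]] .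
  then obtain U where UU: "openin (mtop M) U" "p \<in> U"
    and U: "\<And>q. q \<in> U \<Longrightarrow> (if F q \<in> U' then 1 else 0) \<noteq> (0 :: real)"
    by (rule M.smooth_at_nonzero_nbhd) (use assms(5) in auto)
  have "F q \<in> U'" if "q \<in> U" for q using U[OF that] by (simp split: if_splits)
  with UU show ?thesis by (rule that)
qed

section \<open>Tangent vectors\<close>

lemma tvec_apply:
  fixes v w :: "'a tvec"
  shows "(v + w) f = v f + w f" "(c *\<^sub>R v) f = c * v f" "(0 :: 'a tvec) f = 0" "(- v) f = - v f" "(v - w) f = v f - w f"
  by (simp_all add: plus_fun_def scaleR_fun_def zero_fun_def minus_apply)

lemma tvec_sum_apply: "(\<Sum>a\<in>A. (v a :: 'a tvec)) f = (\<Sum>a\<in>A. v a f)"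
  by (induction A rule: infinite_finite_induct) (simp_all add: tvec_apply)

lemma tangent_not_smooth: "v \<in> tangent M p \<Longrightarrow> \<not> smooth_at M p f \<Longrightarrow> v f = 0"
  by (simp add: tangent_def)

lemma tangent_lincomb:
  "v \<in> tangent M p \<Longrightarrow> smooth_at M p f \<Longrightarrow> smooth_at M p g \<Longrightarrow>
    v (\<lambda>q. a * f q + b * g q) = a * v f + b * v g"
  by (simp add: tangent_def)

lemma tangent_mult:
  "v \<in> tangent M p \<Longrightarrow> smooth_at M p f \<Longrightarrow> smooth_at M p g \<Longrightarrow>
    v (\<lambda>q. f q * g q) = v f * g p + f p * v g"
  by (simp add: tangent_def)

lemma subspace_tangent: "subspace (tangent M p)"
  by (rule subspaceI) (auto simp: tangent_def tvec_apply algebra_simps)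

context atlas_manifold
begin

lemma tangent_const: assumes "v \<in> tangent M p" "p \<in> carrier M" shows "v (\<lambda>q. k) = 0"
proof -
  note s = smooth_at_const[OF assms(2)]
  have "v (\<lambda>q. 1 * 1) = v (\<lambda>q. 1) * 1 + 1 * v (\<lambda>q. 1)" by (rule tangent_mult[OF assms(1) s s])
  then have "v (\<lambda>q. 1) = 0" by simp
  moreover have "v (\<lambda>q. k * 1 + 0 * 1) = k * v (\<lambda>q. 1) + 0 * v (\<lambda>q. 1)"
    by (rule tangent_lincomb[OF assms(1) s s])
  ultimately show ?thesis by simp
qed

lemma tangent_add:
  assumes "v \<in> tangent M p" "smooth_at M p f" "smooth_at M p g"
  shows "v (\<lambda>q. f q + g q) = v f + v g"
  using tangent_lincomb[OF assms, of 1 1] by simp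

lemma tangent_diff:
  assumes "v \<in> tangent M p" "smooth_at M p f" "smooth_at M p g"
  shows "v (\<lambda>q. f q - g q) = v f - v g"
  using tangent_lincomb[OF assms, of 1 "-1"] by simp

lemma tangent_sum:
  assumes v: "v \<in> tangent M p" and p: "p \<in> carrier M" and f: "\<And>a. a \<in> A \<Longrightarrow> smooth_at M p (f a)"
  shows "v (\<lambda>q. \<Sum>a\<in>A. f a q) = (\<Sum>a\<in>A. v (f a))"
  using f
proof (induction A rule: infinite_finite_induct)
  case (insert a A)
  have "smooth_at M p (\<lambda>q. \<Sum>a\<in>A. f a q)" using insert.prems by (intro smooth_at_sum p) auto
  then have "v (\<lambda>q. f a q + (\<Sum>a\<in>A. f a q)) = v (f a) + v (\<lambda>q. \<Sum>a\<in>A. f a q)"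
    using insert.prems by (intro tangent_add[OF v]) auto
  then show ?case using insert by simp
qed (simp_all add: tangent_const[OF v p])

text \<open>
  The product with an indicator function localises: it multiplies the difference of two
  functions with the same germ to zero, and the Leibniz rule does the rest.
\<close>

lemma tangent_germ:
  assumes v: "v \<in> tangent M p" and U: "openin (mtop M) U" "p \<in> U" and eq: "\<And>q. q \<in> U \<Longrightarrow> f q = g q"
  shows "v f = v g"
proof (cases "smooth_at M p f")
  case True
  have p: "p \<in> carrier M" using True by (rule smooth_at_carrier)
  have g: "smooth_at M p g" by (rule smooth_at_germ[OF True U eq])
  let ?h = "\<lambda>q. f q - g q" and ?i = "\<lambda>q. if q \<in> U then 1 else 0 :: real"
  have "v (\<lambda>q. ?h q * ?i q) = v ?h * ?i p + ?h p * v ?i"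
    by (rule tangent_mult[OF v smooth_at_diff[OF True g] smooth_at_indicator[OF U]])
  moreover have "(\<lambda>q. ?h q * ?i q) = (\<lambda>q. 0)" using eq by auto
  ultimately have "v ?h = 0" using U(2) eq[OF U(2)] tangent_const[OF v p] by simp
  then show ?thesis using tangent_diff[OF v True g] by simp
next
  case False
  have "\<not> smooth_at M p g"
  proof
    assume "smooth_at M p g"
    then have "smooth_at M p f" by (rule smooth_at_germ[OF _ U eq[symmetric]])
    with False show False ..
  qed
  then show ?thesis using False tangent_not_smooth[OF v] by simp
qed

text \<open>
  Hadamard's lemma writes \<open>f\<close> as a constant plus products of coordinate
  differences, which vanish at \<open>p\<close>, with smooth functions. The Leibniz rule only
  sees the values of the latter at \<open>p\<close>.
\<close>

lemma tangent_chart: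
  assumes v: "v \<in> tangent M p" and c: "(V, \<phi>) \<in> charts M" "p \<in> V" and f: "smooth_at M p f"
  shows "v f = (\<Sum>i\<in>I. pd i (\<lambda>x. f (inv_into V \<phi> x)) (\<phi> p) * v (\<lambda>q. \<phi> q i))"
proof -
  have p: "p \<in> carrier M" using f by (rule smooth_at_carrier)
  obtain W where W: "ropen I W" "\<phi> p \<in> W" "W \<subseteq> \<phi> ` V" "smooth_on I W (\<lambda>x. f (inv_into V \<phi> x))"
    using smooth_at_chartE[OF c f] by blast
  obtain e h where e: "e > 0" "rbox I (\<phi> p) e \<subseteq> W"
    and h: "\<And>i. i \<in> I \<Longrightarrow> smooth_on I (rbox I (\<phi> p) e) (h i)"
    and eq: "\<And>x. x \<in> rbox I (\<phi> p) e \<Longrightarrow>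
      f (inv_into V \<phi> x) = f (inv_into V \<phi> (\<phi> p)) + (\<Sum>i\<in>I. (x i - \<phi> p i) * h i x)"
    and hp: "\<And>i. i \<in> I \<Longrightarrow> h i (\<phi> p) = pd i (\<lambda>x. f (inv_into V \<phi> x)) (\<phi> p)"
    by (rule hadamard[OF fin W(1,4,2)]) (rule that)
  let ?U = "{q \<in> V. \<phi> q \<in> rbox I (\<phi> p) e}"
  have U: "openin (mtop M) ?U" "p \<in> ?U"
    using openin_chart_preimage[OF c(1) ropen_rbox[OF fin]] c(2) rbox_centre[OF chart_tuples[OF c] e(1)] by auto
  have hs: "smooth_at M p (\<lambda>q. h i (\<phi> q))" if "i \<in> I" for i
    by (rule smooth_at_chartI[OF c ropen_rbox[OF fin] _ h[OF that]]) (use U(2) in auto)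
  have xs: "smooth_at M p (\<lambda>q. \<phi> q i - \<phi> p i)" if "i \<in> I" for i
    by (intro smooth_at_diff smooth_at_coord[OF c that] smooth_at_const p)
  have "v f = v (\<lambda>q. f p + (\<Sum>i\<in>I. (\<phi> q i - \<phi> p i) * h i (\<phi> q)))"
  proof (rule tangent_germ[OF v U])
    fix q assume q: "q \<in> ?U"
    then show "f q = f p + (\<Sum>i\<in>I. (\<phi> q i - \<phi> p i) * h i (\<phi> q))"
      using eq[of "\<phi> q"] chart_inv[OF c(1)] c(2) by simp
  qed
  also have "\<dots> = v (\<lambda>q. f p) + v (\<lambda>q. \<Sum>i\<in>I. (\<phi> q i - \<phi> p i) * h i (\<phi> q))"
    by (intro tangent_add[OF v] smooth_at_const smooth_at_sum smooth_at_mult p xs hs)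
  also have "\<dots> = (\<Sum>i\<in>I. v (\<lambda>q. (\<phi> q i - \<phi> p i) * h i (\<phi> q)))"
    unfolding tangent_const[OF v p] by (subst tangent_sum[OF v p]) (auto intro: smooth_at_mult xs hs)
  also have "\<dots> = (\<Sum>i\<in>I. pd i (\<lambda>x. f (inv_into V \<phi> x)) (\<phi> p) * v (\<lambda>q. \<phi> q i))"
  proof (rule sum.cong[OF refl])
    fix i assume i: "i \<in> I"
    have "v (\<lambda>q. (\<phi> q i - \<phi> p i) * h i (\<phi> q)) = v (\<lambda>q. \<phi> q i - \<phi> p i) * h i (\<phi> p) + (\<phi> p i - \<phi> p i) * v (\<lambda>q. h i (\<phi> q))"
      by (rule tangent_mult[OF v xs[OF i] hs[OF i]])
    also have "v (\<lambda>q. \<phi> q i - \<phi> p i) = v (\<lambda>q. \<phi> q i)"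
      using tangent_diff[OF v smooth_at_coord[OF c i] smooth_at_const[OF p]] tangent_const[OF v p] by simp
    finally show "v (\<lambda>q. (\<phi> q i - \<phi> p i) * h i (\<phi> q)) = pd i (\<lambda>x. f (inv_into V \<phi> x)) (\<phi> p) * v (\<lambda>q. \<phi> q i)"
      using hp[OF i] by simp
  qed
  finally show ?thesis .
qed

lemma tangent_eqI:
  assumes "v \<in> tangent M p" "w \<in> tangent M p" "(V, \<phi>) \<in> charts M" "p \<in> V"
    "\<And>i. i \<in> I \<Longrightarrow> v (\<lambda>q. \<phi> q i) = w (\<lambda>q. \<phi> q i)"
  shows "v = w"
proof
  fix f show "v f = w f"
  proof (cases "smooth_at M p f")
    case True
    show ?thesis
      unfolding tangent_chart[OF assms(1,3,4) True] tangent_chart[OF assms(2-4) True]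
      using assms(5) by (intro sum.cong) auto
  next
    case False then show ?thesis using assms tangent_not_smooth by metis
  qed
qed

definition chart_vector :: "'a set \<Rightarrow> ('a \<Rightarrow> 'i \<Rightarrow> real) \<Rightarrow> 'a \<Rightarrow> ('i \<Rightarrow> real) \<Rightarrow> 'a tvec"
  where "chart_vector V \<phi> p a =
    (\<lambda>f. if smooth_at M p f then \<Sum>i\<in>I. pd i (\<lambda>x. f (inv_into V \<phi> x)) (\<phi> p) * a i else 0)"

lemma chart_vector_tangent:
  assumes c: "(V, \<phi>) \<in> charts M" "p \<in> V"
  shows "chart_vector V \<phi> p a \<in> tangent M p"
proof -
  have L: "chart_vector V \<phi> p a (\<lambda>q. s * f q + t * g q) = s * chart_vector V \<phi> p a f + t * chart_vector V \<phi> p a g"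
    and P: "chart_vector V \<phi> p a (\<lambda>q. f q * g q) = chart_vector V \<phi> p a f * g p + f p * chart_vector V \<phi> p a g"
    if f: "smooth_at M p f" and g: "smooth_at M p g" for f g s t
  proof -
    obtain W where W: "ropen I W" "\<phi> p \<in> W" "W \<subseteq> \<phi> ` V" "smooth_on I W (\<lambda>x. f (inv_into V \<phi> x))"
      using smooth_at_chartE[OF c f] by blast
    obtain W' where W': "ropen I W'" "\<phi> p \<in> W'" "W' \<subseteq> \<phi> ` V" "smooth_on I W' (\<lambda>x. g (inv_into V \<phi> x))"
      using smooth_at_chartE[OF c g] by blast
    have op: "ropen I (W \<inter> W')" using W(1) W'(1) by (rule openin_Int)
    have fs: "smooth_on I (W \<inter> W') (\<lambda>x. f (inv_into V \<phi> x))" and gs: "smooth_on I (W \<inter> W') (\<lambda>x. g (inv_into V \<phi> x))"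
      using smooth_on_subset[OF W(4)] smooth_on_subset[OF W'(4)] by auto
    have p: "\<phi> p \<in> W \<inter> W'" using W W' by blast
    have c1: "smooth_on I (W \<inter> W') (\<lambda>x. k)" for k by (rule smooth_on_const[OF fin op])
    have "pd i (\<lambda>x. s * f (inv_into V \<phi> x) + t * g (inv_into V \<phi> x)) (\<phi> p) =
       s * pd i (\<lambda>x. f (inv_into V \<phi> x)) (\<phi> p) + t * pd i (\<lambda>x. g (inv_into V \<phi> x)) (\<phi> p)" if i: "i \<in> I" for i
      unfolding pd_add[OF smooth_on_mult[OF fin op c1 fs] smooth_on_mult[OF fin op c1 gs] i p]
        pd_mult[OF c1 fs i p] pd_mult[OF c1 gs i p] pd_const by simp
    then show "chart_vector V \<phi> p a (\<lambda>q. s * f q + t * g q) = s * chart_vector V \<phi> p a f + t * chart_vector V \<phi> p a g"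
      using f g smooth_at_lincomb[OF f g] unfolding chart_vector_def
      by (simp add: sum_distrib_left sum.distrib[symmetric] algebra_simps)
    have "pd i (\<lambda>x. f (inv_into V \<phi> x) * g (inv_into V \<phi> x)) (\<phi> p) =
       pd i (\<lambda>x. f (inv_into V \<phi> x)) (\<phi> p) * g p + f p * pd i (\<lambda>x. g (inv_into V \<phi> x)) (\<phi> p)" if i: "i \<in> I" for i
      unfolding pd_mult[OF fs gs i p] using chart_inv[OF c] by simp
    then show "chart_vector V \<phi> p a (\<lambda>q. f q * g q) = chart_vector V \<phi> p a f * g p + f p * chart_vector V \<phi> p a g"
      using f g smooth_at_mult[OF f g] unfolding chart_vector_def
      by (simp add: sum_distrib_left sum_distrib_right sum.distrib[symmetric] algebra_simps)
  qed
  show ?thesis unfolding tangent_def mem_Collect_eq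
    using L P by (intro conjI allI impI) (simp_all add: chart_vector_def)
qed

lemma chart_vector_coord:
  assumes c: "(V, \<phi>) \<in> charts M" "p \<in> V" and i: "i \<in> I"
  shows "chart_vector V \<phi> p a (\<lambda>q. \<phi> q i) = a i"
proof -
  have "pd j (\<lambda>x. \<phi> (inv_into V \<phi> x) i) (\<phi> p) = (if j = i then 1 else 0)" if "j \<in> I" for j
  proof -
    have "pd j (\<lambda>x. \<phi> (inv_into V \<phi> x) i) (\<phi> p) = pd j (\<lambda>x. x i) (\<phi> p)"
      by (rule pd_cong[OF fin chartD(3)[OF c(1)] that]) (use c(2) in \<open>auto simp: f_inv_into_f\<close>)
    then show ?thesis by (simp add: pd_coord)
  qed
  then have "chart_vector V \<phi> p a (\<lambda>q. \<phi> q i) = (\<Sum>j\<in>I. (if j = i then 1 else 0) * a j)"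
    using smooth_at_coord[OF c i] by (simp add: chart_vector_def)
  also have "\<dots> = (\<Sum>j\<in>I. if j = i then a j else 0)" by (intro sum.cong) auto
  finally show ?thesis using fin i by simp
qed

lemma chart_vector_eq:
  assumes "v \<in> tangent M p" "(V, \<phi>) \<in> charts M" "p \<in> V"
  shows "v = chart_vector V \<phi> p (\<lambda>i. v (\<lambda>q. \<phi> q i))"
  by (rule tangent_eqI[OF assms(1) chart_vector_tangent[OF assms(2,3)] assms(2,3)])
    (simp add: chart_vector_coord[OF assms(2,3)])

section \<open>Vector fields, brackets and forms\<close>

lemma vector_field_chart_vector:
  assumes c: "(V, \<phi>) \<in> charts M" and U: "openin (mtop M) U" "U \<subseteq> V"
    and a: "\<And>i q. i \<in> I \<Longrightarrow> q \<in> U \<Longrightarrow> smooth_at M q (a i)"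
  shows "vector_field_on M U (\<lambda>q. chart_vector V \<phi> q (\<lambda>i. a i q))"
  unfolding vector_field_on_def
proof (intro ballI conjI allI impI)
  fix p assume p: "p \<in> U"
  then have pV: "p \<in> V" using U(2) by blast
  show "chart_vector V \<phi> p (\<lambda>i. a i p) \<in> tangent M p" by (rule chart_vector_tangent[OF c pV])
  fix f assume f: "smooth_at M p f"
  obtain W where W: "ropen I W" "\<phi> p \<in> W" "W \<subseteq> \<phi> ` V" "smooth_on I W (\<lambda>x. f (inv_into V \<phi> x))"
    using smooth_at_chartE[OF c pV f] by blast
  obtain T where T: "openin (mtop M) T" "p \<in> T" "\<And>q. q \<in> T \<Longrightarrow> smooth_at M q f"
    using smooth_at_nbhd[OF f] by blast
  have pc: "p \<in> carrier M" using pV chartD(1)[OF c] by blast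
  have "smooth_at M p (\<lambda>q. \<Sum>i\<in>I. pd i (\<lambda>x. f (inv_into V \<phi> x)) (\<phi> q) * a i q)"
  proof (intro smooth_at_sum smooth_at_mult pc)
    fix i assume i: "i \<in> I"
    show "smooth_at M p (\<lambda>q. pd i (\<lambda>x. f (inv_into V \<phi> x)) (\<phi> q))"
      by (rule smooth_at_chartI[OF c pV W(1,2) smooth_on_pd[OF W(4) i]]) simp
  qed (use a p in blast)
  then show "smooth_at M p (\<lambda>q. chart_vector V \<phi> q (\<lambda>i. a i q) f)"
    by (rule smooth_at_germ[OF _ T(1,2)]) (simp add: chart_vector_def T(3))
qed

lemma vector_field_onD:
  assumes "vector_field_on M U X" "p \<in> U"
  shows "X p \<in> tangent M p" "smooth_at M p f \<Longrightarrow> smooth_at M p (\<lambda>q. X q f)"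
  using assms by (auto simp: vector_field_on_def)

lemma vector_field_on_subset: "vector_field_on M U X \<Longrightarrow> V \<subseteq> U \<Longrightarrow> vector_field_on M V X"
  by (auto simp: vector_field_on_def)

lemma local_sectionD:
  assumes "local_section M D p X"
  shows "X p \<in> tangent M p" "X p \<in> D p" "smooth_at M p f \<Longrightarrow> smooth_at M p (\<lambda>q. X q f)"
  using assms vector_field_onD by (auto simp: local_section_def)

lemma openin_mtop_subset: "openin (mtop M) U \<Longrightarrow> U \<subseteq> carrier M"
  using openin_subset topspace_mtop by metis

lemma lie_bracket_tangent:
  assumes X: "local_section M D p X" and Y: "local_section M D' p Y"
  shows "lie_bracket M X Y p \<in> tangent M p"
proof -
  obtain U where U: "openin (mtop M) U" "p \<in> U" "vector_field_on M U X" using X by (auto simp: local_section_def)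
  obtain U' where U': "openin (mtop M) U'" "p \<in> U'" "vector_field_on M U' Y" using Y by (auto simp: local_section_def)
  note Xp = local_sectionD(1)[OF X] and Yp = local_sectionD(1)[OF Y]
  have op: "openin (mtop M) (U \<inter> U')" using U(1) U'(1) by (rule openin_Int)
  have p: "p \<in> carrier M" using U openin_mtop_subset by blast
  let ?B = "lie_bracket M X Y p"
  have L: "?B (\<lambda>q. s * f q + t * g q) = s * ?B f + t * ?B g"
    and P: "?B (\<lambda>q. f q * g q) = ?B f * g p + f p * ?B g"
    if f: "smooth_at M p f" and g: "smooth_at M p g" for f g s t
  proof -
    obtain T where T: "openin (mtop M) T" "p \<in> T" "\<And>q. q \<in> T \<Longrightarrow> smooth_at M q f"
      using smooth_at_nbhd[OF f] by blast
    obtain T' where T': "openin (mtop M) T'" "p \<in> T'" "\<And>q. q \<in> T' \<Longrightarrow> smooth_at M q g"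
      using smooth_at_nbhd[OF g] by blast
    let ?N = "(U \<inter> U') \<inter> (T \<inter> T')"
    have N: "openin (mtop M) ?N" "p \<in> ?N" using op T(1) T'(1) U(2) U'(2) T(2) T'(2) by (auto intro: openin_Int)
    note Xf = local_sectionD(3)[OF X f] and Xg = local_sectionD(3)[OF X g]
      and Yf = local_sectionD(3)[OF Y f] and Yg = local_sectionD(3)[OF Y g]
    have "X p (\<lambda>q. Y q (\<lambda>q. s * f q + t * g q)) = X p (\<lambda>q. s * Y q f + t * Y q g)"
      by (rule tangent_germ[OF Xp N], rule tangent_lincomb) (use T(3) T'(3) vector_field_onD(1)[OF U'(3)] in auto)
    moreover have "Y p (\<lambda>q. X q (\<lambda>q. s * f q + t * g q)) = Y p (\<lambda>q. s * X q f + t * X q g)"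
      by (rule tangent_germ[OF Yp N], rule tangent_lincomb) (use T(3) T'(3) vector_field_onD(1)[OF U(3)] in auto)
    ultimately show "?B (\<lambda>q. s * f q + t * g q) = s * ?B f + t * ?B g"
      using f g smooth_at_lincomb[OF f g] tangent_lincomb[OF Xp Yf Yg] tangent_lincomb[OF Yp Xf Xg]
      by (simp add: lie_bracket_def algebra_simps)
    have "X p (\<lambda>q. Y q (\<lambda>q. f q * g q)) = X p (\<lambda>q. Y q f * g q + f q * Y q g)"
      by (rule tangent_germ[OF Xp N], rule tangent_mult) (use T(3) T'(3) vector_field_onD(1)[OF U'(3)] in auto)
    also have "\<dots> = (X p (\<lambda>q. Y q f) * g p + Y p f * X p g) + (X p f * Y p g + f p * X p (\<lambda>q. Y q g))"
      by (simp add: tangent_add[OF Xp smooth_at_mult[OF Yf g] smooth_at_mult[OF f Yg]]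
          tangent_mult[OF Xp Yf g] tangent_mult[OF Xp f Yg])
    finally have 1: "X p (\<lambda>q. Y q (\<lambda>q. f q * g q)) = (X p (\<lambda>q. Y q f) * g p + Y p f * X p g) + (X p f * Y p g + f p * X p (\<lambda>q. Y q g))" .
    have "Y p (\<lambda>q. X q (\<lambda>q. f q * g q)) = Y p (\<lambda>q. X q f * g q + f q * X q g)"
      by (rule tangent_germ[OF Yp N], rule tangent_mult) (use T(3) T'(3) vector_field_onD(1)[OF U(3)] in auto)
    also have "\<dots> = (Y p (\<lambda>q. X q f) * g p + X p f * Y p g) + (Y p f * X p g + f p * Y p (\<lambda>q. X q g))"
      by (simp add: tangent_add[OF Yp smooth_at_mult[OF Xf g] smooth_at_mult[OF f Xg]]
          tangent_mult[OF Yp Xf g] tangent_mult[OF Yp f Xg])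
    finally have 2: "Y p (\<lambda>q. X q (\<lambda>q. f q * g q)) = (Y p (\<lambda>q. X q f) * g p + X p f * Y p g) + (Y p f * X p g + f p * Y p (\<lambda>q. X q g))" .
    show "?B (\<lambda>q. f q * g q) = ?B f * g p + f p * ?B g"
      using f g smooth_at_mult[OF f g] by (simp add: lie_bracket_def 1 2 algebra_simps)
  qed
  show ?thesis unfolding tangent_def mem_Collect_eq
    using L P by (intro conjI allI impI) (simp_all add: lie_bracket_def)
qed

lemma local_section_tangent_extension:
  assumes "v \<in> tangent M p" "p \<in> carrier M"
  shows "\<exists>X. local_section M (tangent M) p X \<and> X p = v"
proof -
  obtain V \<phi> where c: "(V, \<phi>) \<in> charts M" "p \<in> V" using assms(2) by (rule carrier_chartE)
  define X where "X q = chart_vector V \<phi> q (\<lambda>i. v (\<lambda>q. \<phi> q i))" for q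
  have op: "openin (mtop M) V" by (rule openin_chart_domain[OF c(1)])
  have "vector_field_on M V X" unfolding X_def
    by (rule vector_field_chart_vector[OF c(1) op order_refl])
      (use chartD(1)[OF c(1)] in \<open>auto intro: smooth_at_const\<close>)
  then have "local_section M (tangent M) p X"
    unfolding local_section_def using op c(2) vector_field_onD(1) by blast
  moreover have "X p = v" unfolding X_def by (rule chart_vector_eq[OF assms(1) c, symmetric])
  ultimately show ?thesis by blast
qed

lemma smooth_form_local:
  assumes U: "openin (mtop M) U" "p \<in> U"
    and \<eta>: "\<And>q v. q \<in> U \<Longrightarrow> v \<in> tangent M q \<Longrightarrow> \<eta> q v = (\<Sum>k\<in>K. F k q * v (G k))"
    and F: "\<And>k. k \<in> K \<Longrightarrow> smooth_at M p (F k)" and G: "\<And>k. k \<in> K \<Longrightarrow> smooth_at M p (G k)"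
    and Y: "local_section M (tangent M) p Y"
  shows "smooth_at M p (\<lambda>q. \<eta> q (Y q))"
    and "v \<in> tangent M p \<Longrightarrow> v (\<lambda>q. \<eta> q (Y q)) = (\<Sum>k\<in>K. v (F k) * Y p (G k) + F k p * v (\<lambda>q. Y q (G k)))"
proof -
  obtain U' where U': "openin (mtop M) U'" "p \<in> U'" "\<forall>q\<in>U'. Y q \<in> tangent M q"
    using Y by (auto simp: local_section_def)
  have N: "openin (mtop M) (U \<inter> U')" "p \<in> U \<inter> U'" using U U' by (auto intro: openin_Int)
  have p: "p \<in> carrier M" using U openin_mtop_subset by blast
  note YG = local_sectionD(3)[OF Y G]
  have eq: "(\<Sum>k\<in>K. F k q * Y q (G k)) = \<eta> q (Y q)" if "q \<in> U \<inter> U'" for q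
    using \<eta>[of q "Y q"] U'(3) that by simp
  have s: "smooth_at M p (\<lambda>q. \<Sum>k\<in>K. F k q * Y q (G k))"
    by (intro smooth_at_sum p smooth_at_mult F YG)
  show "smooth_at M p (\<lambda>q. \<eta> q (Y q))" by (rule smooth_at_germ[OF s N eq])
  assume v: "v \<in> tangent M p"
  have "v (\<lambda>q. \<eta> q (Y q)) = v (\<lambda>q. \<Sum>k\<in>K. F k q * Y q (G k))"
    by (rule tangent_germ[OF v N eq[symmetric]])
  also have "\<dots> = (\<Sum>k\<in>K. v (\<lambda>q. F k q * Y q (G k)))"
    by (rule tangent_sum[OF v p]) (intro smooth_at_mult F YG)
  also have "\<dots> = (\<Sum>k\<in>K. v (F k) * Y p (G k) + F k p * v (\<lambda>q. Y q (G k)))"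
    by (intro sum.cong refl tangent_mult[OF v] F YG)
  finally show "v (\<lambda>q. \<eta> q (Y q)) = (\<Sum>k\<in>K. v (F k) * Y p (G k) + F k p * v (\<lambda>q. Y q (G k)))" .
qed

text \<open>
  This is \<open>d\<eta> = \<Sum> dF \<and> dG\<close> for \<open>\<eta> = \<Sum> F dG\<close>. In the invariant formula the second-order terms
  cancel against those of the bracket, so the result does not depend on the extensions.
\<close>

lemma ext_deriv_eq:
  assumes U: "openin (mtop M) U" "p \<in> U"
    and \<eta>: "\<And>q v. q \<in> U \<Longrightarrow> v \<in> tangent M q \<Longrightarrow> \<eta> q v = (\<Sum>k\<in>K. F k q * v (G k))"
    and F: "\<And>k. k \<in> K \<Longrightarrow> smooth_at M p (F k)" and G: "\<And>k. k \<in> K \<Longrightarrow> smooth_at M p (G k)"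
    and v: "v \<in> tangent M p" and w: "w \<in> tangent M p"
  shows "ext_deriv M \<eta> p v w = (\<Sum>k\<in>K. v (F k) * w (G k) - w (F k) * v (G k))"
proof -
  have p: "p \<in> carrier M" using U openin_mtop_subset by blast
  have formula: "X p (\<lambda>q. \<eta> q (Y q)) - Y p (\<lambda>q. \<eta> q (X q)) - \<eta> p (lie_bracket M X Y p)
      = (\<Sum>k\<in>K. X p (F k) * Y p (G k) - Y p (F k) * X p (G k))"
    if X: "local_section M (tangent M) p X" and Y: "local_section M (tangent M) p Y" for X Y
  proof -
    have "\<eta> p (lie_bracket M X Y p) = (\<Sum>k\<in>K. F k p * lie_bracket M X Y p (G k))"
      by (rule \<eta>[OF U(2) lie_bracket_tangent[OF X Y]])
    also have "\<dots> = (\<Sum>k\<in>K. F k p * (X p (\<lambda>q. Y q (G k)) - Y p (\<lambda>q. X q (G k))))"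
      using G by (intro sum.cong) (auto simp: lie_bracket_def)
    finally have 3: "\<eta> p (lie_bracket M X Y p) = (\<Sum>k\<in>K. F k p * (X p (\<lambda>q. Y q (G k)) - Y p (\<lambda>q. X q (G k))))" .
    have 1: "X p (\<lambda>q. \<eta> q (Y q)) = (\<Sum>k\<in>K. X p (F k) * Y p (G k) + F k p * X p (\<lambda>q. Y q (G k)))"
      by (rule smooth_form_local(2)[where \<eta> = \<eta> and F = F and G = G and K = K, OF U \<eta> F G Y local_sectionD(1)[OF X]])
    have 2: "Y p (\<lambda>q. \<eta> q (X q)) = (\<Sum>k\<in>K. Y p (F k) * X p (G k) + F k p * Y p (\<lambda>q. X q (G k)))"
      by (rule smooth_form_local(2)[where \<eta> = \<eta> and F = F and G = G and K = K, OF U \<eta> F G X local_sectionD(1)[OF Y]])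
    show ?thesis unfolding 1 2 3 sum_subtractf[symmetric] by (intro sum.cong) (auto simp: algebra_simps)
  qed
  obtain X where X: "local_section M (tangent M) p X" "X p = v"
    using local_section_tangent_extension[OF v p] by blast
  obtain Y where Y: "local_section M (tangent M) p Y" "Y p = w"
    using local_section_tangent_extension[OF w p] by blast
  show ?thesis unfolding ext_deriv_def
  proof (rule some_equality)
    show "\<exists>X Y. local_section M (tangent M) p X \<and> local_section M (tangent M) p Y \<and> X p = v \<and> Y p = w \<and>
        (\<Sum>k\<in>K. v (F k) * w (G k) - w (F k) * v (G k)) =
        X p (\<lambda>q. \<eta> q (Y q)) - Y p (\<lambda>q. \<eta> q (X q)) - \<eta> p (lie_bracket M X Y p)"
      by (rule exI[of _ X], rule exI[of _ Y]) (use formula[OF X(1) Y(1)] X Y in simp)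
  next
    fix c assume "\<exists>X Y. local_section M (tangent M) p X \<and> local_section M (tangent M) p Y \<and> X p = v \<and> Y p = w \<and>
        c = X p (\<lambda>q. \<eta> q (Y q)) - Y p (\<lambda>q. \<eta> q (X q)) - \<eta> p (lie_bracket M X Y p)"
    then obtain X' Y' where "local_section M (tangent M) p X'" "local_section M (tangent M) p Y'" "X' p = v" "Y' p = w"
      "c = X' p (\<lambda>q. \<eta> q (Y' q)) - Y' p (\<lambda>q. \<eta> q (X' q)) - \<eta> p (lie_bracket M X' Y' p)" by blast
    with formula[of X' Y'] show "c = (\<Sum>k\<in>K. v (F k) * w (G k) - w (F k) * v (G k))" by simp
  qed
qed

lemma distribution_local_extension:
  assumes D: "distribution M U d D" and p: "p \<in> U" and v: "v \<in> D p"
  shows "\<exists>X. local_section M D p X \<and> X p = v"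
proof -
  obtain V X where V: "openin (mtop M) V" "p \<in> V" "V \<subseteq> U"
    and X: "\<forall>i<d. vector_field_on M V (X i)"
    and s: "\<forall>q\<in>V. inj_on (\<lambda>i. X i q) {..<d} \<and> independent ((\<lambda>i. X i q) ` {..<d}) \<and>
                      span ((\<lambda>i. X i q) ` {..<d}) = D q"
    using bspec[OF D[unfolded distribution_def] p] by blast
  have "v \<in> span ((\<lambda>i. X i p) ` {..<d})" using s V(2) v by blast
  then obtain c where "v = (\<Sum>w\<in>(\<lambda>i. X i p) ` {..<d}. c w *\<^sub>R w)"
    by (auto simp: span_finite)
  then have v: "v = (\<Sum>i<d. c (X i p) *\<^sub>R X i p)"
    using s V(2) by (simp add: sum.reindex)
  define Y where "Y q = (\<Sum>i<d. c (X i p) *\<^sub>R X i q)" for q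
  have "vector_field_on M V Y"
    unfolding vector_field_on_def
  proof (intro ballI conjI allI impI)
    fix q assume q: "q \<in> V"
    have qc: "q \<in> carrier M" using q V(1) openin_mtop_subset by blast
    show "Y q \<in> tangent M q" unfolding Y_def
      by (intro subspace_sum subspace_tangent subspace_scale) (use X q vector_field_onD(1) in auto)
    fix f assume f: "smooth_at M q f"
    have "smooth_at M q (\<lambda>q. \<Sum>i<d. c (X i p) * X i q f)"
      by (intro smooth_at_sum smooth_at_mult smooth_at_const qc) (use X q f vector_field_onD(2) in auto)
    then show "smooth_at M q (\<lambda>q. Y q f)" by (simp add: Y_def tvec_sum_apply tvec_apply)
  qed
  moreover have "Y q \<in> D q" if q: "q \<in> V" for q
  proof -
    have "Y q \<in> span ((\<lambda>i. X i q) ` {..<d})"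
      unfolding Y_def by (intro span_sum span_scale span_base) auto
    then show ?thesis using s q by blast
  qed
  ultimately have "local_section M D p Y" unfolding local_section_def using V by blast
  moreover have "Y p = v" by (simp add: Y_def v)
  ultimately show ?thesis by blast
qed

lemma levi_as_bracket:
  assumes D: "distribution M U d D" and p: "p \<in> U" and v: "v \<in> D p" and w: "w \<in> D p"
  obtains X Y where "local_section M D p X" "local_section M D p Y" "X p = v" "Y p = w"
    "levi M D p v w = coset (D p) (lie_bracket M X Y p)"
proof -
  let ?P = "\<lambda>c. \<exists>X Y. local_section M D p X \<and> local_section M D p Y \<and> X p = v \<and> Y p = w \<and>
           c = coset (D p) (lie_bracket M X Y p)"
  have "\<exists>c. ?P c"
    using distribution_local_extension[OF D p v] distribution_local_extension[OF D p w] by blast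
  then have "?P (levi M D p v w)" unfolding levi_def by (rule someI_ex)
  then show ?thesis using that by blast
qed

text \<open>
  A family of vector fields with dual functions is a frame of the distribution that it spans:
  linear independence is read off from the dual functions.
\<close>

lemma distribution_dual_frameI:
  assumes "\<And>p. p \<in> U \<Longrightarrow> \<exists>V (Y :: 'k \<Rightarrow> 'a \<Rightarrow> 'a tvec) g. openin (mtop M) V \<and> p \<in> V \<and> V \<subseteq> U \<and>
      (\<forall>k\<in>K. vector_field_on M V (Y k)) \<and>
      (\<forall>q\<in>V. subspace (D q) \<and> (\<forall>k\<in>K. Y k q \<in> D q \<and> (\<forall>l\<in>K. Y k q (g l) = (if k = l then 1 else 0))) \<and>
        (\<forall>v\<in>D q. v = (\<Sum>k\<in>K. v (g k) *\<^sub>R Y k q)))"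
    and K: "finite K" "card K = d"
  shows "distribution M U d D"
  unfolding distribution_def
proof
  fix p assume "p \<in> U"
  obtain V and Y :: "'k \<Rightarrow> 'a \<Rightarrow> 'a tvec" and g where V: "openin (mtop M) V" "p \<in> V" "V \<subseteq> U"
    and Y: "\<forall>k\<in>K. vector_field_on M V (Y k)"
    and D: "\<forall>q\<in>V. subspace (D q) \<and> (\<forall>k\<in>K. Y k q \<in> D q \<and> (\<forall>l\<in>K. Y k q (g l) = (if k = l then 1 else 0))) \<and>
        (\<forall>v\<in>D q. v = (\<Sum>k\<in>K. v (g k) *\<^sub>R Y k q))"
    using assms(1)[OF \<open>p \<in> U\<close>] by blast
  obtain e where e: "bij_betw e {..<d} K" using ex_bij_betw_nat_finite[OF K(1)] K(2) by (auto simp: atLeast0LessThan)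
  have "inj_on (\<lambda>i. Y (e i) q) {..<d} \<and> independent ((\<lambda>i. Y (e i) q) ` {..<d}) \<and>
      span ((\<lambda>i. Y (e i) q) ` {..<d}) = D q" if q: "q \<in> V" for q
  proof -
    have dual: "Y k q (g l) = (if k = l then 1 else 0)" if "k \<in> K" "l \<in> K" for k l using D q that by blast
    have im: "(\<lambda>i. Y (e i) q) ` {..<d} = (\<lambda>k. Y k q) ` K"
      using e by (auto simp: bij_betw_def)
    have injK: "inj_on (\<lambda>k. Y k q) K"
    proof (rule inj_onI)
      fix k l assume kl: "k \<in> K" "l \<in> K" "Y k q = Y l q"
      then have "Y l q (g l) = Y k q (g l)" by simp
      then show "k = l" using dual kl(1,2) by (auto split: if_splits)
    qed
    have inj: "inj_on (\<lambda>i. Y (e i) q) {..<d}"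
      using comp_inj_on[of e "{..<d}" "\<lambda>k. Y k q"] e injK by (auto simp: bij_betw_def comp_def)
    have ind: "independent ((\<lambda>k. Y k q) ` K)"
      unfolding dependent_finite[OF finite_imageI[OF K(1)]]
    proof (rule notI, elim exE conjE bexE)
      fix u w assume u: "(\<Sum>v\<in>(\<lambda>k. Y k q) ` K. u v *\<^sub>R v) = 0" and w: "w \<in> (\<lambda>k. Y k q) ` K" "u w \<noteq> 0"
      obtain l where l: "l \<in> K" "w = Y l q" using w(1) by blast
      have "0 = (\<Sum>k\<in>K. u (Y k q) *\<^sub>R Y k q) (g l)" using u by (simp add: sum.reindex[OF injK] tvec_apply)
      also have "\<dots> = (\<Sum>k\<in>K. if k = l then u (Y k q) else 0)"
        unfolding tvec_sum_apply by (intro sum.cong) (auto simp: tvec_apply dual l(1))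
      also have "\<dots> = u w" using K(1) l by simp
      finally show False using w(2) by simp
    qed
    have "span ((\<lambda>k. Y k q) ` K) = D q"
    proof
      show "span ((\<lambda>k. Y k q) ` K) \<subseteq> D q" by (rule span_minimal) (use D q in auto)
      show "D q \<subseteq> span ((\<lambda>k. Y k q) ` K)"
      proof
        fix v assume "v \<in> D q"
        then have "v = (\<Sum>k\<in>K. v (g k) *\<^sub>R Y k q)" using D q by blast
        also have "\<dots> \<in> span ((\<lambda>k. Y k q) ` K)" by (intro span_sum span_scale span_base) auto
        finally show "v \<in> span ((\<lambda>k. Y k q) ` K)" .
      qed
    qed
    then show ?thesis using inj ind im by simp
  qed
  moreover have "\<forall>i<d. vector_field_on M V (Y (e i))" using Y e by (auto simp: bij_betw_def)
  ultimately show "\<exists>V (X :: nat \<Rightarrow> 'a \<Rightarrow> 'a tvec). openin (mtop M) V \<and> p \<in> V \<and> V \<subseteq> U \<and>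
              (\<forall>i<d. vector_field_on M V (X i)) \<and>
              (\<forall>q\<in>V. inj_on (\<lambda>i. X i q) {..<d} \<and> independent ((\<lambda>i. X i q) ` {..<d}) \<and>
                      span ((\<lambda>i. X i q) ` {..<d}) = D q)"
    using V by (intro exI[of _ V] exI[of _ "\<lambda>i. Y (e i)"]) auto
qed

end

lemma coset_eq_iff: "subspace D \<Longrightarrow> coset D z = D \<longleftrightarrow> z \<in> D"
proof
  assume D: "subspace D" and "coset D z = D"
  then show "z \<in> D" using subspace_0[OF D] unfolding coset_def by force
next
  assume D: "subspace D" and z: "z \<in> D"
  show "coset D z = D"
  proof
    show "coset D z \<subseteq> D" using D z by (auto simp: coset_def subspace_add)
    show "D \<subseteq> coset D z"
    proof
      fix w assume "w \<in> D"
      then have "w - z \<in> D" "w = z + (w - z)" using D z by (auto simp: subspace_diff)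
      then show "w \<in> coset D z" unfolding coset_def by blast
    qed
  qed
qed

section \<open>New charts from old ones\<close>

context atlas_manifold
begin

text \<open>
  A chart can be verified by testing on smooth functions alone: the openness of the overlaps
  with charts of the atlas results from applying the last assumption to indicator functions.
\<close>

lemma chartsI:
  assumes V: "openin (mtop M) V" and inj: "inj_on \<phi> V" and op: "ropen I (\<phi> ` V)"
    and sm: "\<And>p i. p \<in> V \<Longrightarrow> i \<in> I \<Longrightarrow> smooth_at M p (\<lambda>q. \<phi> q i)"
    and inv: "\<And>p f. p \<in> V \<Longrightarrow> smooth_at M p f \<Longrightarrow> smooth_in_chart V \<phi> p f"
  shows "(V, \<phi>) \<in> charts M"
proof -
  have VM: "V \<subseteq> carrier M" using openin_mtop_subset[OF V] .
  have "compatible_charts I (V, \<phi>) (W, \<psi>)" if d: "(W, \<psi>) \<in> atlas M" for W \<psi>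
  proof -
    have dc: "(W, \<psi>) \<in> charts M" using d atlas_subset_charts by blast
    have opW: "ropen I (\<psi> ` (W \<inter> V))" using ropen_chart_image[OF V dc] by (simp add: Int_commute)
    have loc: "\<exists>T. ropen I T \<and> \<phi> p \<in> T \<and> T \<subseteq> \<phi> ` (V \<inter> W)" if p: "p \<in> V" "p \<in> W" for p
    proof -
      define f where "f q = (if q \<in> W then 1 else 0 :: real)" for q
      have fs: "smooth_at M p f"
        unfolding f_def by (rule smooth_at_indicator[OF openin_chart_domain[OF dc] p(2)])
      have "smooth_in_chart V \<phi> p f"
        by (rule inv[OF p(1) fs])
      then obtain T where T: "ropen I T" "\<phi> p \<in> T" "T \<subseteq> \<phi> ` V" "smooth_on I T (\<lambda>x. f (inv_into V \<phi> x))"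
        by (auto simp: smooth_in_chart_def)
      have fp: "inv_into V \<phi> (\<phi> p) = p" using inj p(1) by (rule inv_into_f_f)
      have cont: "continuous_on T (\<lambda>x. f (inv_into V \<phi> x))"
        using T(4) ropen_subset_tuples[OF T(1)] by (rule smooth_on_continuous)
      obtain e where e: "e > 0" "rbox I (\<phi> p) e \<subseteq> T"
        "\<And>y. y \<in> rbox I (\<phi> p) e \<Longrightarrow> \<bar>f (inv_into V \<phi> y) - f (inv_into V \<phi> (\<phi> p))\<bar> < 1"
        by (rule continuous_on_rboxE[OF fin T(1) cont T(2) zero_less_one]) (rule that)
      have "rbox I (\<phi> p) e \<subseteq> \<phi> ` (V \<inter> W)"
      proof
        fix y assume y: "y \<in> rbox I (\<phi> p) e"
        then have "y \<in> \<phi> ` V" using e(2) T(3) by blast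
        moreover have "inv_into V \<phi> y \<in> W" using e(3)[OF y] fp p(2) by (auto simp: f_def split: if_splits)
        ultimately show "y \<in> \<phi> ` (V \<inter> W)"
          by (intro image_eqI[of _ \<phi> "inv_into V \<phi> y"]) (simp_all add: f_inv_into_f inv_into_into)
      qed
      moreover have "\<phi> p \<in> rbox I (\<phi> p) e"
        by (rule rbox_centre[OF _ e(1)]) (use T(1,2) ropen_subset_tuples in blast)
      ultimately show ?thesis using ropen_rbox[OF fin] by blast
    qed
    have opV: "ropen I (\<phi> ` (V \<inter> W))"
      by (subst openin_subopen) (use loc in blast)
    have 1: "smooth_on I (\<phi> ` (V \<inter> W)) (\<lambda>x. \<psi> (inv_into V \<phi> x) i)" if i: "i \<in> I" for i
    proof (rule smooth_on_local[OF fin opV])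
      fix x assume "x \<in> \<phi> ` (V \<inter> W)"
      then obtain p where p: "p \<in> V" "p \<in> W" "x = \<phi> p" by blast
      obtain T where T: "ropen I T" "\<phi> p \<in> T" "smooth_on I T (\<lambda>x. \<psi> (inv_into V \<phi> x) i)"
        using inv[OF p(1) smooth_at_coord[OF dc p(2) i]] by (auto simp: smooth_in_chart_def)
      show "\<exists>T. ropen I T \<and> x \<in> T \<and> T \<subseteq> \<phi> ` (V \<inter> W) \<and> smooth_on I T (\<lambda>x. \<psi> (inv_into V \<phi> x) i)"
        using T p opV by (intro exI[of _ "T \<inter> \<phi> ` (V \<inter> W)"]) (auto intro: smooth_on_subset)
    qed
    have 2: "smooth_on I (\<psi> ` (W \<inter> V)) (\<lambda>x. \<phi> (inv_into W \<psi> x) i)" if i: "i \<in> I" for i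
    proof (rule smooth_on_local[OF fin opW])
      fix x assume "x \<in> \<psi> ` (W \<inter> V)"
      then obtain p where p: "p \<in> V" "p \<in> W" "x = \<psi> p" by blast
      obtain T where T: "ropen I T" "\<psi> p \<in> T" "T \<subseteq> \<psi> ` W" "smooth_on I T (\<lambda>x. \<phi> (inv_into W \<psi> x) i)"
        by (rule smooth_at_chartE[OF dc p(2) sm[OF p(1) i]]) (rule that)
      show "\<exists>T. ropen I T \<and> x \<in> T \<and> T \<subseteq> \<psi> ` (W \<inter> V) \<and> smooth_on I T (\<lambda>x. \<phi> (inv_into W \<psi> x) i)"
        using T p opW by (intro exI[of _ "T \<inter> \<psi> ` (W \<inter> V)"]) (auto intro: smooth_on_subset)
    qed
    show ?thesis unfolding compatible_charts_def smooth_transition_def using opV opW 1 2 by blast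
  qed
  then show ?thesis unfolding charts_def is_chart_def using VM inj op by auto
qed

lemma chart_compose:
  assumes c: "(V, \<phi>) \<in> charts M" and U: "ropen I U" "U \<subseteq> \<phi> ` V" and H: "\<And>i. i \<in> I \<Longrightarrow> smooth_on I U (\<lambda>x. H x i)"
    and inj: "inj_on H U" and HU: "ropen I (H ` U)"
    and inv: "\<And>i. i \<in> I \<Longrightarrow> smooth_on I (H ` U) (\<lambda>y. inv_into U H y i)"
  shows "({q \<in> V. \<phi> q \<in> U}, \<lambda>q. H (\<phi> q)) \<in> charts M"
proof (rule chartsI)
  let ?V = "{q \<in> V. \<phi> q \<in> U}"
  show "openin (mtop M) ?V" by (rule openin_chart_preimage[OF c U(1)])
  show inj': "inj_on (\<lambda>q. H (\<phi> q)) ?V"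
    using inj chartD(2)[OF c] by (auto simp: inj_on_def)
  have im: "(\<lambda>q. H (\<phi> q)) ` ?V = H ` U" using U(2) by auto
  show "ropen I ((\<lambda>q. H (\<phi> q)) ` ?V)" unfolding im by (rule HU)
  show "smooth_at M p (\<lambda>q. H (\<phi> q) i)" if "p \<in> ?V" "i \<in> I" for p i
    by (rule smooth_at_chartI[OF c _ U(1) _ H[OF that(2)]]) (use that in auto)
  fix p f assume p: "p \<in> ?V" and f: "smooth_at M p f"
  have pV: "p \<in> V" using p by simp
  obtain T where T: "ropen I T" "\<phi> p \<in> T" "T \<subseteq> \<phi> ` V" "smooth_on I T (\<lambda>x. f (inv_into V \<phi> x))"
    using smooth_at_chartE[OF c pV f] by blast
  have tm: "tuple_map I (\<lambda>i y. inv_into U H y i) (H x) = x" if "x \<in> U" for x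
    using that inj U(1) ropen_subset_tuples by (intro tuple_map_eqI) auto
  have "continuous_on (H ` U) (tuple_map I (\<lambda>i y. inv_into U H y i))"
    unfolding tuple_map_def
    by (rule continuous_on_tuple_valued) (rule smooth_on_continuous[OF inv ropen_subset_tuples[OF HU]])
  then have op: "ropen I {y \<in> H ` U. tuple_map I (\<lambda>i y. inv_into U H y i) y \<in> T}"
    by (rule ropen_preimage[OF HU _ _ T(1)]) auto
  let ?T = "{y \<in> H ` U. tuple_map I (\<lambda>i y. inv_into U H y i) y \<in> T}"
  have "smooth_on I ?T (\<lambda>y. f (inv_into V \<phi> (tuple_map I (\<lambda>i y. inv_into U H y i) y)))"
  proof (rule smooth_on_compose[OF fin fin op T(1,4)])
    show "smooth_on I ?T (\<lambda>y. inv_into U H y i)" if "i \<in> I" for i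
      by (rule smooth_on_subset[OF inv[OF that]]) blast
  qed blast
  then have "smooth_on I ?T (\<lambda>y. f (inv_into ?V (\<lambda>q. H (\<phi> q)) y))"
  proof (rule smooth_on_cong[OF fin op])
    fix y assume y: "y \<in> ?T"
    then obtain q where q: "q \<in> ?V" "y = H (\<phi> q)" using U(2) by auto
    have "inv_into ?V (\<lambda>q. H (\<phi> q)) y = q" unfolding q(2) using inj' q(1) by (rule inv_into_f_f)
    moreover have "inv_into V \<phi> (tuple_map I (\<lambda>i y. inv_into U H y i) y) = q"
      using q tm[of "\<phi> q"] chart_inv[OF c] by simp
    ultimately show "f (inv_into V \<phi> (tuple_map I (\<lambda>i y. inv_into U H y i) y)) = f (inv_into ?V (\<lambda>q. H (\<phi> q)) y)"
      by simp
  qed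
  then show "smooth_in_chart ?V (\<lambda>q. H (\<phi> q)) p f"
    unfolding smooth_in_chart_def using op p T(2) tm im by (intro exI[of _ ?T]) auto
qed

lemma chart_restrict:
  assumes c: "(V, \<phi>) \<in> charts M" and U: "ropen I U" "U \<subseteq> \<phi> ` V"
  shows "({q \<in> V. \<phi> q \<in> U}, \<phi>) \<in> charts M"
proof -
  have "({q \<in> V. \<phi> q \<in> U}, \<lambda>q. (\<lambda>x. x) (\<phi> q)) \<in> charts M"
  proof (rule chart_compose[OF c U])
    show "smooth_on I ((\<lambda>x. x) ` U) (\<lambda>y. inv_into U (\<lambda>x. x) y i)" if "i \<in> I" for i
      unfolding image_ident
      by (rule smooth_on_cong[OF fin U(1) smooth_on_coord[OF fin U(1) that]])
        (use f_inv_into_f[of _ "\<lambda>x. x" U] in simp)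
    show "smooth_on I U (\<lambda>x. x i)" if "i \<in> I" for i by (rule smooth_on_coord[OF fin U(1) that])
  qed (use U(1) in auto)
  then show ?thesis by simp
qed

end

section \<open>Adapted charts of a fibred manifold\<close>

lemma ropen_UNIV_project:
  assumes "ropen (UNIV :: ('n::finite + 'm::finite) set) W"
  shows "ropen UNIV ((\<lambda>y i. y (Inl i)) ` W)"
  unfolding ropen_iff_box[OF finite]
proof (intro conjI ballI)
  fix x :: "'n \<Rightarrow> real" assume "x \<in> (\<lambda>y i. y (Inl i)) ` W"
  then obtain y where y: "y \<in> W" "x = (\<lambda>i. y (Inl i))" by blast
  obtain e where e: "e > 0" "\<And>z. z \<in> tuples UNIV \<Longrightarrow> (\<And>i. i \<in> UNIV \<Longrightarrow> \<bar>z i - y i\<bar> < e) \<Longrightarrow> z \<in> W"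
    using ropen_boxE[OF finite assms y(1)] by metis
  have "z \<in> (\<lambda>y i. y (Inl i)) ` W" if z: "\<forall>i\<in>UNIV. \<bar>z i - x i\<bar> < e" for z
  proof -
    have "case_sum z (\<lambda>\<alpha>. y (Inr \<alpha>)) \<in> W"
      by (rule e(2)) (use z y(2) e(1) in \<open>auto split: sum.split\<close>)
    then have "(\<lambda>i. case_sum z (\<lambda>\<alpha>. y (Inr \<alpha>)) (Inl i)) \<in> (\<lambda>y i. y (Inl i)) ` W" by (rule imageI)
    then show ?thesis by simp
  qed
  then show "\<exists>e>0. \<forall>z\<in>tuples UNIV. (\<forall>i\<in>UNIV. \<bar>z i - x i\<bar> < e) \<longrightarrow> z \<in> (\<lambda>y i. y (Inl i)) ` W"
    using e(1) by blast
qed simp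

text \<open>The rows to be added are the new vectors of a basis that extends the given rows.\<close>

lemma complete_to_invertible_matrix:
  fixes a :: "'n::finite \<Rightarrow> real ^ ('n + 'm::finite)"
  assumes ind: "\<And>c. (\<Sum>i\<in>UNIV. c i *\<^sub>R a i) = 0 \<Longrightarrow> (\<forall>i. c i = 0)"
  obtains b :: "'m \<Rightarrow> real ^ ('n + 'm)" where "invertible (\<chi> k. case_sum a b k)"
proof -
  have inj: "inj a"
  proof (rule injI, rule ccontr)
    fix i j assume ij: "a i = a j" "i \<noteq> j"
    have "(\<Sum>k\<in>UNIV. (if k = i then 1 else if k = j then -1 else 0) *\<^sub>R a k) =
      (\<Sum>k\<in>{i, j}. (if k = i then 1 else if k = j then -1 else 0) *\<^sub>R a k)"
      by (rule sum.mono_neutral_right) auto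
    also have "\<dots> = 0" using ij by simp
    finally show False using ind[of "\<lambda>k. if k = i then 1 else if k = j then -1 else 0"] by (metis zero_neq_one)
  qed
  have indS: "independent (range a)"
    unfolding dependent_finite[OF finite_imageI[OF finite]]
  proof (rule notI, elim exE conjE bexE)
    fix u w assume u: "(\<Sum>v\<in>range a. u v *\<^sub>R v) = 0" and w: "w \<in> range a" "u w \<noteq> 0"
    have "(\<Sum>i\<in>UNIV. u (a i) *\<^sub>R a i) = 0" using u by (simp add: sum.reindex[OF inj])
    then show False using ind[of "\<lambda>i. u (a i)"] w by auto
  qed
  define B where "B = extend_basis (range a)"
  have B: "range a \<subseteq> B" "independent B" "span B = UNIV"
    using extend_basis_superset[OF indS] independent_extend_basis[OF indS] span_extend_basis[OF indS] by (auto simp: B_def)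
  have finB: "finite B" using B(2) by (rule independent_imp_finite)
  have "card B = CARD('n + 'm)"
    using dim_eq_card[of B UNIV] B by (simp add: dim_UNIV)
  then have cardB: "card B = CARD('n) + CARD('m)" by simp
  have "card (range a) = CARD('n)" using inj by (simp add: card_image)
  then have "card (B - range a) = CARD('m)" using card_Diff_subset[of "range a" B] B(1) cardB by simp
  then obtain b :: "'m \<Rightarrow> real ^ ('n + 'm)" where b: "bij_betw b UNIV (B - range a)"
    using finite_same_card_bij[of "UNIV :: 'm set" "B - range a"] finB by auto
  let ?A = "\<chi> k. case_sum a b k"
  have "\<forall>k. c k = 0" if c: "(\<Sum>k\<in>UNIV. c k *s row k ?A) = 0" for c
  proof -
    have bij: "bij_betw (case_sum a b) UNIV B"
    proof -
      have ab: "a i \<noteq> b \<alpha>" for i \<alpha> using b unfolding bij_betw_def by blast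
      have "inj (case_sum a b)"
      proof (rule injI)
        fix k l assume "case_sum a b k = case_sum a b l"
        then show "k = l" using inj b ab ab[symmetric] by (auto simp: bij_betw_def inj_on_def split: sum.splits)
      qed
      moreover have "range (case_sum a b) = range a \<union> range b"
        by (auto simp: UNIV_sum image_Un image_image)
      ultimately show ?thesis using b B(1) by (auto simp: bij_betw_def)
    qed
    define u where "u v = c (inv_into UNIV (case_sum a b) v)" for v
    have uk: "u (case_sum a b k) = c k" for k
      using bij unfolding u_def bij_betw_def by (simp add: inv_into_f_f)
    have "row k ?A = case_sum a b k" for k by (simp add: row_def vec_eq_iff)
    then have "0 = (\<Sum>k\<in>UNIV. u (case_sum a b k) *\<^sub>R case_sum a b k)"
      using c by (simp add: uk scalar_mult_eq_scaleR)
    also have "\<dots> = (\<Sum>v\<in>B. u v *\<^sub>R v)"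
      by (rule sum.reindex_bij_betw[OF bij])
    finally have u0: "\<forall>v\<in>B. u v = 0" using B(2) unfolding dependent_finite[OF finB] by fastforce
    have "c k = 0" for k
      using u0 bij_betwE[OF bij] uk[of k] by auto
    then show ?thesis ..
  qed
  then have "\<exists>B. ?A ** B = mat 1" unfolding matrix_right_invertible_independent_rows by blast
  then have "invertible ?A" by (simp add: invertible_right_inverse)
  then show ?thesis by (rule that)
qed

lemma pd_linear:
  fixes w :: "'k::finite \<Rightarrow> real"
  shows "smooth_on UNIV UNIV (\<lambda>x. \<Sum>k\<in>UNIV. w k * x k)" "pd j (\<lambda>x. \<Sum>k\<in>UNIV. w k * x k) x = w j"
proof -
  have op: "ropen UNIV (UNIV :: ('k \<Rightarrow> real) set)" using ropen_tuples[of "UNIV :: 'k set"] by simp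
  have s: "smooth_on UNIV UNIV (\<lambda>x. w k * x k)" for k
    by (intro smooth_on_mult smooth_on_const smooth_on_coord finite op UNIV_I)
  show "smooth_on UNIV UNIV (\<lambda>x. \<Sum>k\<in>UNIV. w k * x k)" by (rule smooth_on_sum[OF finite op s])
  have "pd j (\<lambda>x. \<Sum>k\<in>UNIV. w k * x k) x = (\<Sum>k\<in>UNIV. pd j (\<lambda>x. w k * x k) x)"
    by (rule pd_sum[OF finite s]) auto
  also have "\<dots> = (\<Sum>k\<in>UNIV. if j = k then w k else 0)"
    by (intro sum.cong refl, subst pd_mult[OF smooth_on_const[OF finite op] smooth_on_coord[OF finite op]])
      (auto simp: pd_const pd_coord)
  finally show "pd j (\<lambda>x. \<Sum>k\<in>UNIV. w k * x k) x = w j" by simp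
qed

locale fibred =
  fixes E :: "('e, 'n::finite + 'm::finite) mfd" and Q :: "('q, 'n) mfd" and \<pi> :: "'e \<Rightarrow> 'q"
  assumes fibred: "fibred_manifold E Q \<pi>"
begin

lemma idx_UNIV [simp]: "idx E = UNIV" "idx Q = UNIV"
  and smooth_EQ: "smooth_manifold E" "smooth_manifold Q"
  and surj: "\<pi> ` carrier E = carrier Q"
  and submersion: "e \<in> carrier E \<Longrightarrow> smooth_map_at E Q \<pi> e"
    "e \<in> carrier E \<Longrightarrow> tmap Q \<pi> e ` tangent E e = tangent Q (\<pi> e)"
  using fibred by (auto simp: fibred_manifold_def)

sublocale E: atlas_manifold E by (rule smooth_manifold_atlas_manifold[OF smooth_EQ(1)])
sublocale Q: atlas_manifold Q by (rule smooth_manifold_atlas_manifold[OF smooth_EQ(2)])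

lemma pi_carrier: "e \<in> carrier E \<Longrightarrow> \<pi> e \<in> carrier Q" using surj by blast

text \<open>
  Regard \<open>k\<close> as the components of a tangent vector at \<open>\<pi> e\<close>. It lifts to a vector \<open>v\<close> at \<open>e\<close>,
  and evaluating the linear relation on \<open>v\<close> yields \<open>\<Sum>\<^sub>i (k i)\<^sup>2 = 0\<close>.
\<close>

lemma submersion_rows_independent:
  assumes c: "(V, \<phi>) \<in> charts E" "e \<in> V" and d: "(B, \<xi>) \<in> charts Q" "\<pi> e \<in> B"
    and z: "(\<Sum>i\<in>UNIV. k i *\<^sub>R (\<chi> l. pd l (\<lambda>x. \<xi> (\<pi> (inv_into V \<phi> x)) i) (\<phi> e))) = (0 :: real ^ ('n + 'm))"
  shows "\<forall>i. k i = 0"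
proof -
  have e: "e \<in> carrier E" using E.chartD(1)[OF c(1)] c(2) by blast
  let ?w = "Q.chart_vector B \<xi> (\<pi> e) k"
  have w: "?w \<in> tangent Q (\<pi> e)" by (rule Q.chart_vector_tangent[OF d])
  then obtain v where v: "v \<in> tangent E e" "?w = tmap Q \<pi> e v" using submersion(2)[OF e] by blast
  have s: "smooth_at Q (\<pi> e) (\<lambda>q. \<xi> q i)" for i by (rule Q.smooth_at_coord[OF d]) simp
  have s': "smooth_at E e (\<lambda>q. \<xi> (\<pi> q) i)" for i
    using submersion(1)[OF e, unfolded smooth_map_at_def, THEN conjunct2, rule_format, OF s] .
  have ki: "k i = (\<Sum>l\<in>UNIV. pd l (\<lambda>x. \<xi> (\<pi> (inv_into V \<phi> x)) i) (\<phi> e) * v (\<lambda>q. \<phi> q l))" for i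
  proof -
    have "k i = ?w (\<lambda>q. \<xi> q i)" by (simp add: Q.chart_vector_coord[OF d])
    also have "\<dots> = v (\<lambda>q. \<xi> (\<pi> q) i)" unfolding v(2) tmap_def using s by simp
    also have "\<dots> = (\<Sum>l\<in>UNIV. pd l (\<lambda>x. \<xi> (\<pi> (inv_into V \<phi> x)) i) (\<phi> e) * v (\<lambda>q. \<phi> q l))"
      using E.tangent_chart[OF v(1) c s'] by simp
    finally show ?thesis .
  qed
  have zl: "(\<Sum>i\<in>UNIV. k i * pd l (\<lambda>x. \<xi> (\<pi> (inv_into V \<phi> x)) i) (\<phi> e)) = 0" for l
    using arg_cong[OF z, of "\<lambda>u. u $ l"] by simp
  have "(\<Sum>i\<in>UNIV. k i * k i) =
    (\<Sum>i\<in>UNIV. \<Sum>l\<in>UNIV. (k i * pd l (\<lambda>x. \<xi> (\<pi> (inv_into V \<phi> x)) i) (\<phi> e)) * v (\<lambda>q. \<phi> q l))"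
    by (subst (2) ki) (simp add: sum_distrib_left mult_ac)
  also have "\<dots> = (\<Sum>l\<in>UNIV. (\<Sum>i\<in>UNIV. k i * pd l (\<lambda>x. \<xi> (\<pi> (inv_into V \<phi> x)) i) (\<phi> e)) * v (\<lambda>q. \<phi> q l))"
    by (subst sum.swap) (simp add: sum_distrib_right)
  also have "\<dots> = 0" unfolding zl by simp
  finally show ?thesis by (simp add: sum_nonneg_eq_0_iff)
qed

text \<open>
  The base coordinates pulled back along \<open>\<pi>\<close> have independent differentials. Linear functions
  of the coordinates of any chart complete them to a local coordinate system.
\<close>

lemma adapted_chart_exists:
  assumes e: "e \<in> carrier E"
  obtains V \<phi> \<xi> where "(V, \<phi>, \<xi>) \<in> adapted_charts E Q \<pi>" "e \<in> V"
proof -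
  obtain V0 \<phi>0 where c: "(V0, \<phi>0) \<in> charts E" "e \<in> V0" using e by (rule E.carrier_chartE)
  obtain B \<xi> where d: "(B, \<xi>) \<in> charts Q" "\<pi> e \<in> B" using pi_carrier[OF e] by (rule Q.carrier_chartE)
  obtain V1 where V1: "openin (mtop E) V1" "e \<in> V1" "\<And>q. q \<in> V1 \<Longrightarrow> \<pi> q \<in> B"
    by (rule smooth_map_at_preimage[OF E.atlas_manifold_axioms Q.atlas_manifold_axioms submersion(1)[OF e]
        Q.openin_chart_domain[OF d(1)] d(2)]) (rule that)
  define W where "W = \<phi>0 ` (V1 \<inter> V0)"
  have W: "ropen UNIV W" using E.ropen_chart_image[OF V1(1) c(1)] by (simp add: W_def)
  define g where "g i x = \<xi> (\<pi> (inv_into V0 \<phi>0 x)) i" for i x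
  have g: "smooth_on UNIV W (g i)" for i
  proof (rule smooth_on_local[OF finite W])
    fix x assume "x \<in> W"
    then obtain q where q: "q \<in> V1" "q \<in> V0" "x = \<phi>0 q" by (auto simp: W_def)
    have qE: "q \<in> carrier E" using q(2) E.chartD(1)[OF c(1)] by blast
    have "smooth_at Q (\<pi> q) (\<lambda>q. \<xi> q i)" by (rule Q.smooth_at_coord[OF d(1) V1(3)[OF q(1)]]) simp
    with submersion(1)[OF qE, unfolded smooth_map_at_def]
    have sE: "smooth_at E q (\<lambda>q. \<xi> (\<pi> q) i)" by blast
    obtain T where T: "ropen UNIV T" "\<phi>0 q \<in> T" "T \<subseteq> \<phi>0 ` V0"
      "smooth_on UNIV T (\<lambda>x. \<xi> (\<pi> (inv_into V0 \<phi>0 x)) i)"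
      by (rule E.smooth_at_chartE[OF c(1) q(2) sE, unfolded idx_UNIV]) (rule that)
    have "smooth_on UNIV T (g i)" using T(4) by (simp add: g_def[abs_def])
    with T(1,2) show "\<exists>T. ropen UNIV T \<and> x \<in> T \<and> T \<subseteq> W \<and> smooth_on UNIV T (g i)"
      using W q(3) \<open>x \<in> W\<close> by (intro exI[of _ "T \<inter> W"]) (auto intro: smooth_on_subset)
  qed
  obtain b :: "'m \<Rightarrow> real ^ ('n + 'm)" where b: "invertible (\<chi> k. case_sum (\<lambda>i. \<chi> l. pd l (g i) (\<phi>0 e)) b k)"
    by (rule complete_to_invertible_matrix[OF submersion_rows_independent[OF c d, folded g_def]]) (assumption, rule that)
  define h where "h k = case_sum g (\<lambda>\<alpha> x. \<Sum>l\<in>UNIV. b \<alpha> $ l * x l) k" for k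
  define H where "H = (\<lambda>x k. h k x)"
  have h: "smooth_on UNIV W (h k)" for k
    using g smooth_on_subset[OF pd_linear(1)] by (auto simp: h_def split: sum.split)
  have "(\<chi> k l. pd l (h k) (\<phi>0 e)) = (\<chi> k. case_sum (\<lambda>i. \<chi> l. pd l (g i) (\<phi>0 e)) b k)"
    by (simp add: vec_eq_iff h_def pd_linear(2) split: sum.split)
  then have inv: "invertible (\<chi> k l. pd l (h k) (\<phi>0 e) :: real ^ ('n + 'm) ^ ('n + 'm))" using b by simp
  have eW: "\<phi>0 e \<in> W" using c(2) V1(2) by (auto simp: W_def)
  obtain U where U: "ropen UNIV U" "\<phi>0 e \<in> U" "U \<subseteq> W" "inj_on H U" "ropen UNIV (H ` U)"
    and invH: "\<And>i. smooth_on UNIV (H ` U) (\<lambda>y. inv_into U H y i)"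
    by (rule smooth_inverse_function[OF W h eW inv, folded H_def]) (rule that)
  define V where "V = {q \<in> V0. \<phi>0 q \<in> U}"
  define \<phi> where "\<phi> q = H (\<phi>0 q)" for q
  have UV0: "U \<subseteq> \<phi>0 ` V0" using U(3) by (auto simp: W_def)
  have chart: "(V, \<phi>) \<in> charts E"
    unfolding V_def \<phi>_def
    by (rule E.chart_compose[OF c(1)]) (use U UV0 invH smooth_on_subset[OF h U(3)] in \<open>auto simp: H_def\<close>)
  have VV1: "V \<subseteq> V1"
  proof
    fix q assume q: "q \<in> V"
    then have "\<phi>0 q \<in> \<phi>0 ` (V1 \<inter> V0)" using U(3) by (auto simp: V_def W_def)
    then show "q \<in> V1" using q E.chartD(2)[OF c(1)] by (auto simp: V_def inj_on_def)
  qed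
  have comp: "\<phi> q (Inl i) = \<xi> (\<pi> q) i" if "q \<in> V" for q i
    using that E.chart_inv[OF c(1)] by (simp add: \<phi>_def H_def h_def g_def V_def)
  have "\<xi> ` \<pi> ` V = (\<lambda>y i. y (Inl i)) ` (\<phi> ` V)"
    unfolding image_image by (rule image_cong) (auto simp: comp)
  then have op: "ropen UNIV (\<xi> ` \<pi> ` V)"
    using ropen_UNIV_project E.chartD(3)[OF chart] by simp
  have "{q \<in> B. \<xi> q \<in> \<xi> ` \<pi> ` V} = \<pi> ` V"
  proof
    show "{q \<in> B. \<xi> q \<in> \<xi> ` \<pi> ` V} \<subseteq> \<pi> ` V"
    proof
      fix q assume "q \<in> {q \<in> B. \<xi> q \<in> \<xi> ` \<pi> ` V}"
      then obtain v where v: "v \<in> V" "q \<in> B" "\<xi> q = \<xi> (\<pi> v)" by blast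
      then have "q = \<pi> v" using inj_onD[OF Q.chartD(2)[OF d(1)]] VV1 V1(3) by blast
      then show "q \<in> \<pi> ` V" using v(1) by blast
    qed
  qed (use VV1 V1(3) in auto)
  moreover have "({q \<in> B. \<xi> q \<in> \<xi> ` \<pi> ` V}, \<xi>) \<in> charts Q"
    by (rule Q.chart_restrict[OF d(1)]) (use op VV1 V1(3) in auto)
  ultimately have "(V, \<phi>, \<xi>) \<in> adapted_charts E Q \<pi>"
    using chart comp by (auto simp: adapted_charts_def)
  moreover have "e \<in> V" using c(2) U(2) by (simp add: V_def)
  ultimately show ?thesis by (rule that)
qed

end

section \<open>Jets of functions in coordinates\<close>

lemma finite_multisets_le: "finite {J :: 'n::finite multiset. size J \<le> r}"
proof -
  have "{J :: 'n multiset. size J \<le> r} = (\<Union>k\<le>r. multisets_of_size UNIV k)"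
    by (auto simp: multisets_of_size_def)
  then show ?thesis by (simp add: finite_multisets_of_size)
qed

lemma jet_idx_iff [simp]: "Inl i \<in> jet_idx r" "Inr (\<alpha>, J) \<in> jet_idx r \<longleftrightarrow> size J \<le> r"
  by (auto simp: jet_idx_def)

lemma finite_jet_idx [simp]: "finite (jet_idx r :: ('n::finite, 'm::finite) jet_index set)"
  unfolding jet_idx_def by (intro finite_Plus finite_cartesian_product finite_multisets_le finite)

lemma jet_idx_mono: "k \<le> s \<Longrightarrow> jet_idx k \<subseteq> jet_idx s"
  by (auto simp: jet_idx_def)

lemma jet_idxE:
  assumes "l \<in> jet_idx r"
  obtains i where "l = Inl i" | \<alpha> J where "l = Inr (\<alpha>, J)" "size J \<le> r"
  using assms by (auto simp: jet_idx_def)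

definition jet_comp :: "('m \<Rightarrow> ('n \<Rightarrow> real) \<Rightarrow> real) \<Rightarrow> ('n, 'm) jet_index \<Rightarrow> ('n \<Rightarrow> real) \<Rightarrow> real"
  where "jet_comp f l = (case l of Inl i \<Rightarrow> (\<lambda>y. y i) | Inr (\<alpha>, J) \<Rightarrow> pd_multi J (f \<alpha>))"

definition prolong :: "nat \<Rightarrow> ('m \<Rightarrow> ('n \<Rightarrow> real) \<Rightarrow> real) \<Rightarrow> ('n \<Rightarrow> real) \<Rightarrow> ('n, 'm) jet_index \<Rightarrow> real"
  where "prolong r f = tuple_map (jet_idx r) (jet_comp f)"

lemma prolong_apply [simp]:
  "prolong r f y (Inl i) = y i" "size J \<le> r \<Longrightarrow> prolong r f y (Inr (\<alpha>, J)) = pd_multi J (f \<alpha>) y"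
  by (simp_all add: prolong_def jet_comp_def)

lemma prolong_in_tuples [simp]: "prolong r f y \<in> tuples (jet_idx r)"
  by (simp add: prolong_def)

lemma prolong_eq_iff:
  "prolong r f x = prolong r g y \<longleftrightarrow>
    x = y \<and> (\<forall>\<alpha> J. size J \<le> r \<longrightarrow> pd_multi J (f \<alpha>) x = pd_multi J (g \<alpha>) y)"
proof
  assume eq: "prolong r f x = prolong r g y"
  have "x i = y i" for i using fun_cong[OF eq, of "Inl i"] by simp
  moreover have "pd_multi J (f \<alpha>) x = pd_multi J (g \<alpha>) y" if "size J \<le> r" for \<alpha> J
    using fun_cong[OF eq, of "Inr (\<alpha>, J)"] that by simp
  ultimately show "x = y \<and> (\<forall>\<alpha> J. size J \<le> r \<longrightarrow> pd_multi J (f \<alpha>) x = pd_multi J (g \<alpha>) y)" by blast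
next
  assume "x = y \<and> (\<forall>\<alpha> J. size J \<le> r \<longrightarrow> pd_multi J (f \<alpha>) x = pd_multi J (g \<alpha>) y)"
  then show "prolong r f x = prolong r g y"
    by (intro tuples_eqI[of _ "jet_idx r"]) (auto elim!: jet_idxE)
qed

lemma restrict_tuple_map: "restrict z A = tuple_map A (\<lambda>l z. z l) z"
  by (simp add: tuple_map_def)

lemma restrict_prolong: "k \<le> s \<Longrightarrow> restrict (prolong s f y) (jet_idx k) = prolong k f y"
  by (rule tuples_eqI[of _ "jet_idx k"]) (auto elim!: jet_idxE)

lemma smooth_jet_comp:
  fixes f :: "'m \<Rightarrow> ('n::finite \<Rightarrow> real) \<Rightarrow> real"
  assumes "ropen UNIV N" "\<And>\<alpha>. smooth_on UNIV N (f \<alpha>)"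
  shows "smooth_on UNIV N (jet_comp f l)"
  using smooth_on_coord[OF finite assms(1)] smooth_on_pd_multi[OF finite assms]
  by (auto simp: jet_comp_def split: sum.split prod.split)

text \<open>
  The \<open>j\<close>-th partial derivative of the jet coordinate \<open>l\<close> along every
  prolonged function, as a function of jets of one order higher.
\<close>

definition jet_shift :: "'n \<Rightarrow> ('n, 'm) jet_index \<Rightarrow> (('n, 'm) jet_index \<Rightarrow> real) \<Rightarrow> real"
  where "jet_shift j l z = (case l of Inl i \<Rightarrow> (if j = i then 1 else 0) | Inr (\<beta>, K) \<Rightarrow> z (Inr (\<beta>, add_mset j K)))"

lemma pd_jet_comp:
  fixes f :: "'m \<Rightarrow> ('n::finite \<Rightarrow> real) \<Rightarrow> real"
  assumes "ropen UNIV N" "\<And>\<alpha>. smooth_on UNIV N (f \<alpha>)" "y \<in> N" "l \<in> jet_idx k" "Suc k \<le> s"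
  shows "pd j (jet_comp f l) y = jet_shift j l (prolong s f y)"
  using assms(4,5) pd_multi_add_mset[OF finite assms(1,2) UNIV_I _ assms(3)]
  by (auto simp: jet_comp_def jet_shift_def pd_coord split: sum.split prod.split)

text \<open>
  By the chain rule this is the \<open>j\<close>-th partial derivative of \<open>F\<close> along every prolonged function.
\<close>

definition total_deriv :: "nat \<Rightarrow> 'n \<Rightarrow> ((('n, 'm) jet_index \<Rightarrow> real) \<Rightarrow> real) \<Rightarrow> (('n, 'm) jet_index \<Rightarrow> real) \<Rightarrow> real"
  where "total_deriv k j F z = (\<Sum>l\<in>jet_idx k. pd l F (restrict z (jet_idx k)) * jet_shift j l z)"

context
  fixes f :: "'m::finite \<Rightarrow> ('n::finite \<Rightarrow> real) \<Rightarrow> real" and N k T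
  assumes N: "ropen UNIV N" and f: "\<And>\<alpha>. smooth_on UNIV N (f \<alpha>)" and T: "ropen (jet_idx k) T"
    and maps: "\<And>y. y \<in> N \<Longrightarrow> prolong k f y \<in> T"
begin

lemma smooth_prolong: "smooth_on (jet_idx k) T F \<Longrightarrow> smooth_on UNIV N (\<lambda>y. F (prolong k f y))"
  unfolding prolong_def
  by (rule smooth_on_compose[OF finite finite_jet_idx N T])
    (use smooth_jet_comp[OF N f] maps in \<open>auto simp: prolong_def\<close>)

lemma pd_prolong:
  assumes F: "smooth_on (jet_idx k) T F" and "y \<in> N" "Suc k \<le> s"
  shows "pd j (\<lambda>y. F (prolong k f y)) y = total_deriv k j F (prolong s f y)"
proof -
  have "pd j (\<lambda>y. F (tuple_map (jet_idx k) (jet_comp f) y)) y =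
      (\<Sum>l\<in>jet_idx k. pd l F (tuple_map (jet_idx k) (jet_comp f) y) * pd j (jet_comp f l) y)"
    by (rule pd_compose_smooth[OF finite finite_jet_idx N T F])
      (use smooth_jet_comp[OF N f] maps assms in \<open>auto simp: prolong_def\<close>)
  also have "\<dots> = total_deriv k j F (prolong s f y)"
    unfolding total_deriv_def
    using restrict_prolong[of k s f y] assms(3) pd_jet_comp[where f = f, OF N f assms(2) _ assms(3)]
    by (intro sum.cong) (auto simp: prolong_def)
  finally show ?thesis by (simp add: prolong_def)
qed

end

lemma smooth_total_deriv:
  fixes F :: "(('n::finite, 'm::finite) jet_index \<Rightarrow> real) \<Rightarrow> real"
  assumes F: "smooth_on (jet_idx k) T F" and T: "ropen (jet_idx k) T" and S: "ropen (jet_idx s) S"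
    and ks: "Suc k \<le> s" and maps: "\<And>z. z \<in> S \<Longrightarrow> restrict z (jet_idx k) \<in> T"
  shows "smooth_on (jet_idx s) S (total_deriv k j F)"
proof -
  have coord: "smooth_on (jet_idx s) S (\<lambda>z. z l)" if "l \<in> jet_idx s" for l :: "('n, 'm) jet_index"
    by (rule smooth_on_coord[OF finite_jet_idx S that])
  have 1: "smooth_on (jet_idx s) S (\<lambda>z. pd l F (restrict z (jet_idx k)))" if l: "l \<in> jet_idx k" for l
    unfolding restrict_tuple_map
  proof (rule smooth_on_compose[OF finite_jet_idx finite_jet_idx S T smooth_on_pd[OF F l]])
    show "smooth_on (jet_idx s) S (\<lambda>z. z l')" if "l' \<in> jet_idx k" for l' :: "('n, 'm) jet_index"
      using coord jet_idx_mono[of k s] ks that by auto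
  qed (use maps in \<open>simp add: restrict_tuple_map\<close>)
  have 2: "smooth_on (jet_idx s) S (jet_shift j l)" if l: "l \<in> jet_idx k" for l :: "('n, 'm) jet_index"
  proof (cases l)
    case (Inl i)
    then show ?thesis using smooth_on_const[OF finite_jet_idx S] by (simp add: jet_shift_def[abs_def])
  next
    case (Inr b)
    then obtain \<beta> K where "l = Inr (\<beta>, K)" by (cases b) auto
    then show ?thesis using coord[of "Inr (\<beta>, add_mset j K)"] l ks by (simp add: jet_shift_def[abs_def])
  qed
  show ?thesis unfolding total_deriv_def[abs_def]
    by (intro smooth_on_sum smooth_on_mult 1 2 finite_jet_idx S)
qed

section \<open>Taylor monomials\<close>

definition taylor_monom :: "('n::finite \<Rightarrow> real) \<Rightarrow> 'n multiset \<Rightarrow> ('n \<Rightarrow> real) \<Rightarrow> real"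
  where "taylor_monom a K y = (\<Prod>i\<in>UNIV. (y i - a i) ^ count K i / fact (count K i))"

lemma ropen_UNIV: "ropen UNIV UNIV"
  using ropen_tuples[of UNIV] by simp

lemma smooth_taylor_monom: "smooth_on UNIV UNIV (taylor_monom a K)"
proof -
  have "smooth_on UNIV UNIV (\<lambda>y. (y i - a i) ^ count K i * inverse (fact (count K i)))" for i
    by (intro smooth_on_mult smooth_on_power smooth_on_diff smooth_on_coord smooth_on_const finite ropen_UNIV UNIV_I)
  then show ?thesis
    unfolding taylor_monom_def[abs_def] divide_inverse
    by (intro smooth_on_prod finite ropen_UNIV)
qed

lemma pd_taylor_monom:
  "pd i (taylor_monom a K) y = (if i \<in># K then taylor_monom a (K - {#i#}) y else 0)"
proof (rule pd_eqI)
  define R where "R = (\<Prod>k\<in>UNIV - {i}. (y k - a k) ^ count K k / fact (count K k))"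
  have split: "taylor_monom a L (y(i := t)) = (t - a i) ^ count L i / fact (count L i) * R"
    if "\<And>k. k \<noteq> i \<Longrightarrow> count L k = count K k" for L t
  proof -
    have "taylor_monom a L (y(i := t)) = (t - a i) ^ count L i / fact (count L i) *
        (\<Prod>k\<in>UNIV - {i}. ((y(i := t)) k - a k) ^ count L k / fact (count L k))"
      unfolding taylor_monom_def by (subst prod.remove[of UNIV i]) auto
    also have "(\<Prod>k\<in>UNIV - {i}. ((y(i := t)) k - a k) ^ count L k / fact (count L k)) = R"
      unfolding R_def by (rule prod.cong) (auto simp: that)
    finally show ?thesis .
  qed
  have d: "((\<lambda>t. (t - a i) ^ n / fact n * R) has_real_derivative
      (if n = 0 then 0 else (y i - a i) ^ (n - 1) / fact (n - 1) * R)) (at (y i))" for n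
  proof (cases n)
    case (Suc m)
    have "((\<lambda>t. (t - a i) ^ Suc m) has_real_derivative (1 + real m) * (1 * (y i - a i) ^ m)) (at (y i))"
      by (rule DERIV_power_Suc) (auto intro!: derivative_eq_intros)
    then have "((\<lambda>t. (t - a i) ^ Suc m) has_real_derivative real (Suc m) * (y i - a i) ^ m) (at (y i))"
      by simp
    then have "((\<lambda>t. (t - a i) ^ Suc m / fact (Suc m) * R) has_real_derivative
        (real (Suc m) * (y i - a i) ^ m) / fact (Suc m) * R) (at (y i))"
      by (intro DERIV_cmult_right DERIV_cdivide)
    also have "(real (Suc m) * (y i - a i) ^ m) / fact (Suc m) = (y i - a i) ^ m / fact m"
      by (simp add: fact_Suc del: of_nat_Suc)
    finally show ?thesis using Suc by simp
  qed simp
  have "(\<lambda>t. taylor_monom a K (y(i := t))) = (\<lambda>t. (t - a i) ^ count K i / fact (count K i) * R)"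
    by (simp add: split)
  moreover have "(if count K i = 0 then 0 else (y i - a i) ^ (count K i - 1) / fact (count K i - 1) * R) =
      (if i \<in># K then taylor_monom a (K - {#i#}) y else 0)"
  proof (cases "i \<in># K")
    case True
    then obtain n where n: "count K i = Suc n" by (metis count_greater_zero_iff gr0_implies_Suc)
    show ?thesis using True split[of "K - {#i#}" "y i"] by (simp add: n)
  next
    case False
    then have "count K i = 0" by (simp add: not_in_iff)
    then show ?thesis using False by simp
  qed
  ultimately show "((\<lambda>t. taylor_monom a K (y(i := t))) has_real_derivative
      (if i \<in># K then taylor_monom a (K - {#i#}) y else 0)) (at (y i))"
    using d[of "count K i"] by (simp only:)
qed

lemma taylor_monom_centre: "taylor_monom a K a = (if K = {#} then 1 else 0)"
proof (cases "K = {#}")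
  case False
  then obtain i where "i \<in># K" by blast
  then have "(a i - a i) ^ count K i / fact (count K i) = 0" by (simp add: power_0_left)
  then have "\<exists>i\<in>UNIV. (a i - a i) ^ count K i / fact (count K i) = 0" by blast
  then show ?thesis using False by (simp add: taylor_monom_def prod_zero_iff)
qed (simp add: taylor_monom_def)

lemma pd_multi_taylor_monom:
  "pd_multi J (taylor_monom a K) y = (if J \<subseteq># K then taylor_monom a (K - J) y else 0)"
proof (induction J arbitrary: y)
  case (add i J)
  have "pd_multi (add_mset i J) (taylor_monom a K) y = pd i (pd_multi J (taylor_monom a K)) y"
    by (rule pd_multi_add_mset[OF finite ropen_UNIV smooth_taylor_monom]) auto
  also have "pd_multi J (taylor_monom a K) = (if J \<subseteq># K then taylor_monom a (K - J) else (\<lambda>y. 0))"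
    using add by auto
  also have "pd i \<dots> y = (if add_mset i J \<subseteq># K then taylor_monom a (K - add_mset i J) y else 0)"
  proof (cases "J \<subseteq># K")
    case True
    then obtain L where L: "K = J + L" by (metis mset_subset_eq_exists_conv)
    have "i \<in># L \<longleftrightarrow> J + {#i#} \<subseteq># J + L" unfolding mset_subset_eq_mono_add_left_cancel by simp
    then have "i \<in># K - J \<longleftrightarrow> add_mset i J \<subseteq># K" by (simp add: L)
    then show ?thesis using True by (simp add: pd_taylor_monom)
  next
    case False
    then have "\<not> add_mset i J \<subseteq># K" by (metis mset_subset_eq_insertD subset_mset.less_imp_le)
    then show ?thesis using False by (simp add: pd_const)
  qed
  finally show ?case .
qed simp

definition taylor_poly :: "nat \<Rightarrow> ('n::finite \<Rightarrow> real) \<Rightarrow> ('n multiset \<Rightarrow> real) \<Rightarrow> ('n \<Rightarrow> real) \<Rightarrow> real"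
  where "taylor_poly r a k y = (\<Sum>K\<in>{K. size K \<le> r}. k K * taylor_monom a K y)"

lemma smooth_taylor_poly: "smooth_on UNIV UNIV (taylor_poly r a k)"
  unfolding taylor_poly_def[abs_def]
  by (intro smooth_on_sum smooth_on_mult smooth_on_const smooth_taylor_monom finite ropen_UNIV)

lemma pd_multi_taylor_poly:
  assumes "size J \<le> r" shows "pd_multi J (taylor_poly r a k) a = k J"
proof -
  have "pd_multi J (taylor_poly r a k) y = (\<Sum>K\<in>{K. size K \<le> r}. k K * pd_multi J (taylor_monom a K) y)" for y
  proof (induction J arbitrary: y)
    case empty
    show ?case by (simp add: taylor_poly_def)
  next
    case (add i J)
    have s: "smooth_on UNIV UNIV (pd_multi J (taylor_monom a K))" for K
      by (rule smooth_on_pd_multi[OF finite ropen_UNIV smooth_taylor_monom]) simp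
    have c: "smooth_on UNIV UNIV (\<lambda>y :: 'a \<Rightarrow> real. k K)" for K by (rule smooth_on_const[OF finite ropen_UNIV])
    have "pd_multi (add_mset i J) (taylor_poly r a k) y = pd i (pd_multi J (taylor_poly r a k)) y"
      by (rule pd_multi_add_mset[OF finite ropen_UNIV smooth_taylor_poly]) auto
    also have "pd_multi J (taylor_poly r a k) = (\<lambda>y. \<Sum>K\<in>{K. size K \<le> r}. k K * pd_multi J (taylor_monom a K) y)"
      using add by blast
    also have "pd i \<dots> y = (\<Sum>K\<in>{K. size K \<le> r}. pd i (\<lambda>y. k K * pd_multi J (taylor_monom a K) y) y)"
      by (rule pd_sum[OF finite_multisets_le smooth_on_mult[OF finite ropen_UNIV c s]]) auto
    also have "\<dots> = (\<Sum>K\<in>{K. size K \<le> r}. k K * pd_multi (add_mset i J) (taylor_monom a K) y)"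
      by (intro sum.cong refl, subst pd_mult[OF c s], simp, simp)
        (simp add: pd_const pd_multi_add_mset[OF finite ropen_UNIV smooth_taylor_monom])
    finally show ?case .
  qed
  also have "(\<Sum>K\<in>{K. size K \<le> r}. k K * pd_multi J (taylor_monom a K) a) =
      (\<Sum>K\<in>{K. size K \<le> r}. if K = J then k K else 0)"
    by (intro sum.cong refl)
      (auto simp: pd_multi_taylor_monom taylor_monom_centre Diff_eq_empty_iff_mset subset_mset.antisym)
  also have "\<dots> = k J"
    by (subst sum.delta[OF finite_multisets_le]) (use assms in simp)
  finally show ?thesis .
qed

section \<open>Sections in adapted coordinates\<close>

text \<open>
  The jet coordinates of order zero, relabelled as coordinates of the total space.
\<close>

definition jet_point :: "(('n, 'm) jet_index \<Rightarrow> real) \<Rightarrow> 'n + 'm \<Rightarrow> real"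
  where "jet_point z k = (case k of Inl i \<Rightarrow> z (Inl i) | Inr \<alpha> \<Rightarrow> z (Inr (\<alpha>, {#})))"

definition jet_base :: "(('n, 'm) jet_index \<Rightarrow> real) \<Rightarrow> 'n \<Rightarrow> real"
  where "jet_base z i = z (Inl i)"

lemma jet_point_restrict [simp]: "jet_point (restrict z (jet_idx k)) = jet_point z"
  by (auto simp: jet_point_def fun_eq_iff split: sum.split)

lemma ropen_jet_point:
  fixes W :: "('n::finite + 'm::finite \<Rightarrow> real) set"
  assumes "ropen UNIV W"
  shows "ropen (jet_idx k) {z \<in> tuples (jet_idx k). jet_point z \<in> W}"
proof (rule ropen_preimage[OF ropen_tuples _ _ assms])
  have "continuous_on (tuples (jet_idx k)) (\<lambda>z. jet_point z l)" for l :: "'n + 'm"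
    by (cases l) (auto simp: jet_point_def intro: continuous_on_subset[OF continuous_on_product_coordinates])
  then show "continuous_on (tuples (jet_idx k :: ('n, 'm) jet_index set)) jet_point"
    by (intro continuous_on_coordinatewise_then_product)
qed simp

context fibred
begin

abbreviation adapted :: "'e set \<Rightarrow> ('e \<Rightarrow> 'n + 'm \<Rightarrow> real) \<Rightarrow> ('q \<Rightarrow> 'n \<Rightarrow> real) \<Rightarrow> bool"
  where "adapted V \<phi> \<xi> \<equiv> (V, \<phi>, \<xi>) \<in> adapted_charts E Q \<pi>"

lemma adaptedD:
  assumes "adapted V \<phi> \<xi>"
  shows "(V, \<phi>) \<in> charts E" "(\<pi> ` V, \<xi>) \<in> charts Q" "e \<in> V \<Longrightarrow> \<phi> e (Inl i) = \<xi> (\<pi> e) i"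
  using assms by (auto simp: adapted_charts_def)

lemma sections_atD:
  assumes "\<sigma> \<in> sections_at E Q \<pi> x"
  shows "\<pi> (\<sigma> x) = x" "x \<in> carrier Q" "\<sigma> x \<in> carrier E" "smooth_map_at Q E \<sigma> x"
proof -
  obtain U where U: "openin (mtop Q) U" "x \<in> U" "\<forall>y\<in>U. smooth_map_at Q E \<sigma> y \<and> \<pi> (\<sigma> y) = y"
    using assms by (auto simp: sections_at_def)
  then show "\<pi> (\<sigma> x) = x" "x \<in> carrier Q" "smooth_map_at Q E \<sigma> x" using Q.openin_mtop_subset by blast+
  then show "\<sigma> x \<in> carrier E" by (simp add: smooth_map_at_def)
qed

definition section_rep :: "'e set \<Rightarrow> ('e \<Rightarrow> 'n + 'm \<Rightarrow> real) \<Rightarrow> ('q \<Rightarrow> 'n \<Rightarrow> real) \<Rightarrow> ('q \<Rightarrow> 'e) \<Rightarrow> 'm \<Rightarrow> ('n \<Rightarrow> real) \<Rightarrow> real"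
  where "section_rep V \<phi> \<xi> \<sigma> \<alpha> y = \<phi> (\<sigma> (inv_into (\<pi> ` V) \<xi> y)) (Inr \<alpha>)"

definition section_jet :: "'e set \<Rightarrow> ('e \<Rightarrow> 'n + 'm \<Rightarrow> real) \<Rightarrow> ('q \<Rightarrow> 'n \<Rightarrow> real) \<Rightarrow> nat \<Rightarrow> ('q \<Rightarrow> 'e) \<Rightarrow> 'q \<Rightarrow> ('n, 'm) jet_index \<Rightarrow> real"
  where "section_jet V \<phi> \<xi> r \<sigma> x = prolong r (section_rep V \<phi> \<xi> \<sigma>) (\<xi> x)"

lemma section_deriv_eq: "section_deriv \<pi> (V, \<phi>, \<xi>) \<sigma> \<alpha> J x = pd_multi J (section_rep V \<phi> \<xi> \<sigma> \<alpha>) (\<xi> x)"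
  by (simp add: section_deriv_def section_rep_def[abs_def])

lemma section_local:
  assumes c: "adapted V \<phi> \<xi>" and \<sigma>: "\<sigma> \<in> sections_at E Q \<pi> x" and V: "\<sigma> x \<in> V"
  obtains N where "ropen UNIV N" "\<xi> x \<in> N" "N \<subseteq> \<xi> ` \<pi> ` V"
    "\<And>\<alpha>. smooth_on UNIV N (section_rep V \<phi> \<xi> \<sigma> \<alpha>)"
    "\<And>y. y \<in> N \<Longrightarrow> \<sigma> (inv_into (\<pi> ` V) \<xi> y) \<in> V"
    "\<And>y. y \<in> N \<Longrightarrow> \<sigma> \<in> sections_at E Q \<pi> (inv_into (\<pi> ` V) \<xi> y)"
proof -
  note cE = adaptedD(1)[OF c] and cQ = adaptedD(2)[OF c]
  obtain U where U: "openin (mtop Q) U" "x \<in> U" "\<forall>y\<in>U. smooth_map_at Q E \<sigma> y \<and> \<pi> (\<sigma> y) = y"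
    using \<sigma> by (auto simp: sections_at_def)
  have x: "x \<in> \<pi> ` V" using V sections_atD(1)[OF \<sigma>] by force
  obtain U2 where U2: "openin (mtop Q) U2" "x \<in> U2" "\<And>q. q \<in> U2 \<Longrightarrow> \<sigma> q \<in> V"
    by (rule smooth_map_at_preimage[OF Q.atlas_manifold_axioms E.atlas_manifold_axioms sections_atD(4)[OF \<sigma>]
        E.openin_chart_domain[OF cE] V]) (rule that)
  define N where "N = \<xi> ` (U \<inter> U2 \<inter> \<pi> ` V)"
  have N: "ropen UNIV N" using Q.ropen_chart_image[OF openin_Int[OF U(1) U2(1)] cQ] by (simp add: N_def)
  have s: "smooth_on UNIV N (section_rep V \<phi> \<xi> \<sigma> \<alpha>)" for \<alpha>
  proof (rule smooth_on_local[OF finite N])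
    fix y assume "y \<in> N"
    then obtain q where q: "q \<in> U" "q \<in> U2" "q \<in> \<pi> ` V" "y = \<xi> q" by (auto simp: N_def)
    have "smooth_at E (\<sigma> q) (\<lambda>e. \<phi> e (Inr \<alpha>))" by (rule E.smooth_at_coord[OF cE U2(3)[OF q(2)]]) simp
    then have sQ: "smooth_at Q q (\<lambda>q. \<phi> (\<sigma> q) (Inr \<alpha>))"
      using U(3) q(1) by (auto simp: smooth_map_at_def)
    obtain T where T: "ropen UNIV T" "\<xi> q \<in> T" "T \<subseteq> \<xi> ` \<pi> ` V"
        "smooth_on UNIV T (\<lambda>x. \<phi> (\<sigma> (inv_into (\<pi> ` V) \<xi> x)) (Inr \<alpha>))"
      by (rule Q.smooth_at_chartE[OF cQ q(3) sQ, unfolded idx_UNIV]) (rule that)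
    have "smooth_on UNIV T (section_rep V \<phi> \<xi> \<sigma> \<alpha>)" using T(4) by (simp add: section_rep_def[abs_def])
    then show "\<exists>T. ropen UNIV T \<and> y \<in> T \<and> T \<subseteq> N \<and> smooth_on UNIV T (section_rep V \<phi> \<xi> \<sigma> \<alpha>)"
      using T N q(4) \<open>y \<in> N\<close> by (intro exI[of _ "T \<inter> N"]) (auto intro: smooth_on_subset)
  qed
  show ?thesis
  proof (rule that[OF N _ _ s])
    show "\<xi> x \<in> N" using U(2) U2(2) x by (auto simp: N_def)
    show "N \<subseteq> \<xi> ` \<pi> ` V" by (auto simp: N_def)
    fix y assume "y \<in> N"
    then obtain q where q: "q \<in> U" "q \<in> U2" "q \<in> \<pi> ` V" "y = \<xi> q" by (auto simp: N_def)
    have i: "inv_into (\<pi> ` V) \<xi> y = q" using q(3,4) Q.chart_inv[OF cQ] by simp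
    show "\<sigma> (inv_into (\<pi> ` V) \<xi> y) \<in> V" unfolding i by (rule U2(3)[OF q(2)])
    show "\<sigma> \<in> sections_at E Q \<pi> (inv_into (\<pi> ` V) \<xi> y)"
      unfolding i sections_at_def using U q(1) by blast
  qed
qed

lemma section_jet_in_tuples [simp]: "section_jet V \<phi> \<xi> r \<sigma> x \<in> tuples (jet_idx r)"
  by (simp add: section_jet_def)

context
  fixes V \<phi> \<xi> \<sigma> x
  assumes c: "adapted V \<phi> \<xi>" and \<sigma>: "\<sigma> \<in> sections_at E Q \<pi> x" and V: "\<sigma> x \<in> V"
begin

lemma section_base: "x \<in> \<pi> ` V"
  using V sections_atD(1)[OF \<sigma>] by force

lemma inv_base: "inv_into (\<pi> ` V) \<xi> (\<xi> x) = x"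
  by (rule Q.chart_inv[OF adaptedD(2)[OF c] section_base])

lemma jet_point_section_jet: "jet_point (section_jet V \<phi> \<xi> r \<sigma> x) = \<phi> (\<sigma> x)"
proof
  fix k show "jet_point (section_jet V \<phi> \<xi> r \<sigma> x) k = \<phi> (\<sigma> x) k"
    by (cases k) (simp_all add: jet_point_def section_jet_def section_rep_def inv_base adaptedD(3)[OF c V] sections_atD(1)[OF \<sigma>])
qed

lemma jet_base_section_jet: "jet_base (section_jet V \<phi> \<xi> r \<sigma> x) = \<xi> x"
  by (simp add: jet_base_def section_jet_def fun_eq_iff)

lemma restrict_section_jet: "k \<le> r \<Longrightarrow> restrict (section_jet V \<phi> \<xi> r \<sigma> x) (jet_idx k) = section_jet V \<phi> \<xi> k \<sigma> x"
  by (simp add: section_jet_def restrict_prolong)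

end

text \<open>
  The section has the Taylor polynomials with the prescribed derivatives as its components;
  it is defined where these stay in the image of the chart.
\<close>

lemma section_jet_realize:
  assumes c: "adapted V \<phi> \<xi>" and z: "z \<in> tuples (jet_idx r)" "jet_point z \<in> \<phi> ` V"
  obtains \<sigma> x where "\<sigma> \<in> sections_at E Q \<pi> x" "\<sigma> x \<in> V" "section_jet V \<phi> \<xi> r \<sigma> x = z"
proof -
  note cE = adaptedD(1)[OF c] and cQ = adaptedD(2)[OF c]
  obtain e where e: "e \<in> V" "\<phi> e = jet_point z" using z(2) by auto
  define x where "x = \<pi> e"
  define P where "P \<alpha> = taylor_poly r (jet_base z) (\<lambda>K. z (Inr (\<alpha>, K)))" for \<alpha>
  have base: "\<xi> x = jet_base z"
    using adaptedD(3)[OF c e(1)] e(2) by (simp add: x_def jet_base_def jet_point_def fun_eq_iff)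
  have P: "smooth_on UNIV UNIV (P \<alpha>)" for \<alpha> unfolding P_def by (rule smooth_taylor_poly)
  have Pz: "pd_multi J (P \<alpha>) (\<xi> x) = z (Inr (\<alpha>, J))" if "size J \<le> r" for J \<alpha>
    unfolding P_def base by (rule pd_multi_taylor_poly[OF that])
  define G where "G = tuple_map UNIV (\<lambda>k. case k of Inl i \<Rightarrow> (\<lambda>y. y i) | Inr \<alpha> \<Rightarrow> P \<alpha>)"
  have G: "G y (Inl i) = y i" "G y (Inr \<alpha>) = P \<alpha> y" for y i \<alpha> by (simp_all add: G_def)
  have Gs: "smooth_on UNIV UNIV (case k of Inl i \<Rightarrow> (\<lambda>y. y i) | Inr \<alpha> \<Rightarrow> P \<alpha>)" for k
    using P smooth_on_coord[OF finite ropen_UNIV] by (auto split: sum.split)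
  have Gx: "G (\<xi> x) = jet_point z"
  proof
    fix k show "G (\<xi> x) k = jet_point z k"
      using Pz[of "{#}"] by (cases k) (simp_all add: G jet_point_def base, simp add: jet_base_def)
  qed
  have "continuous_on UNIV G" unfolding G_def tuple_map_def
    by (rule continuous_on_tuple_valued) (rule smooth_on_continuous[OF Gs], simp)
  then have "ropen UNIV {y \<in> UNIV. G y \<in> \<phi> ` V}"
    using E.chartD(3)[OF cE] by (intro ropen_preimage[OF ropen_UNIV]) auto
  then have opG: "ropen UNIV {y. G y \<in> \<phi> ` V}" by simp
  define U where "U = {q \<in> \<pi> ` V. \<xi> q \<in> {y. G y \<in> \<phi> ` V}}"
  have U: "openin (mtop Q) U" unfolding U_def using opG by (intro Q.openin_chart_preimage[OF cQ]) simp
  have "G (\<xi> x) \<in> \<phi> ` V" using Gx z(2) by simp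
  then have xU: "x \<in> U" using e(1) by (simp add: U_def x_def)
  define \<sigma> where "\<sigma> q = inv_into V \<phi> (G (\<xi> q))" for q
  have \<sigma>V: "\<sigma> q \<in> V" "\<phi> (\<sigma> q) = G (\<xi> q)" if "q \<in> U" for q
    using that unfolding \<sigma>_def U_def by (auto intro: inv_into_into f_inv_into_f)
  have \<pi>\<sigma>: "\<pi> (\<sigma> q) = q" if "q \<in> U" for q
  proof -
    have "\<xi> (\<pi> (\<sigma> q)) i = \<xi> q i" for i
      using adaptedD(3)[OF c \<sigma>V(1)[OF that], of i] \<sigma>V(2)[OF that] G(1) by simp
    then have "\<xi> (\<pi> (\<sigma> q)) = \<xi> q" by blast
    then show ?thesis using inj_onD[OF Q.chartD(2)[OF cQ]] \<sigma>V(1)[OF that] that by (auto simp: U_def)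
  qed
  have smooth: "smooth_map_at Q E \<sigma> q" if q: "q \<in> U" for q
    unfolding smooth_map_at_def
  proof (intro conjI allI impI)
    show "\<sigma> q \<in> carrier E" using \<sigma>V(1)[OF q] E.chartD(1)[OF cE] by blast
    fix f assume f: "smooth_at E (\<sigma> q) f"
    obtain T where T: "ropen UNIV T" "\<phi> (\<sigma> q) \<in> T" "T \<subseteq> \<phi> ` V" "smooth_on UNIV T (\<lambda>x. f (inv_into V \<phi> x))"
      by (rule E.smooth_at_chartE[OF cE \<sigma>V(1)[OF q] f, unfolded idx_UNIV]) (rule that)
    have "continuous_on UNIV G" unfolding G_def tuple_map_def
      by (rule continuous_on_tuple_valued) (rule smooth_on_continuous[OF Gs], simp)
    then have "ropen UNIV {y \<in> UNIV. G y \<in> T}" by (rule ropen_preimage[OF ropen_UNIV]) (auto intro: T(1))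
    then have op: "ropen UNIV {y. G y \<in> T}" by simp
    have "smooth_on UNIV {y. G y \<in> T} (\<lambda>y. f (inv_into V \<phi> (G y)))"
      unfolding G_def
      by (rule smooth_on_compose[OF finite finite _ T(1,4)])
        (use op smooth_on_subset[OF Gs] in \<open>auto simp: G_def\<close>)
    moreover have "q \<in> \<pi> ` V" using q by (simp add: U_def)
    ultimately show "smooth_at Q q (\<lambda>q. f (\<sigma> q))"
      using op T(2) \<sigma>V(2)[OF q] by (intro Q.smooth_at_chartI[OF cQ]) (auto simp: \<sigma>_def)
  qed
  have sec: "\<sigma> \<in> sections_at E Q \<pi> x"
    unfolding sections_at_def using U xU smooth \<pi>\<sigma> by blast
  have opN: "ropen UNIV (\<xi> ` (U \<inter> \<pi> ` V))" using Q.ropen_chart_image[OF U cQ] by simp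
  have "pd_multi J (section_rep V \<phi> \<xi> \<sigma> \<alpha>) (\<xi> x) = pd_multi J (P \<alpha>) (\<xi> x)" for J \<alpha>
  proof (rule pd_multi_cong[OF finite opN])
    show "\<xi> x \<in> \<xi> ` (U \<inter> \<pi> ` V)" using xU by (auto simp: U_def)
    fix y assume "y \<in> \<xi> ` (U \<inter> \<pi> ` V)"
    then obtain q where q: "q \<in> U" "q \<in> \<pi> ` V" "y = \<xi> q" by blast
    then show "section_rep V \<phi> \<xi> \<sigma> \<alpha> y = P \<alpha> y"
      using Q.chart_inv[OF cQ] \<sigma>V(2) by (simp add: section_rep_def G)
  qed simp
  then have "section_jet V \<phi> \<xi> r \<sigma> x = z"
    using z(1) by (intro tuples_eqI[of _ "jet_idx r"])
      (auto elim!: jet_idxE simp: section_jet_def Pz, simp add: base jet_base_def)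
  with sec \<sigma>V(1)[OF xU] show ?thesis by (rule that)
qed

section \<open>Transition functions of jet coordinates\<close>

text \<open>
  The coordinates of the jets with value in \<open>V\<close>. They are arbitrary above order
  zero.
\<close>

definition jet_region :: "('e \<Rightarrow> 'n + 'm \<Rightarrow> real) \<Rightarrow> 'e set \<Rightarrow> nat \<Rightarrow> (('n, 'm) jet_index \<Rightarrow> real) set"
  where "jet_region \<phi> V k = {z \<in> tuples (jet_idx k). jet_point z \<in> \<phi> ` V}"

lemma ropen_jet_region:
  assumes "adapted V \<phi> \<xi>" "openin (mtop E) U" shows "ropen (jet_idx k) (jet_region \<phi> (V \<inter> U) k)"
  using ropen_jet_point E.ropen_chart_image[OF assms(2) adaptedD(1)[OF assms(1)]]
  by (simp add: jet_region_def Int_commute)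

lemma jet_region_restrict: "z \<in> jet_region \<phi> V s \<Longrightarrow> restrict z (jet_idx k) \<in> jet_region \<phi> V k"
  by (simp add: jet_region_def)

context
  fixes V \<phi> \<xi> V' \<phi>' \<xi>'
  assumes c: "adapted V \<phi> \<xi>" and c': "adapted V' \<phi>' \<xi>'"
begin

lemma openin_adapted: "openin (mtop E) V'"
  by (rule E.openin_chart_domain[OF adaptedD(1)[OF c']])

lemma section_jet_region:
  assumes "\<sigma> \<in> sections_at E Q \<pi> x" "\<sigma> x \<in> V" "\<sigma> x \<in> V'"
  shows "section_jet V \<phi> \<xi> k \<sigma> x \<in> jet_region \<phi> (V \<inter> V') k"
  using jet_point_section_jet[OF c assms(1,2)] assms by (simp add: jet_region_def)

definition base_transition :: "('n \<Rightarrow> real) \<Rightarrow> 'n \<Rightarrow> real"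
  where "base_transition y = \<xi>' (inv_into (\<pi> ` V) \<xi> y)"

lemma smooth_base_transition:
  "ropen UNIV (\<xi> ` (\<pi> ` V \<inter> \<pi> ` V'))" "smooth_on UNIV (\<xi> ` (\<pi> ` V \<inter> \<pi> ` V')) (\<lambda>y. base_transition y i)"
  using Q.smooth_transition_charts[OF adaptedD(2)[OF c] adaptedD(2)[OF c']]
  by (auto simp: smooth_transition_def base_transition_def)

lemma jet_region_base:
  assumes "z \<in> jet_region \<phi> (V \<inter> V') k" shows "jet_base z \<in> \<xi> ` (\<pi> ` V \<inter> \<pi> ` V')"
proof -
  obtain e where e: "e \<in> V" "e \<in> V'" "jet_point z = \<phi> e" using assms by (auto simp: jet_region_def)
  have "jet_base z i = \<xi> (\<pi> e) i" for i
    using adaptedD(3)[OF c e(1), of i] e(3)[symmetric] by (simp add: jet_base_def jet_point_def)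
  then have "jet_base z = \<xi> (\<pi> e)" by blast
  then show ?thesis using e by blast
qed

lemma smooth_comp_jet_base:
  assumes "smooth_on UNIV (\<xi> ` (\<pi> ` V \<inter> \<pi> ` V')) g"
  shows "smooth_on (jet_idx k) (jet_region \<phi> (V \<inter> V') k) (\<lambda>z. g (jet_base z))"
proof -
  note op = ropen_jet_region[OF c openin_adapted, where k = k]
  have jb: "jet_base z = tuple_map UNIV (\<lambda>i z. z (Inl i)) z" for z :: "('n, 'm) jet_index \<Rightarrow> real"
    by (simp add: fun_eq_iff jet_base_def)
  show ?thesis unfolding jb
    by (rule smooth_on_compose[OF finite_jet_idx finite op smooth_base_transition(1) assms])
      (use smooth_on_coord[OF finite_jet_idx op] jet_region_base in \<open>auto simp flip: jb\<close>)
qed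

end

text \<open>
  Derivatives of a section in one adapted chart are smooth functions of the derivatives of at
  most the same order in another one: apply the chain rule repeatedly, each step trading a
  partial derivative in the new base coordinates for total derivatives in the old ones.
\<close>

lemma jet_transition_exists:
  assumes c: "adapted V \<phi> \<xi>" and c': "adapted V' \<phi>' \<xi>'"
  shows "\<exists>F. smooth_on (jet_idx (size J)) (jet_region \<phi> (V \<inter> V') (size J)) F \<and>
    (\<forall>\<sigma> x. \<sigma> \<in> sections_at E Q \<pi> x \<longrightarrow> \<sigma> x \<in> V \<longrightarrow> \<sigma> x \<in> V' \<longrightarrow>
       pd_multi J (section_rep V' \<phi>' \<xi>' \<sigma> \<alpha>) (\<xi>' x) = F (section_jet V \<phi> \<xi> (size J) \<sigma> x))"
proof (induction J)
  case empty
  note cE = adaptedD(1)[OF c] and cE' = adaptedD(1)[OF c']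
  have t: "ropen UNIV (\<phi> ` (V \<inter> V'))" "\<And>k. smooth_on UNIV (\<phi> ` (V \<inter> V')) (\<lambda>y. \<phi>' (inv_into V \<phi> y) k)"
    using E.smooth_transition_charts[OF cE cE'] by (auto simp: smooth_transition_def)
  note op = ropen_jet_region[OF c openin_adapted[OF c c'], where k = 0]
  have jp: "jet_point z = tuple_map UNIV (\<lambda>k z. jet_point z k) z" for z :: "('n, 'm) jet_index \<Rightarrow> real"
    by (simp add: fun_eq_iff)
  have jps: "smooth_on (jet_idx 0) (jet_region \<phi> (V \<inter> V') 0) (\<lambda>z. jet_point z k)" for k
    using smooth_on_coord[OF finite_jet_idx op] by (cases k) (simp_all add: jet_point_def)
  define F where "F z = \<phi>' (inv_into V \<phi> (jet_point z)) (Inr \<alpha>)" for z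
  have "smooth_on (jet_idx 0) (jet_region \<phi> (V \<inter> V') 0) F"
    unfolding F_def[abs_def]
    by (subst jp, rule smooth_on_compose[OF finite_jet_idx finite op t(1) t(2)])
      (use jps in \<open>auto simp: jet_region_def simp flip: jp\<close>)
  moreover have "section_rep V' \<phi>' \<xi>' \<sigma> \<alpha> (\<xi>' x) = F (section_jet V \<phi> \<xi> 0 \<sigma> x)"
    if "\<sigma> \<in> sections_at E Q \<pi> x" "\<sigma> x \<in> V" "\<sigma> x \<in> V'" for \<sigma> x
    unfolding F_def jet_point_section_jet[OF c that(1,2)] section_rep_def inv_base[OF c' that(1,3)]
    using E.chart_inv[OF cE that(2)] by simp
  ultimately show ?case by auto
next
  case (add i J)
  then obtain F where F: "smooth_on (jet_idx (size J)) (jet_region \<phi> (V \<inter> V') (size J)) F"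
    and Feq: "\<And>\<sigma> x. \<sigma> \<in> sections_at E Q \<pi> x \<Longrightarrow> \<sigma> x \<in> V \<Longrightarrow> \<sigma> x \<in> V' \<Longrightarrow>
       pd_multi J (section_rep V' \<phi>' \<xi>' \<sigma> \<alpha>) (\<xi>' x) = F (section_jet V \<phi> \<xi> (size J) \<sigma> x)" by blast
  let ?k = "size J"
  let ?\<tau> = "base_transition V' \<xi>' \<xi>"
  note \<tau> = smooth_base_transition[OF c' c]
  note op = ropen_jet_region[OF c openin_adapted[OF c c']]
  note cQ = adaptedD(2)[OF c] and cQ' = adaptedD(2)[OF c']
  define F' where "F' z = (\<Sum>j\<in>UNIV. total_deriv ?k j F z * pd i (\<lambda>y. ?\<tau> y j) (base_transition V \<xi> \<xi>' (jet_base z)))" for z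
  have "smooth_on (jet_idx (Suc ?k)) (jet_region \<phi> (V \<inter> V') (Suc ?k)) F'"
    unfolding F'_def[abs_def]
  proof (intro smooth_on_sum smooth_on_mult finite_jet_idx op)
    fix j :: 'n
    show "smooth_on (jet_idx (Suc ?k)) (jet_region \<phi> (V \<inter> V') (Suc ?k)) (total_deriv ?k j F)"
      by (rule smooth_total_deriv[OF F op op order_refl jet_region_restrict])
    show "smooth_on (jet_idx (Suc ?k)) (jet_region \<phi> (V \<inter> V') (Suc ?k))
        (\<lambda>z. pd i (\<lambda>y. ?\<tau> y j) (base_transition V \<xi> \<xi>' (jet_base z)))"
    proof (rule smooth_comp_jet_base[OF c c'])
      have tm: "base_transition V \<xi> \<xi>' y = tuple_map UNIV (\<lambda>l y. base_transition V \<xi> \<xi>' y l) y" for y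
        by (simp add: fun_eq_iff)
      show "smooth_on UNIV (\<xi> ` (\<pi> ` V \<inter> \<pi> ` V')) (\<lambda>y. pd i (\<lambda>y. ?\<tau> y j) (base_transition V \<xi> \<xi>' y))"
      proof (subst tm, rule smooth_on_compose[OF finite finite _ \<tau>(1) smooth_on_pd[OF \<tau>(2) UNIV_I]])
        fix y assume "y \<in> \<xi> ` (\<pi> ` V \<inter> \<pi> ` V')"
        then obtain q where q: "q \<in> \<pi> ` V" "q \<in> \<pi> ` V'" "y = \<xi> q" by blast
        have "base_transition V \<xi> \<xi>' y = \<xi>' q"
          unfolding base_transition_def[OF c c'] q(3) Q.chart_inv[OF cQ q(1)] ..
        then show "tuple_map UNIV (\<lambda>l y. base_transition V \<xi> \<xi>' y l) y \<in> \<xi>' ` (\<pi> ` V' \<inter> \<pi> ` V)"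
          unfolding tm[symmetric] using q by blast
      qed (use smooth_base_transition[OF c c'] in auto)
    qed
  qed
  moreover have "pd_multi (add_mset i J) (section_rep V' \<phi>' \<xi>' \<sigma> \<alpha>) (\<xi>' x) = F' (section_jet V \<phi> \<xi> (Suc ?k) \<sigma> x)"
    if \<sigma>: "\<sigma> \<in> sections_at E Q \<pi> x" and V: "\<sigma> x \<in> V" "\<sigma> x \<in> V'" for \<sigma> x
  proof -
    let ?f = "section_rep V \<phi> \<xi> \<sigma>" and ?f' = "section_rep V' \<phi>' \<xi>' \<sigma>"
    obtain N' where N': "ropen UNIV N'" "\<xi>' x \<in> N'" "N' \<subseteq> \<xi>' ` \<pi> ` V'"
      and f': "\<And>\<alpha>. smooth_on UNIV N' (?f' \<alpha>)"
      and secV': "\<And>y. y \<in> N' \<Longrightarrow> \<sigma> (inv_into (\<pi> ` V') \<xi>' y) \<in> V'"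
      and sec': "\<And>y. y \<in> N' \<Longrightarrow> \<sigma> \<in> sections_at E Q \<pi> (inv_into (\<pi> ` V') \<xi>' y)"
      by (rule section_local[OF c' \<sigma> V(2)]) (rule that)
    obtain N0 where N0: "ropen UNIV N0" "\<xi> x \<in> N0" "N0 \<subseteq> \<xi> ` \<pi> ` V"
      and f0: "\<And>\<alpha>. smooth_on UNIV N0 (?f \<alpha>)"
      and secV: "\<And>y. y \<in> N0 \<Longrightarrow> \<sigma> (inv_into (\<pi> ` V) \<xi> y) \<in> V"
      and sec: "\<And>y. y \<in> N0 \<Longrightarrow> \<sigma> \<in> sections_at E Q \<pi> (inv_into (\<pi> ` V) \<xi> y)"
      by (rule section_local[OF c \<sigma> V(1)]) (rule that)
    \<comment> \<open>Shrink to a set of base points whose sections stay in both charts.\<close>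
    define S where "S = {q \<in> \<pi> ` V. \<xi> q \<in> N0} \<inter> {q \<in> \<pi> ` V'. \<xi>' q \<in> N'}"
    have S: "openin (mtop Q) S" unfolding S_def
      using Q.openin_chart_preimage[OF cQ, of N0] Q.openin_chart_preimage[OF cQ', of N'] N0(1) N'(1)
      by (intro openin_Int) simp_all
    have xS: "x \<in> S" using N0(2) N'(2) section_base[OF c \<sigma> V(1)] section_base[OF c' \<sigma> V(2)] by (simp add: S_def)
    have Sq: "\<sigma> \<in> sections_at E Q \<pi> q" "\<sigma> q \<in> V" "\<sigma> q \<in> V'" "q \<in> \<pi> ` V" "q \<in> \<pi> ` V'" if "q \<in> S" for q
      using that sec[of "\<xi> q"] secV[of "\<xi> q"] secV'[of "\<xi>' q"] Q.chart_inv[OF cQ, of q] Q.chart_inv[OF cQ', of q]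
      unfolding S_def by auto
    define N where "N = \<xi> ` (S \<inter> \<pi> ` V)"
    define M where "M = \<xi>' ` (S \<inter> \<pi> ` V')"
    have N: "ropen UNIV N" using Q.ropen_chart_image[OF S cQ] by (simp add: N_def)
    have M: "ropen UNIV M" using Q.ropen_chart_image[OF S cQ'] by (simp add: M_def)
    have "N \<subseteq> N0" by (auto simp: N_def S_def)
    then have f: "smooth_on UNIV N (?f \<alpha>)" for \<alpha> using f0 smooth_on_subset by blast
    have mapsN: "prolong ?k ?f y \<in> jet_region \<phi> (V \<inter> V') ?k" if y: "y \<in> N" for y
    proof -
      obtain q where "q \<in> S" "y = \<xi> q" using y by (auto simp: N_def)
      then show ?thesis using section_jet_region[OF c c' Sq(1-3)] by (simp add: section_jet_def)
    qed
    define g where "g y = F (prolong ?k ?f y)" for y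
    have g: "smooth_on UNIV N g" unfolding g_def[abs_def] by (rule smooth_prolong[OF N f op mapsN F])
    have tm: "?\<tau> y = tuple_map UNIV (\<lambda>l y. ?\<tau> y l) y" for y by (simp add: fun_eq_iff)
    have \<tau>M: "smooth_on UNIV M (\<lambda>y. ?\<tau> y l)" for l
      by (rule smooth_on_subset[OF \<tau>(2)]) (use Sq in \<open>auto simp: M_def\<close>)
    have \<tau>q: "?\<tau> (\<xi>' q) = \<xi> q" if "q \<in> S" for q
      unfolding base_transition_def[OF c' c] Q.chart_inv[OF cQ' Sq(5)[OF that]] ..
    have \<xi>'M: "\<xi>' x \<in> M" using xS Sq(5)[OF xS] by (auto simp: M_def)
    have "pd_multi (add_mset i J) (?f' \<alpha>) (\<xi>' x) = pd i (pd_multi J (?f' \<alpha>)) (\<xi>' x)"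
      by (rule pd_multi_add_mset[OF finite N'(1) f']) (use N'(2) in auto)
    also have "\<dots> = pd i (\<lambda>y. g (tuple_map UNIV (\<lambda>l y. ?\<tau> y l) y)) (\<xi>' x)"
    proof (rule pd_cong[OF finite M UNIV_I \<xi>'M])
      fix y assume "y \<in> M"
      then obtain q where q: "q \<in> S" "y = \<xi>' q" by (auto simp: M_def)
      show "pd_multi J (?f' \<alpha>) y = g (tuple_map UNIV (\<lambda>l y. ?\<tau> y l) y)"
        unfolding tm[symmetric] q(2) \<tau>q[OF q(1)] Feq[OF Sq(1-3)[OF q(1)]]
        by (simp add: g_def section_jet_def)
    qed
    also have "\<dots> = (\<Sum>j\<in>UNIV. pd j g (tuple_map UNIV (\<lambda>l y. ?\<tau> y l) (\<xi>' x)) * pd i (\<lambda>y. ?\<tau> y j) (\<xi>' x))"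
    proof (rule pd_compose_smooth[OF finite finite M N g \<tau>M _ UNIV_I \<xi>'M])
      fix y assume "y \<in> M"
      then obtain q where q: "q \<in> S" "y = \<xi>' q" by (auto simp: M_def)
      show "tuple_map UNIV (\<lambda>l y. ?\<tau> y l) y \<in> N"
        unfolding tm[symmetric] q(2) \<tau>q[OF q(1)] using q(1) Sq(4)[OF q(1)] by (auto simp: N_def)
    qed
    also have "\<dots> = F' (section_jet V \<phi> \<xi> (Suc ?k) \<sigma> x)"
    proof -
      have xN: "\<xi> x \<in> N" using xS Sq(4)[OF xS] by (auto simp: N_def)
      have "base_transition V \<xi> \<xi>' (\<xi> x) = \<xi>' x"
        unfolding base_transition_def[OF c c'] Q.chart_inv[OF cQ Sq(4)[OF xS]] ..
      moreover have "pd j g (\<xi> x) = total_deriv ?k j F (section_jet V \<phi> \<xi> (Suc ?k) \<sigma> x)" for j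
        unfolding g_def[abs_def] section_jet_def by (rule pd_prolong[OF N f op mapsN F xN order_refl])
      ultimately show ?thesis
        unfolding F'_def jet_base_section_jet[OF c \<sigma> V(1)] tm[symmetric] \<tau>q[OF xS] by simp
    qed
    finally show ?thesis .
  qed
  ultimately show ?case by (intro exI[of _ F'] conjI) auto
qed

end

section \<open>The jet bundle as a manifold\<close>

context fibred
begin

lemma section_jet_chart_independent:
  assumes c: "adapted V \<phi> \<xi>" and c': "adapted V' \<phi>' \<xi>'"
    and \<sigma>: "\<sigma> \<in> sections_at E Q \<pi> x" and \<tau>: "\<tau> \<in> sections_at E Q \<pi> x"
    and V: "\<sigma> x \<in> V" "\<sigma> x \<in> V'" and x: "\<sigma> x = \<tau> x"
    and eq: "section_jet V \<phi> \<xi> r \<sigma> x = section_jet V \<phi> \<xi> r \<tau> x"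
  shows "section_jet V' \<phi>' \<xi>' r \<sigma> x = section_jet V' \<phi>' \<xi>' r \<tau> x"
proof -
  have "pd_multi J (section_rep V' \<phi>' \<xi>' \<sigma> \<alpha>) (\<xi>' x) = pd_multi J (section_rep V' \<phi>' \<xi>' \<tau> \<alpha>) (\<xi>' x)"
    if J: "size J \<le> r" for \<alpha> J
  proof -
    obtain F where F: "\<And>\<sigma> x. \<sigma> \<in> sections_at E Q \<pi> x \<Longrightarrow> \<sigma> x \<in> V \<Longrightarrow> \<sigma> x \<in> V' \<Longrightarrow>
       pd_multi J (section_rep V' \<phi>' \<xi>' \<sigma> \<alpha>) (\<xi>' x) = F (section_jet V \<phi> \<xi> (size J) \<sigma> x)"
      using jet_transition_exists[OF c c', of J \<alpha>] by blast
    have "section_jet V \<phi> \<xi> (size J) \<sigma> x = section_jet V \<phi> \<xi> (size J) \<tau> x"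
      using arg_cong[OF eq, of "\<lambda>z. restrict z (jet_idx (size J))"] J
      by (simp add: restrict_section_jet[OF c \<sigma> V(1)] restrict_section_jet[OF c \<tau>] V(1) flip: x)
    then show ?thesis using F[OF \<sigma> V] F[OF \<tau>] V x by simp
  qed
  then show ?thesis by (simp add: section_jet_def prolong_eq_iff)
qed

lemma jet_equiv_iff:
  assumes c: "adapted V \<phi> \<xi>" and V: "\<sigma> x \<in> V"
  shows "jet_equiv E Q \<pi> r x \<sigma> \<tau> \<longleftrightarrow> \<sigma> \<in> sections_at E Q \<pi> x \<and> \<tau> \<in> sections_at E Q \<pi> x \<and>
    \<sigma> x = \<tau> x \<and> section_jet V \<phi> \<xi> r \<sigma> x = section_jet V \<phi> \<xi> r \<tau> x"
proof -
  have *: "(\<forall>\<alpha> J. size J \<le> r \<longrightarrow> section_deriv \<pi> (V', \<phi>', \<xi>') \<sigma> \<alpha> J x = section_deriv \<pi> (V', \<phi>', \<xi>') \<tau> \<alpha> J x)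
      \<longleftrightarrow> section_jet V' \<phi>' \<xi>' r \<sigma> x = section_jet V' \<phi>' \<xi>' r \<tau> x" for V' \<phi>' \<xi>'
    by (simp add: section_deriv_eq section_jet_def prolong_eq_iff)
  show ?thesis
  proof
    assume e: "jet_equiv E Q \<pi> r x \<sigma> \<tau>"
    then obtain c' where s: "\<sigma> \<in> sections_at E Q \<pi> x" "\<tau> \<in> sections_at E Q \<pi> x" "\<sigma> x = \<tau> x"
      and c': "c' \<in> adapted_charts E Q \<pi>" "\<sigma> x \<in> fst c'"
        "\<forall>\<alpha> J. size J \<le> r \<longrightarrow> section_deriv \<pi> c' \<sigma> \<alpha> J x = section_deriv \<pi> c' \<tau> \<alpha> J x"
      unfolding jet_equiv_def by blast
    obtain V' \<phi>' \<xi>' where d: "c' = (V', \<phi>', \<xi>')" by (cases c') auto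
    have "section_jet V \<phi> \<xi> r \<sigma> x = section_jet V \<phi> \<xi> r \<tau> x"
      by (rule section_jet_chart_independent[OF _ c s(1,2) _ V s(3)]) (use c' d * in auto)
    then show "\<sigma> \<in> sections_at E Q \<pi> x \<and> \<tau> \<in> sections_at E Q \<pi> x \<and>
      \<sigma> x = \<tau> x \<and> section_jet V \<phi> \<xi> r \<sigma> x = section_jet V \<phi> \<xi> r \<tau> x" using s by blast
  next
    assume a: "\<sigma> \<in> sections_at E Q \<pi> x \<and> \<tau> \<in> sections_at E Q \<pi> x \<and>
      \<sigma> x = \<tau> x \<and> section_jet V \<phi> \<xi> r \<sigma> x = section_jet V \<phi> \<xi> r \<tau> x"
    then show "jet_equiv E Q \<pi> r x \<sigma> \<tau>"
      unfolding jet_equiv_def using c V *[of V \<phi> \<xi>] by (intro conjI bexI[of _ "(V, \<phi>, \<xi>)"]) auto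
  qed
qed

lemma section_adaptedE:
  assumes "\<sigma> \<in> sections_at E Q \<pi> x"
  obtains V \<phi> \<xi> where "adapted V \<phi> \<xi>" "\<sigma> x \<in> V"
  using adapted_chart_exists[OF sections_atD(3)[OF assms]] by blast

lemma jet_eq_iff:
  assumes "\<sigma> \<in> sections_at E Q \<pi> x" "\<tau> \<in> sections_at E Q \<pi> y"
  shows "jet E Q \<pi> r x \<sigma> = jet E Q \<pi> r y \<tau> \<longleftrightarrow> x = y \<and> jet_equiv E Q \<pi> r x \<sigma> \<tau>"
proof -
  obtain V \<phi> \<xi> where c: "adapted V \<phi> \<xi>" "\<sigma> x \<in> V" by (rule section_adaptedE[OF assms(1)])
  note e = jet_equiv_iff[OF c(1)]
  show ?thesis
  proof
    assume eq: "jet E Q \<pi> r x \<sigma> = jet E Q \<pi> r y \<tau>"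
    then have xy: "x = y" and sets: "{\<tau>. jet_equiv E Q \<pi> r x \<sigma> \<tau>} = {\<sigma>. jet_equiv E Q \<pi> r y \<tau> \<sigma>}"
      by (auto simp: jet_def)
    have "jet_equiv E Q \<pi> r x \<sigma> \<sigma>" using e[of \<sigma> x] c(2) assms(1) by simp
    then have *: "jet_equiv E Q \<pi> r y \<tau> \<sigma>" using sets by blast
    then have "\<tau> y \<in> V" using c(2) xy by (simp add: jet_equiv_def)
    then show "x = y \<and> jet_equiv E Q \<pi> r x \<sigma> \<tau>" using * e[of \<tau> y] e[of \<sigma> x] c(2) xy by simp
  next
    assume a: "x = y \<and> jet_equiv E Q \<pi> r x \<sigma> \<tau>"
    then have "\<tau> y \<in> V" using c(2) by (auto simp: jet_equiv_def)
    then have "jet_equiv E Q \<pi> r x \<sigma> \<rho> \<longleftrightarrow> jet_equiv E Q \<pi> r y \<tau> \<rho>" for \<rho>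
      using a e[of \<sigma> x] e[of \<tau> y] c(2) by auto
    then show "jet E Q \<pi> r x \<sigma> = jet E Q \<pi> r y \<tau>" using a by (simp add: jet_def)
  qed
qed

abbreviation JM :: "nat \<Rightarrow> (('e, 'q) jet, ('n, 'm) jet_index) mfd"
  where "JM r \<equiv> jet_manifold E Q \<pi> r"

lemma idx_JM [simp]: "idx (JM r) = jet_idx r"
  by (simp add: jet_manifold_def)

lemma fst_jet [simp]: "fst (jet E Q \<pi> r x \<sigma>) = x"
  by (simp add: jet_def)

lemma jet_rep_equiv:
  assumes "\<sigma> \<in> sections_at E Q \<pi> x"
  shows "jet_equiv E Q \<pi> r x \<sigma> (jet_rep (jet E Q \<pi> r x \<sigma>))"
proof -
  obtain V \<phi> \<xi> where c: "adapted V \<phi> \<xi>" "\<sigma> x \<in> V" by (rule section_adaptedE[OF assms])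
  have "\<sigma> \<in> snd (jet E Q \<pi> r x \<sigma>)"
    using jet_equiv_iff[where \<sigma> = \<sigma> and x = x, OF c, of r \<sigma>] assms by (simp add: jet_def)
  then have "jet_rep (jet E Q \<pi> r x \<sigma>) \<in> snd (jet E Q \<pi> r x \<sigma>)"
    unfolding jet_rep_def by (rule someI[where P = "\<lambda>\<sigma>'. \<sigma>' \<in> snd (jet E Q \<pi> r x \<sigma>)"])
  then show ?thesis by (simp add: jet_def)
qed

lemma jet_rep_section:
  assumes "\<sigma> \<in> sections_at E Q \<pi> x"
  shows "jet_rep (jet E Q \<pi> r x \<sigma>) \<in> sections_at E Q \<pi> x" "jet_rep (jet E Q \<pi> r x \<sigma>) x = \<sigma> x"
  using jet_rep_equiv[OF assms, of r] by (auto simp: jet_equiv_def)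

lemma jet_coords_jet:
  assumes c: "adapted V \<phi> \<xi>" and \<sigma>: "\<sigma> \<in> sections_at E Q \<pi> x" "\<sigma> x \<in> V"
  shows "jet_coords \<pi> r (V, \<phi>, \<xi>) (jet E Q \<pi> r x \<sigma>) = section_jet V \<phi> \<xi> r \<sigma> x"
proof -
  let ?p = "jet E Q \<pi> r x \<sigma>"
  have "jet_coords \<pi> r (V, \<phi>, \<xi>) ?p = section_jet V \<phi> \<xi> r (jet_rep ?p) x"
  proof (rule tuples_eqI[of _ "jet_idx r"])
    show "jet_coords \<pi> r (V, \<phi>, \<xi>) ?p \<in> tuples (jet_idx r)" by (simp add: jet_coords_def)
    fix l :: "('n, 'm) jet_index" assume "l \<in> jet_idx r"
    then show "jet_coords \<pi> r (V, \<phi>, \<xi>) ?p l = section_jet V \<phi> \<xi> r (jet_rep ?p) x l"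
      by (elim jet_idxE) (simp_all add: jet_coords_def section_jet_def section_deriv_eq)
  qed simp
  also have "\<dots> = section_jet V \<phi> \<xi> r \<sigma> x"
    using jet_rep_equiv[OF \<sigma>(1), of r] jet_equiv_iff[where \<sigma> = \<sigma> and x = x, OF c \<sigma>(2), of r] by auto
  finally show ?thesis .
qed

lemma jet_domain_iff:
  assumes \<sigma>: "\<sigma> \<in> sections_at E Q \<pi> x"
  shows "jet E Q \<pi> r x \<sigma> \<in> jet_domain E Q \<pi> r c \<longleftrightarrow> \<sigma> x \<in> fst c"
proof
  assume "jet E Q \<pi> r x \<sigma> \<in> jet_domain E Q \<pi> r c"
  then obtain y \<tau> where "jet E Q \<pi> r x \<sigma> = jet E Q \<pi> r y \<tau>" "\<tau> \<in> sections_at E Q \<pi> y" "\<tau> y \<in> fst c"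
    by (auto simp: jet_domain_def)
  then show "\<sigma> x \<in> fst c" using jet_eq_iff[OF \<sigma>] by (metis jet_equiv_def)
next
  assume "\<sigma> x \<in> fst c"
  then show "jet E Q \<pi> r x \<sigma> \<in> jet_domain E Q \<pi> r c"
    using \<sigma> sections_atD(2)[OF \<sigma>] by (auto simp: jet_domain_def)
qed

lemma jet_domainE:
  assumes "p \<in> jet_domain E Q \<pi> r (V, \<phi>, \<xi>)"
  obtains x \<sigma> where "p = jet E Q \<pi> r x \<sigma>" "\<sigma> \<in> sections_at E Q \<pi> x" "\<sigma> x \<in> V"
  using assms by (auto simp: jet_domain_def)

lemma carrier_JM: "carrier (JM r) = {jet E Q \<pi> r x \<sigma> | x \<sigma>. \<sigma> \<in> sections_at E Q \<pi> x}"
proof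
  show "carrier (JM r) \<subseteq> {jet E Q \<pi> r x \<sigma> | x \<sigma>. \<sigma> \<in> sections_at E Q \<pi> x}"
    by (auto simp: carrier_def jet_manifold_def jet_domain_def)
  show "{jet E Q \<pi> r x \<sigma> | x \<sigma>. \<sigma> \<in> sections_at E Q \<pi> x} \<subseteq> carrier (JM r)"
  proof (rule subsetI, elim CollectE exE conjE)
    fix p x \<sigma> assume p: "p = jet E Q \<pi> r x \<sigma>" and \<sigma>: "\<sigma> \<in> sections_at E Q \<pi> x"
    obtain V \<phi> \<xi> where c: "adapted V \<phi> \<xi>" "\<sigma> x \<in> V" by (rule section_adaptedE[OF \<sigma>])
    then show "p \<in> carrier (JM r)"
      unfolding p using jet_domain_iff[OF \<sigma>, of r "(V, \<phi>, \<xi>)"] by (auto simp: carrier_def jet_manifold_def)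
  qed
qed

lemma jet_coords_image:
  assumes c: "adapted V \<phi> \<xi>" and c': "adapted V' \<phi>' \<xi>'"
  shows "jet_coords \<pi> r (V, \<phi>, \<xi>) ` (jet_domain E Q \<pi> r (V, \<phi>, \<xi>) \<inter> jet_domain E Q \<pi> r (V', \<phi>', \<xi>'))
     = jet_region \<phi> (V \<inter> V') r"
proof
  show "jet_coords \<pi> r (V, \<phi>, \<xi>) ` (jet_domain E Q \<pi> r (V, \<phi>, \<xi>) \<inter> jet_domain E Q \<pi> r (V', \<phi>', \<xi>'))
      \<subseteq> jet_region \<phi> (V \<inter> V') r"
  proof safe
    fix p assume p: "p \<in> jet_domain E Q \<pi> r (V, \<phi>, \<xi>)" "p \<in> jet_domain E Q \<pi> r (V', \<phi>', \<xi>')"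
    obtain x \<sigma> where \<sigma>: "p = jet E Q \<pi> r x \<sigma>" "\<sigma> \<in> sections_at E Q \<pi> x" "\<sigma> x \<in> V" by (rule jet_domainE[OF p(1)])
    then have V': "\<sigma> x \<in> V'" using p(2) jet_domain_iff[OF \<sigma>(2)] by simp
    show "jet_coords \<pi> r (V, \<phi>, \<xi>) p \<in> jet_region \<phi> (V \<inter> V') r"
      unfolding \<sigma>(1) jet_coords_jet[OF c \<sigma>(2,3)] by (rule section_jet_region[OF c c' \<sigma>(2,3) V'])
  qed
  show "jet_region \<phi> (V \<inter> V') r \<subseteq>
      jet_coords \<pi> r (V, \<phi>, \<xi>) ` (jet_domain E Q \<pi> r (V, \<phi>, \<xi>) \<inter> jet_domain E Q \<pi> r (V', \<phi>', \<xi>'))"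
  proof
    fix z assume z: "z \<in> jet_region \<phi> (V \<inter> V') r"
    then have z1: "z \<in> tuples (jet_idx r)" "jet_point z \<in> \<phi> ` V" by (auto simp: jet_region_def)
    obtain \<sigma> x where \<sigma>: "\<sigma> \<in> sections_at E Q \<pi> x" "\<sigma> x \<in> V" "section_jet V \<phi> \<xi> r \<sigma> x = z"
      by (rule section_jet_realize[OF c z1]) (rule that)
    obtain e where e: "e \<in> V" "e \<in> V'" "jet_point z = \<phi> e" using z by (auto simp: jet_region_def)
    have "\<phi> (\<sigma> x) = \<phi> e" using jet_point_section_jet[OF c \<sigma>(1,2), of r] \<sigma>(3) e(3) by simp
    then have "\<sigma> x = e" using inj_onD[OF E.chartD(2)[OF adaptedD(1)[OF c]]] \<sigma>(2) e(1) by blast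
    then show "z \<in> jet_coords \<pi> r (V, \<phi>, \<xi>) ` (jet_domain E Q \<pi> r (V, \<phi>, \<xi>) \<inter> jet_domain E Q \<pi> r (V', \<phi>', \<xi>'))"
      using jet_domain_iff[OF \<sigma>(1)] \<sigma>(2) e(2) jet_coords_jet[OF c \<sigma>(1,2), of r] \<sigma>(3)
      by (intro image_eqI[of _ _ "jet E Q \<pi> r x \<sigma>"]) auto
  qed
qed

lemma jet_coords_image_domain:
  "adapted V \<phi> \<xi> \<Longrightarrow> jet_coords \<pi> r (V, \<phi>, \<xi>) ` jet_domain E Q \<pi> r (V, \<phi>, \<xi>) = jet_region \<phi> V r"
  using jet_coords_image[of V \<phi> \<xi> V \<phi> \<xi> r] by simp

lemma inj_jet_coords:
  assumes c: "adapted V \<phi> \<xi>"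
  shows "inj_on (jet_coords \<pi> r (V, \<phi>, \<xi>)) (jet_domain E Q \<pi> r (V, \<phi>, \<xi>))"
proof (rule inj_onI)
  fix p q assume p: "p \<in> jet_domain E Q \<pi> r (V, \<phi>, \<xi>)" and q: "q \<in> jet_domain E Q \<pi> r (V, \<phi>, \<xi>)"
    and eq: "jet_coords \<pi> r (V, \<phi>, \<xi>) p = jet_coords \<pi> r (V, \<phi>, \<xi>) q"
  obtain x \<sigma> where \<sigma>: "p = jet E Q \<pi> r x \<sigma>" "\<sigma> \<in> sections_at E Q \<pi> x" "\<sigma> x \<in> V" by (rule jet_domainE[OF p])
  obtain y \<tau> where \<tau>: "q = jet E Q \<pi> r y \<tau>" "\<tau> \<in> sections_at E Q \<pi> y" "\<tau> y \<in> V" by (rule jet_domainE[OF q])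
  have e: "section_jet V \<phi> \<xi> r \<sigma> x = section_jet V \<phi> \<xi> r \<tau> y"
    using eq \<sigma> \<tau> jet_coords_jet[OF c] by simp
  have "\<phi> (\<sigma> x) = \<phi> (\<tau> y)"
    using arg_cong[OF e, of jet_point] jet_point_section_jet[OF c \<sigma>(2,3)] jet_point_section_jet[OF c \<tau>(2,3)] by simp
  then have st: "\<sigma> x = \<tau> y" using inj_onD[OF E.chartD(2)[OF adaptedD(1)[OF c]]] \<sigma>(3) \<tau>(3) by blast
  then have xy: "x = y" using sections_atD(1)[OF \<sigma>(2)] sections_atD(1)[OF \<tau>(2)] by simp
  then show "p = q"
    unfolding \<sigma>(1) \<tau>(1) jet_eq_iff[OF \<sigma>(2) \<tau>(2)]
    using jet_equiv_iff[where \<sigma> = \<sigma> and x = x, OF c \<sigma>(3)] \<sigma>(2) \<tau>(2) st e by simp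
qed

text \<open>
  The transition function of a jet coordinate of order \<open>s\<close> is a function of jets of order \<open>s\<close>,
  and the same one for all jet bundles of order at least \<open>s\<close>.
\<close>

definition jet_transition where
  "jet_transition V \<phi> \<xi> V' \<phi>' \<xi>' \<alpha> J = (SOME F. smooth_on (jet_idx (size J)) (jet_region \<phi> (V \<inter> V') (size J)) F \<and>
    (\<forall>\<sigma> x. \<sigma> \<in> sections_at E Q \<pi> x \<longrightarrow> \<sigma> x \<in> V \<longrightarrow> \<sigma> x \<in> V' \<longrightarrow>
       pd_multi J (section_rep V' \<phi>' \<xi>' \<sigma> \<alpha>) (\<xi>' x) = F (section_jet V \<phi> \<xi> (size J) \<sigma> x)))"

lemma jet_transition:
  assumes c: "adapted V \<phi> \<xi>" and c': "adapted V' \<phi>' \<xi>'"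
  shows "smooth_on (jet_idx (size J)) (jet_region \<phi> (V \<inter> V') (size J)) (jet_transition V \<phi> \<xi> V' \<phi>' \<xi>' \<alpha> J)"
    and "\<sigma> \<in> sections_at E Q \<pi> x \<Longrightarrow> \<sigma> x \<in> V \<Longrightarrow> \<sigma> x \<in> V' \<Longrightarrow>
      pd_multi J (section_rep V' \<phi>' \<xi>' \<sigma> \<alpha>) (\<xi>' x) =
        jet_transition V \<phi> \<xi> V' \<phi>' \<xi>' \<alpha> J (section_jet V \<phi> \<xi> (size J) \<sigma> x)"
  using someI_ex[OF jet_transition_exists[OF c c', of J \<alpha>]] unfolding jet_transition_def by blast+

lemma jet_coords_transition:
  assumes c: "adapted V \<phi> \<xi>" and c': "adapted V' \<phi>' \<xi>'"
    and p: "p \<in> jet_domain E Q \<pi> r (V, \<phi>, \<xi>)" "p \<in> jet_domain E Q \<pi> r (V', \<phi>', \<xi>')"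
  shows "jet_coords \<pi> r (V', \<phi>', \<xi>') p (Inl i) = base_transition V \<xi> \<xi>' (jet_base (jet_coords \<pi> r (V, \<phi>, \<xi>) p)) i"
    and "size J \<le> r \<Longrightarrow> jet_coords \<pi> r (V', \<phi>', \<xi>') p (Inr (\<alpha>, J)) =
       jet_transition V \<phi> \<xi> V' \<phi>' \<xi>' \<alpha> J (restrict (jet_coords \<pi> r (V, \<phi>, \<xi>) p) (jet_idx (size J)))"
proof -
  obtain x \<sigma> where \<sigma>: "p = jet E Q \<pi> r x \<sigma>" "\<sigma> \<in> sections_at E Q \<pi> x" "\<sigma> x \<in> V" by (rule jet_domainE[OF p(1)])
  then have V': "\<sigma> x \<in> V'" using p(2) jet_domain_iff[OF \<sigma>(2)] by simp
  note z = jet_coords_jet[OF c \<sigma>(2,3)] and z' = jet_coords_jet[OF c' \<sigma>(2) V']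
  show "jet_coords \<pi> r (V', \<phi>', \<xi>') p (Inl i) = base_transition V \<xi> \<xi>' (jet_base (jet_coords \<pi> r (V, \<phi>, \<xi>) p)) i"
    unfolding \<sigma>(1) z z' jet_base_section_jet[OF c \<sigma>(2,3)] base_transition_def[OF c c'] inv_base[OF c \<sigma>(2,3)]
    by (simp add: section_jet_def)
  show "jet_coords \<pi> r (V', \<phi>', \<xi>') p (Inr (\<alpha>, J)) =
       jet_transition V \<phi> \<xi> V' \<phi>' \<xi>' \<alpha> J (restrict (jet_coords \<pi> r (V, \<phi>, \<xi>) p) (jet_idx (size J)))"
    if J: "size J \<le> r"
    unfolding \<sigma>(1) z z' restrict_section_jet[OF c \<sigma>(2,3) J] jet_transition(2)[OF c c' \<sigma>(2,3) V', symmetric]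
    using J by (simp add: section_jet_def)
qed

lemma atlas_manifold_JM: "atlas_manifold (JM r)"
proof
  show "finite (idx (JM r))" by simp
next
  fix d assume "d \<in> atlas (JM r)"
  then obtain V \<phi> \<xi> where c: "adapted V \<phi> \<xi>" "d = (jet_domain E Q \<pi> r (V, \<phi>, \<xi>), jet_coords \<pi> r (V, \<phi>, \<xi>))"
    by (auto simp: jet_manifold_def)
  show "is_chart (idx (JM r)) d"
    using inj_jet_coords[OF c(1)] ropen_jet_region[OF c(1) openin_adapted[OF c(1) c(1)]] jet_coords_image_domain[OF c(1)]
    by (simp add: c(2) is_chart_def)
next
  have tr: "smooth_transition (jet_idx r) (jet_domain E Q \<pi> r (V, \<phi>, \<xi>), jet_coords \<pi> r (V, \<phi>, \<xi>))
      (jet_domain E Q \<pi> r (V', \<phi>', \<xi>'), jet_coords \<pi> r (V', \<phi>', \<xi>'))"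
    if c: "adapted V \<phi> \<xi>" and c': "adapted V' \<phi>' \<xi>'" for V \<phi> \<xi> V' \<phi>' \<xi>'
  proof -
    note op = ropen_jet_region[OF c openin_adapted[OF c c']]
    let ?D = "jet_domain E Q \<pi> r (V, \<phi>, \<xi>)" and ?X = "jet_coords \<pi> r (V, \<phi>, \<xi>)"
    let ?D' = "jet_domain E Q \<pi> r (V', \<phi>', \<xi>')" and ?X' = "jet_coords \<pi> r (V', \<phi>', \<xi>')"
    have inv: "inv_into ?D ?X z \<in> ?D \<inter> ?D' \<and> ?X (inv_into ?D ?X z) = z" if z: "z \<in> jet_region \<phi> (V \<inter> V') r" for z
    proof -
      obtain p where p: "p \<in> ?D" "p \<in> ?D'" "z = ?X p" using z jet_coords_image[OF c c', of r] by blast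
      then have "inv_into ?D ?X z = p" using inj_jet_coords[OF c] by simp
      then show ?thesis using p by simp
    qed
    have "smooth_on (jet_idx r) (jet_region \<phi> (V \<inter> V') r) (\<lambda>z. ?X' (inv_into ?D ?X z) l)" if l: "l \<in> jet_idx r" for l
      using l
    proof (cases rule: jet_idxE)
      case (1 i)
      have "smooth_on (jet_idx r) (jet_region \<phi> (V \<inter> V') r) (\<lambda>z. base_transition V \<xi> \<xi>' (jet_base z) i)"
        by (rule smooth_comp_jet_base[OF c c' smooth_base_transition(2)[OF c c']])
      then show ?thesis
      proof (rule smooth_on_cong[OF finite_jet_idx op])
        fix z assume "z \<in> jet_region \<phi> (V \<inter> V') r"
        from inv[OF this] show "base_transition V \<xi> \<xi>' (jet_base z) i = ?X' (inv_into ?D ?X z) l"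
          using jet_coords_transition(1)[OF c c', of "inv_into ?D ?X z" r i] 1 by simp
      qed
    next
      case (2 \<alpha> J)
      have "smooth_on (jet_idx r) (jet_region \<phi> (V \<inter> V') r)
          (\<lambda>z. jet_transition V \<phi> \<xi> V' \<phi>' \<xi>' \<alpha> J (restrict z (jet_idx (size J))))"
        unfolding restrict_tuple_map
      proof (rule smooth_on_compose[OF finite_jet_idx finite_jet_idx op op jet_transition(1)[OF c c']])
        show "smooth_on (jet_idx r) (jet_region \<phi> (V \<inter> V') r) (\<lambda>z. z l)" if "l \<in> jet_idx (size J)" for l
          using that jet_idx_mono[OF 2(2)] by (intro smooth_on_coord[OF finite_jet_idx op]) blast
      qed (simp add: jet_region_restrict flip: restrict_tuple_map)
      then show ?thesis
      proof (rule smooth_on_cong[OF finite_jet_idx op])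
        fix z assume "z \<in> jet_region \<phi> (V \<inter> V') r"
        from inv[OF this] show "jet_transition V \<phi> \<xi> V' \<phi>' \<xi>' \<alpha> J (restrict z (jet_idx (size J))) = ?X' (inv_into ?D ?X z) l"
          using jet_coords_transition(2)[OF c c' _ _ 2(2), of "inv_into ?D ?X z" \<alpha>] 2 by simp
      qed
    qed
    then show ?thesis using op by (simp add: smooth_transition_def jet_coords_image[OF c c'])
  qed
  fix d d' assume "d \<in> atlas (JM r)" "d' \<in> atlas (JM r)"
  then show "compatible_charts (idx (JM r)) d d'"
    unfolding compatible_charts_def by (auto simp: jet_manifold_def intro: tr)
qed

sublocale J: atlas_manifold "JM r" for r by (rule atlas_manifold_JM)

lemma jet_chart:
  "adapted V \<phi> \<xi> \<Longrightarrow> (jet_domain E Q \<pi> r (V, \<phi>, \<xi>), jet_coords \<pi> r (V, \<phi>, \<xi>)) \<in> charts (JM r)"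
  using J.atlas_subset_charts[of r] by (auto simp: jet_manifold_def)

definition jet_value :: "('e, 'q) jet \<Rightarrow> 'e" where "jet_value p = jet_rep p (fst p)"

lemma jet_value_jet: "\<sigma> \<in> sections_at E Q \<pi> x \<Longrightarrow> jet_value (jet E Q \<pi> r x \<sigma>) = \<sigma> x"
  by (simp add: jet_value_def jet_rep_section)

lemma jet_domain_eq: "jet_domain E Q \<pi> r (V, \<phi>, \<xi>) = {p \<in> carrier (JM r). jet_value p \<in> V}"
  using jet_domain_iff by (auto simp: carrier_JM jet_value_jet elim!: jet_domainE)

lemma openin_jet_value:
  assumes U: "openin (mtop E) U" shows "openin (mtop (JM r)) {p \<in> carrier (JM r). jet_value p \<in> U}"
  unfolding J.openin_mtop_iff
proof (intro conjI ballI, safe)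
  fix D X assume "(D, X) \<in> atlas (JM r)"
  then obtain V \<phi> \<xi> where c: "adapted V \<phi> \<xi>" and D: "D = jet_domain E Q \<pi> r (V, \<phi>, \<xi>)" "X = jet_coords \<pi> r (V, \<phi>, \<xi>)"
    by (auto simp: jet_manifold_def)
  have "X ` ({p \<in> carrier (JM r). jet_value p \<in> U} \<inter> D) = jet_region \<phi> (V \<inter> U) r"
  proof
    show "X ` ({p \<in> carrier (JM r). jet_value p \<in> U} \<inter> D) \<subseteq> jet_region \<phi> (V \<inter> U) r"
    proof safe
      fix p assume p: "p \<in> D" "jet_value p \<in> U"
      obtain x \<sigma> where \<sigma>: "p = jet E Q \<pi> r x \<sigma>" "\<sigma> \<in> sections_at E Q \<pi> x" "\<sigma> x \<in> V"
        by (rule jet_domainE[OF p(1)[unfolded D(1)]])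
      show "X p \<in> jet_region \<phi> (V \<inter> U) r"
        using p(2) \<sigma>(3) unfolding D(2) \<sigma>(1) jet_coords_jet[OF c \<sigma>(2,3)]
        by (simp add: jet_region_def jet_point_section_jet[OF c \<sigma>(2,3)] jet_value_jet[OF \<sigma>(2)])
    qed
    show "jet_region \<phi> (V \<inter> U) r \<subseteq> X ` ({p \<in> carrier (JM r). jet_value p \<in> U} \<inter> D)"
    proof
      fix z assume z: "z \<in> jet_region \<phi> (V \<inter> U) r"
      then have z1: "z \<in> tuples (jet_idx r)" "jet_point z \<in> \<phi> ` V" by (auto simp: jet_region_def)
      obtain \<sigma> x where \<sigma>: "\<sigma> \<in> sections_at E Q \<pi> x" "\<sigma> x \<in> V" "section_jet V \<phi> \<xi> r \<sigma> x = z"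
        by (rule section_jet_realize[OF c z1]) (rule that)
      obtain e where e: "e \<in> V" "e \<in> U" "jet_point z = \<phi> e" using z by (auto simp: jet_region_def)
      have "\<phi> (\<sigma> x) = \<phi> e" using jet_point_section_jet[OF c \<sigma>(1,2), of r] \<sigma>(3) e(3) by simp
      then have "\<sigma> x = e" using inj_onD[OF E.chartD(2)[OF adaptedD(1)[OF c]]] \<sigma>(2) e(1) by blast
      then show "z \<in> X ` ({p \<in> carrier (JM r). jet_value p \<in> U} \<inter> D)"
        unfolding D using \<sigma> e(2) jet_coords_jet[OF c \<sigma>(1,2), of r]
        by (intro image_eqI[of _ _ "jet E Q \<pi> r x \<sigma>"]) (auto simp: jet_domain_eq jet_value_jet carrier_JM)
    qed
  qed
  then show "ropen (idx (JM r)) (X ` ({p \<in> carrier (JM r). jet_value p \<in> U} \<inter> D))"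
    using ropen_jet_region[OF c U] by simp
qed

lemma jet_value_carrier: "p \<in> carrier (JM r) \<Longrightarrow> jet_value p \<in> carrier E"
  by (auto simp: carrier_JM jet_value_jet sections_atD)

lemma carrier_JM_chartE:
  assumes "p \<in> carrier (JM r)"
  obtains V \<phi> \<xi> where "adapted V \<phi> \<xi>" "p \<in> jet_domain E Q \<pi> r (V, \<phi>, \<xi>)"
proof -
  obtain V \<phi> \<xi> where "adapted V \<phi> \<xi>" "jet_value p \<in> V"
    by (rule adapted_chart_exists[OF jet_value_carrier[OF assms]]) (rule that)
  then show ?thesis using assms that by (simp add: jet_domain_eq)
qed

text \<open>
  Jets with distinct values are separated by neighbourhoods of these in \<open>E\<close>; jets
  with the same value lie in a common chart.
\<close>

lemma Hausdorff_JM: "Hausdorff_space (mtop (JM r))"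
  unfolding Hausdorff_space_def
proof (intro allI impI)
  fix p q assume "p \<in> topspace (mtop (JM r)) \<and> q \<in> topspace (mtop (JM r)) \<and> p \<noteq> q"
  then have pq: "p \<in> carrier (JM r)" "q \<in> carrier (JM r)" "p \<noteq> q" by (simp_all add: J.topspace_mtop)
  show "\<exists>U V. openin (mtop (JM r)) U \<and> openin (mtop (JM r)) V \<and> p \<in> U \<and> q \<in> V \<and> disjnt U V"
  proof (cases "jet_value p = jet_value q")
    case False
    have "Hausdorff_space (mtop E)" using smooth_EQ(1) by (simp add: smooth_manifold_def)
    then obtain U V where U: "openin (mtop E) U" "openin (mtop E) V" "jet_value p \<in> U" "jet_value q \<in> V" "disjnt U V"
      using False jet_value_carrier pq(1,2) unfolding Hausdorff_space_def E.topspace_mtop by metis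
    show ?thesis
      using openin_jet_value[OF U(1), of r] openin_jet_value[OF U(2), of r] U(3-5) pq
      by (intro exI[of _ "{p \<in> carrier (JM r). jet_value p \<in> U}"] exI[of _ "{p \<in> carrier (JM r). jet_value p \<in> V}"])
        (auto simp: disjnt_def)
  next
    case True
    obtain V \<phi> \<xi> where c: "adapted V \<phi> \<xi>" "p \<in> jet_domain E Q \<pi> r (V, \<phi>, \<xi>)" using pq(1) by (rule carrier_JM_chartE)
    let ?D = "jet_domain E Q \<pi> r (V, \<phi>, \<xi>)" and ?X = "jet_coords \<pi> r (V, \<phi>, \<xi>)"
    have q: "q \<in> ?D" using c(2) True pq(2) by (simp add: jet_domain_eq)
    note ch = jet_chart[OF c(1), of r]
    have ne: "?X p \<noteq> ?X q" using inj_onD[OF inj_jet_coords[OF c(1)] _ c(2) q] pq(3) by blast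
    have "Hausdorff_space (powertop_real (jet_idx r :: ('n, 'm) jet_index set))"
      by (simp add: Hausdorff_space_product_topology)
    then obtain A B where AB: "ropen (jet_idx r) A" "ropen (jet_idx r) B" "?X p \<in> A" "?X q \<in> B" "disjnt A B"
      using ne J.chart_tuples[OF ch c(2)] J.chart_tuples[OF ch q] unfolding Hausdorff_space_def
      by (metis idx_JM topspace_powertop_real)
    show ?thesis
      using J.openin_chart_preimage[OF ch, of A] J.openin_chart_preimage[OF ch, of B] AB c(2) q
      by (intro exI[of _ "{p \<in> ?D. ?X p \<in> A}"] exI[of _ "{p \<in> ?D. ?X p \<in> B}"]) (auto simp: disjnt_def)
  qed
qed

end

lemma rational_boxes:
  fixes I :: "'i set"
  assumes "finite I"
  obtains \<B> where "countable \<B>" "\<And>B. B \<in> \<B> \<Longrightarrow> ropen I B"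
    "\<And>W x. ropen I W \<Longrightarrow> x \<in> W \<Longrightarrow> \<exists>B\<in>\<B>. x \<in> B \<and> B \<subseteq> W"
proof -
  define \<B> where "\<B> = (\<lambda>(a, n). rbox I a (1 / real (Suc n))) ` (PiE I (\<lambda>_. \<rat>) \<times> UNIV)"
  show ?thesis
  proof (rule that[of \<B>])
    have "countable (PiE I (\<lambda>_. \<rat> :: real set))" using assms by (intro countable_PiE countable_rat)
    then show "countable \<B>" unfolding \<B>_def by (intro countable_image countable_SIGMA) auto
    show "ropen I B" if "B \<in> \<B>" for B using that ropen_rbox[OF assms] by (auto simp: \<B>_def)
    fix W x assume W: "ropen I W" "x \<in> W"
    obtain e where e: "e > 0" "\<And>y. y \<in> tuples I \<Longrightarrow> (\<And>i. i \<in> I \<Longrightarrow> \<bar>y i - x i\<bar> < e) \<Longrightarrow> y \<in> W"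
      using ropen_boxE[OF assms W] by metis
    obtain n where n: "1 / real (Suc n) < e / 2"
      using e(1) nat_approx_posE[of "e / 2"] by auto
    define d where "d = 1 / real (Suc n)"
    have d: "d > 0" by (simp add: d_def)
    have "\<exists>q\<in>\<rat>. x i < q \<and> q < x i + d" for i using Rats_dense_in_real[of "x i" "x i + d"] d by auto
    then obtain q where q: "\<And>i. q i \<in> \<rat>" "\<And>i. x i < q i" "\<And>i. q i < x i + d" by metis
    let ?B = "rbox I (restrict q I) d"
    have "?B \<in> \<B>"
      unfolding \<B>_def d_def using q(1) by (intro image_eqI[of _ _ "(restrict q I, n)"]) auto
    moreover have "\<bar>x i - q i\<bar> < d" for i using q(2)[of i] q(3)[of i] by linarith
    then have "x \<in> ?B" using W ropen_subset_tuples[OF W(1)] by (auto simp: rbox_def)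
    moreover have "?B \<subseteq> W"
    proof
      fix y assume y: "y \<in> ?B"
      show "y \<in> W"
      proof (rule e(2))
        show "y \<in> tuples I" using y by (simp add: rbox_def)
        fix i assume i: "i \<in> I"
        have "\<bar>y i - q i\<bar> < d" using y i by (simp add: rbox_def)
        then show "\<bar>y i - x i\<bar> < e" using q(2)[of i] q(3)[of i] n unfolding d_def[symmetric] by linarith
      qed
    qed
    ultimately show "\<exists>B\<in>\<B>. x \<in> B \<and> B \<subseteq> W" by blast
  qed
qed

context fibred
begin

text \<open>
  As \<open>E\<close> is a Lindelof space, it is covered by countably many adapted charts. Each
  of them contributes the preimages of countably many boxes.
\<close>

lemma second_countable_JM: "second_countable (mtop (JM r))"
proof -
  have "Lindelof_space (mtop E)"
    using smooth_EQ(1) by (auto simp: smooth_manifold_def intro: second_countable_imp_Lindelof_space)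
  moreover have "\<Union>(fst ` adapted_charts E Q \<pi>) = topspace (mtop E)"
    unfolding E.topspace_mtop
  proof
    show "\<Union>(fst ` adapted_charts E Q \<pi>) \<subseteq> carrier E" using E.chartD(1)[OF adaptedD(1)] by fastforce
    show "carrier E \<subseteq> \<Union>(fst ` adapted_charts E Q \<pi>)"
    proof
      fix e assume "e \<in> carrier E"
      then obtain V \<phi> \<xi> where "adapted V \<phi> \<xi>" "e \<in> V" by (rule adapted_chart_exists)
      then show "e \<in> \<Union>(fst ` adapted_charts E Q \<pi>)" by (intro UN_I[of "(V, \<phi>, \<xi>)"]) auto
    qed
  qed
  moreover have "openin (mtop E) U" if "U \<in> fst ` adapted_charts E Q \<pi>" for U
    using that E.openin_chart_domain[OF adaptedD(1)] by auto
  ultimately obtain \<V> where \<V>: "countable \<V>" "\<V> \<subseteq> fst ` adapted_charts E Q \<pi>" "\<Union>\<V> = carrier E"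
    unfolding Lindelof_space_def E.topspace_mtop by meson
  obtain C where C: "countable C" "C \<subseteq> adapted_charts E Q \<pi>" "\<V> = fst ` C"
    using \<V>(1,2) by (metis countable_subset_image)
  obtain \<B> where \<B>: "countable \<B>" "\<And>B. B \<in> \<B> \<Longrightarrow> ropen (jet_idx r :: ('n, 'm) jet_index set) B"
    "\<And>W x. ropen (jet_idx r) W \<Longrightarrow> x \<in> W \<Longrightarrow> \<exists>B\<in>\<B>. x \<in> B \<and> B \<subseteq> W"
    by (rule rational_boxes[OF finite_jet_idx, of r]) (rule that)
  let ?S = "\<lambda>c B. {p \<in> jet_domain E Q \<pi> r c. jet_coords \<pi> r c p \<in> B}"
  show ?thesis unfolding second_countable_def
  proof (intro exI[of _ "(\<lambda>(c, B). ?S c B) ` (C \<times> \<B>)"] conjI ballI allI impI)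
    show "countable ((\<lambda>(c, B). ?S c B) ` (C \<times> \<B>))" using C(1) \<B>(1) by (intro countable_image countable_SIGMA)
    fix V assume "V \<in> (\<lambda>(c, B). ?S c B) ` (C \<times> \<B>)"
    then obtain c B where V: "c \<in> C" "B \<in> \<B>" "V = ?S c B" by auto
    obtain W \<phi> \<xi> where c: "c = (W, \<phi>, \<xi>)" by (cases c) auto
    show "openin (mtop (JM r)) V"
      unfolding V(3) c by (rule J.openin_chart_preimage[OF jet_chart]) (use V C(2) c \<B>(2) in auto)
  next
    fix U p assume "openin (mtop (JM r)) U \<and> p \<in> U"
    then have U: "openin (mtop (JM r)) U" "p \<in> U" by auto
    then have pJ: "p \<in> carrier (JM r)" using J.openin_mtop_subset by blast
    then have "jet_value p \<in> \<Union>(fst ` C)" using jet_value_carrier \<V>(3) C(3) by blast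
    then obtain V \<phi> \<xi> where c: "(V, \<phi>, \<xi>) \<in> C" "jet_value p \<in> V" by force
    have p: "p \<in> jet_domain E Q \<pi> r (V, \<phi>, \<xi>)" using c(2) pJ by (simp add: jet_domain_eq)
    have ad: "adapted V \<phi> \<xi>" using c(1) C(2) by blast
    note ch = jet_chart[OF ad, of r]
    have "ropen (jet_idx r) (jet_coords \<pi> r (V, \<phi>, \<xi>) ` (U \<inter> jet_domain E Q \<pi> r (V, \<phi>, \<xi>)))"
      using J.ropen_chart_image[OF U(1) ch] by simp
    then obtain B where B: "B \<in> \<B>" "jet_coords \<pi> r (V, \<phi>, \<xi>) p \<in> B"
      "B \<subseteq> jet_coords \<pi> r (V, \<phi>, \<xi>) ` (U \<inter> jet_domain E Q \<pi> r (V, \<phi>, \<xi>))"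
      using \<B>(3)[OF _ imageI[OF IntI[OF U(2) p]]] by blast
    have "?S (V, \<phi>, \<xi>) B \<subseteq> U"
    proof
      fix q assume q: "q \<in> ?S (V, \<phi>, \<xi>) B"
      then obtain q' where q': "q' \<in> U" "q' \<in> jet_domain E Q \<pi> r (V, \<phi>, \<xi>)"
        "jet_coords \<pi> r (V, \<phi>, \<xi>) q = jet_coords \<pi> r (V, \<phi>, \<xi>) q'" using B(3) by blast
      then have "q = q'" using inj_onD[OF inj_jet_coords[OF ad]] q by blast
      then show "q \<in> U" using q'(1) by simp
    qed
    then show "\<exists>W\<in>(\<lambda>(c, B). ?S c B) ` (C \<times> \<B>). p \<in> W \<and> W \<subseteq> U"
      using c(1) B(1,2) p by (intro bexI[of _ "?S (V, \<phi>, \<xi>) B"]) auto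
  qed
qed

lemma carrier_JM_nonempty: "carrier (JM r) \<noteq> {}"
proof -
  obtain e where "e \<in> carrier E" using smooth_EQ(1) by (auto simp: smooth_manifold_def)
  then obtain V \<phi> \<xi> where c: "adapted V \<phi> \<xi>" "e \<in> V" by (rule adapted_chart_exists)
  define z :: "('n, 'm) jet_index \<Rightarrow> real"
    where "z = restrict (\<lambda>l. case l of Inl i \<Rightarrow> \<phi> e (Inl i) | Inr (\<alpha>, J) \<Rightarrow> \<phi> e (Inr \<alpha>)) (jet_idx r)"
  have "jet_point z = \<phi> e" by (auto simp: jet_point_def z_def fun_eq_iff split: sum.split)
  then have z: "z \<in> tuples (jet_idx r)" "jet_point z \<in> \<phi> ` V" using c(2) by (simp_all add: z_def)
  obtain \<sigma> x where "\<sigma> \<in> sections_at E Q \<pi> x"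
    by (rule section_jet_realize[OF c(1) z]) (rule that)
  then show ?thesis unfolding carrier_JM by blast
qed

lemma smooth_manifold_JM: "smooth_manifold (JM r)"
  unfolding smooth_manifold_def
  using J.is_chart_atlas J.compatible_atlas Hausdorff_JM second_countable_JM carrier_JM_nonempty
  by (simp del: idx_JM) simp

end

section \<open>Contact forms and vertical vectors on jet bundles\<close>

context atlas_manifold
begin

lemma tangent_compose:
  assumes K: "finite K" and T: "ropen K T" and F: "smooth_on K T F" and p: "p \<in> carrier M"
    and g: "\<And>l. l \<in> K \<Longrightarrow> smooth_at M p (g l)" and gp: "tuple_map K g p \<in> T"
  shows "smooth_at M p (\<lambda>q. F (tuple_map K g q))"
    and "v \<in> tangent M p \<Longrightarrow> v (\<lambda>q. F (tuple_map K g q)) = (\<Sum>l\<in>K. pd l F (tuple_map K g p) * v (g l))"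
proof -
  obtain V \<phi> where c: "(V, \<phi>) \<in> charts M" "p \<in> V" using p by (rule carrier_chartE)
  have "\<exists>W. ropen I W \<and> \<phi> p \<in> W \<and> W \<subseteq> \<phi> ` V \<and> smooth_on I W (\<lambda>x. g l (inv_into V \<phi> x))" if "l \<in> K" for l
    using g[OF that] unfolding smooth_at_iff_chart[OF c] smooth_in_chart_def .
  then obtain W where W: "\<And>l. l \<in> K \<Longrightarrow> ropen I (W l)" "\<And>l. l \<in> K \<Longrightarrow> \<phi> p \<in> W l"
    "\<And>l. l \<in> K \<Longrightarrow> smooth_on I (W l) (\<lambda>x. g l (inv_into V \<phi> x))" by metis
  define N where "N = \<phi> ` V \<inter> (\<Inter>l\<in>K. W l)"
  have N: "ropen I N"
  proof (cases "K = {}")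
    case False
    then show ?thesis unfolding N_def
      by (intro openin_Int chartD(3)[OF c(1)] openin_INT2 K W(1))
  qed (simp add: N_def chartD(3)[OF c(1)])
  have gs: "smooth_on I N (\<lambda>x. g l (inv_into V \<phi> x))" if "l \<in> K" for l
    by (rule smooth_on_subset[OF W(3)[OF that]]) (use that in \<open>auto simp: N_def\<close>)
  let ?h = "\<lambda>l x. g l (inv_into V \<phi> x)"
  have tm: "tuple_map K ?h x = tuple_map K g (inv_into V \<phi> x)" for x by (simp add: tuple_map_def)
  define N' where "N' = {x \<in> N. tuple_map K ?h x \<in> T}"
  have "continuous_on N (tuple_map K ?h)" unfolding tuple_map_def
    by (rule continuous_on_tuple_valued) (rule smooth_on_continuous[OF gs ropen_subset_tuples[OF N]])
  then have N': "ropen I N'" unfolding N'_def by (rule ropen_preimage[OF N _ _ T]) auto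
  have gs': "smooth_on I N' (?h l)" if "l \<in> K" for l
    by (rule smooth_on_subset[OF gs[OF that]]) (auto simp: N'_def)
  have maps: "tuple_map K ?h x \<in> T" if "x \<in> N'" for x using that by (simp add: N'_def)
  have pN: "\<phi> p \<in> N'" using c(2) W(2) gp by (auto simp: N'_def N_def tm chart_inv[OF c])
  have sm: "smooth_on I N' (\<lambda>x. F (tuple_map K ?h x))"
    by (rule smooth_on_compose[OF fin K N' T F gs' maps])
  show s: "smooth_at M p (\<lambda>q. F (tuple_map K g q))"
    by (rule smooth_at_chartI[OF c N' pN sm]) (simp add: tm chart_inv[OF c(1)])
  assume v: "v \<in> tangent M p"
  have "v (\<lambda>q. F (tuple_map K g q)) =
      (\<Sum>i\<in>I. pd i (\<lambda>x. F (tuple_map K g (inv_into V \<phi> x))) (\<phi> p) * v (\<lambda>q. \<phi> q i))"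
    by (rule tangent_chart[OF v c s])
  also have "\<dots> = (\<Sum>i\<in>I. (\<Sum>l\<in>K. pd l F (tuple_map K g p) * pd i (?h l) (\<phi> p)) * v (\<lambda>q. \<phi> q i))"
    using pd_compose_smooth[OF fin K N' T F gs' maps _ pN] by (simp add: tm chart_inv[OF c])
  also have "\<dots> = (\<Sum>l\<in>K. pd l F (tuple_map K g p) * (\<Sum>i\<in>I. pd i (?h l) (\<phi> p) * v (\<lambda>q. \<phi> q i)))"
    unfolding sum_distrib_left sum_distrib_right by (subst sum.swap) (simp add: mult.assoc)
  also have "\<dots> = (\<Sum>l\<in>K. pd l F (tuple_map K g p) * v (g l))"
    by (intro sum.cong refl) (simp add: tangent_chart[OF v c g])
  finally show "v (\<lambda>q. F (tuple_map K g q)) = (\<Sum>l\<in>K. pd l F (tuple_map K g p) * v (g l))" .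
qed

end

context fibred
begin

text \<open>
  Along a section, the chain rule expresses a total derivative of a transition function through
  the new jet coordinates of one order higher. As every jet is the jet of a section, this is an
  identity between functions of jets.
\<close>

lemma total_deriv_transition:
  assumes c: "adapted V \<phi> \<xi>" and c': "adapted V' \<phi>' \<xi>'"
    and \<sigma>: "\<sigma> \<in> sections_at E Q \<pi> x" and V: "\<sigma> x \<in> V" "\<sigma> x \<in> V'" and J: "size J < r"
  shows "total_deriv (size J) j (jet_transition V \<phi> \<xi> V' \<phi>' \<xi>' \<alpha> J) (section_jet V \<phi> \<xi> r \<sigma> x) =
    (\<Sum>i\<in>UNIV. section_jet V' \<phi>' \<xi>' r \<sigma> x (Inr (\<alpha>, add_mset i J)) * pd j (\<lambda>y. base_transition V \<xi> \<xi>' y i) (\<xi> x))"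
proof -
  let ?k = "size J" and ?F = "jet_transition V \<phi> \<xi> V' \<phi>' \<xi>' \<alpha> J"
  let ?\<chi> = "base_transition V \<xi> \<xi>'"
  let ?f = "section_rep V \<phi> \<xi> \<sigma>" and ?f' = "section_rep V' \<phi>' \<xi>' \<sigma>"
  note cQ = adaptedD(2)[OF c] and cQ' = adaptedD(2)[OF c']
  note \<chi> = smooth_base_transition[OF c c']
  note op = ropen_jet_region[OF c openin_adapted[OF c c']]
  obtain N' where N': "ropen UNIV N'" "\<xi>' x \<in> N'" "N' \<subseteq> \<xi>' ` \<pi> ` V'"
    and f': "\<And>\<alpha>. smooth_on UNIV N' (?f' \<alpha>)"
    and secV': "\<And>y. y \<in> N' \<Longrightarrow> \<sigma> (inv_into (\<pi> ` V') \<xi>' y) \<in> V'"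
    and sec': "\<And>y. y \<in> N' \<Longrightarrow> \<sigma> \<in> sections_at E Q \<pi> (inv_into (\<pi> ` V') \<xi>' y)"
    by (rule section_local[OF c' \<sigma> V(2)]) (rule that)
  obtain N0 where N0: "ropen UNIV N0" "\<xi> x \<in> N0" "N0 \<subseteq> \<xi> ` \<pi> ` V"
    and f0: "\<And>\<alpha>. smooth_on UNIV N0 (?f \<alpha>)"
    and secV: "\<And>y. y \<in> N0 \<Longrightarrow> \<sigma> (inv_into (\<pi> ` V) \<xi> y) \<in> V"
    and sec: "\<And>y. y \<in> N0 \<Longrightarrow> \<sigma> \<in> sections_at E Q \<pi> (inv_into (\<pi> ` V) \<xi> y)"
    by (rule section_local[OF c \<sigma> V(1)]) (rule that)
  define S where "S = {q \<in> \<pi> ` V. \<xi> q \<in> N0} \<inter> {q \<in> \<pi> ` V'. \<xi>' q \<in> N'}"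
  have S: "openin (mtop Q) S" unfolding S_def
    using Q.openin_chart_preimage[OF cQ, of N0] Q.openin_chart_preimage[OF cQ', of N'] N0(1) N'(1)
    by (intro openin_Int) simp_all
  have xS: "x \<in> S" using N0(2) N'(2) section_base[OF c \<sigma> V(1)] section_base[OF c' \<sigma> V(2)] by (simp add: S_def)
  have Sq: "\<sigma> \<in> sections_at E Q \<pi> q" "\<sigma> q \<in> V" "\<sigma> q \<in> V'" "q \<in> \<pi> ` V" "q \<in> \<pi> ` V'" "\<xi>' q \<in> N'" if "q \<in> S" for q
    using that sec[of "\<xi> q"] secV[of "\<xi> q"] secV'[of "\<xi>' q"] Q.chart_inv[OF cQ, of q] Q.chart_inv[OF cQ', of q]
    unfolding S_def by auto
  define N where "N = \<xi> ` (S \<inter> \<pi> ` V)"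
  have N: "ropen UNIV N" using Q.ropen_chart_image[OF S cQ] by (simp add: N_def)
  have "N \<subseteq> N0" by (auto simp: N_def S_def)
  then have f: "smooth_on UNIV N (?f \<alpha>)" for \<alpha> using f0 smooth_on_subset by blast
  have xN: "\<xi> x \<in> N" using xS Sq(4)[OF xS] by (auto simp: N_def)
  have mapsN: "prolong ?k ?f y \<in> jet_region \<phi> (V \<inter> V') ?k" if y: "y \<in> N" for y
  proof -
    obtain q where "q \<in> S" "y = \<xi> q" using y by (auto simp: N_def)
    then show ?thesis using section_jet_region[OF c c' Sq(1-3)] by (simp add: section_jet_def)
  qed
  have \<chi>q: "?\<chi> (\<xi> q) = \<xi>' q" if "q \<in> S" for q
    unfolding base_transition_def[OF c c'] Q.chart_inv[OF cQ Sq(4)[OF that]] ..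
  have tm: "?\<chi> y = tuple_map UNIV (\<lambda>l y. ?\<chi> y l) y" for y by (simp add: fun_eq_iff)
  have "total_deriv ?k j ?F (section_jet V \<phi> \<xi> r \<sigma> x) = pd j (\<lambda>y. ?F (prolong ?k ?f y)) (\<xi> x)"
    unfolding section_jet_def
    by (rule pd_prolong[OF N f op mapsN jet_transition(1)[OF c c'] xN Suc_leI[OF J], symmetric])
  also have "\<dots> = pd j (\<lambda>y. pd_multi J (?f' \<alpha>) (tuple_map UNIV (\<lambda>l y. ?\<chi> y l) y)) (\<xi> x)"
  proof (rule pd_cong[OF finite N UNIV_I xN])
    fix y assume "y \<in> N"
    then obtain q where q: "q \<in> S" "y = \<xi> q" by (auto simp: N_def)
    show "?F (prolong ?k ?f y) = pd_multi J (?f' \<alpha>) (tuple_map UNIV (\<lambda>l y. ?\<chi> y l) y)"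
      unfolding tm[symmetric] q(2) \<chi>q[OF q(1)] jet_transition(2)[OF c c' Sq(1-3)[OF q(1)]]
      by (simp add: section_jet_def)
  qed
  also have "\<dots> = (\<Sum>i\<in>UNIV. pd i (pd_multi J (?f' \<alpha>)) (tuple_map UNIV (\<lambda>l y. ?\<chi> y l) (\<xi> x)) * pd j (\<lambda>y. ?\<chi> y i) (\<xi> x))"
  proof (rule pd_compose_smooth[OF finite finite N N'(1) smooth_on_pd_multi[OF finite N'(1) f'] _ _ UNIV_I xN])
    show "smooth_on UNIV N (\<lambda>y. ?\<chi> y l)" for l
      by (rule smooth_on_subset[OF \<chi>(2)]) (use Sq in \<open>auto simp: N_def\<close>)
    fix y assume "y \<in> N"
    then obtain q where q: "q \<in> S" "y = \<xi> q" by (auto simp: N_def)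
    show "tuple_map UNIV (\<lambda>l y. ?\<chi> y l) y \<in> N'"
      unfolding tm[symmetric] q(2) \<chi>q[OF q(1)] by (rule Sq(6)[OF q(1)])
  qed simp
  also have "\<dots> = (\<Sum>i\<in>UNIV. section_jet V' \<phi>' \<xi>' r \<sigma> x (Inr (\<alpha>, add_mset i J)) * pd j (\<lambda>y. ?\<chi> y i) (\<xi> x))"
    unfolding tm[symmetric] \<chi>q[OF xS] using J
    by (simp add: section_jet_def pd_multi_add_mset[OF finite N'(1) f' UNIV_I _ N'(2)] Suc_le_eq)
  finally show ?thesis .
qed

context
  fixes V \<phi> \<xi> r p
  assumes c: "adapted V \<phi> \<xi>" and p: "p \<in> jet_domain E Q \<pi> r (V, \<phi>, \<xi>)"
begin

abbreviation (input) "crd \<equiv> jet_coords \<pi> r (V, \<phi>, \<xi>)"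

lemma jet_carrier: "p \<in> carrier (JM r)" using J.chartD(1)[OF jet_chart[OF c]] p by blast

lemma smooth_jet_coord: "l \<in> jet_idx r \<Longrightarrow> smooth_at (JM r) p (\<lambda>q. crd q l)"
  using J.smooth_at_coord[OF jet_chart[OF c] p] by simp

lemma jet_tangent_eqI:
  "v \<in> tangent (JM r) p \<Longrightarrow> w \<in> tangent (JM r) p \<Longrightarrow>
    (\<And>i. v (\<lambda>q. crd q (Inl i)) = w (\<lambda>q. crd q (Inl i))) \<Longrightarrow>
    (\<And>\<alpha> J. size J \<le> r \<Longrightarrow> v (\<lambda>q. crd q (Inr (\<alpha>, J))) = w (\<lambda>q. crd q (Inr (\<alpha>, J)))) \<Longrightarrow> v = w"
  by (rule J.tangent_eqI[OF _ _ jet_chart[OF c] p]) (auto elim!: jet_idxE)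

lemma jet_vector_coord:
  "l \<in> jet_idx r \<Longrightarrow> J.chart_vector r (jet_domain E Q \<pi> r (V, \<phi>, \<xi>)) crd p a (\<lambda>q. crd q l) = a l"
  using J.chart_vector_coord[OF jet_chart[OF c] p] by simp

lemma jet_vector_tangent:
  "J.chart_vector r (jet_domain E Q \<pi> r (V, \<phi>, \<xi>)) crd p a \<in> tangent (JM r) p"
  by (rule J.chart_vector_tangent[OF jet_chart[OF c] p])

lemma tangent_transition:
  assumes c': "adapted V' \<phi>' \<xi>'" and p': "p \<in> jet_domain E Q \<pi> r (V', \<phi>', \<xi>')" and v: "v \<in> tangent (JM r) p"
  shows "v (\<lambda>q. jet_coords \<pi> r (V', \<phi>', \<xi>') q (Inl i)) =
      (\<Sum>j\<in>UNIV. pd j (\<lambda>y. base_transition V \<xi> \<xi>' y i) (jet_base (crd p)) * v (\<lambda>q. crd q (Inl j)))"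
    and "size J \<le> r \<Longrightarrow> v (\<lambda>q. jet_coords \<pi> r (V', \<phi>', \<xi>') q (Inr (\<alpha>, J))) =
      (\<Sum>l\<in>jet_idx (size J). pd l (jet_transition V \<phi> \<xi> V' \<phi>' \<xi>' \<alpha> J) (restrict (crd p) (jet_idx (size J))) * v (\<lambda>q. crd q l))"
proof -
  let ?D = "jet_domain E Q \<pi> r (V, \<phi>, \<xi>)" and ?D' = "jet_domain E Q \<pi> r (V', \<phi>', \<xi>')"
  note ch = jet_chart[OF c, of r] and ch' = jet_chart[OF c', of r]
  have U: "openin (mtop (JM r)) (?D \<inter> ?D')" "p \<in> ?D \<inter> ?D'"
    using J.openin_chart_domain[OF ch] J.openin_chart_domain[OF ch'] p p' by (auto intro: openin_Int)
  have zp: "crd p \<in> jet_region \<phi> (V \<inter> V') r" using jet_coords_image[OF c c', of r] U(2) by blast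
  note op = ropen_jet_region[OF c openin_adapted[OF c c']]
  have jb: "jet_base (crd q) = tuple_map UNIV (\<lambda>j q. crd q (Inl j)) q" for q
    by (simp add: fun_eq_iff jet_base_def)
  have "v (\<lambda>q. jet_coords \<pi> r (V', \<phi>', \<xi>') q (Inl i)) =
      v (\<lambda>q. base_transition V \<xi> \<xi>' (tuple_map UNIV (\<lambda>j q. crd q (Inl j)) q) i)"
    by (rule J.tangent_germ[OF v U]) (use jet_coords_transition(1)[OF c c'] in \<open>auto simp flip: jb\<close>)
  also have "\<dots> = (\<Sum>j\<in>UNIV. pd j (\<lambda>y. base_transition V \<xi> \<xi>' y i) (tuple_map UNIV (\<lambda>j q. crd q (Inl j)) p) * v (\<lambda>q. crd q (Inl j)))"
    by (rule J.tangent_compose(2)[OF finite smooth_base_transition[OF c c'] jet_carrier smooth_jet_coord _ v])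
      (use jet_region_base[OF c c' zp] in \<open>simp_all flip: jb\<close>)
  finally show "v (\<lambda>q. jet_coords \<pi> r (V', \<phi>', \<xi>') q (Inl i)) =
      (\<Sum>j\<in>UNIV. pd j (\<lambda>y. base_transition V \<xi> \<xi>' y i) (jet_base (crd p)) * v (\<lambda>q. crd q (Inl j)))"
    by (simp flip: jb)
  assume J: "size J \<le> r"
  have rs: "restrict (crd q) (jet_idx (size J)) = tuple_map (jet_idx (size J)) (\<lambda>l q. crd q l) q" for q
    by (simp add: tuple_map_def)
  have "v (\<lambda>q. jet_coords \<pi> r (V', \<phi>', \<xi>') q (Inr (\<alpha>, J))) =
      v (\<lambda>q. jet_transition V \<phi> \<xi> V' \<phi>' \<xi>' \<alpha> J (tuple_map (jet_idx (size J)) (\<lambda>l q. crd q l) q))"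
    by (rule J.tangent_germ[OF v U]) (use jet_coords_transition(2)[OF c c' _ _ J] in \<open>auto simp flip: rs\<close>)
  also have "\<dots> = (\<Sum>l\<in>jet_idx (size J). pd l (jet_transition V \<phi> \<xi> V' \<phi>' \<xi>' \<alpha> J)
      (tuple_map (jet_idx (size J)) (\<lambda>l q. crd q l) p) * v (\<lambda>q. crd q l))"
    by (rule J.tangent_compose(2)[OF finite_jet_idx op jet_transition(1)[OF c c'] jet_carrier smooth_jet_coord _ v])
      (use jet_region_restrict[OF zp] jet_idx_mono[OF J] in \<open>auto simp flip: rs\<close>)
  finally show "v (\<lambda>q. jet_coords \<pi> r (V', \<phi>', \<xi>') q (Inr (\<alpha>, J))) =
      (\<Sum>l\<in>jet_idx (size J). pd l (jet_transition V \<phi> \<xi> V' \<phi>' \<xi>' \<alpha> J) (restrict (crd p) (jet_idx (size J))) * v (\<lambda>q. crd q l))"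
    by (simp flip: rs)
qed

text \<open>
  If the contact forms of one chart vanish at \<open>v\<close>, then \<open>v\<close> acts on functions of jets of order
  less than \<open>r\<close> as the combination of total derivatives given by its base components. The total
  derivatives of the transition functions are known from \<open>total_deriv_transition\<close>.
\<close>

lemma contact_form_transition:
  assumes c': "adapted V' \<phi>' \<xi>'" and p': "p \<in> jet_domain E Q \<pi> r (V', \<phi>', \<xi>')" and v: "v \<in> tangent (JM r) p"
    and ct: "\<And>\<beta> K. size K < r \<Longrightarrow> contact_form \<pi> r (V, \<phi>, \<xi>) \<beta> K p v = 0" and J: "size J < r"
  shows "contact_form \<pi> r (V', \<phi>', \<xi>') \<alpha> J p v = 0"
proof -
  let ?F = "jet_transition V \<phi> \<xi> V' \<phi>' \<xi>' \<alpha> J" and ?k = "size J"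
  let ?X' = "jet_coords \<pi> r (V', \<phi>', \<xi>')"
  obtain x \<sigma> where \<sigma>: "p = jet E Q \<pi> r x \<sigma>" "\<sigma> \<in> sections_at E Q \<pi> x" "\<sigma> x \<in> V" by (rule jet_domainE[OF p])
  then have V': "\<sigma> x \<in> V'" using p' jet_domain_iff[OF \<sigma>(2)] by simp
  have z: "crd p = section_jet V \<phi> \<xi> r \<sigma> x" "?X' p = section_jet V' \<phi>' \<xi>' r \<sigma> x"
    using jet_coords_jet[OF c \<sigma>(2,3)] jet_coords_jet[OF c' \<sigma>(2) V'] \<sigma>(1) by auto
  have base: "jet_base (crd p) = \<xi> x" unfolding z by (rule jet_base_section_jet[OF c \<sigma>(2,3)])
  let ?x = "\<lambda>j. v (\<lambda>q. crd q (Inl j))"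
  have vl: "v (\<lambda>q. crd q l) = (\<Sum>j\<in>UNIV. jet_shift j l (crd p) * ?x j)" if "l \<in> jet_idx ?k" for l
    using that
  proof (cases rule: jet_idxE)
    case (1 i)
    then have "(\<Sum>j\<in>UNIV. jet_shift j l (crd p) * ?x j) = (\<Sum>j\<in>UNIV. if j = i then ?x j else 0)"
      by (intro sum.cong) (auto simp: jet_shift_def)
    then show ?thesis by (simp add: 1)
  next
    case (2 \<beta> K)
    then have "size K < r" using J by simp
    from ct[OF this, of \<beta>] show ?thesis unfolding 2(1) contact_form_def by (simp add: jet_shift_def)
  qed
  have "v (\<lambda>q. ?X' q (Inr (\<alpha>, J))) =
     (\<Sum>l\<in>jet_idx ?k. pd l ?F (restrict (crd p) (jet_idx ?k)) * (\<Sum>j\<in>UNIV. jet_shift j l (crd p) * ?x j))"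
    using tangent_transition(2)[OF c' p' v, of J \<alpha>] J vl by simp
  also have "\<dots> = (\<Sum>j\<in>UNIV. total_deriv ?k j ?F (crd p) * ?x j)"
    unfolding total_deriv_def sum_distrib_left sum_distrib_right by (subst sum.swap) (simp add: mult.assoc)
  also have "\<dots> = (\<Sum>j\<in>UNIV. (\<Sum>i\<in>UNIV. ?X' p (Inr (\<alpha>, add_mset i J)) * pd j (\<lambda>y. base_transition V \<xi> \<xi>' y i) (\<xi> x)) * ?x j)"
    unfolding z total_deriv_transition[OF c c' \<sigma>(2,3) V' J] ..
  also have "\<dots> = (\<Sum>i\<in>UNIV. ?X' p (Inr (\<alpha>, add_mset i J)) * v (\<lambda>q. ?X' q (Inl i)))"
    unfolding tangent_transition(1)[OF c' p' v] base sum_distrib_left sum_distrib_right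
    by (subst sum.swap) (simp add: mult.assoc)
  finally show ?thesis by (simp add: contact_form_def)
qed

lemma cartan_iff:
  "v \<in> cartan_distribution E Q \<pi> r p \<longleftrightarrow> v \<in> tangent (JM r) p \<and>
    (\<forall>\<alpha> J. size J < r \<longrightarrow> v (\<lambda>q. crd q (Inr (\<alpha>, J))) =
      (\<Sum>i\<in>UNIV. crd p (Inr (\<alpha>, add_mset i J)) * v (\<lambda>q. crd q (Inl i))))"
proof -
  have "v \<in> cartan_distribution E Q \<pi> r p \<longleftrightarrow> v \<in> tangent (JM r) p \<and>
      (\<forall>\<alpha> J. size J < r \<longrightarrow> contact_form \<pi> r (V, \<phi>, \<xi>) \<alpha> J p v = 0)" (is "?L \<longleftrightarrow> ?R")
  proof
    assume ?L then show ?R using c p unfolding cartan_distribution_def by blast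
  next
    assume R: ?R
    show ?L unfolding cartan_distribution_def mem_Collect_eq
    proof (intro conjI ballI impI allI)
      show "v \<in> tangent (JM r) p" using R by blast
      fix c' \<alpha> J assume c': "c' \<in> adapted_charts E Q \<pi>" "p \<in> jet_domain E Q \<pi> r c'" "size (J :: 'n multiset) < r"
      obtain V' \<phi>' \<xi>' where d: "c' = (V', \<phi>', \<xi>')" by (cases c') auto
      show "contact_form \<pi> r c' \<alpha> J p v = 0" unfolding d
        by (rule contact_form_transition) (use c' d R in auto)
    qed
  qed
  then show ?thesis by (simp add: contact_form_def)
qed

lemma jet_proj_coords:
  assumes "s \<le> r" "q \<in> jet_domain E Q \<pi> r (V, \<phi>, \<xi>)"
  shows "jet_proj E Q \<pi> s q \<in> jet_domain E Q \<pi> s (V, \<phi>, \<xi>)"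
    "jet_coords \<pi> s (V, \<phi>, \<xi>) (jet_proj E Q \<pi> s q) = restrict (crd q) (jet_idx s)"
proof -
  obtain x \<sigma> where \<sigma>: "q = jet E Q \<pi> r x \<sigma>" "\<sigma> \<in> sections_at E Q \<pi> x" "\<sigma> x \<in> V" by (rule jet_domainE[OF assms(2)])
  let ?\<tau> = "jet_rep q"
  have \<tau>: "?\<tau> \<in> sections_at E Q \<pi> x" "?\<tau> x \<in> V" using jet_rep_section[OF \<sigma>(2), of r] \<sigma> by auto
  have pr: "jet_proj E Q \<pi> s q = jet E Q \<pi> s x ?\<tau>" by (simp add: jet_proj_def \<sigma>(1))
  show "jet_proj E Q \<pi> s q \<in> jet_domain E Q \<pi> s (V, \<phi>, \<xi>)"
    unfolding pr using jet_domain_iff[OF \<tau>(1)] \<tau>(2) by simp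
  have "crd q = section_jet V \<phi> \<xi> r \<sigma> x" unfolding \<sigma>(1) by (rule jet_coords_jet[OF c \<sigma>(2,3)])
  also have "\<dots> = section_jet V \<phi> \<xi> r ?\<tau> x"
    using jet_rep_equiv[OF \<sigma>(2), of r] jet_equiv_iff[where \<sigma> = \<sigma> and x = x, OF c \<sigma>(3)] \<sigma>(1) by auto
  finally show "jet_coords \<pi> s (V, \<phi>, \<xi>) (jet_proj E Q \<pi> s q) = restrict (crd q) (jet_idx s)"
    unfolding pr jet_coords_jet[OF c \<tau>] by (simp add: restrict_section_jet[OF c \<tau> assms(1)])
qed

lemma vertical_iff:
  assumes r: "r \<ge> 1"
  shows "v \<in> vertical_distribution E Q \<pi> r p \<longleftrightarrow> v \<in> tangent (JM r) p \<and>
    (\<forall>i. v (\<lambda>q. crd q (Inl i)) = 0) \<and> (\<forall>\<alpha> J. size J < r \<longrightarrow> v (\<lambda>q. crd q (Inr (\<alpha>, J))) = 0)"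
proof -
  let ?s = "r - 1" and ?D = "jet_domain E Q \<pi> r (V, \<phi>, \<xi>)" and ?Dlow = "jet_domain E Q \<pi> (r - 1) (V, \<phi>, \<xi>)"
  let ?Xlow = "jet_coords \<pi> (r - 1) (V, \<phi>, \<xi>)"
  have s: "?s \<le> r" by simp
  let ?pr = "jet_proj E Q \<pi> ?s"
  note pr = jet_proj_coords[OF s]
  note ch = jet_chart[OF c, of r] and ch0 = jet_chart[OF c, of ?s]
  have U: "openin (mtop (JM r)) ?D" by (rule J.openin_chart_domain[OF ch])
  have "v \<in> vertical_distribution E Q \<pi> r p \<longleftrightarrow> v \<in> tangent (JM r) p \<and>
    (\<forall>l\<in>jet_idx ?s. v (\<lambda>q. crd q l) = 0)" (is "?L \<longleftrightarrow> ?R")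
  proof
    assume L: ?L
    then have v: "v \<in> tangent (JM r) p" and t: "tmap (JM ?s) ?pr p v = 0"
      by (auto simp: vertical_distribution_def)
    have "v (\<lambda>q. crd q l) = 0" if l: "l \<in> jet_idx ?s" for l
    proof -
      have "smooth_at (JM ?s) (?pr p) (\<lambda>q. ?Xlow q l)"
        using J.smooth_at_coord[OF ch0 pr(1)[OF p]] l by simp
      then have "v (\<lambda>q. ?Xlow (?pr q) l) = 0"
        using fun_cong[OF t, of "\<lambda>q. ?Xlow q l"] by (simp add: tmap_def zero_fun_def)
      moreover have "v (\<lambda>q. ?Xlow (?pr q) l) = v (\<lambda>q. crd q l)"
        by (rule J.tangent_germ[OF v U p]) (simp only: pr(2) restrict_apply' l)
      ultimately show ?thesis by simp
    qed
    then show ?R using v by blast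
  next
    assume R: ?R
    then have v: "v \<in> tangent (JM r) p" by blast
    have "tmap (JM ?s) ?pr p v f = 0" for f
    proof (cases "smooth_at (JM ?s) (?pr p) f")
      case True
      obtain T where T: "ropen (jet_idx ?s) T" "?Xlow (?pr p) \<in> T" "T \<subseteq> ?Xlow ` ?Dlow" "smooth_on (jet_idx ?s) T (\<lambda>x. f (inv_into ?Dlow ?Xlow x))"
        by (rule J.smooth_at_chartE[OF ch0 pr(1)[OF p] True, unfolded idx_JM]) (rule that)
      have rs: "restrict (crd q) (jet_idx ?s) = tuple_map (jet_idx ?s) (\<lambda>l q. crd q l) q" for q
        by (simp add: tuple_map_def)
      have Tp: "tuple_map (jet_idx ?s) (\<lambda>l q. crd q l) p \<in> T" using T(2) unfolding pr(2)[OF p] rs .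
      have "v (\<lambda>q. f (?pr q)) = v (\<lambda>q. f (inv_into ?Dlow ?Xlow (tuple_map (jet_idx ?s) (\<lambda>l q. crd q l) q)))"
      proof (rule J.tangent_germ[OF v U p])
        fix q assume q: "q \<in> ?D"
        show "f (?pr q) = f (inv_into ?Dlow ?Xlow (tuple_map (jet_idx ?s) (\<lambda>l q. crd q l) q))"
          unfolding rs[symmetric] pr(2)[OF q, symmetric] J.chart_inv[OF ch0 pr(1)[OF q]] ..
      qed
      also have "\<dots> = (\<Sum>l\<in>jet_idx ?s. pd l (\<lambda>x. f (inv_into ?Dlow ?Xlow x)) (tuple_map (jet_idx ?s) (\<lambda>l q. crd q l) p) * v (\<lambda>q. crd q l))"
        by (rule J.tangent_compose(2)[OF finite_jet_idx T(1,4) jet_carrier smooth_jet_coord _ v])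
          (use Tp jet_idx_mono[OF s] in auto)
      also have "\<dots> = 0" using R by simp
      finally show ?thesis using True by (simp add: tmap_def)
    qed (simp add: tmap_def)
    then have "tmap (JM ?s) ?pr p v = 0" by (simp add: zero_fun_def fun_eq_iff)
    then show ?L using v by (simp add: vertical_distribution_def)
  qed
  also have "(\<forall>l\<in>jet_idx ?s. v (\<lambda>q. crd q l) = 0) \<longleftrightarrow>
     (\<forall>i. v (\<lambda>q. crd q (Inl i)) = 0) \<and> (\<forall>\<alpha> J. size J < r \<longrightarrow> v (\<lambda>q. crd q (Inr (\<alpha>, J))) = 0)"
  proof -
    have "size J \<le> r - 1 \<longleftrightarrow> size J < r" for J :: "'n multiset" using r by linarith
    then show ?thesis by (auto elim!: jet_idxE)
  qed
  finally show ?thesis .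
qed

end

end

section \<open>Frames of the Cartan and the vertical distribution\<close>

definition top_idx :: "nat \<Rightarrow> ('n, 'm) jet_index set"
  where "top_idx r = {Inr (\<alpha>, K) | \<alpha> K. size K = r}"

text \<open>
  Labels of the coordinates that determine the vectors of the Cartan distribution.
\<close>

definition cartan_idx :: "nat \<Rightarrow> ('n, 'm) jet_index set"
  where "cartan_idx r = range Inl \<union> top_idx r"

lemma cartan_idx_subset: "cartan_idx r \<subseteq> jet_idx r" "top_idx r \<subseteq> jet_idx r"
  by (auto simp: cartan_idx_def top_idx_def)

lemma finite_cartan_idx [simp]:
  "finite (cartan_idx r :: ('n::finite, 'm::finite) jet_index set)"
  "finite (top_idx r :: ('n::finite, 'm::finite) jet_index set)"
  using cartan_idx_subset finite_subset finite_jet_idx by metis+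

context fibred
begin

lemma subspace_cartan:
  assumes "p \<in> carrier (JM r)" shows "subspace (cartan_distribution E Q \<pi> r p)"
proof -
  obtain V \<phi> \<xi> where c: "adapted V \<phi> \<xi>" "p \<in> jet_domain E Q \<pi> r (V, \<phi>, \<xi>)" using assms by (rule carrier_JM_chartE)
  show ?thesis
    by (rule subspaceI) (auto simp: cartan_iff[OF c] subspace_0[OF subspace_tangent] subspace_add[OF subspace_tangent]
        subspace_scale[OF subspace_tangent] tvec_apply sum.distrib[symmetric] sum_distrib_left algebra_simps)
qed

lemma subspace_vertical:
  assumes "p \<in> carrier (JM r)" "r \<ge> 1" shows "subspace (vertical_distribution E Q \<pi> r p)"
proof -
  obtain V \<phi> \<xi> where c: "adapted V \<phi> \<xi>" "p \<in> jet_domain E Q \<pi> r (V, \<phi>, \<xi>)" using assms(1) by (rule carrier_JM_chartE)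
  show ?thesis
    by (rule subspaceI) (auto simp: vertical_iff[OF c assms(2)] subspace_0[OF subspace_tangent] subspace_add[OF subspace_tangent]
        subspace_scale[OF subspace_tangent] tvec_apply)
qed

context
  fixes V \<phi> \<xi> and r :: nat
  assumes c: "adapted V \<phi> \<xi>"
begin

abbreviation (input) "jdom \<equiv> jet_domain E Q \<pi> r (V, \<phi>, \<xi>)"
abbreviation (input) "crds \<equiv> jet_coords \<pi> r (V, \<phi>, \<xi>)"

text \<open>
  The base coordinate \<open>i\<close> labels the truncated total derivative in direction \<open>i\<close>, a label of
  top order the corresponding coordinate vector.
\<close>

definition cartan_coef :: "('n, 'm) jet_index \<Rightarrow> ('e, 'q) jet \<Rightarrow> ('n, 'm) jet_index \<Rightarrow> real"
  where "cartan_coef k q l = (case k of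
      Inl i \<Rightarrow> (case l of Inl j \<Rightarrow> (if i = j then 1 else 0)
        | Inr (\<alpha>, J) \<Rightarrow> (if size J < r then crds q (Inr (\<alpha>, add_mset i J)) else 0))
    | Inr b \<Rightarrow> (if l = Inr b then 1 else 0))"

definition cartan_field :: "('n, 'm) jet_index \<Rightarrow> ('e, 'q) jet \<Rightarrow> ('e, 'q) jet tvec"
  where "cartan_field k q = J.chart_vector r jdom crds q (\<lambda>l. cartan_coef k q l)"

lemma cartan_field_tangent: "q \<in> jdom \<Longrightarrow> cartan_field k q \<in> tangent (JM r) q"
  unfolding cartan_field_def by (rule jet_vector_tangent[OF c])

lemma cartan_field_coord: "q \<in> jdom \<Longrightarrow> l \<in> jet_idx r \<Longrightarrow> cartan_field k q (\<lambda>q. crds q l) = cartan_coef k q l"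
  unfolding cartan_field_def by (rule jet_vector_coord[OF c])

lemma openin_dom: "openin (mtop (JM r)) jdom"
  by (rule J.openin_chart_domain[OF jet_chart[OF c]])

lemma cartan_field_smooth: "vector_field_on (JM r) jdom (cartan_field k)"
  unfolding cartan_field_def
proof (rule J.vector_field_chart_vector[OF jet_chart[OF c] openin_dom order_refl])
  fix l :: "('n, 'm) jet_index" and q assume q: "q \<in> jdom"
  have const: "smooth_at (JM r) q (\<lambda>q. s)" for s by (rule J.smooth_at_const[OF jet_carrier[OF c q]])
  have u: "smooth_at (JM r) q (\<lambda>q. crds q (Inr (\<alpha>, add_mset i J)))" if "size J < r" for \<alpha> i J
    by (rule smooth_jet_coord[OF c q]) (use that in simp)
  show "smooth_at (JM r) q (\<lambda>q. cartan_coef k q l)"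
  proof (cases k)
    case (Inl i)
    show ?thesis
    proof (cases l)
      case (Inl j) then show ?thesis using \<open>k = Inl i\<close> const by (simp add: cartan_coef_def)
    next
      case (Inr b)
      obtain \<alpha> J where "b = (\<alpha>, J)" by (cases b)
      then show ?thesis using \<open>k = Inl i\<close> Inr const u by (cases "size J < r") (simp_all add: cartan_coef_def)
    qed
  next
    case (Inr b) then show ?thesis using const by (simp add: cartan_coef_def)
  qed
qed

lemma cartan_field_dual:
  assumes "q \<in> jdom" "k \<in> cartan_idx r" "l \<in> cartan_idx r"
  shows "cartan_field k q (\<lambda>q. crds q l) = (if k = l then 1 else 0)"
  using assms(2,3) cartan_field_coord[OF assms(1), of l k] cartan_idx_subset(1)
  by (auto simp: cartan_idx_def top_idx_def cartan_coef_def split: if_splits)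

lemma cartan_field_in_cartan:
  assumes q: "q \<in> jdom" and k: "k \<in> cartan_idx r"
  shows "cartan_field k q \<in> cartan_distribution E Q \<pi> r q"
  unfolding cartan_iff[OF c q]
proof (intro conjI cartan_field_tangent[OF q] allI impI)
  fix \<alpha> and J :: "'n multiset" assume J: "size J < r"
  have "cartan_coef k q (Inr (\<alpha>, J)) = (\<Sum>i\<in>UNIV. crds q (Inr (\<alpha>, add_mset i J)) * cartan_coef k q (Inl i))"
  proof (cases k)
    case (Inl j)
    then have "(\<Sum>i\<in>UNIV. crds q (Inr (\<alpha>, add_mset i J)) * cartan_coef k q (Inl i)) =
        (\<Sum>i\<in>UNIV. if i = j then crds q (Inr (\<alpha>, add_mset i J)) else 0)"
      by (intro sum.cong) (auto simp: cartan_coef_def)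
    then show ?thesis using Inl J by (simp add: cartan_coef_def)
  next
    case (Inr b)
    then show ?thesis using k J by (auto simp: cartan_coef_def cartan_idx_def top_idx_def)
  qed
  then show "cartan_field k q (\<lambda>q. crds q (Inr (\<alpha>, J))) =
      (\<Sum>i\<in>UNIV. crds q (Inr (\<alpha>, add_mset i J)) * cartan_field k q (\<lambda>q. crds q (Inl i)))"
    using J by (simp add: cartan_field_coord[OF q])
qed

lemma cartan_eqI:
  assumes q: "q \<in> jdom" and v: "v \<in> cartan_distribution E Q \<pi> r q" and w: "w \<in> cartan_distribution E Q \<pi> r q"
    and eq: "\<And>k. k \<in> cartan_idx r \<Longrightarrow> v (\<lambda>q. crds q k) = w (\<lambda>q. crds q k)"
  shows "v = w"
proof (rule jet_tangent_eqI[OF c q])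
  have x: "v (\<lambda>q. crds q (Inl i)) = w (\<lambda>q. crds q (Inl i))" for i
    by (rule eq) (simp add: cartan_idx_def)
  show "v (\<lambda>q. crds q (Inl i)) = w (\<lambda>q. crds q (Inl i))" for i by (rule x)
  fix \<alpha> and J :: "'n multiset" assume J: "size J \<le> r"
  show "v (\<lambda>q. crds q (Inr (\<alpha>, J))) = w (\<lambda>q. crds q (Inr (\<alpha>, J)))"
  proof (cases "size J < r")
    case True
    then show ?thesis using v w x unfolding cartan_iff[OF c q] by simp
  next
    case False
    with J show ?thesis by (intro eq) (auto simp: cartan_idx_def top_idx_def)
  qed
qed (use v w in \<open>auto simp: cartan_iff[OF c q]\<close>)

lemma cartan_expansion:
  assumes q: "q \<in> jdom" and v: "v \<in> cartan_distribution E Q \<pi> r q"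
  shows "v = (\<Sum>k\<in>cartan_idx r. v (\<lambda>q. crds q k) *\<^sub>R cartan_field k q)"
proof (rule cartan_eqI[OF q v])
  show "(\<Sum>k\<in>cartan_idx r. v (\<lambda>q. crds q k) *\<^sub>R cartan_field k q) \<in> cartan_distribution E Q \<pi> r q"
    by (intro subspace_sum[OF subspace_cartan[OF jet_carrier[OF c q]]]
        subspace_scale[OF subspace_cartan[OF jet_carrier[OF c q]]] cartan_field_in_cartan[OF q])
  fix l :: "('n, 'm) jet_index" assume l: "l \<in> cartan_idx r"
  have "(\<Sum>k\<in>cartan_idx r. v (\<lambda>q. crds q k) *\<^sub>R cartan_field k q) (\<lambda>q. crds q l) =
      (\<Sum>k\<in>cartan_idx r. if k = l then v (\<lambda>q. crds q k) else 0)"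
    unfolding tvec_sum_apply tvec_apply by (intro sum.cong) (auto simp: cartan_field_dual[OF q _ l])
  then show "v (\<lambda>q. crds q l) = (\<Sum>k\<in>cartan_idx r. v (\<lambda>q. crds q k) *\<^sub>R cartan_field k q) (\<lambda>q. crds q l)"
    using l by simp
qed

lemma vertical_subset_cartan:
  assumes "q \<in> jdom" "r \<ge> 1" "v \<in> vertical_distribution E Q \<pi> r q"
  shows "v \<in> cartan_distribution E Q \<pi> r q"
  using assms(3) unfolding vertical_iff[OF c assms(1,2)] cartan_iff[OF c assms(1)] by simp

lemma top_field_vertical:
  assumes q: "q \<in> jdom" and r: "r \<ge> 1" and k: "k \<in> top_idx r"
  shows "cartan_field k q \<in> vertical_distribution E Q \<pi> r q"
  unfolding vertical_iff[OF c q r] using k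
  by (auto simp: cartan_field_tangent[OF q] cartan_field_coord[OF q] cartan_coef_def top_idx_def)

lemma vertical_expansion:
  assumes q: "q \<in> jdom" and r: "r \<ge> 1" and v: "v \<in> vertical_distribution E Q \<pi> r q"
  shows "v = (\<Sum>k\<in>top_idx r. v (\<lambda>q. crds q k) *\<^sub>R cartan_field k q)"
proof -
  have "v = (\<Sum>k\<in>cartan_idx r. v (\<lambda>q. crds q k) *\<^sub>R cartan_field k q)"
    by (rule cartan_expansion[OF q vertical_subset_cartan[OF q r v]])
  also have "\<dots> = (\<Sum>k\<in>top_idx r. v (\<lambda>q. crds q k) *\<^sub>R cartan_field k q)"
    by (rule sum.mono_neutral_right) (use v in \<open>auto simp: cartan_idx_def vertical_iff[OF c q r]\<close>)
  finally show ?thesis .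
qed

end

lemma distribution_cartan:
  "distribution (JM r) (carrier (JM r)) (card (cartan_idx r :: ('n, 'm) jet_index set)) (cartan_distribution E Q \<pi> r)"
proof (rule J.distribution_dual_frameI[where K = "cartan_idx r :: ('n, 'm) jet_index set", OF _ finite_cartan_idx(1) refl])
  fix p assume "p \<in> carrier (JM r)"
  then obtain V \<phi> \<xi> where c: "adapted V \<phi> \<xi>" and p: "p \<in> jet_domain E Q \<pi> r (V, \<phi>, \<xi>)" by (rule carrier_JM_chartE)
  show "\<exists>W (Y :: ('n, 'm) jet_index \<Rightarrow> ('e, 'q) jet \<Rightarrow> ('e, 'q) jet tvec) g. openin (mtop (JM r)) W \<and> p \<in> W \<and> W \<subseteq> carrier (JM r) \<and>
      (\<forall>k\<in>cartan_idx r. vector_field_on (JM r) W (Y k)) \<and>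
      (\<forall>q\<in>W. subspace (cartan_distribution E Q \<pi> r q) \<and> (\<forall>k\<in>cartan_idx r. Y k q \<in> cartan_distribution E Q \<pi> r q \<and>
          (\<forall>l\<in>cartan_idx r. Y k q (g l) = (if k = l then 1 else 0))) \<and>
        (\<forall>v\<in>cartan_distribution E Q \<pi> r q. v = (\<Sum>k\<in>cartan_idx r. v (g k) *\<^sub>R Y k q)))"
    by (intro exI[of _ "jet_domain E Q \<pi> r (V, \<phi>, \<xi>)"] exI[of _ "cartan_field V \<phi> \<xi> r"]
        exI[of _ "\<lambda>k q. jet_coords \<pi> r (V, \<phi>, \<xi>) q k"] conjI ballI openin_dom[OF c] p
        cartan_field_smooth[OF c] subspace_cartan cartan_field_in_cartan[OF c] cartan_field_dual[OF c] cartan_expansion[OF c] subsetI)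
      (auto intro: jet_carrier[OF c])
qed

lemma distribution_vertical:
  assumes r: "r \<ge> 1"
  shows "distribution (JM r) (carrier (JM r)) (card (top_idx r :: ('n, 'm) jet_index set)) (vertical_distribution E Q \<pi> r)"
proof (rule J.distribution_dual_frameI[where K = "top_idx r :: ('n, 'm) jet_index set", OF _ finite_cartan_idx(2) refl])
  fix p assume "p \<in> carrier (JM r)"
  then obtain V \<phi> \<xi> where c: "adapted V \<phi> \<xi>" and p: "p \<in> jet_domain E Q \<pi> r (V, \<phi>, \<xi>)" by (rule carrier_JM_chartE)
  have t: "k \<in> cartan_idx r" if "k \<in> top_idx r" for k :: "('n, 'm) jet_index" using that by (simp add: cartan_idx_def)
  show "\<exists>W (Y :: ('n, 'm) jet_index \<Rightarrow> ('e, 'q) jet \<Rightarrow> ('e, 'q) jet tvec) g. openin (mtop (JM r)) W \<and> p \<in> W \<and> W \<subseteq> carrier (JM r) \<and>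
      (\<forall>k\<in>top_idx r. vector_field_on (JM r) W (Y k)) \<and>
      (\<forall>q\<in>W. subspace (vertical_distribution E Q \<pi> r q) \<and> (\<forall>k\<in>top_idx r. Y k q \<in> vertical_distribution E Q \<pi> r q \<and>
          (\<forall>l\<in>top_idx r. Y k q (g l) = (if k = l then 1 else 0))) \<and>
        (\<forall>v\<in>vertical_distribution E Q \<pi> r q. v = (\<Sum>k\<in>top_idx r. v (g k) *\<^sub>R Y k q)))"
    by (intro exI[of _ "jet_domain E Q \<pi> r (V, \<phi>, \<xi>)"] exI[of _ "cartan_field V \<phi> \<xi> r"]
        exI[of _ "\<lambda>k q. jet_coords \<pi> r (V, \<phi>, \<xi>) q k"] conjI ballI openin_dom[OF c] p
        cartan_field_smooth[OF c] subspace_vertical[OF _ r] top_field_vertical[OF c _ r] cartan_field_dual[OF c]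
        vertical_expansion[OF c _ r] subsetI t)
      (auto intro: jet_carrier[OF c])
qed

section \<open>The Levi tensor of the Cartan distribution\<close>

text \<open>The two-form \<open>\<Sum>\<^sub>i du\<^sub>J\<^sub>+\<^sub>i \<and> dx\<^sub>i\<close>.\<close>

definition levi_form :: "'e set \<Rightarrow> ('e \<Rightarrow> 'n + 'm \<Rightarrow> real) \<Rightarrow> ('q \<Rightarrow> 'n \<Rightarrow> real) \<Rightarrow> nat \<Rightarrow> 'm \<Rightarrow> 'n multiset \<Rightarrow>
    ('e, 'q) jet tvec \<Rightarrow> ('e, 'q) jet tvec \<Rightarrow> real"
  where "levi_form V \<phi> \<xi> r \<alpha> J v w = (\<Sum>i\<in>UNIV.
      v (\<lambda>q. jet_coords \<pi> r (V, \<phi>, \<xi>) q (Inr (\<alpha>, add_mset i J))) * w (\<lambda>q. jet_coords \<pi> r (V, \<phi>, \<xi>) q (Inl i)) -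
      w (\<lambda>q. jet_coords \<pi> r (V, \<phi>, \<xi>) q (Inr (\<alpha>, add_mset i J))) * v (\<lambda>q. jet_coords \<pi> r (V, \<phi>, \<xi>) q (Inl i)))"

text \<open>
  Cartan fields differentiate \<open>u\<^sub>J\<close> as the contact form prescribes. In the bracket, the derivatives
  of their base components then cancel against the remaining terms of the contact form.
\<close>

lemma contact_form_bracket:
  assumes c: "adapted V \<phi> \<xi>" and p: "p \<in> jet_domain E Q \<pi> r (V, \<phi>, \<xi>)"
    and X: "local_section (JM r) (cartan_distribution E Q \<pi> r) p X"
    and Y: "local_section (JM r) (cartan_distribution E Q \<pi> r) p Y" and J: "size J < r"
  shows "contact_form \<pi> r (V, \<phi>, \<xi>) \<alpha> J p (lie_bracket (JM r) X Y p) = levi_form V \<phi> \<xi> r \<alpha> J (X p) (Y p)"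
proof -
  let ?crd = "jet_coords \<pi> r (V, \<phi>, \<xi>)"
  let ?x = "\<lambda>i q. ?crd q (Inl i)" and ?u = "\<lambda>i q. ?crd q (Inr (\<alpha>, add_mset i J))"
  note sx = smooth_jet_coord[OF c p jet_idx_iff(1)]
  have su: "smooth_at (JM r) p (?u i)" for i by (rule smooth_jet_coord[OF c p]) (use J in simp)
  have sJ: "smooth_at (JM r) p (\<lambda>q. ?crd q (Inr (\<alpha>, J)))" by (rule smooth_jet_coord[OF c p]) (use J in simp)
  have der: "v (\<lambda>q. Z q (\<lambda>q. ?crd q (Inr (\<alpha>, J)))) = (\<Sum>i\<in>UNIV. v (?u i) * Z p (?x i) + ?u i p * v (\<lambda>q. Z q (?x i)))"
    if v: "v \<in> tangent (JM r) p" and Z: "local_section (JM r) (cartan_distribution E Q \<pi> r) p Z" for v Z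
  proof -
    obtain U where U: "openin (mtop (JM r)) U" "p \<in> U" "\<forall>q\<in>U. Z q \<in> cartan_distribution E Q \<pi> r q"
      using Z by (auto simp: local_section_def)
    have N: "openin (mtop (JM r)) (U \<inter> jet_domain E Q \<pi> r (V, \<phi>, \<xi>))" "p \<in> U \<inter> jet_domain E Q \<pi> r (V, \<phi>, \<xi>)"
      using U p openin_dom[OF c] by (auto intro: openin_Int)
    note sZ = J.local_sectionD(3)[OF Z sx]
    have "v (\<lambda>q. Z q (\<lambda>q. ?crd q (Inr (\<alpha>, J)))) = v (\<lambda>q. \<Sum>i\<in>UNIV. ?u i q * Z q (?x i))"
      by (rule J.tangent_germ[OF v N]) (use U(3) J in \<open>auto simp: cartan_iff[OF c]\<close>)
    also have "\<dots> = (\<Sum>i\<in>UNIV. v (\<lambda>q. ?u i q * Z q (?x i)))"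
      by (rule J.tangent_sum[OF v jet_carrier[OF c p]]) (intro J.smooth_at_mult su sZ)
    also have "\<dots> = (\<Sum>i\<in>UNIV. v (?u i) * Z p (?x i) + ?u i p * v (\<lambda>q. Z q (?x i)))"
      by (intro sum.cong refl tangent_mult[OF v su sZ])
    finally show ?thesis .
  qed
  note Xp = J.local_sectionD(1)[OF X] and Yp = J.local_sectionD(1)[OF Y]
  show ?thesis
    unfolding contact_form_def levi_form_def lie_bracket_def
    by (simp add: sx sJ der[OF Xp Y] der[OF Yp X] sum_subtractf[symmetric] sum.distrib[symmetric] algebra_simps)
qed

text \<open>
  Below the top order the contact forms also prescribe the values of Cartan vectors on \<open>u\<^sub>J\<^sub>+\<^sub>i\<close>,
  and their coefficients \<open>u\<^sub>J\<^sub>+\<^sub>i\<^sub>+\<^sub>j\<close> are symmetric in \<open>i\<close> and \<open>j\<close>.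
\<close>

lemma levi_form_low_order:
  assumes c: "adapted V \<phi> \<xi>" and p: "p \<in> jet_domain E Q \<pi> r (V, \<phi>, \<xi>)"
    and v: "v \<in> cartan_distribution E Q \<pi> r p" and w: "w \<in> cartan_distribution E Q \<pi> r p" and J: "Suc (size J) < r"
  shows "levi_form V \<phi> \<xi> r \<alpha> J v w = 0"
proof -
  let ?crd = "jet_coords \<pi> r (V, \<phi>, \<xi>)"
  have e: "z (\<lambda>q. ?crd q (Inr (\<alpha>, add_mset i J))) = (\<Sum>j\<in>UNIV. ?crd p (Inr (\<alpha>, add_mset j (add_mset i J))) * z (\<lambda>q. ?crd q (Inl j)))"
    if "z \<in> cartan_distribution E Q \<pi> r p" for z i
    using that J by (simp add: cartan_iff[OF c p])
  have "(\<Sum>i\<in>UNIV. \<Sum>j\<in>UNIV. ?crd p (Inr (\<alpha>, add_mset j (add_mset i J))) * v (\<lambda>q. ?crd q (Inl j)) * w (\<lambda>q. ?crd q (Inl i))) =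
      (\<Sum>i\<in>UNIV. \<Sum>j\<in>UNIV. ?crd p (Inr (\<alpha>, add_mset j (add_mset i J))) * w (\<lambda>q. ?crd q (Inl j)) * v (\<lambda>q. ?crd q (Inl i)))"
    by (subst sum.swap) (simp add: add_mset_commute mult_ac)
  then show ?thesis
    unfolding levi_form_def e[OF v] e[OF w] sum_subtractf by (simp add: sum_distrib_right)
qed

lemma levi_eq_iff:
  assumes c: "adapted V \<phi> \<xi>" and p: "p \<in> jet_domain E Q \<pi> r (V, \<phi>, \<xi>)"
    and v: "v \<in> cartan_distribution E Q \<pi> r p" and w: "w \<in> cartan_distribution E Q \<pi> r p"
  shows "levi (JM r) (cartan_distribution E Q \<pi> r) p v w = cartan_distribution E Q \<pi> r p \<longleftrightarrow>
    (\<forall>\<alpha> J. Suc (size J) = r \<longrightarrow> levi_form V \<phi> \<xi> r \<alpha> J v w = 0)"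
proof -
  have pc: "p \<in> carrier (JM r)" by (rule jet_carrier[OF c p])
  obtain X Y where XY: "local_section (JM r) (cartan_distribution E Q \<pi> r) p X"
      "local_section (JM r) (cartan_distribution E Q \<pi> r) p Y" "X p = v" "Y p = w"
      "levi (JM r) (cartan_distribution E Q \<pi> r) p v w = coset (cartan_distribution E Q \<pi> r p) (lie_bracket (JM r) X Y p)"
    by (rule J.levi_as_bracket[OF distribution_cartan pc v w]) (rule that)
  have Z: "lie_bracket (JM r) X Y p \<in> tangent (JM r) p" by (rule J.lie_bracket_tangent[OF XY(1,2)])
  have "levi (JM r) (cartan_distribution E Q \<pi> r) p v w = cartan_distribution E Q \<pi> r p \<longleftrightarrow>
      lie_bracket (JM r) X Y p \<in> cartan_distribution E Q \<pi> r p"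
    unfolding XY(5) by (rule coset_eq_iff[OF subspace_cartan[OF pc]])
  also have "\<dots> \<longleftrightarrow> (\<forall>\<alpha> J. size J < r \<longrightarrow> contact_form \<pi> r (V, \<phi>, \<xi>) \<alpha> J p (lie_bracket (JM r) X Y p) = 0)"
    unfolding cartan_iff[OF c p] contact_form_def using Z by simp
  also have "\<dots> \<longleftrightarrow> (\<forall>\<alpha> J. size J < r \<longrightarrow> levi_form V \<phi> \<xi> r \<alpha> J v w = 0)"
    using contact_form_bracket[OF c p XY(1,2)] XY(3,4) by simp
  also have "\<dots> \<longleftrightarrow> (\<forall>\<alpha> J. Suc (size J) = r \<longrightarrow> levi_form V \<phi> \<xi> r \<alpha> J v w = 0)"
    using levi_form_low_order[OF c p v w] by (metis Suc_lessI lessI)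
  finally show ?thesis .
qed

text \<open>
  The vertical space pairs trivially with itself because its vectors have no base components;
  the truncated total derivatives span a complement whose vectors have no top components.
\<close>

lemma legendrian_vertical:
  assumes p: "p \<in> carrier (JM r)" and r: "r \<ge> 1"
  shows "legendrian (JM r) (cartan_distribution E Q \<pi> r) p (vertical_distribution E Q \<pi> r p)"
proof -
  obtain V \<phi> \<xi> where c: "adapted V \<phi> \<xi>" and pd: "p \<in> jet_domain E Q \<pi> r (V, \<phi>, \<xi>)" using p by (rule carrier_JM_chartE)
  let ?C = "cartan_distribution E Q \<pi> r" and ?G = "vertical_distribution E Q \<pi> r"
  let ?crd = "jet_coords \<pi> r (V, \<phi>, \<xi>)"
  define W where "W = {v \<in> ?C p. \<forall>\<alpha> K. size K = r \<longrightarrow> v (\<lambda>q. ?crd q (Inr (\<alpha>, K))) = 0}"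
  have GC: "?G p \<subseteq> ?C p" using vertical_subset_cartan[OF c pd r] by blast
  have G: "isotropic (JM r) ?C p (?G p)"
    unfolding isotropic_def
  proof (intro conjI ballI subspace_vertical[OF p r] GC)
    fix v w assume vw: "v \<in> ?G p" "w \<in> ?G p"
    then have "levi_form V \<phi> \<xi> r \<alpha> J v w = 0" for \<alpha> J
      by (simp add: levi_form_def vertical_iff[OF c pd r])
    then show "levi (JM r) ?C p v w = ?C p"
      using levi_eq_iff[OF c pd subsetD[OF GC vw(1)] subsetD[OF GC vw(2)]] by blast
  qed
  have sW: "subspace W"
    unfolding W_def using subspace_cartan[OF p]
    by (intro subspaceI) (auto simp: subspace_0 subspace_add subspace_scale tvec_apply)
  have W: "isotropic (JM r) ?C p W"
    unfolding isotropic_def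
  proof (intro conjI ballI sW)
    show "W \<subseteq> ?C p" by (auto simp: W_def)
    fix v w assume vw: "v \<in> W" "w \<in> W"
    then have vwC: "v \<in> ?C p" "w \<in> ?C p" by (auto simp: W_def)
    have "levi_form V \<phi> \<xi> r \<alpha> J v w = 0" if "Suc (size J) = r" for \<alpha> J
      using vw that by (simp add: levi_form_def W_def)
    then show "levi (JM r) ?C p v w = ?C p" using levi_eq_iff[OF c pd vwC] by blast
  qed
  have int: "?G p \<inter> W = {0}"
  proof
    show "?G p \<inter> W \<subseteq> {0}"
    proof
      fix v assume v: "v \<in> ?G p \<inter> W"
      have "v = 0"
        by (rule cartan_eqI[OF c pd])
          (use v GC subspace_0[OF subspace_cartan[OF p]] in
            \<open>auto simp: W_def vertical_iff[OF c pd r] cartan_idx_def top_idx_def tvec_apply\<close>)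
      then show "v \<in> {0}" by simp
    qed
    show "{0} \<subseteq> ?G p \<inter> W" using subspace_0[OF sW] subspace_0[OF subspace_vertical[OF p r]] by blast
  qed
  have "?C p = {v + w | v w. v \<in> ?G p \<and> w \<in> W}"
  proof
    show "{v + w | v w. v \<in> ?G p \<and> w \<in> W} \<subseteq> ?C p"
      using GC subspace_add[OF subspace_cartan[OF p]] by (auto simp: W_def)
    show "?C p \<subseteq> {v + w | v w. v \<in> ?G p \<and> w \<in> W}"
    proof
      fix v assume v: "v \<in> ?C p"
      define g where "g = (\<Sum>k\<in>top_idx r. v (\<lambda>q. ?crd q k) *\<^sub>R cartan_field V \<phi> \<xi> r k p)"
      have g: "g \<in> ?G p" unfolding g_def
        by (intro subspace_sum[OF subspace_vertical[OF p r]] subspace_scale[OF subspace_vertical[OF p r]]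
            top_field_vertical[OF c pd r])
      have "v - g \<in> W" unfolding W_def
      proof (intro CollectI conjI allI impI)
        show "v - g \<in> ?C p" using subspace_diff[OF subspace_cartan[OF p] v] g GC by blast
        fix \<alpha> :: 'm and K :: "'n multiset" assume K: "size K = r"
        then have l: "Inr (\<alpha>, K) \<in> top_idx r" by (auto simp: top_idx_def)
        have "g (\<lambda>q. ?crd q (Inr (\<alpha>, K))) = (\<Sum>k\<in>top_idx r. if k = Inr (\<alpha>, K) then v (\<lambda>q. ?crd q k) else 0)"
          unfolding g_def tvec_sum_apply tvec_apply using l
          by (intro sum.cong) (auto simp: cartan_field_dual[OF c pd] cartan_idx_def)
        then have "g (\<lambda>q. ?crd q (Inr (\<alpha>, K))) = v (\<lambda>q. ?crd q (Inr (\<alpha>, K)))" using l by simp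
        then show "(v - g) (\<lambda>q. ?crd q (Inr (\<alpha>, K))) = 0" by (simp add: tvec_apply)
      qed
      moreover have "v = g + (v - g)" by simp
      ultimately show "v \<in> {v + w | v w. v \<in> ?G p \<and> w \<in> W}" using g by blast
    qed
  qed
  then have "direct_sum (?G p) W (?C p)"
    unfolding direct_sum_def using subspace_vertical[OF p r] sW int by blast
  then show ?thesis unfolding legendrian_def using G W by blast
qed

end

section \<open>A \<open>k\<close>-contact form for the Cartan distribution\<close>

text \<open>
  The coefficients \<open>(-x)\<^sup>K / K!\<close>. They are inverse to the Taylor coefficients \<open>x\<^sup>K / K!\<close> with
  which the translations \<open>u \<mapsto> u + x\<^sup>K / K!\<close> act on the jet coordinates.
\<close>

definition sgn_monom :: "'n::finite multiset \<Rightarrow> ('n \<Rightarrow> real) \<Rightarrow> real"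
  where "sgn_monom K y = (-1) ^ size K * taylor_monom (\<lambda>_. 0) K y"

lemma sgn_monom_empty [simp]: "sgn_monom {#} y = 1"
  by (simp add: sgn_monom_def taylor_monom_def)

lemma smooth_sgn_monom: "smooth_on UNIV UNIV (sgn_monom K)"
  unfolding sgn_monom_def[abs_def]
  by (intro smooth_on_mult smooth_on_const smooth_taylor_monom finite ropen_UNIV)

lemma pd_sgn_monom: "pd i (sgn_monom K) y = (if i \<in># K then - sgn_monom (K - {#i#}) y else 0)"
proof -
  have "pd i (sgn_monom K) y = (-1) ^ size K * pd i (taylor_monom (\<lambda>_. 0) K) y"
    unfolding sgn_monom_def[abs_def]
    by (subst pd_mult[OF smooth_on_const[OF finite ropen_UNIV] smooth_taylor_monom]) (simp_all add: pd_const)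
  also have "\<dots> = (if i \<in># K then - sgn_monom (K - {#i#}) y else 0)"
    by (auto simp: pd_taylor_monom sgn_monom_def dest!: multi_member_split)
  finally show ?thesis .
qed

definition above :: "nat \<Rightarrow> 'n multiset \<Rightarrow> 'n multiset set"
  where "above r J = {I. J \<subseteq># I \<and> size I < r}"

lemma finite_above [simp]: "finite (above r J :: 'n::finite multiset set)"
  by (rule finite_subset[OF _ finite_multisets_le[of r]]) (auto simp: above_def)

context fibred
begin

lemma distribution_local_cong:
  assumes D: "distribution (JM r) U d D" and U': "openin (mtop (JM r)) U'" "U' \<subseteq> U" and eq: "\<And>q. q \<in> U' \<Longrightarrow> D' q = D q"
  shows "distribution (JM r) U' d D'"
  unfolding distribution_def
proof
  fix p assume p: "p \<in> U'"
  obtain V and X :: "nat \<Rightarrow> ('e, 'q) jet \<Rightarrow> ('e, 'q) jet tvec" where V: "openin (mtop (JM r)) V" "p \<in> V" "V \<subseteq> U"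
    and X: "\<forall>i<d. vector_field_on (JM r) V (X i)"
    and s: "\<forall>q\<in>V. inj_on (\<lambda>i. X i q) {..<d} \<and> independent ((\<lambda>i. X i q) ` {..<d}) \<and>
                      span ((\<lambda>i. X i q) ` {..<d}) = D q"
    using bspec[OF D[unfolded distribution_def] subsetD[OF U'(2) p]] by blast
  show "\<exists>V (X :: nat \<Rightarrow> ('e, 'q) jet \<Rightarrow> ('e, 'q) jet tvec). openin (mtop (JM r)) V \<and> p \<in> V \<and> V \<subseteq> U' \<and>
              (\<forall>i<d. vector_field_on (JM r) V (X i)) \<and>
              (\<forall>q\<in>V. inj_on (\<lambda>i. X i q) {..<d} \<and> independent ((\<lambda>i. X i q) ` {..<d}) \<and>
                      span ((\<lambda>i. X i q) ` {..<d}) = D' q)"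
  proof (intro exI[of _ "V \<inter> U'"] exI[of _ X] conjI)
    show "openin (mtop (JM r)) (V \<inter> U')" using V(1) U'(1) by (rule openin_Int)
    show "\<forall>i<d. vector_field_on (JM r) (V \<inter> U') (X i)"
    proof (intro allI impI)
      fix i assume "i < d"
      then have "vector_field_on (JM r) V (X i)" using X by blast
      then show "vector_field_on (JM r) (V \<inter> U') (X i)" by (rule J.vector_field_on_subset) blast
    qed
  qed (use V(2) p s eq in auto)
qed

context
  fixes V \<phi> \<xi> and r :: nat
  assumes c: "adapted V \<phi> \<xi>" and r: "r \<ge> 1"
begin

abbreviation (input) "D \<equiv> jet_domain E Q \<pi> r (V, \<phi>, \<xi>)"
abbreviation (input) "X \<equiv> jet_coords \<pi> r (V, \<phi>, \<xi>)"

text \<open>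
  The form \<open>eta\<close> is \<open>\<Sum> (-x)\<^sup>I\<^sup>-\<^sup>J / (I - J)! \<theta>\<^sub>I\<close> for the contact forms \<open>\<theta>\<^sub>I\<close> (\<open>eta_eq_contact_forms\<close>),
  written as \<open>dU - \<Sum>\<^sub>i P\<^sub>i dx\<^sub>i\<close> with the potential \<open>U\<close> and with coefficients \<open>P\<^sub>i\<close> that are linear
  in the jet coordinates of top order. In this shape its exterior derivative is \<open>\<Sum>\<^sub>i dx\<^sub>i \<and> dP\<^sub>i\<close>.
\<close>

definition eta_potential :: "'m \<Rightarrow> 'n multiset \<Rightarrow> ('e, 'q) jet \<Rightarrow> real"
  where "eta_potential \<alpha> J q = (\<Sum>I\<in>above r J. sgn_monom (I - J) (jet_base (X q)) * X q (Inr (\<alpha>, I)))"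

definition eta_coef :: "'m \<Rightarrow> 'n multiset \<Rightarrow> 'n \<Rightarrow> ('e, 'q) jet \<Rightarrow> real"
  where "eta_coef \<alpha> J i q = (\<Sum>I\<in>{I \<in> above r J. Suc (size I) = r}.
    sgn_monom (I - J) (jet_base (X q)) * X q (Inr (\<alpha>, add_mset i I)))"

definition eta :: "'m \<Rightarrow> 'n multiset \<Rightarrow> ('e, 'q) jet \<Rightarrow> ('e, 'q) jet tvec \<Rightarrow> real"
  where "eta \<alpha> J q v = v (eta_potential \<alpha> J) - (\<Sum>i\<in>UNIV. eta_coef \<alpha> J i q * v (\<lambda>q. X q (Inl i)))"

context
  fixes p
  assumes p: "p \<in> D"
begin

lemma smooth_sgn_base: "smooth_at (JM r) p (\<lambda>q. sgn_monom K (jet_base (X q)))"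
  and tangent_sgn_base: "v \<in> tangent (JM r) p \<Longrightarrow> v (\<lambda>q. sgn_monom K (jet_base (X q))) =
    (\<Sum>i\<in>UNIV. pd i (sgn_monom K) (jet_base (X p)) * v (\<lambda>q. X q (Inl i)))"
proof -
  have jb: "jet_base (X q) = tuple_map UNIV (\<lambda>i q. X q (Inl i)) q" for q
    by (simp add: fun_eq_iff jet_base_def)
  note t = J.tangent_compose[where g = "\<lambda>i q. X q (Inl i)", OF finite ropen_UNIV smooth_sgn_monom[of K] jet_carrier[OF c p]
      smooth_jet_coord[OF c p jet_idx_iff(1)]]
  show "smooth_at (JM r) p (\<lambda>q. sgn_monom K (jet_base (X q)))"
    unfolding jb by (rule t(1)) simp_all
  show "v (\<lambda>q. sgn_monom K (jet_base (X q))) =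
    (\<Sum>i\<in>UNIV. pd i (sgn_monom K) (jet_base (X p)) * v (\<lambda>q. X q (Inl i)))" if "v \<in> tangent (JM r) p"
    unfolding jb by (rule t(2)) (simp_all add: that)
qed

lemma smooth_u: "size I \<le> r \<Longrightarrow> smooth_at (JM r) p (\<lambda>q. X q (Inr (\<alpha>, I)))"
  by (rule smooth_jet_coord[OF c p]) simp

lemma smooth_eta_potential: "smooth_at (JM r) p (eta_potential \<alpha> J)"
  unfolding eta_potential_def[abs_def]
  by (intro J.smooth_at_sum[OF jet_carrier[OF c p]] J.smooth_at_mult smooth_sgn_base smooth_u) (simp add: above_def)

lemma smooth_eta_coef: "smooth_at (JM r) p (eta_coef \<alpha> J i)"
  unfolding eta_coef_def[abs_def]
  by (intro J.smooth_at_sum[OF jet_carrier[OF c p]] J.smooth_at_mult smooth_sgn_base smooth_u) (simp add: above_def)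

lemma tangent_monom_sum:
  assumes v: "v \<in> tangent (JM r) p" and A: "\<And>I. I \<in> A \<Longrightarrow> size (f I) \<le> r"
  shows "v (\<lambda>q. \<Sum>I\<in>A. sgn_monom (g I) (jet_base (X q)) * X q (Inr (\<alpha>, f I))) =
    (\<Sum>I\<in>A. (\<Sum>i\<in>UNIV. pd i (sgn_monom (g I)) (jet_base (X p)) * v (\<lambda>q. X q (Inl i))) * X p (Inr (\<alpha>, f I)) +
      sgn_monom (g I) (jet_base (X p)) * v (\<lambda>q. X q (Inr (\<alpha>, f I))))"
proof -
  have "v (\<lambda>q. \<Sum>I\<in>A. sgn_monom (g I) (jet_base (X q)) * X q (Inr (\<alpha>, f I))) =
      (\<Sum>I\<in>A. v (\<lambda>q. sgn_monom (g I) (jet_base (X q)) * X q (Inr (\<alpha>, f I))))"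
    by (rule J.tangent_sum[OF v jet_carrier[OF c p]]) (intro J.smooth_at_mult smooth_sgn_base smooth_u A)
  also have "\<dots> = (\<Sum>I\<in>A. (\<Sum>i\<in>UNIV. pd i (sgn_monom (g I)) (jet_base (X p)) * v (\<lambda>q. X q (Inl i))) * X p (Inr (\<alpha>, f I)) +
      sgn_monom (g I) (jet_base (X p)) * v (\<lambda>q. X q (Inr (\<alpha>, f I))))"
    by (intro sum.cong refl)
      (simp add: tangent_mult[OF v smooth_sgn_base smooth_u[OF A]] tangent_sgn_base[OF v])
  finally show ?thesis .
qed

text \<open>
  Differentiating \<open>(-x)\<^sup>I\<^sup>-\<^sup>J\<close> lowers its exponent by a unit multi-index, so the resulting terms cancel the
  terms \<open>u\<^sub>I\<^sub>+\<^sub>i dx\<^sup>i\<close> of the contact forms one order lower; only the top order survives.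
\<close>

lemma eta_telescope:
  "(\<Sum>I\<in>above r J. sgn_monom (I - J) (jet_base (X p)) * X p (Inr (\<alpha>, add_mset i I))) =
    eta_coef \<alpha> J i p - (\<Sum>I\<in>above r J. pd i (sgn_monom (I - J)) (jet_base (X p)) * X p (Inr (\<alpha>, I)))"
proof -
  let ?c = "\<lambda>I. sgn_monom (I - J) (jet_base (X p)) * X p (Inr (\<alpha>, add_mset i I))"
  let ?top = "{I \<in> above r J. Suc (size I) = r}" and ?low = "{I \<in> above r J. Suc (size I) < r}"
  have "above r J = ?top \<union> ?low" by (auto simp: above_def)
  then have "sum ?c (above r J) = sum ?c (?top \<union> ?low)" by simp
  also have "\<dots> = sum ?c ?top + sum ?c ?low"
    by (rule sum.union_disjoint) auto
  also have "sum ?c ?low = (\<Sum>I\<in>{I \<in> above r J. i \<in># I - J}. sgn_monom (I - J - {#i#}) (jet_base (X p)) * X p (Inr (\<alpha>, I)))"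
  proof (rule sum.reindex_bij_witness[where i = "\<lambda>I. I - {#i#}" and j = "add_mset i"])
    fix I assume "I \<in> ?low"
    then obtain L where L: "I = J + L" "Suc (size I) < r"
      unfolding above_def by (auto simp: mset_subset_eq_exists_conv)
    then show "add_mset i I \<in> {I \<in> above r J. i \<in># I - J}" by (simp add: above_def)
    show "sgn_monom (add_mset i I - J - {#i#}) (jet_base (X p)) * X p (Inr (\<alpha>, add_mset i I)) = ?c I"
      using L(1) by simp
    show "add_mset i I - {#i#} = I" by simp
  next
    fix I assume "I \<in> {I \<in> above r J. i \<in># I - J}"
    then obtain L where L: "I = J + L" "size I < r" "i \<in># L"
      unfolding above_def by (auto simp: mset_subset_eq_exists_conv)
    then obtain L' where L': "L = add_mset i L'" by (metis multi_member_split)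
    show "add_mset i (I - {#i#}) = I" using L L' by simp
    show "I - {#i#} \<in> ?low" using L L' by (simp add: above_def)
  qed
  also have "\<dots> = - (\<Sum>I\<in>above r J. pd i (sgn_monom (I - J)) (jet_base (X p)) * X p (Inr (\<alpha>, I)))"
    unfolding sum_negf[symmetric]
    by (rule sum.mono_neutral_cong_left) (auto simp: pd_sgn_monom)
  finally show ?thesis by (simp add: eta_coef_def)
qed

lemma eta_eq_contact_forms:
  assumes v: "v \<in> tangent (JM r) p"
  shows "eta \<alpha> J p v = (\<Sum>I\<in>above r J. sgn_monom (I - J) (jet_base (X p)) * contact_form \<pi> r (V, \<phi>, \<xi>) \<alpha> I p v)"
proof -
  let ?s = "\<lambda>I. sgn_monom (I - J) (jet_base (X p))" and ?d = "\<lambda>i I. pd i (sgn_monom (I - J)) (jet_base (X p))"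
  let ?x = "\<lambda>i. v (\<lambda>q. X q (Inl i))" and ?u = "\<lambda>I. X p (Inr (\<alpha>, I))" and ?du = "\<lambda>I. v (\<lambda>q. X q (Inr (\<alpha>, I)))"
  have "(\<Sum>I\<in>above r J. ?s I * contact_form \<pi> r (V, \<phi>, \<xi>) \<alpha> I p v) =
      (\<Sum>I\<in>above r J. ?s I * ?du I) - (\<Sum>i\<in>UNIV. (\<Sum>I\<in>above r J. ?s I * ?u (add_mset i I)) * ?x i)"
    unfolding contact_form_def right_diff_distrib sum_subtractf sum_distrib_left sum_distrib_right
    by (subst sum.swap) (simp add: mult.assoc)
  also have "\<dots> = (\<Sum>I\<in>above r J. ?s I * ?du I) + (\<Sum>i\<in>UNIV. (\<Sum>I\<in>above r J. ?d i I * ?u I) * ?x i) -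
      (\<Sum>i\<in>UNIV. eta_coef \<alpha> J i p * ?x i)"
    unfolding eta_telescope left_diff_distrib sum_subtractf by simp
  also have "(\<Sum>i\<in>UNIV. (\<Sum>I\<in>above r J. ?d i I * ?u I) * ?x i) = (\<Sum>I\<in>above r J. (\<Sum>i\<in>UNIV. ?d i I * ?x i) * ?u I)"
    unfolding sum_distrib_right by (subst sum.swap) (simp add: mult_ac)
  also have "(\<Sum>I\<in>above r J. ?s I * ?du I) + \<dots> = v (eta_potential \<alpha> J)"
    unfolding eta_potential_def[abs_def]
    by (subst tangent_monom_sum[OF v]) (auto simp: above_def sum.distrib)
  finally show ?thesis by (simp add: eta_def)
qed

text \<open>
  The forms \<open>eta\<close> depend on the contact forms through a unitriangular matrix, as
  they involve only contact forms of higher order besides the one with the same label.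
\<close>

lemma eta_zero_iff:
  assumes v: "v \<in> tangent (JM r) p"
  shows "(\<forall>\<alpha> J. size J < r \<longrightarrow> eta \<alpha> J p v = 0) \<longleftrightarrow> v \<in> cartan_distribution E Q \<pi> r p"
proof
  assume "v \<in> cartan_distribution E Q \<pi> r p"
  then have "contact_form \<pi> r (V, \<phi>, \<xi>) \<alpha> I p v = 0" if "size I < r" for \<alpha> I
    using that by (simp add: cartan_iff[OF c p] contact_form_def)
  then show "\<forall>\<alpha> J. size J < r \<longrightarrow> eta \<alpha> J p v = 0"
    unfolding eta_eq_contact_forms[OF v] by (auto simp: above_def intro: sum.neutral)
next
  assume e: "\<forall>\<alpha> J. size J < r \<longrightarrow> eta \<alpha> J p v = 0"
  have "contact_form \<pi> r (V, \<phi>, \<xi>) \<alpha> J p v = 0" if "size J < r" for \<alpha> and J :: "'n multiset"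
    using that
  proof (induction "r - size J" arbitrary: J rule: less_induct)
    case less
    have "(\<Sum>I\<in>above r J. sgn_monom (I - J) (jet_base (X p)) * contact_form \<pi> r (V, \<phi>, \<xi>) \<alpha> I p v) =
        (\<Sum>I\<in>{J}. sgn_monom (I - J) (jet_base (X p)) * contact_form \<pi> r (V, \<phi>, \<xi>) \<alpha> I p v)"
    proof (rule sum.mono_neutral_right[OF finite_above])
      show "\<forall>I\<in>above r J - {J}. sgn_monom (I - J) (jet_base (X p)) * contact_form \<pi> r (V, \<phi>, \<xi>) \<alpha> I p v = 0"
      proof
        fix I assume I: "I \<in> above r J - {J}"
        then have "J \<subset># I" "size I < r" by (auto simp: above_def subset_mset_def)
        then have "size J < size I" using mset_subset_size by blast
        then have "contact_form \<pi> r (V, \<phi>, \<xi>) \<alpha> I p v = 0"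
          using \<open>size I < r\<close> by (intro less.hyps) auto
        then show "sgn_monom (I - J) (jet_base (X p)) * contact_form \<pi> r (V, \<phi>, \<xi>) \<alpha> I p v = 0" by simp
      qed
    qed (use less.prems in \<open>auto simp: above_def\<close>)
    then show ?case using e less.prems eta_eq_contact_forms[OF v, of \<alpha> J] by simp
  qed
  then show "v \<in> cartan_distribution E Q \<pi> r p"
    unfolding cartan_iff[OF c p] contact_form_def using v by simp
qed

lemma eta_lincomb:
  "eta \<alpha> J p (a *\<^sub>R v + b *\<^sub>R w) = a * eta \<alpha> J p v + b * eta \<alpha> J p w"
  by (simp add: eta_def tvec_apply sum.distrib sum_distrib_left algebra_simps)

end

lemma eta_sum_form:
  "eta \<alpha> J q v = (\<Sum>k\<in>(UNIV :: 'n option set). (case k of None \<Rightarrow> 1 | Some i \<Rightarrow> - eta_coef \<alpha> J i q) *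
      v (case k of None \<Rightarrow> eta_potential \<alpha> J | Some i \<Rightarrow> (\<lambda>q. X q (Inl i))))"
proof -
  have "(\<Sum>k\<in>(UNIV :: 'n option set). f k) = f None + (\<Sum>i\<in>UNIV. f (Some i))" for f :: "'n option \<Rightarrow> real"
    unfolding UNIV_option_conv by (subst sum.insert) (auto simp: sum.reindex)
  then show ?thesis by (simp add: eta_def sum_negf)
qed

lemma eta_sum_smooth:
  assumes "p \<in> D"
  shows "smooth_at (JM r) p (\<lambda>q. case k of None \<Rightarrow> 1 | Some i \<Rightarrow> - eta_coef \<alpha> J i q)"
    "smooth_at (JM r) p (case k of None \<Rightarrow> eta_potential \<alpha> J | Some i \<Rightarrow> (\<lambda>q. X q (Inl i)))"
proof -
  have "smooth_at (JM r) p (\<lambda>q. 0 - eta_coef \<alpha> J i q)" for i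
    by (intro J.smooth_at_diff J.smooth_at_const jet_carrier[OF c] smooth_eta_coef assms)
  then show "smooth_at (JM r) p (\<lambda>q. case k of None \<Rightarrow> 1 | Some i \<Rightarrow> - eta_coef \<alpha> J i q)"
    using J.smooth_at_const[OF jet_carrier[OF c assms]] by (cases k) simp_all
  show "smooth_at (JM r) p (case k of None \<Rightarrow> eta_potential \<alpha> J | Some i \<Rightarrow> (\<lambda>q. X q (Inl i)))"
    using smooth_eta_potential[OF assms] smooth_jet_coord[OF c assms] by (cases k) simp_all
qed

lemma one_form_eta: "one_form_on (JM r) D (eta \<alpha> J)"
  unfolding one_form_on_def
proof (intro ballI conjI allI impI)
  fix p assume p: "p \<in> D"
  show "eta \<alpha> J p (a *\<^sub>R v + b *\<^sub>R w) = a * eta \<alpha> J p v + b * eta \<alpha> J p w" for a b v w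
    by (rule eta_lincomb[OF p])
  fix Y assume Y: "local_section (JM r) (tangent (JM r)) p Y"
  show "smooth_at (JM r) p (\<lambda>q. eta \<alpha> J q (Y q))"
    by (rule J.smooth_form_local(1)[where F = "\<lambda>k q. case k of None \<Rightarrow> 1 | Some i \<Rightarrow> - eta_coef \<alpha> J i q" and
        G = "\<lambda>k. case k of None \<Rightarrow> eta_potential \<alpha> J | Some i \<Rightarrow> (\<lambda>q. X q (Inl i))" and \<eta> = "eta \<alpha> J", OF openin_dom[OF c] p eta_sum_form eta_sum_smooth[OF p] Y])
qed

lemma ext_deriv_eta:
  assumes p: "p \<in> D" and v: "v \<in> tangent (JM r) p" and w: "w \<in> tangent (JM r) p"
  shows "ext_deriv (JM r) (eta \<alpha> J) p v w =
    (\<Sum>i\<in>UNIV. w (eta_coef \<alpha> J i) * v (\<lambda>q. X q (Inl i)) - v (eta_coef \<alpha> J i) * w (\<lambda>q. X q (Inl i)))"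
proof -
  have neg: "z (\<lambda>q. - eta_coef \<alpha> J i q) = - z (eta_coef \<alpha> J i)" if "z \<in> tangent (JM r) p" for z i
    using tangent_lincomb[OF that smooth_eta_coef[OF p] smooth_eta_coef[OF p], of "-1" _ _ _ 0] by simp
  have one: "z (\<lambda>q. 1) = 0" if "z \<in> tangent (JM r) p" for z
    by (rule J.tangent_const[OF that jet_carrier[OF c p]])
  have s: "(\<Sum>k\<in>(UNIV :: 'n option set). f k) = f None + (\<Sum>i\<in>UNIV. f (Some i))" for f :: "'n option \<Rightarrow> real"
    unfolding UNIV_option_conv by (subst sum.insert) (auto simp: sum.reindex)
  show ?thesis
    unfolding J.ext_deriv_eq[where F = "\<lambda>k q. case k of None \<Rightarrow> 1 | Some i \<Rightarrow> - eta_coef \<alpha> J i q" and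
        G = "\<lambda>k. case k of None \<Rightarrow> eta_potential \<alpha> J | Some i \<Rightarrow> (\<lambda>q. X q (Inl i))" and \<eta> = "eta \<alpha> J", OF openin_dom[OF c] p eta_sum_form eta_sum_smooth[OF p] v w] s
    by (simp add: neg v w one)
qed

text \<open>
  For \<open>J\<close> of order \<open>r - 1\<close> the coefficients of \<open>eta\<close> are the coordinates \<open>u\<^sub>J\<^sub>+\<^sub>i\<close>. Contracting the
  exterior derivatives of these forms with coordinate vectors isolates every base component and
  every top component of \<open>v\<close>. The coefficients of the other forms do not contribute more.
\<close>

lemma ext_deriv_eta_zero_iff:
  assumes p: "p \<in> D" and v: "v \<in> tangent (JM r) p"
  shows "(\<forall>\<alpha> J. size J < r \<longrightarrow> (\<forall>w\<in>tangent (JM r) p. ext_deriv (JM r) (eta \<alpha> J) p v w = 0)) \<longleftrightarrow>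
    (\<forall>i. v (\<lambda>q. X q (Inl i)) = 0) \<and> (\<forall>\<alpha> K. size K = r \<longrightarrow> v (\<lambda>q. X q (Inr (\<alpha>, K))) = 0)" (is "?L \<longleftrightarrow> ?R")
proof
  assume R: ?R
  have "v (eta_coef \<alpha> J i) = 0" for \<alpha> J i
    unfolding eta_coef_def[abs_def] using R
    by (subst tangent_monom_sum[OF p v]) (auto intro!: sum.neutral)
  then show ?L using R ext_deriv_eta[OF p v] by simp
next
  assume L: ?L
  have top: "eta_coef \<alpha> J i q = X q (Inr (\<alpha>, add_mset i J))" if J: "Suc (size J) = r" for \<alpha> J i q
  proof -
    have "{I \<in> above r J. Suc (size I) = r} = {J}"
      using J by (auto simp: above_def dest: mset_subset_size simp: subset_mset.le_less)
    then show ?thesis by (simp add: eta_coef_def)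
  qed
  have form: "(\<Sum>i\<in>UNIV. w (\<lambda>q. X q (Inr (\<alpha>, add_mset i J))) * v (\<lambda>q. X q (Inl i)) -
      v (\<lambda>q. X q (Inr (\<alpha>, add_mset i J))) * w (\<lambda>q. X q (Inl i))) = 0"
    if J: "Suc (size J) = r" and w: "w \<in> tangent (JM r) p" for \<alpha> J w
  proof -
    have "eta_coef \<alpha> J i = (\<lambda>q. X q (Inr (\<alpha>, add_mset i J)))" for i using top[OF J] by blast
    then show ?thesis using L J w ext_deriv_eta[where \<alpha> = \<alpha> and J = J, OF p v w] by auto
  qed
  let ?e = "\<lambda>l. J.chart_vector r D X p (\<lambda>k. if k = l then 1 else 0)"
  note et = jet_vector_tangent[OF c p]
  note ec = jet_vector_coord[OF c p]
  obtain \<alpha>0 :: 'm where True by blast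
  have x: "v (\<lambda>q. X q (Inl j)) = 0" for j
  proof -
    define J where "J = replicate_mset (r - 1) j"
    have J: "Suc (size J) = r" using r by (simp add: J_def)
    have "0 = (\<Sum>i\<in>UNIV. ?e (Inr (\<alpha>0, add_mset j J)) (\<lambda>q. X q (Inr (\<alpha>0, add_mset i J))) * v (\<lambda>q. X q (Inl i)) -
      v (\<lambda>q. X q (Inr (\<alpha>0, add_mset i J))) * ?e (Inr (\<alpha>0, add_mset j J)) (\<lambda>q. X q (Inl i)))"
      using form[OF J et] by simp
    also have "\<dots> = (\<Sum>i\<in>UNIV. if i = j then v (\<lambda>q. X q (Inl i)) else 0)"
      using J by (intro sum.cong) (auto simp: ec)
    finally show ?thesis by simp
  qed
  have "v (\<lambda>q. X q (Inr (\<alpha>, K))) = 0" if K: "size K = r" for \<alpha> K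
  proof -
    have "K \<noteq> {#}" using K r by auto
    then obtain j J where KJ: "K = add_mset j J" by (metis multiset_cases)
    have J: "Suc (size J) = r" using K KJ by simp
    have "0 = (\<Sum>i\<in>UNIV. - (v (\<lambda>q. X q (Inr (\<alpha>, add_mset i J))) * ?e (Inl j) (\<lambda>q. X q (Inl i))))"
      using form[where \<alpha> = \<alpha>, OF J et] by (simp add: x)
    also have "\<dots> = (\<Sum>i\<in>UNIV. if i = j then - v (\<lambda>q. X q (Inr (\<alpha>, add_mset i J))) else 0)"
      by (intro sum.cong) (auto simp: ec)
    finally show ?thesis by (simp add: KJ)
  qed
  then show ?R using x by blast
qed

end

lemma card_sizes:
  "card {J :: 'n multiset. size J = k} = (CARD('n) + k - 1) choose k"
  using card_multisets_of_size[of "UNIV :: 'n set" k] by (simp add: multisets_of_size_def)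

lemma card_sizes_less:
  assumes "r \<ge> 1"
  shows "card {J :: 'n multiset. size J < r} = (CARD('n) + r - 1) choose (r - 1)"
proof -
  obtain n where n: "CARD('n) = Suc n" by (metis finite_UNIV_card_ge_0 finite Suc_pred)
  have fin: "finite {J :: 'n multiset. size J = k}" for k
    by (rule finite_subset[OF _ finite_multisets_le[of k]]) auto
  have "{J :: 'n multiset. size J < r} = (\<Union>k\<le>r - 1. {J. size J = k})" using assms by auto
  also have "card \<dots> = (\<Sum>k\<le>r - 1. card {J :: 'n multiset. size J = k})"
    by (rule card_UN_disjoint) (auto simp: fin)
  also have "\<dots> = (\<Sum>k\<le>r - 1. (n + k) choose k)" unfolding card_sizes n by simp
  also have "\<dots> = Suc (n + (r - 1)) choose (r - 1)" by (rule sum_choose_lower)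
  also have "Suc (n + (r - 1)) = CARD('n) + r - 1" using n assms by simp
  finally show ?thesis .
qed

lemma mdim_JM:
  assumes r: "r \<ge> 1"
  shows "card (cartan_idx r :: ('n, 'm) jet_index set) + CARD('m) * ((CARD('n) + r - 1) choose (r - 1)) = mdim (JM r)"
proof -
  let ?low = "{Inr (\<alpha>, J) | \<alpha> J. size J < r} :: ('n, 'm) jet_index set"
  have low: "?low = Inr ` (UNIV \<times> {J. size J < r})" by auto
  have "card ?low = CARD('m) * ((CARD('n) + r - 1) choose (r - 1))"
    unfolding low using card_sizes_less[OF r] by (simp add: card_image card_cartesian_product)
  moreover have "jet_idx r = cartan_idx r \<union> ?low" "cartan_idx r \<inter> ?low = {}"
    by (auto simp: cartan_idx_def top_idx_def elim!: jet_idxE)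
  moreover have "finite ?low" by (rule finite_subset[OF _ finite_jet_idx[of r]]) auto
  ultimately show ?thesis unfolding mdim_def idx_JM by (simp add: card_Un_disjoint)
qed

lemma k_contact_JM:
  assumes r: "r \<ge> 1"
  shows "k_contact_manifold (CARD('m) * ((CARD('n) + r - 1) choose (r - 1))) (JM r) (cartan_distribution E Q \<pi> r)"
proof -
  let ?k = "CARD('m) * ((CARD('n) + r - 1) choose (r - 1))" and ?C = "cartan_distribution E Q \<pi> r"
  let ?d = "card (cartan_idx r :: ('n, 'm) jet_index set)"
  have "\<exists>U \<eta>. p \<in> U \<and> k_contact_form (JM r) U ?k \<eta> \<and> (\<forall>q\<in>U. ?C q = ker_form (JM r) ?k \<eta> q)" if "p \<in> carrier (JM r)" for p
  proof -
    obtain V \<phi> \<xi> where c: "adapted V \<phi> \<xi>" and p: "p \<in> jet_domain E Q \<pi> r (V, \<phi>, \<xi>)"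
      using \<open>p \<in> carrier (JM r)\<close> by (rule carrier_JM_chartE)
    let ?D = "jet_domain E Q \<pi> r (V, \<phi>, \<xi>)" and ?X = "jet_coords \<pi> r (V, \<phi>, \<xi>)"
    let ?B = "UNIV \<times> {J :: 'n multiset. size J < r} :: ('m \<times> 'n multiset) set"
    have finB: "finite ?B"
      by (intro finite_cartesian_product finite finite_subset[OF _ finite_multisets_le[of r]]) auto
    have "card ?B = ?k" using card_sizes_less[OF r] by (simp add: card_cartesian_product)
    then obtain e where e: "bij_betw e {..<?k} ?B"
      using ex_bij_betw_nat_finite[OF finB] by (auto simp: atLeast0LessThan)
    define \<eta> where "\<eta> A = eta V \<phi> \<xi> r (fst (e A)) (snd (e A))" for A
    have all: "(\<forall>A<?k. P (fst (e A)) (snd (e A))) \<longleftrightarrow> (\<forall>\<alpha> J. size J < r \<longrightarrow> P \<alpha> J)" for P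
    proof
      assume a: "\<forall>A<?k. P (fst (e A)) (snd (e A))"
      show "\<forall>\<alpha> J. size J < r \<longrightarrow> P \<alpha> J"
      proof (intro allI impI)
        fix \<alpha> and J :: "'n multiset" assume "size J < r"
        then have "(\<alpha>, J) \<in> e ` {..<?k}" using e by (auto simp: bij_betw_def)
        then obtain A where A: "(\<alpha>, J) = e A" "A \<in> {..<?k}" by (rule imageE)
        then have "P (fst (e A)) (snd (e A))" using a by simp
        then show "P \<alpha> J" unfolding A(1)[symmetric] by simp
      qed
    next
      assume a: "\<forall>\<alpha> J. size J < r \<longrightarrow> P \<alpha> J"
      show "\<forall>A<?k. P (fst (e A)) (snd (e A))"
      proof (intro allI impI)
        fix A assume "A < ?k"
        then have "e A \<in> ?B" using bij_betwE[OF e] by blast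
        then show "P (fst (e A)) (snd (e A))" using a by auto
      qed
    qed
    have ker: "ker_form (JM r) ?k \<eta> q = ?C q" if q: "q \<in> ?D" for q
    proof -
      have "v \<in> ker_form (JM r) ?k \<eta> q \<longleftrightarrow> v \<in> ?C q" for v
      proof (cases "v \<in> tangent (JM r) q")
        case True
        then show ?thesis
          using all[of "\<lambda>\<alpha> J. eta V \<phi> \<xi> r \<alpha> J q v = 0"] eta_zero_iff[OF c r q True] by (simp add: ker_form_def \<eta>_def)
      next
        case False then show ?thesis by (simp add: ker_form_def cartan_iff[OF c q])
      qed
      then show ?thesis by blast
    qed
    have sum: "direct_sum (ker_form (JM r) ?k \<eta> q) (ker_ext_deriv (JM r) ?k \<eta> q) (tangent (JM r) q)" if q: "q \<in> ?D" for q
    proof -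
      define R where "R = {v \<in> tangent (JM r) q. (\<forall>i. v (\<lambda>q. ?X q (Inl i)) = 0) \<and>
        (\<forall>\<alpha> K. size K = r \<longrightarrow> v (\<lambda>q. ?X q (Inr (\<alpha>, K))) = 0)}"
      have qc: "q \<in> carrier (JM r)" by (rule jet_carrier[OF c q])
      have "v \<in> ker_ext_deriv (JM r) ?k \<eta> q \<longleftrightarrow> v \<in> R" for v
      proof (cases "v \<in> tangent (JM r) q")
        case True
        then show ?thesis
          using all[of "\<lambda>\<alpha> J. \<forall>w\<in>tangent (JM r) q. ext_deriv (JM r) (eta V \<phi> \<xi> r \<alpha> J) q v w = 0"]
            ext_deriv_eta_zero_iff[OF c r q True] by (simp add: ker_ext_deriv_def R_def \<eta>_def)
      next
        case False then show ?thesis by (simp add: ker_ext_deriv_def R_def)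
      qed
      then have kR: "ker_ext_deriv (JM r) ?k \<eta> q = R" by blast
      have sR: "subspace R" unfolding R_def
        by (rule subspaceI) (auto simp: subspace_0[OF subspace_tangent] subspace_add[OF subspace_tangent]
            subspace_scale[OF subspace_tangent] tvec_apply)
      have CT: "?C q \<subseteq> tangent (JM r) q" by (auto simp: cartan_iff[OF c q])
      have int: "?C q \<inter> R = {0}"
      proof
        show "?C q \<inter> R \<subseteq> {0}"
        proof
          fix v assume v: "v \<in> ?C q \<inter> R"
          have "v = 0"
            by (rule cartan_eqI[OF c q])
              (use v subspace_0[OF subspace_cartan[OF qc]] in \<open>auto simp: R_def cartan_idx_def top_idx_def tvec_apply\<close>)
          then show "v \<in> {0}" by simp
        qed
        show "{0} \<subseteq> ?C q \<inter> R" using subspace_0[OF sR] subspace_0[OF subspace_cartan[OF qc]] by blast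
      qed
      have "tangent (JM r) q = {v + w | v w. v \<in> ?C q \<and> w \<in> R}"
      proof
        show "{v + w | v w. v \<in> ?C q \<and> w \<in> R} \<subseteq> tangent (JM r) q"
          using CT by (auto simp: R_def intro!: subspace_add[OF subspace_tangent])
        show "tangent (JM r) q \<subseteq> {v + w | v w. v \<in> ?C q \<and> w \<in> R}"
        proof
          fix v assume v: "v \<in> tangent (JM r) q"
          define g where "g = (\<Sum>k\<in>cartan_idx r. v (\<lambda>q. ?X q k) *\<^sub>R cartan_field V \<phi> \<xi> r k q)"
          have g: "g \<in> ?C q" unfolding g_def
            by (intro subspace_sum[OF subspace_cartan[OF qc]] subspace_scale[OF subspace_cartan[OF qc]]
                cartan_field_in_cartan[OF c q])
          have gl: "g (\<lambda>q. ?X q l) = v (\<lambda>q. ?X q l)" if l: "l \<in> cartan_idx r" for l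
          proof -
            have "g (\<lambda>q. ?X q l) = (\<Sum>k\<in>cartan_idx r. if k = l then v (\<lambda>q. ?X q k) else 0)"
              unfolding g_def tvec_sum_apply tvec_apply by (intro sum.cong) (auto simp: cartan_field_dual[OF c q _ l])
            then show ?thesis using l by simp
          qed
          have "v - g \<in> R" unfolding R_def
            using subspace_diff[OF subspace_tangent v] g CT gl
            by (auto simp: tvec_apply cartan_idx_def top_idx_def)
          moreover have "v = g + (v - g)" by simp
          ultimately show "v \<in> {v + w | v w. v \<in> ?C q \<and> w \<in> R}" using g by blast
        qed
      qed
      then show ?thesis unfolding direct_sum_def ker[OF q] kR using subspace_cartan[OF qc] sR int by blast
    qed
    have "Inl undefined \<in> (cartan_idx r :: ('n, 'm) jet_index set)" by (simp add: cartan_idx_def)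
    then have "?d > 0" by (metis card_gt_0_iff empty_iff finite_cartan_idx(1))
    moreover have "distribution (JM r) ?D ?d (ker_form (JM r) ?k \<eta>)"
      by (rule distribution_local_cong[OF distribution_cartan openin_dom[OF c]])
        (use jet_carrier[OF c] ker in auto)
    ultimately have "k_contact_form (JM r) ?D ?k \<eta>"
      unfolding k_contact_form_def using openin_dom[OF c] one_form_eta[OF c r] mdim_JM[OF r] sum
      by (auto simp: \<eta>_def)
    then show ?thesis using p ker by blast
  qed
  then show ?thesis
    unfolding k_contact_manifold_def regular_distribution_def
    using smooth_manifold_JM distribution_cartan mdim_JM[OF r] by blast
qed

end

section \<open>Integrability of the vertical distribution\<close>

lemma atlas_manifold_open_subset:
  assumes "finite I" "ropen I W"
  shows "atlas_manifold (open_subset_mfd I W)"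
proof
  show "finite (idx (open_subset_mfd I W))" using assms(1) by (simp add: open_subset_mfd_def)
  fix c assume c: "c \<in> atlas (open_subset_mfd I W)"
  then show "is_chart (idx (open_subset_mfd I W)) c"
    using assms(2) by (simp add: open_subset_mfd_def is_chart_def)
  have "smooth_on I W (\<lambda>x. inv_into W (\<lambda>x. x) x i)" if "i \<in> I" for i
    by (rule smooth_on_cong[OF assms smooth_on_coord[OF assms that]])
      (use f_inv_into_f[of _ "\<lambda>x. x" W] in simp)
  then show "compatible_charts (idx (open_subset_mfd I W)) c d" if "d \<in> atlas (open_subset_mfd I W)" for d
    using assms(2) c that by (simp add: open_subset_mfd_def compatible_charts_def smooth_transition_def)
qed

context fibred
begin

text \<open>
  The integral manifolds are the fibres of the projection: fix all jet coordinates below the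
  top order and let the top ones vary.
\<close>

lemma integrable_vertical:
  assumes r: "r \<ge> 1"
  shows "integrable (JM r) (card (top_idx r :: ('n, 'm) jet_index set)) (vertical_distribution E Q \<pi> r)"
  unfolding integrable_def
proof
  fix p assume "p \<in> carrier (JM r)"
  then obtain V \<phi> \<xi> where c: "adapted V \<phi> \<xi>" and p: "p \<in> jet_domain E Q \<pi> r (V, \<phi>, \<xi>)" by (rule carrier_JM_chartE)
  let ?D = "jet_domain E Q \<pi> r (V, \<phi>, \<xi>)" and ?X = "jet_coords \<pi> r (V, \<phi>, \<xi>)"
  let ?K = "top_idx r :: ('n, 'm) jet_index set"
  define d where "d = card ?K"
  note ch = jet_chart[OF c, of r]
  obtain e where e: "bij_betw e {..<d} ?K"
    using ex_bij_betw_nat_finite[OF finite_cartan_idx(2)[of r]] by (auto simp: atLeast0LessThan d_def)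
  define e' where "e' = inv_into {..<d} e"
  have e': "e' (e i) = i" "e i \<in> ?K" if "i < d" for i
    using that e by (auto simp: e'_def bij_betw_def inv_into_f_f)
  have e'K: "e' l < d" "e (e' l) = l" if "l \<in> ?K" for l
  proof -
    have l: "l \<in> e ` {..<d}" using that e by (simp add: bij_betw_def)
    show "e' l < d" using inv_into_into[OF l] by (simp add: e'_def)
    show "e (e' l) = l" using f_inv_into_f[OF l] by (simp add: e'_def)
  qed
  define W where "W = tuples {..<d}"
  have W: "ropen {..<d} W" unfolding W_def by (rule ropen_tuples)
  let ?N = "open_subset_mfd {..<d} W"
  interpret N: atlas_manifold ?N by (rule atlas_manifold_open_subset[OF _ W]) simp
  have idxN: "idx ?N = {..<d}" by (simp add: open_subset_mfd_def)
  have chN: "(W, \<lambda>x. x) \<in> charts ?N" using N.atlas_subset_charts by (simp add: open_subset_mfd_def)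
  define zl where "zl l y = (if l \<in> ?K then y (e' l) else ?X p l)" for l y
  define z where "z = tuple_map (jet_idx r) zl"
  define s where "s y = inv_into ?D ?X (z y)" for y
  have zX: "z y \<in> ?X ` ?D" for y
  proof -
    have "jet_point (z y) k = jet_point (?X p) k" for k
      using r by (cases k) (auto simp: jet_point_def z_def zl_def top_idx_def)
    then have "jet_point (z y) = jet_point (?X p)" by blast
    moreover have "?X p \<in> jet_region \<phi> V r" using p jet_coords_image_domain[OF c, of r] by blast
    ultimately show ?thesis unfolding jet_coords_image_domain[OF c] by (simp add: jet_region_def z_def)
  qed
  have sD: "s y \<in> ?D" and Xs: "?X (s y) = z y" for y
    using zX[of y] unfolding s_def by (auto intro: inv_into_into f_inv_into_f)
  have zle: "z y (e i) = y i" if "i < d" for y i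
  proof -
    have "e i \<in> jet_idx r" using e'(2)[OF that] cartan_idx_subset(2) by blast
    then show ?thesis using e'[OF that] by (simp add: z_def zl_def tuple_map_def)
  qed
  have inj: "inj_on s W"
  proof (rule inj_onI)
    fix y y' assume y: "y \<in> W" "y' \<in> W" "s y = s y'"
    then have "z y = z y'" using Xs by metis
    then show "y = y'" using y(1,2) zle unfolding W_def by (intro tuples_eqI[of y "{..<d}"]) (auto, metis)
  qed
  have ps: "p \<in> s ` W"
  proof
    let ?y = "\<lambda>i\<in>{..<d}. ?X p (e i)"
    show "?y \<in> W" by (simp add: W_def)
    have "z ?y = ?X p"
    proof (rule tuples_eqI[of _ "jet_idx r"])
      show "?X p \<in> tuples (jet_idx r)" using J.chart_tuples[OF ch p] by simp
    qed (use e'K in \<open>auto simp: z_def zl_def\<close>)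
    then show "p = s ?y" unfolding s_def using J.chart_inv[OF ch p] by simp
  qed
  have main: "smooth_map_at ?N (JM r) s y \<and> inj_on (tmap (JM r) s y) (tangent ?N y) \<and>
      tmap (JM r) s y ` tangent ?N y = vertical_distribution E Q \<pi> r (s y)" if y: "y \<in> W" for y
  proof -
    have yc: "y \<in> carrier ?N" using y by (simp add: open_subset_mfd_def carrier_def)
    have co: "smooth_at ?N y (\<lambda>q. q i)" if "i < d" for i
      using N.smooth_at_coord[OF chN y] that by (simp add: idxN)
    have zs: "smooth_at ?N y (zl l)" for l
      using co[OF e'K(1)] N.smooth_at_const[OF yc] by (cases "l \<in> ?K") (simp_all add: zl_def[abs_def])
    have pull: "smooth_at ?N y (\<lambda>q. f (s q)) \<and> (t \<in> tangent ?N y \<longrightarrow> t (\<lambda>q. f (s q)) =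
        (\<Sum>l\<in>jet_idx r. pd l (\<lambda>x. f (inv_into ?D ?X x)) (z y) * t (zl l)))"
      if f: "smooth_at (JM r) (s y) f" for f t
    proof -
      obtain T where T: "ropen (jet_idx r) T" "?X (s y) \<in> T" "T \<subseteq> ?X ` ?D" "smooth_on (jet_idx r) T (\<lambda>x. f (inv_into ?D ?X x))"
        by (rule J.smooth_at_chartE[OF ch sD f, unfolded idx_JM]) (rule that)
      have "tuple_map (jet_idx r) zl y \<in> T" using T(2) by (simp add: Xs z_def)
      from N.tangent_compose[OF finite_jet_idx T(1,4) yc zs this] show ?thesis
        unfolding s_def z_def by blast
    qed
    let ?a = "\<lambda>t l. if l \<in> ?K then t (\<lambda>q. q (e' l)) else 0"
    have tm: "tmap (JM r) s y t = J.chart_vector r ?D ?X (s y) (?a t)" if t: "t \<in> tangent ?N y" for t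
    proof
      fix f
      have "t (zl l) = ?a t l" for l
        using N.tangent_const[OF t yc] by (simp add: zl_def[abs_def])
      then show "tmap (JM r) s y t f = J.chart_vector r ?D ?X (s y) (?a t) f"
        using pull[of f t] t by (simp add: tmap_def J.chart_vector_def Xs)
    qed
    have "smooth_map_at ?N (JM r) s y"
      unfolding smooth_map_at_def using jet_carrier[OF c sD] pull by blast
    moreover have "inj_on (tmap (JM r) s y) (tangent ?N y)"
    proof (rule inj_onI)
      fix t t' assume t: "t \<in> tangent ?N y" "t' \<in> tangent ?N y" "tmap (JM r) s y t = tmap (JM r) s y t'"
      show "t = t'"
      proof (rule N.tangent_eqI[OF t(1,2) chN y])
        fix i assume "i \<in> idx ?N"
        then have i: "i < d" by (simp add: idxN)
        have "e i \<in> jet_idx r" using e'(2)[OF i] cartan_idx_subset(2) by blast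
        note coord = jet_vector_coord[OF c sD this]
        have "?a t (e i) = ?a t' (e i)"
          using fun_cong[OF t(3), of "\<lambda>q. ?X q (e i)"]
          unfolding tm[OF t(1)] tm[OF t(2)] coord .
        then show "t (\<lambda>q. q i) = t' (\<lambda>q. q i)" using e'[OF i] by simp
      qed
    qed
    moreover have "tmap (JM r) s y ` tangent ?N y = vertical_distribution E Q \<pi> r (s y)"
    proof
      show "tmap (JM r) s y ` tangent ?N y \<subseteq> vertical_distribution E Q \<pi> r (s y)"
        by (auto simp: tm vertical_iff[OF c sD r] jet_vector_tangent[OF c sD] jet_vector_coord[OF c sD] top_idx_def)
      show "vertical_distribution E Q \<pi> r (s y) \<subseteq> tmap (JM r) s y ` tangent ?N y"
      proof
        fix v assume v: "v \<in> vertical_distribution E Q \<pi> r (s y)"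
        define t where "t = N.chart_vector W (\<lambda>x. x) y (\<lambda>i. v (\<lambda>q. ?X q (e i)))"
        have t: "t \<in> tangent ?N y" unfolding t_def by (rule N.chart_vector_tangent[OF chN y])
        have ti: "t (\<lambda>q. q i) = v (\<lambda>q. ?X q (e i))" if "i < d" for i
          unfolding t_def using N.chart_vector_coord[OF chN y] that by (simp add: idxN)
        have "v = tmap (JM r) s y t"
        proof (rule jet_tangent_eqI[OF c sD])
          show "v \<in> tangent (JM r) (s y)" using v by (simp add: vertical_iff[OF c sD r])
          show "tmap (JM r) s y t \<in> tangent (JM r) (s y)" unfolding tm[OF t] by (rule jet_vector_tangent[OF c sD])
          show "v (\<lambda>q. ?X q (Inl i)) = tmap (JM r) s y t (\<lambda>q. ?X q (Inl i))" for i
            using v unfolding tm[OF t] by (simp add: vertical_iff[OF c sD r] jet_vector_coord[OF c sD] top_idx_def)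
          fix \<alpha> and J :: "'n multiset" assume J: "size J \<le> r"
          show "v (\<lambda>q. ?X q (Inr (\<alpha>, J))) = tmap (JM r) s y t (\<lambda>q. ?X q (Inr (\<alpha>, J)))"
          proof (cases "size J = r")
            case True
            then have "Inr (\<alpha>, J) \<in> ?K" by (auto simp: top_idx_def)
            then show ?thesis using J e'K ti unfolding tm[OF t] by (simp add: jet_vector_coord[OF c sD])
          next
            case False
            then show ?thesis using J v unfolding tm[OF t]
              by (simp add: vertical_iff[OF c sD r] jet_vector_coord[OF c sD] top_idx_def)
          qed
        qed
        then show "v \<in> tmap (JM r) s y ` tangent ?N y" using t by blast
      qed
    qed
    ultimately show ?thesis by blast
  qed
  show "\<exists>W (s :: (nat \<Rightarrow> real) \<Rightarrow> ('e, 'q) jet). openin (powertop_real {..<card ?K}) W \<and> p \<in> s ` W \<and> inj_on s W \<and>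
      (\<forall>y\<in>W. smooth_map_at (open_subset_mfd {..<card ?K} W) (JM r) s y \<and>
         inj_on (tmap (JM r) s y) (tangent (open_subset_mfd {..<card ?K} W) y) \<and>
         tmap (JM r) s y ` tangent (open_subset_mfd {..<card ?K} W) y = vertical_distribution E Q \<pi> r (s y))"
    using W ps inj main unfolding d_def[symmetric] by blast
qed

end

section \<open>Isotropic subspaces have at most the rank of the vertical distribution\<close>

text \<open>
  Take a minimal set of coordinates whose vanishing implies that of all others. Leaving out one of
  them admits a vector on which the rest vanishes but not all coordinates do; rescaled, this is
  the dual vector.
\<close>

lemma separating_coordinates:
  fixes L :: "'v::real_vector set" and x :: "'n::finite \<Rightarrow> 'v \<Rightarrow> real"
  assumes L: "subspace L" and x: "\<And>i c v. x i (c *\<^sub>R v) = c * x i v"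
  obtains B where "\<And>v. v \<in> L \<Longrightarrow> (\<forall>i\<in>B. x i v = 0) \<Longrightarrow> (\<forall>i. x i v = 0)"
    "\<And>a. a \<in> B \<Longrightarrow> \<exists>w\<in>L. x a w = 1 \<and> (\<forall>b\<in>B - {a}. x b w = 0)"
proof -
  define sep where "sep B \<longleftrightarrow> (\<forall>v\<in>L. (\<forall>i\<in>B. x i v = 0) \<longrightarrow> (\<forall>i. x i v = 0))" for B
  have "sep UNIV" by (simp add: sep_def)
  then obtain B where B: "sep B" "\<And>B'. sep B' \<Longrightarrow> card B \<le> card B'"
    using ex_has_least_nat[of sep UNIV card] by blast
  show ?thesis
  proof (rule that)
    show "\<forall>i. x i v = 0" if "v \<in> L" "\<forall>i\<in>B. x i v = 0" for v using B(1) that by (simp add: sep_def)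
    fix a assume a: "a \<in> B"
    then have "card (B - {a}) < card B" by (intro psubset_card_mono) auto
    then have "\<not> sep (B - {a})" using B(2) by (metis not_le)
    then obtain v where v: "v \<in> L" "\<forall>i\<in>B - {a}. x i v = 0" "\<not> (\<forall>i. x i v = 0)" by (auto simp: sep_def)
    then have ne: "x a v \<noteq> 0" using B(1) unfolding sep_def by blast
    show "\<exists>w\<in>L. x a w = 1 \<and> (\<forall>b\<in>B - {a}. x b w = 0)"
      using v ne L by (intro bexI[of _ "(1 / x a v) *\<^sub>R v"]) (auto simp: x subspace_scale)
  qed
qed

context fibred
begin

text \<open>
  Isotropy against the vectors dual to the base coordinates in \<open>B\<close> expresses a top component of
  \<open>v\<close> whose multi-index meets \<open>B\<close> through top components with fewer indices in \<open>B\<close>.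
\<close>

lemma isotropic_vector_zero:
  assumes c: "adapted V \<phi> \<xi>" and p: "p \<in> jet_domain E Q \<pi> r (V, \<phi>, \<xi>)"
    and L: "isotropic (JM r) (cartan_distribution E Q \<pi> r) p L" and v: "v \<in> L"
    and B: "\<And>a. a \<in> B \<Longrightarrow> \<exists>w\<in>L. w (\<lambda>q. jet_coords \<pi> r (V, \<phi>, \<xi>) q (Inl a)) = 1 \<and>
      (\<forall>b\<in>B - {a}. w (\<lambda>q. jet_coords \<pi> r (V, \<phi>, \<xi>) q (Inl b)) = 0)"
    and x: "\<And>i. v (\<lambda>q. jet_coords \<pi> r (V, \<phi>, \<xi>) q (Inl i)) = 0"
    and u: "\<And>\<alpha> K. size K = r \<Longrightarrow> set_mset K \<inter> B = {} \<Longrightarrow> v (\<lambda>q. jet_coords \<pi> r (V, \<phi>, \<xi>) q (Inr (\<alpha>, K))) = 0"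
  shows "v = 0"
proof -
  let ?X = "jet_coords \<pi> r (V, \<phi>, \<xi>)" and ?C = "cartan_distribution E Q \<pi> r p"
  have LC: "L \<subseteq> ?C" using L by (simp add: isotropic_def)
  have top: "v (\<lambda>q. ?X q (Inr (\<alpha>, K))) = 0" if "size K = r" for \<alpha> K
    using that
  proof (induction "size (filter_mset (\<lambda>i. i \<in> B) K)" arbitrary: K rule: less_induct)
    case less
    show ?case
    proof (cases "set_mset K \<inter> B = {}")
      case True
      then show ?thesis using u less.prems by blast
    next
      case False
      then obtain a where a: "a \<in># K" "a \<in> B" by blast
      then obtain J where J: "K = add_mset a J" by (metis multi_member_split)
      obtain w where w: "w \<in> L" "w (\<lambda>q. ?X q (Inl a)) = 1" "\<forall>b\<in>B - {a}. w (\<lambda>q. ?X q (Inl b)) = 0"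
        using B[OF a(2)] by blast
      have "levi (JM r) (cartan_distribution E Q \<pi> r) p v w = ?C" using L v w(1) by (simp add: isotropic_def)
      then have "levi_form V \<phi> \<xi> r \<alpha> J v w = 0"
        using levi_eq_iff[OF c p subsetD[OF LC v] subsetD[OF LC w(1)]] less.prems J by simp
      then have 0: "(\<Sum>i\<in>UNIV. v (\<lambda>q. ?X q (Inr (\<alpha>, add_mset i J))) * w (\<lambda>q. ?X q (Inl i))) = 0"
        by (simp add: levi_form_def x)
      have "v (\<lambda>q. ?X q (Inr (\<alpha>, add_mset i J))) * w (\<lambda>q. ?X q (Inl i)) = 0" if i: "i \<noteq> a" for i
      proof (cases "i \<in> B")
        case True then show ?thesis using w(3) i by simp
      next
        case False
        then have "v (\<lambda>q. ?X q (Inr (\<alpha>, add_mset i J))) = 0"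
          using less.prems a(2) J by (intro less.hyps) auto
        then show ?thesis by simp
      qed
      then have "(\<Sum>i\<in>UNIV. v (\<lambda>q. ?X q (Inr (\<alpha>, add_mset i J))) * w (\<lambda>q. ?X q (Inl i))) =
          (\<Sum>i\<in>{a}. v (\<lambda>q. ?X q (Inr (\<alpha>, add_mset i J))) * w (\<lambda>q. ?X q (Inl i)))"
        by (intro sum.mono_neutral_right) auto
      then show ?thesis using 0 w(2) J by simp
    qed
  qed
  have pc: "p \<in> carrier (JM r)" by (rule jet_carrier[OF c p])
  have "v (\<lambda>q. ?X q k) = 0" if "k \<in> cartan_idx r" for k
  proof (cases k)
    case (Inl i)
    then show ?thesis using x by simp
  next
    case (Inr l)
    then obtain \<alpha> K where k: "k = Inr (\<alpha>, K)" by (cases l) simp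
    then have "size K = r" using that by (auto simp: cartan_idx_def top_idx_def)
    then show ?thesis unfolding k by (rule top)
  qed
  then show ?thesis
    by (intro cartan_eqI[OF c p subsetD[OF LC v] subspace_0[OF subspace_cartan[OF pc]]])
      (simp add: tvec_apply)
qed

text \<open>
  Hence a vector of \<open>L\<close> is determined by its base coordinates in \<open>B\<close> and its top coordinates
  whose multi-index avoids \<open>B\<close>. The former are charged to the multi-indices \<open>r \<cdot> a\<close> with \<open>a \<in> B\<close>,
  which do not avoid \<open>B\<close>, so there are at most as many of both as top coordinates.
\<close>

lemma isotropic_rank_le:
  assumes p: "p \<in> carrier (JM r)" and r: "r \<ge> 1"
    and L: "isotropic (JM r) (cartan_distribution E Q \<pi> r) p L" and S: "independent S" "span S = L"
  shows "finite S \<and> card S \<le> card (top_idx r :: ('n, 'm) jet_index set)"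
proof -
  obtain V \<phi> \<xi> where c: "adapted V \<phi> \<xi>" and pd: "p \<in> jet_domain E Q \<pi> r (V, \<phi>, \<xi>)" using p by (rule carrier_JM_chartE)
  let ?X = "jet_coords \<pi> r (V, \<phi>, \<xi>)" and ?K = "top_idx r :: ('n, 'm) jet_index set"
  have sL: "subspace L" using L by (simp add: isotropic_def)
  obtain B where B: "\<And>v. v \<in> L \<Longrightarrow> (\<forall>i\<in>B. v (\<lambda>q. ?X q (Inl i)) = 0) \<Longrightarrow> (\<forall>i. v (\<lambda>q. ?X q (Inl i)) = 0)"
    and Bdual: "\<And>a. a \<in> B \<Longrightarrow> \<exists>w\<in>L. w (\<lambda>q. ?X q (Inl a)) = 1 \<and> (\<forall>b\<in>B - {a}. w (\<lambda>q. ?X q (Inl b)) = 0)"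
    by (rule separating_coordinates[OF sL, where x = "\<lambda>i v. v (\<lambda>q. ?X q (Inl i))"]) (simp add: tvec_apply, rule that)
  \<comment> \<open>Labels \<open>(\<alpha>, r \<cdot> a)\<close> with \<open>a \<in> B\<close> read off the base coordinate \<open>a\<close>, all others themselves.\<close>
  define m :: "('n, 'm) jet_index \<Rightarrow> ('n, 'm) jet_index" where
    "m k = (if \<exists>\<alpha>. \<exists>a\<in>B. k = Inr (\<alpha>, replicate_mset r a) then Inl (SOME a. a \<in> B \<and> (\<exists>\<alpha>. k = Inr (\<alpha>, replicate_mset r a))) else k)" for k
  have m_rep: "m (Inr (\<alpha>, replicate_mset r a)) = Inl a" if a: "a \<in> B" for \<alpha> a
  proof -
    have "(SOME b. b \<in> B \<and> (\<exists>\<beta>. Inr (\<alpha>, replicate_mset r a) = (Inr (\<beta>, replicate_mset r b) :: ('n, 'm) jet_index))) = a"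
      by (rule some_equality) (use a r in \<open>auto simp: multiset_eq_iff split: if_splits\<close>)
    then show ?thesis using a by (auto simp: m_def)
  qed
  have m_id: "m (Inr (\<alpha>, K)) = Inr (\<alpha>, K)" if "size K = r" "set_mset K \<inter> B = {}" for \<alpha> K
  proof -
    have "K \<noteq> replicate_mset r a" if "a \<in> B" for a
    proof
      assume "K = replicate_mset r a"
      then have "a \<in># K" using r by simp
      then show False using \<open>set_mset K \<inter> B = {}\<close> \<open>a \<in> B\<close> by blast
    qed
    then show ?thesis by (simp add: m_def)
  qed
  define T :: "('e, 'q) jet tvec \<Rightarrow> ('n, 'm) jet_index \<Rightarrow> real"
    where "T v = (\<lambda>k. if k \<in> ?K then v (\<lambda>q. ?X q (m k)) else 0)" for v
  have lin: "linear T"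
    by (rule linearI) (auto simp: T_def fun_eq_iff tvec_apply plus_fun_def scaleR_fun_def)
  have zero: "v = 0" if v: "v \<in> L" and T0: "T v = 0" for v
  proof -
    have Tk: "v (\<lambda>q. ?X q (m k)) = 0" if "k \<in> ?K" for k
      using fun_cong[OF T0, of k] that by (simp add: T_def zero_fun_def)
    have "v (\<lambda>q. ?X q (Inl a)) = 0" if "a \<in> B" for a
      using Tk[of "Inr (undefined, replicate_mset r a)"] m_rep[OF that] by (simp add: top_idx_def)
    then have x: "v (\<lambda>q. ?X q (Inl i)) = 0" for i using B[OF v] by blast
    have u: "v (\<lambda>q. ?X q (Inr (\<alpha>, K))) = 0" if "size K = r" "set_mset K \<inter> B = {}" for \<alpha> K
      using Tk[of "Inr (\<alpha>, K)"] m_id[OF that] that(1) by (simp add: top_idx_def)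
    show ?thesis by (rule isotropic_vector_zero[OF c pd L v Bdual x u])
  qed
  have inj: "inj_on T (span S)" unfolding S(2)
  proof (rule inj_onI)
    fix v w assume vw: "v \<in> L" "w \<in> L" "T v = T w"
    have "v - w = 0" by (rule zero) (use vw sL lin in \<open>auto simp: subspace_diff linear_diff\<close>)
    then show "v = w" by simp
  qed
  have ind: "independent (T ` S)"
    by (rule linear_independent_injective_image[OF lin S(1) inj])
  let ?\<delta> = "\<lambda>k l. if l = k then 1 else 0 :: real"
  have "T v \<in> span (?\<delta> ` ?K)" for v
  proof -
    have "T v = (\<Sum>k\<in>?K. T v k *\<^sub>R ?\<delta> k)"
    proof
      fix l
      have sum: "(\<Sum>k\<in>A. T v k *\<^sub>R ?\<delta> k) l = (\<Sum>k\<in>A. if k = l then T v k else 0)" for A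
        by (induction A rule: infinite_finite_induct) (auto simp: plus_fun_def scaleR_fun_def zero_fun_def)
      show "T v l = (\<Sum>k\<in>?K. T v k *\<^sub>R ?\<delta> k) l" unfolding sum by (simp add: T_def)
    qed
    also have "\<dots> \<in> span (?\<delta> ` ?K)" by (intro span_sum span_scale span_base) auto
    finally show ?thesis .
  qed
  then have "finite (T ` S) \<and> card (T ` S) \<le> card (?\<delta> ` ?K)"
    by (intro independent_span_bound ind) auto
  moreover have "card (?\<delta> ` ?K) \<le> card ?K" by (rule card_image_le) simp
  moreover have "inj_on T S" using inj by (rule inj_on_subset) (rule span_superset)
  ultimately show ?thesis by (simp add: card_image finite_image_iff)
qed

lemma polarisation_vertical:
  assumes r: "r \<ge> 1"
  shows "polarisation (CARD('m) * ((CARD('n) + r - 1) choose (r - 1)))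
    (JM r) (cartan_distribution E Q \<pi> r) (vertical_distribution E Q \<pi> r)"
  unfolding polarisation_def
proof (intro conjI exI allI impI)
  let ?C = "cartan_distribution E Q \<pi> r" and ?d = "card (top_idx r :: ('n, 'm) jet_index set)"
  show "k_contact_manifold (CARD('m) * ((CARD('n) + r - 1) choose (r - 1))) (JM r) ?C" by (rule k_contact_JM[OF r])
  show "integrable_legendrian_subbundle (JM r) ?C ?d (vertical_distribution E Q \<pi> r)"
    unfolding integrable_legendrian_subbundle_def
    using distribution_vertical[OF r] legendrian_vertical[OF _ r] integrable_vertical[OF r] by blast
  fix P' d' assume P': "integrable_legendrian_subbundle (JM r) ?C d' P'"
  obtain p where p: "p \<in> carrier (JM r)" using carrier_JM_nonempty by blast
  have iso: "isotropic (JM r) ?C p (P' p)"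
    using P' p by (auto simp: integrable_legendrian_subbundle_def legendrian_def)
  have D: "distribution (JM r) (carrier (JM r)) d' P'" using P' by (simp add: integrable_legendrian_subbundle_def)
  obtain W and Y :: "nat \<Rightarrow> ('e, 'q) jet \<Rightarrow> ('e, 'q) jet tvec" where
    "p \<in> W" "\<forall>q\<in>W. inj_on (\<lambda>i. Y i q) {..<d'} \<and> independent ((\<lambda>i. Y i q) ` {..<d'}) \<and>
                      span ((\<lambda>i. Y i q) ` {..<d'}) = P' q"
    using bspec[OF D[unfolded distribution_def] p] by blast
  then have Y: "inj_on (\<lambda>i. Y i p) {..<d'}" "independent ((\<lambda>i. Y i p) ` {..<d'})" "span ((\<lambda>i. Y i p) ` {..<d'}) = P' p"
    by auto
  show "d' \<le> ?d" using isotropic_rank_le[OF p r iso Y(2,3)] Y(1) by (simp add: card_image)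
qed

end

theorem lemma6p3:
  fixes E :: "('e, 'n::finite + 'm::finite) mfd"
    and Q :: "('q, 'n) mfd"
    and \<pi> :: "'e \<Rightarrow> 'q"
    and r :: nat
  assumes "fibred_manifold E Q \<pi>"
    and "r \<ge> 1"
  shows "polarisation (CARD('m) * ((CARD('n) + r - 1) choose (r - 1)))
           (jet_manifold E Q \<pi> r) (cartan_distribution E Q \<pi> r) (vertical_distribution E Q \<pi> r)"
  using fibred.polarisation_vertical[OF fibred.intro[OF assms(1)] assms(2)] .

end
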